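(* There exist constants $C,C_{low},C_{up},\varepsilon_0,c>0$ such that the following holds. Let $0<\varepsilon<\varepsilon_0$, $\delta\in(0,1)$, $z\in M$, $\Delta>0$, and $$T\ge C\Big(s_0+\kappa_d(\varepsilon)^{-1}\big(\log N_\varepsilon(M)+\log\tfrac1\delta\big)\Big).$$ Then there is an event of $\mathbb P_z$-probability at least $1-\delta$ on which, provided $\omega_X(\Delta)\le c\,\varepsilon$, $$H_q\big((\Gamma_T^\Delta)^r\big)\cong H_q(M)\quad\text{for every }q=0,\ldots,d\text{ and every }r\text{ with }C_{low}\,\varepsilon\le r\le C_{up}\operatorname{reach}(M).$$
   Context: Setting. $d\ge2$; homology has coefficients in a fixed field. $M\subset\mathbb R^d$ is the closure of a bounded connected open set. $d_M(x,y)$ is the infimum of the lengths of rectifiable curves in $M$ joining $x$ to $y$; $B_M(x,\varepsilon)=\{y\in M:d_M(x,y)<\varepsilon\}$; $\mu(A)=|A|/|M|$ is normalized Lebesgue measure on $M$. $M$ satisfies the following assumptions. (1) Positive reach: $\operatorname{reach}(M)>0$, i.e. every $z$ with $0<\operatorname{dist}(z,M)<\operatorname{reach}(M)$ has a unique nearest point in $M$. (2) There are $c_{ie}\ge1$, $\rho_{ie}>0$ with $d_M(x,y)\le c_{ie}|x-y|$ whenever $x,y\in M$, $|x-y|<\rho_{ie}$. (3) There are $c_{vol},C_{vol},\rho_{vol}>0$ with $c_{vol}\varepsilon^d\le\mu(B_M(x,\varepsilon))\le C_{vol}\varepsilon^d$ for all $x\in M$, $0<\varepsilon<\rho_{vol}$.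 (4) $M$ is an admissible reflecting domain: its boundary is regular enough that reflected Brownian motion in $M$ exists and is unique in law, has a symmetric Neumann heat kernel, the Neumann semigroup on $L^2(M,\mu)$ is compact, the Neumann spectrum is discrete with positive spectral gap, and there are $\rho_{ch}>0$, $L_{ch}\ge1$ such that every $x\in M$ has a neighbourhood $U_x\subset M$ and a chart $\Psi_x$ on $U_x$, bi-Lipschitz with constant $L_{ch}$ and with Jacobian determinants of $\Psi_x,\Psi_x^{-1}$ uniformly bounded above and below, mapping $U_x$ onto a Euclidean ball if $\operatorname{dist}(x,\partial M)\ge\rho_{ch}$ and onto a half-ball with $\partial M$ carried into the flat face if $\operatorname{dist}(x,\partial M)<\rho_{ch}$. (A compact connected Lipschitz domain with uniform chart constants suffices for (4).) (5) Heat-kernel domination: there are $s_0>0$, $a_{hk}\ge1$ such that the transition density $p_t(x,y)$ of the process below with respect to $\mu$ satisfies $p_t(x,y)\le a_{hk}$ for all $t\ge s_0$, $x,y\in M$. Process. $X=(X_t)_{t\ge0}$ is reflected Brownian motion in $M$: the conservative $\mu$-symmetric Hunt process with continuous paths associated with the Dirichlet form $\mathcal E(f,g)=\frac12\int_M\nabla f\cdot\nabla g\,d\mu$, $f,g\in H^1(M)$. $\mathbb P_z$ is its law started at $z$. Notation. $\Gamma_T^\Delta=\{X_{k\Delta}:0\le k\Delta\le T,\ k\in\mathbb Z_{\ge0}\}$ is the trajectory sampled at mesh $\Delta$; for compact $S\subset\mathbb R^d$, $S^r=\{x\in\mathbb R^d:\operatorname{dist}(x,S)\le r\}$; $\omega_X(\Delta)=\sup\{|X_t-X_s|:|t-s|\le\Delta,\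 0\le s,t\le T\}$ is the path modulus. $N_\varepsilon(M)$ is the least $N$ for which there are $x_1,\dots,x_N\in M$ with $M\subseteq\bigcup_iB_M(x_i,\varepsilon)$. $\kappa_2(\varepsilon)=(\log\varepsilon^{-1})^{-1}$ and $\kappa_d(\varepsilon)=\varepsilon^{d-2}$ for $d\ge3$. Constants may depend on $d$, $M$ and the constants in (1)-(5), but not on $T,\delta,\varepsilon,r,\Delta,z$. *)

theory Defs
  imports "HOL-Probability.Probability" "HOL-Homology.Homology"
begin

section \<open>Geometry of a compact domain\<close>

text \<open>Extended-real valued, because the reach of a convex set is infinite.\<close>

definition reach :: "'a::metric_space set \<Rightarrow> ereal" where
  "reach M = Sup {ereal r | r. 0 \<le> r \<and>
     (\<forall>z. 0 < infdist z M \<and> infdist z M < r \<longrightarrow> (\<exists>!y. y \<in> M \<and> dist z y = infdist z M))}"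

definition curve_length :: "(real \<Rightarrow> 'a::metric_space) \<Rightarrow> ereal" where
  "curve_length \<gamma> = Sup {ereal (\<Sum>i<n. dist (\<gamma> (t i)) (\<gamma> (t (Suc i)))) | n t.
     mono_on {..n::nat} t \<and> t ` {..n} \<subseteq> {0..1::real}}"

definition intrinsic_dist :: "'a::metric_space set \<Rightarrow> 'a \<Rightarrow> 'a \<Rightarrow> ereal" where
  "intrinsic_dist M x y = Inf {curve_length \<gamma> | \<gamma>.
     path \<gamma> \<and> path_image \<gamma> \<subseteq> M \<and> pathstart \<gamma> = x \<and> pathfinish \<gamma> = y \<and> curve_length \<gamma> < \<infinity>}"

definition intrinsic_ball :: "'a::metric_space set \<Rightarrow> 'a \<Rightarrow> real \<Rightarrow> 'a set" where
  "intrinsic_ball M x \<epsilon> = {y \<in> M. intrinsic_dist M x y < ereal \<epsilon>}"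

definition covering_number :: "'a::metric_space set \<Rightarrow> real \<Rightarrow> nat" where
  "covering_number M \<epsilon> =
     (LEAST N. \<exists>x::nat \<Rightarrow> 'a. (\<forall>i<N. x i \<in> M) \<and> M \<subseteq> (\<Union>i<N. intrinsic_ball M (x i) \<epsilon>))"

definition offset :: "'a::metric_space set \<Rightarrow> real \<Rightarrow> 'a set" where
  "offset S r = {x. infdist x S \<le> r}"

text \<open>Normalized Lebesgue measure on \<open>M\<close>, as a measure on the whole space concentrated on \<open>M\<close>.\<close>

abbreviation normalized_volume :: "'a::euclidean_space set \<Rightarrow> 'a measure" where
  "normalized_volume M \<equiv> uniform_measure lborel M"

definition kappa :: "nat \<Rightarrow> real \<Rightarrow> real" where
  "kappa d \<epsilon> = (if d = 2 then inverse (ln (1 / \<epsilon>)) else \<epsilon> ^ (d - 2))"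


section \<open>The Neumann Dirichlet form\<close>

definition L2 :: "'a::euclidean_space set \<Rightarrow> ('a \<Rightarrow> real) set" where
  "L2 M = {f \<in> borel_measurable borel. integrable (normalized_volume M) (\<lambda>x. (f x)\<^sup>2)}"

definition L2_inner :: "'a::euclidean_space set \<Rightarrow> ('a \<Rightarrow> real) \<Rightarrow> ('a \<Rightarrow> real) \<Rightarrow> real" where
  "L2_inner M f g = (\<integral>x. f x * g x \<partial>normalized_volume M)"

text \<open>First-order weak derivatives in the interior of \<open>M\<close>, tested against compactly supported
  \<open>C\<^sup>1\<close> functions \<open>\<phi>\<close> (with gradient \<open>\<phi>'\<close>) as in Gilbarg and Trudinger.\<close>

definition weak_gradient ::
    "'a::euclidean_space set \<Rightarrow> ('a \<Rightarrow> real) \<Rightarrow> ('a \<Rightarrow> 'a) \<Rightarrow> bool" where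
  "weak_gradient M f G \<longleftrightarrow>
     G \<in> borel_measurable borel \<and>
     set_integrable (normalized_volume M) (interior M) (\<lambda>x. (norm (G x))\<^sup>2) \<and>
     (\<forall>\<phi> \<phi>'. (\<forall>x. (\<phi> has_derivative (\<lambda>h. \<phi>' x \<bullet> h)) (at x)) \<and> continuous_on UNIV \<phi>' \<and>
        (\<exists>K. compact K \<and> K \<subseteq> interior M \<and> (\<forall>x. x \<notin> K \<longrightarrow> \<phi> x = 0)) \<longrightarrow>
        (\<forall>b\<in>Basis. (\<integral>x. f x * (\<phi>' x \<bullet> b) \<partial>lborel) = - (\<integral>x. (G x \<bullet> b) * \<phi> x \<partial>lborel)))"

definition H1 :: "'a::euclidean_space set \<Rightarrow> ('a \<Rightarrow> real) set" where
  "H1 M = {f \<in> L2 M. \<exists>G. weak_gradient M f G}"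

definition gradient :: "'a::euclidean_space set \<Rightarrow> ('a \<Rightarrow> real) \<Rightarrow> 'a \<Rightarrow> 'a" where
  "gradient M f = (SOME G. weak_gradient M f G)"

text \<open>The integral runs over the interior of \<open>M\<close>, where weak gradients live; for the domains
  considered below the boundary is a null set.\<close>

definition energy :: "'a::euclidean_space set \<Rightarrow> ('a \<Rightarrow> real) \<Rightarrow> ('a \<Rightarrow> real) \<Rightarrow> real" where
  "energy M f g =
     1 / 2 * (LINT x:interior M|normalized_volume M. gradient M f x \<bullet> gradient M g x)"

text \<open>\<open>neumann_op M u h\<close> says that \<open>u\<close> is in the domain of the nonnegative self-adjoint operator on
  \<open>L\<^sup>2(M,\<mu>)\<close> generated by the form, i.e. \<open>-1/2\<close> times the Neumann Laplacian, and is mapped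
  to \<open>h\<close>. Its spectrum is real, so only real \<open>\<eta>\<close> are considered.\<close>

definition neumann_op :: "'a::euclidean_space set \<Rightarrow> ('a \<Rightarrow> real) \<Rightarrow> ('a \<Rightarrow> real) \<Rightarrow> bool" where
  "neumann_op M u h \<longleftrightarrow> u \<in> H1 M \<and> h \<in> L2 M \<and> (\<forall>v\<in>H1 M. energy M u v = L2_inner M h v)"

definition neumann_eigenspace :: "'a::euclidean_space set \<Rightarrow> real \<Rightarrow> ('a \<Rightarrow> real) set" where
  "neumann_eigenspace M \<eta> = {u. neumann_op M u (\<lambda>x. \<eta> * u x)}"

text \<open>\<open>\<eta>\<close> is in the resolvent set iff the operator minus \<open>\<eta>\<close> is injective (modulo null sets) and
  has a bounded inverse defined on all of \<open>L\<^sup>2\<close>.\<close>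

definition neumann_resolvent_set :: "'a::euclidean_space set \<Rightarrow> real set" where
  "neumann_resolvent_set M = {\<eta>.
     (\<forall>u\<in>neumann_eigenspace M \<eta>. AE x in normalized_volume M. u x = 0) \<and>
     (\<exists>K. \<forall>f\<in>L2 M. \<exists>u. neumann_op M u (\<lambda>x. \<eta> * u x + f x) \<and>
        L2_inner M u u \<le> K * L2_inner M f f)}"

definition neumann_spectrum :: "'a::euclidean_space set \<Rightarrow> real set" where
  "neumann_spectrum M = - neumann_resolvent_set M"

definition discrete_neumann_spectrum :: "'a::euclidean_space set \<Rightarrow> bool" where
  "discrete_neumann_spectrum M \<longleftrightarrow>
     (\<forall>\<eta>\<in>neumann_spectrum M. \<not> \<eta> islimpt neumann_spectrum M \<and>
        (\<exists>B. finite B \<and> B \<subseteq> neumann_eigenspace M \<eta> \<and>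
           (\<forall>u\<in>neumann_eigenspace M \<eta>. \<exists>c.
              AE x in normalized_volume M. u x = (\<Sum>b\<in>B. c b * b x))))"

text \<open>Eigenvalues are counted with multiplicity, so the gap includes that \<open>0\<close> is simple.\<close>

definition neumann_spectral_gap :: "'a::euclidean_space set \<Rightarrow> bool" where
  "neumann_spectral_gap M \<longleftrightarrow>
     (\<exists>\<gamma>>0. \<forall>\<eta>\<in>neumann_spectrum M. \<eta> = 0 \<or> \<gamma> \<le> \<eta>) \<and>
     (\<forall>u\<in>neumann_eigenspace M 0. \<exists>c. AE x in normalized_volume M. u x = c)"


section \<open>Reflected Brownian motion\<close>

text \<open>A process is given by a measurable space \<open>Om\<close>, random variables \<open>X t\<close> for \<open>0 \<le> t\<close>, and
  measures \<open>P z\<close> on \<open>Om\<close> for the starting points \<open>z \<in> M\<close>. Values for \<open>t < 0\<close> and for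
  starting points outside \<open>M\<close> are irrelevant.\<close>

definition natural_filtration ::
    "'w measure \<Rightarrow> (real \<Rightarrow> 'w \<Rightarrow> 'a::topological_space) \<Rightarrow> real \<Rightarrow> 'w measure" where
  "natural_filtration Om X t =
     sigma (space Om) {X s -` B \<inter> space Om | s B. 0 \<le> s \<and> s \<le> t \<and> B \<in> sets borel}"

definition right_filtration ::
    "'w measure \<Rightarrow> (real \<Rightarrow> 'w \<Rightarrow> 'a::topological_space) \<Rightarrow> real \<Rightarrow> 'w measure" where
  "right_filtration Om X t = sigma (space Om) (\<Inter>u\<in>{t<..}. sets (natural_filtration Om X u))"

text \<open>Finite stopping times suffice: the strong Markov property on \<open>{\<tau> < \<infinity>}\<close> follows by truncation.\<close>

definition strong_markov ::
    "'a::topological_space set \<Rightarrow> 'w measure \<Rightarrow> (real \<Rightarrow> 'w \<Rightarrow> 'a) \<Rightarrow> ('a \<Rightarrow> 'w measure) \<Rightarrow> bool" where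
  "strong_markov M Om X P \<longleftrightarrow>
     (\<forall>z\<in>M. \<forall>\<tau>. stopping_time (right_filtration Om X) \<tau> \<and> (\<forall>\<omega>\<in>space Om. 0 \<le> \<tau> \<omega>) \<longrightarrow>
        (\<forall>A\<in>sets (filtration.pre_sigma (space Om) (right_filtration Om X) \<tau>).
           \<forall>s\<ge>0. \<forall>B\<in>sets borel.
             measure (P z) {\<omega>\<in>A. X (\<tau> \<omega> + s) \<omega> \<in> B} =
             (\<integral>\<omega>. indicator A \<omega> * measure (P (X (\<tau> \<omega>) \<omega>)) {\<omega>'\<in>space Om. X s \<omega>' \<in> B} \<partial>P z)))"

text \<open>A conservative Hunt process on \<open>M\<close> with continuous paths. Conservativeness is the absence of
  a cemetery state; path continuity subsumes right continuity with left limits and quasi-left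
  continuity.\<close>

definition continuous_hunt_process ::
    "'a::topological_space set \<Rightarrow> 'w measure \<Rightarrow> (real \<Rightarrow> 'w \<Rightarrow> 'a) \<Rightarrow> ('a \<Rightarrow> 'w measure) \<Rightarrow> bool" where
  "continuous_hunt_process M Om X P \<longleftrightarrow>
     (\<forall>t\<ge>0. X t \<in> borel_measurable Om \<and> (\<forall>\<omega>\<in>space Om. X t \<omega> \<in> M)) \<and>
     (\<forall>\<omega>\<in>space Om. continuous_on {0..} (\<lambda>t. X t \<omega>)) \<and>
     (\<forall>z\<in>M. prob_space (P z) \<and> sets (P z) = sets Om \<and> (AE \<omega> in P z. X 0 \<omega> = z)) \<and>
     (\<forall>t\<ge>0. \<forall>B\<in>sets borel.
        (\<lambda>z. measure (P z) {\<omega>\<in>space Om. X t \<omega> \<in> B}) \<in> borel_measurable (restrict_space borel M)) \<and>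
     strong_markov M Om X P"

definition semigroup ::
    "'a set \<Rightarrow> (real \<Rightarrow> 'w \<Rightarrow> 'a) \<Rightarrow> ('a \<Rightarrow> 'w measure) \<Rightarrow> real \<Rightarrow> ('a \<Rightarrow> real) \<Rightarrow> 'a \<Rightarrow> real" where
  "semigroup M X P t f x = (if x \<in> M then \<integral>\<omega>. f (X t \<omega>) \<partial>P x else 0)"

definition symmetric_process ::
    "'a::euclidean_space set \<Rightarrow> (real \<Rightarrow> 'w \<Rightarrow> 'a) \<Rightarrow> ('a \<Rightarrow> 'w measure) \<Rightarrow> bool" where
  "symmetric_process M X P \<longleftrightarrow>
     (\<forall>t>0. \<forall>f\<in>borel_measurable borel. \<forall>g\<in>borel_measurable borel.
        bounded (range f) \<and> bounded (range g) \<longrightarrow>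
        L2_inner M f (semigroup M X P t g) = L2_inner M (semigroup M X P t f) g)"

text \<open>The Dirichlet form of a symmetric process is the limit, as \<open>t\<close> tends to \<open>0\<close>, of the
  approximating forms \<open>(f - P\<^sub>t f, g) / t\<close>; its domain consists of those \<open>f\<close> for which the
  limit with \<open>g = f\<close> is finite.\<close>

definition approx_form ::
    "'a::euclidean_space set \<Rightarrow> (real \<Rightarrow> 'w \<Rightarrow> 'a) \<Rightarrow> ('a \<Rightarrow> 'w measure) \<Rightarrow> real \<Rightarrow>
     ('a \<Rightarrow> real) \<Rightarrow> ('a \<Rightarrow> real) \<Rightarrow> real" where
  "approx_form M X P t f g = 1 / t * L2_inner M (\<lambda>x. f x - semigroup M X P t f x) g"

definition associated_with_neumann_form ::
    "'a::euclidean_space set \<Rightarrow> (real \<Rightarrow> 'w \<Rightarrow> 'a) \<Rightarrow> ('a \<Rightarrow> 'w measure) \<Rightarrow> bool" where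
  "associated_with_neumann_form M X P \<longleftrightarrow>
     (\<forall>f\<in>L2 M. f \<in> H1 M \<longleftrightarrow> (\<exists>l. ((\<lambda>t. approx_form M X P t f f) \<longlongrightarrow> l) (at_right 0))) \<and>
     (\<forall>f\<in>H1 M. \<forall>g\<in>H1 M. ((\<lambda>t. approx_form M X P t f g) \<longlongrightarrow> energy M f g) (at_right 0))"

text \<open>The form determines the laws only for quasi-every starting point. The last conjunct is the
  usual absolute continuity condition, which singles out the version started at \<^emph>\<open>every\<close> point
  of \<open>M\<close>; without it the process could for instance be frozen at a polar point.\<close>

definition reflected_brownian_motion ::
    "'a::euclidean_space set \<Rightarrow> 'w measure \<Rightarrow> (real \<Rightarrow> 'w \<Rightarrow> 'a) \<Rightarrow> ('a \<Rightarrow> 'w measure) \<Rightarrow> bool" where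
  "reflected_brownian_motion M Om X P \<longleftrightarrow>
     continuous_hunt_process M Om X P \<and>
     symmetric_process M X P \<and>
     associated_with_neumann_form M X P \<and>
     (\<forall>z\<in>M. \<forall>t>0. absolutely_continuous (normalized_volume M) (distr (P z) borel (X t)))"

definition path_space :: "'a::topological_space set \<Rightarrow> (real \<Rightarrow> 'a) measure" where
  "path_space M = restrict_space (\<Pi>\<^sub>M t\<in>{0..}. borel)
     {w. continuous_on {0..} w \<and> (\<forall>t\<ge>0. w t \<in> M)}"

definition coordinate :: "real \<Rightarrow> (real \<Rightarrow> 'a) \<Rightarrow> 'a" where
  "coordinate t w = w t"

abbreviation canonical_reflected_brownian_motion ::
    "'a::euclidean_space set \<Rightarrow> ('a \<Rightarrow> (real \<Rightarrow> 'a) measure) \<Rightarrow> bool" where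
  "canonical_reflected_brownian_motion M P \<equiv>
     reflected_brownian_motion M (path_space M) coordinate P"

definition symmetric_transition_density ::
    "'a::euclidean_space set \<Rightarrow> (real \<Rightarrow> 'w \<Rightarrow> 'a) \<Rightarrow> ('a \<Rightarrow> 'w measure) \<Rightarrow>
     (real \<Rightarrow> 'a \<Rightarrow> 'a \<Rightarrow> real) \<Rightarrow> bool" where
  "symmetric_transition_density M X P p \<longleftrightarrow>
     (\<forall>t>0. (\<lambda>(x, y). p t x y) \<in> borel_measurable (borel \<Otimes>\<^sub>M borel) \<and>
        (\<forall>x\<in>M. \<forall>y\<in>M. 0 \<le> p t x y \<and> p t x y = p t y x) \<and>
        (\<forall>z\<in>M. distr (P z) borel (X t) = density (normalized_volume M) (\<lambda>y. ennreal (p t z y))))"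

definition neumann_heat_kernel ::
    "'a::euclidean_space set \<Rightarrow> (real \<Rightarrow> 'a \<Rightarrow> 'a \<Rightarrow> real) \<Rightarrow> bool" where
  "neumann_heat_kernel M p \<longleftrightarrow>
     (\<exists>P. canonical_reflected_brownian_motion M P \<and> symmetric_transition_density M coordinate P p)"

definition compact_semigroup ::
    "'a::euclidean_space set \<Rightarrow> (real \<Rightarrow> 'w \<Rightarrow> 'a) \<Rightarrow> ('a \<Rightarrow> 'w measure) \<Rightarrow> bool" where
  "compact_semigroup M X P \<longleftrightarrow>
     (\<forall>t>0. \<forall>f::nat \<Rightarrow> 'a \<Rightarrow> real. (\<forall>n. f n \<in> L2 M \<and> L2_inner M (f n) (f n) \<le> 1) \<longrightarrow>
        (\<exists>h\<in>L2 M. \<exists>r. strict_mono r \<and>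
           (\<lambda>n. \<integral>x. (semigroup M X P t (f (r n)) x - h x)\<^sup>2 \<partial>normalized_volume M)
             \<longlonglongrightarrow> 0))"


section \<open>Admissible reflecting domains\<close>

definition jacobian_bounds ::
    "real \<Rightarrow> real \<Rightarrow> (real ^ 'n) set \<Rightarrow> (real ^ 'n \<Rightarrow> real ^ 'n) \<Rightarrow> bool" where
  "jacobian_bounds a b U f \<longleftrightarrow>
     (AE y in lebesgue. y \<in> U \<longrightarrow>
        (\<exists>D. (f has_derivative D) (at y within U) \<and>
             a \<le> \<bar>det (matrix D)\<bar> \<and> \<bar>det (matrix D)\<bar> \<le> b))"

definition bilipschitz_chart ::
    "real \<Rightarrow> real \<Rightarrow> real \<Rightarrow> (real ^ 'n) set \<Rightarrow> (real ^ 'n \<Rightarrow> real ^ 'n) \<Rightarrow> bool" where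
  "bilipschitz_chart L a b U \<Psi> \<longleftrightarrow>
     inj_on \<Psi> U \<and> L-lipschitz_on U \<Psi> \<and> L-lipschitz_on (\<Psi> ` U) (inv_into U \<Psi>) \<and>
     jacobian_bounds a b U \<Psi> \<and> jacobian_bounds a b (\<Psi> ` U) (inv_into U \<Psi>)"

definition uniform_charts :: "(real ^ 'n) set \<Rightarrow> real \<Rightarrow> real \<Rightarrow> bool" where
  "uniform_charts M \<rho> L \<longleftrightarrow>
     (\<exists>a b. 0 < a \<and> a \<le> b \<and>
       (\<forall>x\<in>M. \<exists>U \<Psi>.
          U \<subseteq> M \<and> (\<exists>V. open V \<and> x \<in> V \<and> V \<inter> M \<subseteq> U) \<and>
          bilipschitz_chart L a b U \<Psi> \<and>
          (\<rho> \<le> infdist x (frontier M) \<longrightarrow> (\<exists>y r. 0 < r \<and> \<Psi> ` U = ball y r)) \<and>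
          (infdist x (frontier M) < \<rho> \<longrightarrow>
             (\<exists>y r \<nu>. 0 < r \<and> norm \<nu> = 1 \<and>
                \<Psi> ` U = {w \<in> ball y r. 0 \<le> (w - y) \<bullet> \<nu>} \<and>
                \<Psi> ` (U \<inter> frontier M) \<subseteq> {w. (w - y) \<bullet> \<nu> = 0}))))"

text \<open>Existence and uniqueness in law are expressed on the canonical path space.\<close>

definition admissible_reflecting_domain :: "(real ^ 'n) set \<Rightarrow> real \<Rightarrow> real \<Rightarrow> bool" where
  "admissible_reflecting_domain M \<rho> L \<longleftrightarrow>
     (\<exists>P. canonical_reflected_brownian_motion M P \<and>
        (\<forall>Q. canonical_reflected_brownian_motion M Q \<longrightarrow> (\<forall>z\<in>M. Q z = P z)) \<and>
        (\<exists>p. symmetric_transition_density M coordinate P p) \<and>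
        compact_semigroup M coordinate P) \<and>
     discrete_neumann_spectrum M \<and> neumann_spectral_gap M \<and>
     0 < \<rho> \<and> 1 \<le> L \<and> uniform_charts M \<rho> L"


section \<open>Sampled trajectories\<close>

definition sampled_trajectory :: "(real \<Rightarrow> 'w \<Rightarrow> 'a) \<Rightarrow> real \<Rightarrow> real \<Rightarrow> 'w \<Rightarrow> 'a set" where
  "sampled_trajectory X T \<Delta> \<omega> = {X (real k * \<Delta>) \<omega> | k::nat. real k * \<Delta> \<le> T}"

definition path_modulus :: "(real \<Rightarrow> 'w \<Rightarrow> 'a::metric_space) \<Rightarrow> real \<Rightarrow> real \<Rightarrow> 'w \<Rightarrow> real" where
  "path_modulus X T \<Delta> \<omega> = Sup {dist (X t \<omega>) (X s \<omega>) | s t.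
     \<bar>t - s\<bar> \<le> \<Delta> \<and> 0 \<le> s \<and> s \<le> T \<and> 0 \<le> t \<and> t \<le> T}"


section \<open>Singular homology with field coefficients\<close>

text \<open>The library provides singular homology over the integers only; simplices and faces are
  taken from there.\<close>

type_synonym ('a, 'k) coeff_chain = "((nat \<Rightarrow> real) \<Rightarrow> 'a) \<Rightarrow>\<^sub>0 'k"

definition chain_scale :: "'k::field \<Rightarrow> ('a, 'k) coeff_chain \<Rightarrow> ('a, 'k) coeff_chain" where
  "chain_scale a c = Poly_Mapping.map (\<lambda>x. a * x) c"

definition coeff_chains :: "nat \<Rightarrow> 'a topology \<Rightarrow> ('a, 'k::field) coeff_chain set" where
  "coeff_chains q X = {c. Poly_Mapping.keys c \<subseteq> singular_simplex_set q X}"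

definition coeff_boundary :: "nat \<Rightarrow> ('a, 'k::field) coeff_chain \<Rightarrow> ('a, 'k) coeff_chain" where
  "coeff_boundary q c =
     (if q = 0 then 0
      else \<Sum>f\<in>Poly_Mapping.keys c. \<Sum>k\<le>q.
        Poly_Mapping.single (singular_face q k f) ((-1) ^ k * Poly_Mapping.lookup c f))"

definition coeff_cycles :: "nat \<Rightarrow> 'a topology \<Rightarrow> ('a, 'k::field) coeff_chain set" where
  "coeff_cycles q X = {c \<in> coeff_chains q X. coeff_boundary q c = 0}"

definition coeff_boundaries :: "nat \<Rightarrow> 'a topology \<Rightarrow> ('a, 'k::field) coeff_chain set" where
  "coeff_boundaries q X = coeff_boundary (Suc q) ` coeff_chains (Suc q) X"

text \<open>The quotient vector space of cycles modulo boundaries, with cosets as elements. The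
  multiplicative part of the record is unused. A scaled coset is re-saturated with
  boundaries so that scaling by \<open>0\<close> gives the zero coset.\<close>

definition coeff_homology ::
    "nat \<Rightarrow> 'a topology \<Rightarrow> ('k::field, ('a, 'k) coeff_chain set) module" where
  "coeff_homology q X =
     \<lparr>carrier = (\<lambda>z. (+) z ` coeff_boundaries q X) ` coeff_cycles q X,
      monoid.mult = undefined,
      one = undefined,
      zero = coeff_boundaries q X,
      add = (\<lambda>U V. {u + v | u v. u \<in> U \<and> v \<in> V}),
      smult = (\<lambda>a U. {chain_scale a u + b | u b. u \<in> U \<and> b \<in> coeff_boundaries q X})\<rparr>"

definition linearly_isomorphic :: "('k, 'v) module \<Rightarrow> ('k, 'w) module \<Rightarrow> bool" where
  "linearly_isomorphic V W \<longleftrightarrow>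
     (\<exists>\<phi>. bij_betw \<phi> (carrier V) (carrier W) \<and>
        (\<forall>u\<in>carrier V. \<forall>v\<in>carrier V. \<phi> (u \<oplus>\<^bsub>V\<^esub> v) = \<phi> u \<oplus>\<^bsub>W\<^esub> \<phi> v) \<and>
        (\<forall>a. \<forall>u\<in>carrier V. \<phi> (a \<odot>\<^bsub>V\<^esub> u) = a \<odot>\<^bsub>W\<^esub> \<phi> u))"

end

theory Submission
  imports Defs
begin

text \<open>The statement splits into a deterministic and a probabilistic half, joined by a covering argument.

  For the deterministic half, let \<open>S \<subseteq> M\<close> be compact and suppose that every point of \<open>M\<close> is within \<open>r / 2\<close> of
  \<open>S\<close>, where \<open>r\<close> is at most a quarter of the reach. Every point \<open>x\<close> of the offset of \<open>S\<close> then
  has a unique nearest point in \<open>M\<close>, depending continuously on \<open>x\<close>, and the segment from \<open>x\<close> to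
  it stays inside the offset (\<open>offset_segment_to_projection\<close>): if \<open>x\<close> is close to \<open>M\<close>, a point
  of \<open>S\<close> near the projection is near both ends of the segment, and if \<open>x\<close> is far from \<open>M\<close>, the
  empty balls that positive reach provides along normals force the point of \<open>S\<close> near \<open>x\<close> to be near
  the projection as well. So \<open>M\<close> is a deformation retract of the offset. Homotopy invariance of the
  homology with field coefficients is obtained from integral chains: prism chains on the models
  \<open>[0,1] \<times> \<Delta>\<^sup>p\<close> exist because these spaces are contractible, and they extend linearly to any field
  (\<open>coeff_homology_deformation\<close>).

  The probabilistic half is that by time \<open>T\<close> the process has visited every one of the
  \<open>N\<^sub>\<epsilon>(M)\<close> Euclidean balls of radius \<open>\<epsilon> / c_ie\<close> around the centres of a minimal intrinsic cover,
  except on an event of probability \<open>\<delta>\<close>. A path whose modulus at the mesh \<open>\<Delta>\<close> is at most \<open>\<epsilon>\<close>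
  then leaves samples within \<open>3 \<epsilon>\<close> of every point of \<open>M\<close>. By a union bound it is enough that the
  probability to avoid one ball during \<open>[s0, s0 + n]\<close> is at most \<open>a_hk (1 + \<eta>)\<^sup>-\<^sup>n\<close>, with \<open>\<eta>\<close> of the
  order \<open>\<kappa>\<^sub>d(\<epsilon>)\<close>. After time \<open>s0\<close> the law of the process has density at most \<open>a_hk\<close>, so that the
  start is as good as a start from \<open>\<mu>\<close>, and the decay is governed by the lowest Dirichlet eigenvalue of
  \<open>M\<close> minus the ball.

  The eigenvalue bound (\<open>dirichlet_eigenvalue_bound\<close>) compares \<open>f\<close>, vanishing on a ball of radius
  \<open>\<epsilon>\<close> around \<open>y\<close>, with its mean \<open>m\<close>. Positive reach together with the lower volume bound
  gives a cone in \<open>M\<close> with vertex \<open>y\<close>, of a size that does not depend on \<open>y\<close>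
  (\<open>uniform_interior_cone\<close>). On this cone there is a vector field with square integral of order
  \<open>1 / \<kappa>\<^sub>d(\<epsilon>)\<close> whose divergence lives near \<open>y\<close>, where \<open>f = 0\<close>, and at a fixed distance from \<open>y\<close>,
  where it is bounded and has mass bounded below. Integration by parts and the Cauchy-Schwarz inequality bound
  the weighted average of \<open>f\<close> by the square root of \<open>energy / \<kappa>\<^sub>d(\<epsilon>)\<close>, while the Poincare inequality
  bounds \<open>f - m\<close>; hence \<open>m\<^sup>2\<close>, and with it the square norm of \<open>f\<close>, is at most a constant times
  \<open>energy / \<kappa>\<^sub>d(\<epsilon>)\<close>. The Poincare inequality itself (\<open>poincare_inequality\<close>) follows by contradiction
  from the compactness of the semigroup and the simplicity of the eigenvalue \<open>0\<close>.

  The decay (\<open>survival_mass_decay\<close>) is derived from the semigroup alone. The probability \<open>q\<^sub>t\<close> to be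
  in \<open>A\<close> at all dyadic times up to \<open>t\<close> is a decreasing limit of iterates of \<open>1\<^sub>A P\<^sub>h 1\<^sub>A\<close>, and
  \<open>\<phi>(t) = \<langle>1\<^sub>A, q\<^sub>t\<rangle> = \<langle>q\<^sub>t\<^sub>/\<^sub>2, q\<^sub>t\<^sub>/\<^sub>2\<rangle>\<close> is convex on dyadic times. Its slope bounds the energy of \<open>q\<^sub>t\<^sub>/\<^sub>2\<close>,
  which is thereby in \<open>H1\<close>, and the eigenvalue bound turns this into \<open>(1 + \<eta>) \<phi>(n + 1) \<le> \<phi>(n)\<close>.

  The density bound is known for the canonical process only. It is carried over to an arbitrary
  realization by showing that the law on path space of a reflected Brownian motion is again one
  (\<open>canonical_law\<close>), so that uniqueness in law applies.\<close>


section \<open>Projection onto a set of positive reach\<close>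

text \<open>The nearest point to \<open>z\<close> is unique as soon as \<open>z\<close> is closer than
  \<open>R\<close> to \<open>M\<close>. A real radius below the reach replaces the extended-real
  reach in all estimates.\<close>

definition projects_uniquely :: "'a::euclidean_space set \<Rightarrow> real \<Rightarrow> bool" where
  "projects_uniquely M R \<longleftrightarrow>
     (\<forall>z y. infdist z M < R \<and> y \<in> M \<and> dist z y = infdist z M \<longrightarrow> y = closest_point M z)"

lemma closest_point_infdist:
  fixes M :: "'a::euclidean_space set"
  assumes "compact M" "M \<noteq> {}"
  shows "dist z (closest_point M z) = infdist z M"
proof (rule antisym)
  have c: "closed M" using assms by (simp add: compact_imp_closed)
  show "infdist z M \<le> dist z (closest_point M z)"
    using closest_point_in_set[OF c assms(2)] by (rule infdist_le)
  show "dist z (closest_point M z) \<le> infdist z M"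
    using closest_point_le[OF c, of _ z] assms(2) unfolding infdist_def
    by (auto intro: cINF_greatest)
qed

lemma reach_projects_uniquely:
  fixes M :: "'a::euclidean_space set"
  assumes "compact M" "M \<noteq> {}" "ereal R < reach M"
  shows "projects_uniquely M R"
proof -
  obtain r where r: "ereal R < ereal r"
    and u: "\<And>z. 0 < infdist z M \<Longrightarrow> infdist z M < r \<Longrightarrow> \<exists>!y. y \<in> M \<and> dist z y = infdist z M"
    using assms(3) unfolding reach_def less_Sup_iff by auto
  have c: "closed M" using assms by (simp add: compact_imp_closed)
  show ?thesis unfolding projects_uniquely_def
  proof (intro allI impI, elim conjE)
    fix z y assume z: "infdist z M < R" "y \<in> M" "dist z y = infdist z M"
    show "y = closest_point M z"
    proof (cases "infdist z M = 0")
      case True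
      then have "z = y" using z by simp
      then show ?thesis using z closest_point_self by metis
    next
      case False
      then have "0 < infdist z M" using infdist_nonneg[of z M] by simp
      then have "\<exists>!y. y \<in> M \<and> dist z y = infdist z M" using u[of z] z r by simp
      moreover have "closest_point M z \<in> M \<and> dist z (closest_point M z) = infdist z M"
        using closest_point_infdist[OF assms(1,2)] closest_point_in_set[OF c assms(2)] by simp
      ultimately show ?thesis using z by blast
    qed
  qed
qed

text \<open>The graph is the set of pairs that realize the distance, by uniqueness of the nearest point;
  this set is closed, and a map into a compact space with closed graph is continuous.\<close>

lemma continuous_on_closest_point_reach:
  fixes M :: "'a::euclidean_space set"
  assumes "compact M" "M \<noteq> {}" "projects_uniquely M R" "\<And>z. z \<in> D \<Longrightarrow> infdist z M < R"
  shows "continuous_on D (closest_point M)"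
proof -
  have c: "closed M" using assms by (simp add: compact_imp_closed)
  have f: "closest_point M \<in> D \<rightarrow> M" using closest_point_in_set[OF c assms(2)] by auto
  have "(\<lambda>x. (x, closest_point M x)) ` D = (D \<times> M) \<inter> {p. dist (fst p) (snd p) = infdist (fst p) M}"
    using assms(3,4) closest_point_infdist[OF assms(1,2)] closest_point_in_set[OF c assms(2)]
    unfolding projects_uniquely_def by (force simp: image_iff)
  moreover have "closed {p::'a\<times>'a. dist (fst p) (snd p) = infdist (fst p) M}"
    by (intro closed_Collect_eq continuous_intros)
  ultimately have "closedin (top_of_set (D \<times> M)) ((\<lambda>x. (x, closest_point M x)) ` D)"
    by (simp add: closedin_closed_Int)
  then show ?thesis using continuous_closed_graph_eq[OF assms(1) f] by simp
qed

text \<open>Federer's argument. If the nearest point to one point of the ray from \<open>y\<close> in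
  direction \<open>v\<close> is \<open>y\<close>, the same holds along the ray up to distance
  \<open>R\<close>. The set of good parameters is an interval by the triangle inequality. If it
  ended at some \<open>\<tau> < R\<close>, Brouwer's theorem would provide a point beyond the end
  of the good segment, on the same normal, that still projects to \<open>y\<close>.\<close>

lemma infdist_along_normal:
  fixes M :: "'a::euclidean_space set"
  assumes M: "compact M" "M \<noteq> {}" and R: "projects_uniquely M R"
    and y: "y \<in> M" and v: "norm v = 1"
    and z: "0 < \<rho>" "\<rho> < R" "infdist (y + \<rho> *\<^sub>R v) M = \<rho>"
    and s: "0 \<le> s" "s < R"
  shows "infdist (y + s *\<^sub>R v) M = s"
proof -
  define I where "I = {t. 0 \<le> t \<and> infdist (y + t *\<^sub>R v) M = t}"
  have le: "infdist (y + t *\<^sub>R v) M \<le> t" if "0 \<le> t" for t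
    using infdist_le[OF y, of "y + t *\<^sub>R v"] that v by (simp add: dist_norm)
  have down: "t' \<in> I" if "t \<in> I" "0 \<le> t'" "t' \<le> t" for t t'
  proof -
    have "t \<le> infdist (y + t' *\<^sub>R v) M + dist (y + t *\<^sub>R v) (y + t' *\<^sub>R v)"
      using that infdist_triangle[of "y + t *\<^sub>R v" M "y + t' *\<^sub>R v"] by (simp add: I_def)
    moreover have "dist (y + t *\<^sub>R v) (y + t' *\<^sub>R v) = t - t'"
      using that v by (simp add: dist_norm flip: scaleR_diff_left)
    ultimately have "t' \<le> infdist (y + t' *\<^sub>R v) M" by linarith
    then show ?thesis using le[of t'] that by (simp add: I_def)
  qed
  have "s \<in> I"
  proof (rule ccontr)
    assume sI: "s \<notin> I"
    define J where "J = I \<inter> {..s}"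
    have ub: "t < s" if "t \<in> I" for t using down[OF that s(1)] sI by (meson not_le)
    have \<rho>I: "\<rho> \<in> I" using z by (simp add: I_def)
    have cl: "closed I" unfolding I_def
      by (intro closed_Collect_conj closed_Collect_le closed_Collect_eq continuous_intros)
    define \<tau> where "\<tau> = Sup I"
    have bdd: "bdd_above I" using ub by (meson bdd_aboveI less_imp_le)
    have \<tau>I: "\<tau> \<in> I" unfolding \<tau>_def using closed_contains_Sup[OF _ bdd cl] \<rho>I by auto
    have \<tau>0: "0 < \<tau>" using cSup_upper[OF \<rho>I bdd] z(1) unfolding \<tau>_def by linarith
    have \<tau>R: "\<tau> < R" using ub[OF \<tau>I] s by simp
    define x0 where "x0 = y + \<tau> *\<^sub>R v"
    have ix0: "infdist x0 M = \<tau>" using \<tau>I by (simp add: I_def x0_def)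
    (* On the ball of radius e around x0 the projection is continuous and never meets x0. *)
    define e where "e = min (\<tau>/2) ((R - \<tau>)/2)"
    have e: "0 < e" "e < \<tau>" "e < R - \<tau>" using \<tau>0 \<tau>R by (auto simp: e_def min_def)
    let ?\<xi> = "closest_point M"
    have c: "closed M" using M by (simp add: compact_imp_closed)
    have \<xi>M: "?\<xi> x \<in> M" for x using closest_point_in_set[OF c M(2)] .
    have ne: "x0 \<noteq> ?\<xi> x" for x using \<xi>M[of x] ix0 \<tau>0 by auto
    have near: "infdist x M < R" if "x \<in> cball x0 e" for x
      using infdist_triangle[of x M x0] that ix0 e by (simp add: dist_commute)
    (* F moves x0 by e away from the projection of x. At a fixed point x1, the points \<xi> x1,
       x0 and x1 are in this order on a line, so \<xi> x1 is also the point of M nearest to x0,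
       which is y. *)
    define F where "F x = x0 + (e / norm (x0 - ?\<xi> x)) *\<^sub>R (x0 - ?\<xi> x)" for x
    have "continuous_on (cball x0 e) ?\<xi>" by (rule continuous_on_closest_point_reach[OF M R near])
    then have cont: "continuous_on (cball x0 e) F" unfolding F_def
      using ne by (intro continuous_intros) auto
    have "F \<in> cball x0 e \<rightarrow> cball x0 e" using ne e by (auto simp: F_def dist_norm)
    from brouwer_ball[OF e(1) cont this] obtain x1 where x1: "x1 \<in> cball x0 e" "F x1 = x1" .
    define a where "a = ?\<xi> x1"
    define n where "n = norm (x0 - a)"
    have n0: "n > 0" using ne[of x1] by (simp add: n_def a_def)
    have x1eq: "x1 - a = ((n + e) / n) *\<^sub>R (x0 - a)"
    proof -
      have "x1 = x0 + (e / n) *\<^sub>R (x0 - a)" using x1(2) unfolding F_def n_def a_def by simp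
      then have "x1 - a = (1 + e/n) *\<^sub>R (x0 - a)" by (simp add: algebra_simps)
      then show ?thesis using n0 by (simp add: add_divide_distrib)
    qed
    have d1: "infdist x1 M = n + e"
    proof -
      have "infdist x1 M = norm (x1 - a)" using closest_point_infdist[OF M, of x1] by (simp add: a_def dist_norm)
      also have "\<dots> = n + e" unfolding x1eq using n0 e by (simp add: n_def[symmetric])
      finally show ?thesis .
    qed
    have "n \<le> infdist x0 M"
      using infdist_triangle[of x1 M x0] x1(1) d1 by (simp add: dist_commute)
    then have n\<tau>: "infdist x0 M = n" using infdist_le[of a M x0] \<xi>M[of x1] by (simp add: a_def n_def dist_norm)
    have "a = ?\<xi> x0" using R n\<tau> \<tau>R ix0 \<xi>M[of x1] unfolding projects_uniquely_def
      by (auto simp: a_def n_def dist_norm)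
    moreover have "y = ?\<xi> x0" using R ix0 \<tau>R y v \<tau>0 unfolding projects_uniquely_def
      by (auto simp: x0_def dist_norm)
    ultimately have ay: "a = y" by simp
    have "n = \<tau>" using n\<tau> ix0 by simp
    then have "x1 - y = ((\<tau> + e) / \<tau>) *\<^sub>R \<tau> *\<^sub>R v" using x1eq ay by (simp add: x0_def)
    then have "x1 - y = (\<tau> + e) *\<^sub>R v" using \<tau>0 by simp
    then have "x1 = y + (\<tau> + e) *\<^sub>R v" by (simp add: diff_eq_eq add.commute)
    then have "\<tau> + e \<in> I" using d1 \<open>n = \<tau>\<close> e \<tau>0 by (simp add: I_def)
    then have "\<tau> + e \<le> \<tau>" unfolding \<tau>_def using bdd by (rule cSup_upper)
    then show False using e by simp
  qed
  then show ?thesis by (simp add: I_def)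
qed

text \<open>The open ball of radius \<open>s\<close> that touches \<open>M\<close> at the projection of
  \<open>z\<close>, on the side of \<open>z\<close>, contains no point of \<open>M\<close>; the
  inequality expresses that \<open>w\<close> is outside this ball. It is stated without
  normalizing the normal vector, so that it also covers \<open>z \<in> M\<close>.\<close>

lemma reach_inner_bound:
  fixes M :: "'a::euclidean_space set"
  assumes M: "compact M" "M \<noteq> {}" and R: "projects_uniquely M R"
    and z: "infdist z M < R" and s: "0 < s" "s < R" and w: "w \<in> M"
  shows "2 * s * ((w - closest_point M z) \<bullet> (z - closest_point M z))
           \<le> norm (z - closest_point M z) * (norm (w - closest_point M z))\<^sup>2"
proof (cases "z = closest_point M z")
  case True
  then have "z - closest_point M z = 0" by simp
  then show ?thesis by (simp only: inner_zero_right norm_zero)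
next
  case False
  define y where "y = closest_point M z"
  define a where "a = norm (z - y)"
  define v where "v = (1 / a) *\<^sub>R (z - y)"
  have a: "0 < a" using False by (simp add: a_def y_def)
  have v: "norm v = 1" using a by (simp add: v_def a_def)
  have yM: "y \<in> M" using M by (simp add: y_def compact_imp_closed closest_point_in_set)
  have az: "infdist z M = a" using closest_point_infdist[OF M, of z] by (simp add: y_def a_def dist_norm)
  have zeq: "z = y + a *\<^sub>R v" using a by (simp add: v_def)
  have "infdist (y + s *\<^sub>R v) M = s"
    using infdist_along_normal[OF M R yM v, of a s] a az z s zeq by simp
  then have "s \<le> norm (y + s *\<^sub>R v - w)" using infdist_le[OF w, of "y + s *\<^sub>R v"] by (simp add: dist_norm)
  then have "s\<^sup>2 \<le> (norm (y + s *\<^sub>R v - w))\<^sup>2" using s by (simp add: power_mono)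
  also have "\<dots> = (norm (w - y))\<^sup>2 + s\<^sup>2 - 2 * s * ((w - y) \<bullet> v)"
    using v unfolding power2_norm_eq_inner norm_eq_1
    by (simp add: inner_diff_left inner_diff_right inner_add_left inner_add_right inner_commute algebra_simps power2_eq_square)
  finally have "2 * s * ((w - y) \<bullet> v) \<le> (norm (w - y))\<^sup>2" by simp
  then have "a * (2 * s * ((w - y) \<bullet> v)) \<le> a * (norm (w - y))\<^sup>2" using a by simp
  moreover have "z - y = a *\<^sub>R v" using zeq by simp
  ultimately show ?thesis unfolding y_def[symmetric] a_def[symmetric]
    by (simp add: mult_ac)
qed

text \<open>A segment lies in a ball as soon as both ends do, so it suffices to find one point of
  \<open>S\<close> within \<open>r\<close> of \<open>x\<close> and of its projection
  \<open>y\<close>. If \<open>dist x y + \<eta> \<le> r\<close>, a point of \<open>S\<close>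
  within \<open>\<eta>\<close> of \<open>y\<close> will do. Otherwise \<open>dist x y \<ge> r /
  2\<close>, and the empty ball of radius \<open>2 r\<close> above \<open>y\<close> keeps the
  points of \<open>M\<close> that are within \<open>r\<close> of \<open>x\<close> within
  \<open>r\<close> of \<open>y\<close>.\<close>

lemma offset_segment_to_projection:
  fixes M :: "'a::euclidean_space set"
  assumes M: "compact M" "M \<noteq> {}" and R: "projects_uniquely M R"
    and S: "compact S" "S \<noteq> {}" "S \<subseteq> M" and dense: "\<And>y. y \<in> M \<Longrightarrow> infdist y S \<le> \<eta>"
    and r: "0 < r" "\<eta> \<le> r / 2" "2 * r < R" and x: "x \<in> offset S r"
  shows "closed_segment x (closest_point M x) \<subseteq> offset S r"
proof -
  define y where "y = closest_point M x"
  define a where "a = norm (x - y)"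
  have yM: "y \<in> M" using M by (simp add: y_def compact_imp_closed closest_point_in_set)
  have near: "\<exists>s\<in>S. dist w s = infdist w S" for w
    using closest_point_infdist[OF S(1,2), of w] closest_point_in_set[OF compact_imp_closed[OF S(1)] S(2), of w] by blast
  obtain s where s: "s \<in> S" "dist x s \<le> r" using near[of x] x unfolding offset_def by auto
  have "infdist x M \<le> r" using s S infdist_le[of s M x] by auto
  then have ar: "a \<le> r" using closest_point_infdist[OF M, of x] by (simp add: a_def y_def dist_norm)
  have sub: "closed_segment x y \<subseteq> offset S r"
    if "u \<in> S" "dist x u \<le> r" "dist y u \<le> r" for u
  proof
    fix z assume "z \<in> closed_segment x y"
    moreover have "closed_segment x y \<subseteq> cball u r" using that by (intro closed_segment_subset) (auto simp: dist_commute)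
    ultimately have "dist z u \<le> r" by (auto simp: dist_commute)
    then show "z \<in> offset S r" using infdist_le2[OF that(1)] by (simp add: offset_def)
  qed
  show ?thesis
  proof (cases "a + \<eta> \<le> r")
    case True
    obtain u where u: "u \<in> S" "dist y u \<le> \<eta>" using near[of y] dense[OF yM] by auto
    have "dist x u \<le> r" using dist_triangle[of x u y] u True by (simp add: a_def dist_norm)
    moreover have "dist y u \<le> r" using u r by simp
    ultimately show ?thesis using sub[OF u(1)] by (simp add: y_def)
  next
    case False
    define Q where "Q = (norm (s - y))\<^sup>2"
    have a2: "r / 2 \<le> a" using False r by simp
    define P where "P = (s - y) \<bullet> (x - y)"
    (* w = s and an empty ball of radius 2 r; the rest is arithmetic with r / 2 \<le> a \<le>
       r. *)
    have "2 * (2 * r) * P \<le> a * Q"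
      using reach_inner_bound[OF M R, of x "2*r" s] s S r ar closest_point_infdist[OF M, of x]
      unfolding y_def[symmetric] a_def[symmetric] Q_def P_def dist_norm by (simp add: subset_iff)
    moreover have "(norm (x - s))\<^sup>2 = a\<^sup>2 + Q - 2 * P"
      unfolding a_def Q_def P_def power2_norm_eq_inner
      by (simp add: inner_diff_left inner_diff_right inner_commute algebra_simps)
    moreover have "(norm (x - s))\<^sup>2 \<le> r\<^sup>2" using s by (simp add: dist_norm power_mono)
    moreover have "2 * r * (a\<^sup>2 + Q - r\<^sup>2) \<le> 2 * r * (2 * P)"
      using r(1) calculation by (intro mult_left_mono) auto
    ultimately have "2 * r * (a\<^sup>2 + Q - r\<^sup>2) \<le> a * Q" by linarith
    then have *: "Q * (2 * r - a) \<le> 2 * r * (r\<^sup>2 - a\<^sup>2)" by (simp add: algebra_simps)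
    have "r * r \<le> 2 * a * r" using a2 r by (simp add: mult_mono')
    then have "a * (r * r) \<le> a * (2 * a * r)" using a2 r by (intro mult_left_mono) auto
    then have "2 * r * (r\<^sup>2 - a\<^sup>2) \<le> r\<^sup>2 * (2 * r - a)" by (simp add: power2_eq_square algebra_simps)
    with * have "Q * (2 * r - a) \<le> r\<^sup>2 * (2 * r - a)" by simp
    moreover have "0 < 2 * r - a" using ar r(1) by linarith
    ultimately have "Q \<le> r\<^sup>2" by (rule mult_right_le_imp_le)
    then have "norm (s - y) \<le> r" unfolding Q_def using r(1) by (auto intro: power2_le_imp_le)
    then have "dist y s \<le> r" by (simp add: dist_norm norm_minus_commute)
    then show ?thesis using sub[OF s] by (simp add: y_def)
  qed
qed

section \<open>Uniform interior cones\<close>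

text \<open>A set of width \<open>h\<close> in direction \<open>v\<close> has \<open>m\<close> disjoint
  translates by multiples of \<open>h v\<close>, and these still fit into the ball of twice the
  radius.\<close>

lemma slab_measure_bound:
  fixes v :: "'a::euclidean_space"
  assumes v: "norm v = 1" and S: "S \<in> lmeasurable" "S \<subseteq> ball y \<rho>"
    and slab: "\<And>w. w \<in> S \<Longrightarrow> \<alpha> < w \<bullet> v \<and> w \<bullet> v < \<alpha> + h" and h: "0 < h" "real m * h \<le> \<rho>"
  shows "real m * measure lebesgue S \<le> measure lebesgue (ball y (2 * \<rho>))"
proof -
  let ?S = "\<lambda>k::nat. (+) ((real k * h) *\<^sub>R v) ` S"
  have meas: "?S k \<in> lmeasurable" for k using S(1) by (rule measurable_translation)
  have vv: "v \<bullet> v = 1" using v by (simp add: norm_eq_1)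
  have disj: "disjoint_family_on ?S {..<m}"
  proof (unfold disjoint_family_on_def, intro ballI impI)
    fix i j :: nat assume ij: "i \<noteq> j"
    show "?S i \<inter> ?S j = {}"
    proof (rule ccontr)
      assume "?S i \<inter> ?S j \<noteq> {}"
      then obtain w w' where w: "w \<in> S" "w' \<in> S" "(real i * h) *\<^sub>R v + w = (real j * h) *\<^sub>R v + w'" by auto
      have "((real i * h) *\<^sub>R v + w) \<bullet> v = ((real j * h) *\<^sub>R v + w') \<bullet> v" by (simp only: w(3))
      then have "real i * h + w \<bullet> v = real j * h + w' \<bullet> v" by (simp only: inner_add_left inner_scaleR_left vv mult_1_right)
      then have "\<bar>(real i - real j) * h\<bar> < h" using slab[OF w(1)] slab[OF w(2)] unfolding left_diff_distrib abs_less_iff by linarith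
      then have "\<bar>real i - real j\<bar> < 1" using h(1) by (simp add: abs_mult)
      then show False using ij by linarith
    qed
  qed
  have sub: "?S k \<subseteq> ball y (2 * \<rho>)" if "k < m" for k
  proof safe
    fix w assume "w \<in> S"
    have "real k * h \<le> \<rho>" using that h by (meson less_imp_le mult_right_mono of_nat_le_iff order_trans)
    moreover have "dist y w < \<rho>" using S(2) \<open>w \<in> S\<close> by auto
    moreover have "dist w ((real k * h) *\<^sub>R v + w) = real k * h" using h(1) v by (simp add: dist_norm)
    ultimately show "(real k * h) *\<^sub>R v + w \<in> ball y (2 * \<rho>)"
      using dist_triangle[of y "(real k * h) *\<^sub>R v + w" w] by simp
  qed
  have "real m * measure lebesgue S = (\<Sum>k<m. measure lebesgue (?S k))"
    by (simp add: measure_translation)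
  also have "\<dots> = measure lebesgue (\<Union>k<m. ?S k)"
    using fmeasurableD[OF meas] fmeasurableD2[OF meas] by (intro measure_finite_Union[symmetric] disj) auto
  also have "\<dots> \<le> measure lebesgue (ball y (2 * \<rho>))"
    using sub meas by (intro measure_mono_fmeasurable) auto
  finally show ?thesis .
qed

text \<open>The point \<open>x\<close> is the centroid of \<open>S\<close>. If \<open>S\<close> did not
  reach beyond \<open>x\<close> by \<open>a = \<rho> / (4 m)\<close> in some direction, at most a
  quarter of \<open>S\<close> could lie below \<open>- 3 a\<close>, because the mean height is
  \<open>0\<close>. At least half of \<open>S\<close> would then lie in a slab of width \<open>4
  a\<close>, which is too thin for its volume.\<close>

lemma centroid_spread:
  fixes S :: "'a::euclidean_space set"
  assumes S: "S \<in> sets borel" "S \<subseteq> ball y \<rho>" and \<rho>: "0 < \<rho>" and m: "0 < m"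
    and vol: "2 * measure lborel (ball y (2 * \<rho>)) < real m * measure lborel S"
  shows "\<exists>x. dist x y \<le> \<rho> \<and> (\<forall>v. norm v = 1 \<longrightarrow> (\<exists>w\<in>S. \<rho> / (4 * real m) \<le> (w - x) \<bullet> v))"
proof -
  have fin: "emeasure lborel S \<noteq> \<infinity>"
    using emeasure_bounded_finite[OF bounded_subset[OF bounded_ball S(2)]] by auto
  have pos: "0 < measure lborel S" using vol m
    by (metis (no_types, opaque_lifting) measure_nonneg mult_nonneg_nonneg not_less of_nat_0_le_iff
        order_less_le_trans zero_le_numeral mult_eq_0_iff less_eq_real_def)
  then have e0: "emeasure lborel S \<noteq> 0" by (auto simp: measure_def)
  define N where "N = uniform_measure lborel S"
  interpret N: prob_space N unfolding N_def using e0 fin by (rule prob_space_uniform_measure)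
  have setsN: "sets N = sets borel" by (simp add: N_def)
  have AES: "AE w in N. w \<in> S" unfolding N_def using S e0 fin
    by (intro AE_uniform_measureI) (auto simp: less_top)
  have AEb: "AE w in N. norm (w - y) \<le> \<rho>"
    using AES by (rule eventually_mono) (use S(2) in \<open>auto simp: dist_norm norm_minus_commute\<close>)
  have int: "integrable N (\<lambda>w. w - y)"
    using AEb by (intro N.integrable_const_bound[of _ \<rho>]) (auto simp: setsN measurable_cong_sets[OF setsN refl])
  define x where "x = y + (\<integral>w. w - y \<partial>N)"
  have "norm (\<integral>w. w - y \<partial>N) \<le> \<rho>"
  proof -
    have "norm (\<integral>w. w - y \<partial>N) \<le> (\<integral>w. norm (w - y) \<partial>N)" by (rule integral_norm_bound)
    also have "\<dots> \<le> \<rho>" using N.integral_le_const[OF integrable_norm[OF int] AEb] by simp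
    finally show ?thesis .
  qed
  then have "dist x y \<le> \<rho>" by (simp add: x_def dist_norm)
  moreover have "\<exists>w\<in>S. \<rho> / (4 * real m) \<le> (w - x) \<bullet> v" if v: "norm v = 1" for v
  proof (rule ccontr)
    define a where "a = \<rho> / (4 * real m)"
    have a: "0 < a" using \<rho> m by (simp add: a_def)
    assume "\<not> ?thesis"
    then have lt: "(w - x) \<bullet> v < a" if "w \<in> S" for w using that by (auto simp: a_def not_le)
    (* All of S is below height a; where it is not in the slab (- 3 a, a), it is in S1. *)
    define S1 where "S1 = {w \<in> S. (w - x) \<bullet> v \<le> - 3 * a}"
    have S1: "S1 \<in> sets borel" unfolding S1_def using S(1) by measurable
    have mean: "(\<integral>w. (w - x) \<bullet> v \<partial>N) = 0"
    proof -
      have "(\<lambda>w. (w - x) \<bullet> v) = (\<lambda>w. (w - y) \<bullet> v - (\<integral>w. w - y \<partial>N) \<bullet> v)"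
        by (auto simp: x_def algebra_simps)
      then show ?thesis using int by (simp add: N.prob_space)
    qed
    have intv: "integrable N (\<lambda>w. (w - x) \<bullet> v)"
    proof -
      have "(\<lambda>w. (w - x) \<bullet> v) = (\<lambda>w. (w - y) \<bullet> v - (\<integral>w. w - y \<partial>N) \<bullet> v)"
        by (auto simp: x_def algebra_simps)
      then show ?thesis using int by simp
    qed
    have intS1: "integrable N (\<lambda>w. a - 4 * a * indicator S1 w)"
      using S1 setsN by (intro Bochner_Integration.integrable_diff integrable_mult_right integrable_real_indicator) (auto simp: N.emeasure_eq_measure)
    have "0 \<le> (\<integral>w. a - 4 * a * indicator S1 w \<partial>N)"
      unfolding mean[symmetric]
    proof (rule integral_mono_AE[OF intv intS1])
      show "AE w in N. (w - x) \<bullet> v \<le> a - 4 * a * indicator S1 w"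
        using AES by (rule eventually_mono) (use lt a in \<open>force simp: S1_def indicator_def\<close>)
    qed
    also have "\<dots> = a - 4 * a * measure N S1"
      using S1 setsN by (subst Bochner_Integration.integral_diff)
        (auto simp: N.prob_space N.emeasure_eq_measure intro!: integrable_real_indicator)
    finally have "a * (4 * measure N S1) \<le> a * 1" by simp
    then have q: "4 * measure N S1 \<le> 1" using a by (simp only: mult_le_cancel_left_pos)
    have "measure N S1 = measure lborel S1 / measure lborel S"
      unfolding N_def using S S1 fin e0 S1_def
      by (subst measure_uniform_measure) (auto simp: Int_absorb1 Collect_conj_eq)
    with q pos have S1le: "4 * measure lborel S1 \<le> measure lborel S" by (simp add: field_simps)
    define T where "T = S - S1"
    have T: "T \<in> sets borel" using S S1 by (simp add: T_def)
    have "measure lborel T = measure lborel S - measure lborel S1"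
      unfolding T_def using fin S S1 by (intro measure_Diff) (auto simp: S1_def top.not_eq_extremum)
    then have half: "measure lborel S \<le> 2 * measure lborel T" using S1le pos by linarith
    have Tl: "T \<in> lmeasurable" using T S(2) unfolding T_def
      by (intro bounded_set_imp_lmeasurable) (auto intro: bounded_subset[OF bounded_ball])
    have "real m * measure lebesgue T \<le> measure lebesgue (ball y (2 * \<rho>))"
    proof (rule slab_measure_bound[OF v Tl, of _ _ "x \<bullet> v - 3 * a" "4 * a"])
      show "T \<subseteq> ball y \<rho>" using S by (auto simp: T_def)
      show "x \<bullet> v - 3 * a < w \<bullet> v \<and> w \<bullet> v < x \<bullet> v - 3 * a + 4 * a" if "w \<in> T" for w
        using that lt[of w] by (auto simp: T_def S1_def inner_diff_left)
      show "real m * (4 * a) \<le> \<rho>" using m by (simp add: a_def)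
    qed (use a in simp)
    then have "real m * measure lborel T \<le> measure lborel (ball y (2 * \<rho>))"
      using T by (simp add: measure_completion)
    moreover have "real m * measure lborel S \<le> real m * (2 * measure lborel T)"
      using half by (intro mult_left_mono) auto
    ultimately show False using vol by linarith
  qed
  ultimately show ?thesis by blast
qed

text \<open>If \<open>M\<close> reaches beyond \<open>x\<close> in every direction by an amount that is
  large compared with \<open>\<rho>\<^sup>2\<close>, then \<open>M\<close> contains a ball around
  \<open>x\<close>. A point \<open>z\<close> near \<open>x\<close> outside \<open>M\<close> would
  have an empty ball of radius \<open>s\<close> above its projection. Within distance \<open>5
  \<rho>\<close> of the projection such a ball is flat up to \<open>25 \<rho>\<^sup>2 / (2
  s)\<close>, which contradicts the extension of \<open>M\<close> in the normal direction.\<close>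

lemma ball_in_positive_reach:
  fixes M :: "'a::euclidean_space set"
  assumes M: "compact M" "M \<noteq> {}" and R: "projects_uniquely M R"
    and s: "0 < s" "s < R" and y: "y \<in> M" and \<rho>: "0 < \<rho>" "2 * \<rho> < R" and x: "dist x y \<le> \<rho>"
    and a: "0 < a" "a \<le> \<rho>" "25 * \<rho>\<^sup>2 < s * a"
    and spread: "\<And>v. norm v = 1 \<Longrightarrow> \<exists>w\<in>M \<inter> ball y \<rho>. a \<le> (w - x) \<bullet> v"
  shows "ball x (a / 4) \<subseteq> M"
proof
  fix z assume z: "z \<in> ball x (a / 4)"
  show "z \<in> M"
  proof (rule ccontr)
    assume zM: "z \<notin> M"
    define p where "p = closest_point M z"
    define n where "n = norm (z - p)"
    define v where "v = (1 / n) *\<^sub>R (z - p)"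
    have pM: "p \<in> M" using M by (simp add: p_def compact_imp_closed closest_point_in_set)
    have n: "0 < n" using zM pM by (auto simp: n_def)
    have v: "norm v = 1" using n by (simp add: v_def n_def)
    have zy: "dist z y \<le> 2 * \<rho>" using z x a dist_triangle[of z y x] by (simp add: dist_commute)
    have nz: "infdist z M = n" using closest_point_infdist[OF M, of z] by (simp add: p_def n_def dist_norm)
    have nle: "n \<le> 2 * \<rho>" using infdist_le[OF y, of z] zy nz by simp
    obtain w where w: "w \<in> M" "dist y w < \<rho>" "a \<le> (w - x) \<bullet> v" using spread[OF v] by auto
    have "norm (w - p) \<le> 5 * \<rho>"
      using dist_triangle[of w p y] dist_triangle[of y p z] w(2) zy nle
      by (simp add: dist_norm n_def norm_minus_commute)
    then have wp: "(norm (w - p))\<^sup>2 \<le> (5 * \<rho>)\<^sup>2" by (intro power_mono) auto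
    have "2 * s * ((w - p) \<bullet> (z - p)) \<le> n * (norm (w - p))\<^sup>2"
      using reach_inner_bound[OF M R _ s w(1), of z] nz nle \<rho> by (simp add: p_def n_def)
    also have "z - p = n *\<^sub>R v" using n by (simp add: v_def)
    finally have "n * (2 * s * ((w - p) \<bullet> v)) \<le> n * (norm (w - p))\<^sup>2" by (simp add: mult_ac)
    then have "2 * s * ((w - p) \<bullet> v) \<le> (norm (w - p))\<^sup>2" using n by simp
    with wp have 1: "2 * s * ((w - p) \<bullet> v) \<le> 25 * \<rho>\<^sup>2" by (simp add: power2_eq_square)
    have "(z - p) \<bullet> v = n" using v n by (simp add: v_def norm_eq_1 n_def power2_norm_eq_inner[symmetric] power2_eq_square)
    then have 2: "(w - x) \<bullet> v \<le> (w - p) \<bullet> v + (z - x) \<bullet> v"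
      using n by (simp add: inner_diff_left)
    have "(z - x) \<bullet> v \<le> norm (z - x) * norm v" by (rule norm_cauchy_schwarz)
    also have "\<dots> \<le> a / 4" using z v by (simp add: dist_norm norm_minus_commute)
    finally have "a / 2 \<le> (w - p) \<bullet> v" using 2 w(3) a by simp
    then have "s * a \<le> 2 * s * ((w - p) \<bullet> v)" using s by simp
    with 1 a show False by simp
  qed
qed

text \<open>The convex hull of \<open>y\<close> and a ball inside \<open>M\<close> is contained in
  \<open>M\<close> when the ball is large compared with \<open>\<rho>\<^sup>2\<close>. At a point
  \<open>z\<close> of the segment outside \<open>M\<close>, with outer normal \<open>v\<close>,
  the height of \<open>y\<close> above \<open>z\<close> is at most of the order \<open>t\<^sup>2
  \<rho>\<^sup>2 / s\<close>, because \<open>y\<close> is within a multiple of \<open>t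
  \<rho>\<close> of the projection of \<open>z\<close>, and \<open>w\<close> is lower than
  \<open>z\<close> by a multiple of \<open>b\<close>, because \<open>w + b v\<close> is in
  \<open>M\<close>. But \<open>z\<close> is a convex combination of \<open>y\<close> and
  \<open>w\<close> with weights \<open>1 - t\<close> and \<open>t\<close>.\<close>

lemma segments_to_ball_in_positive_reach:
  fixes M :: "'a::euclidean_space set"
  assumes M: "compact M" "M \<noteq> {}" and R: "projects_uniquely M R"
    and s: "0 < s" "s < R" and y: "y \<in> M" and \<rho>: "0 < \<rho>" "2 * \<rho> < R" and x: "dist x y \<le> \<rho>"
    and b: "0 < b" "b \<le> \<rho> / 2" "36 * \<rho>\<^sup>2 < s * b" and ball: "ball x (2 * b) \<subseteq> M"
    and w: "w \<in> ball x b" and t: "0 \<le> t" "t \<le> 1"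
  shows "y + t *\<^sub>R (w - y) \<in> M"
proof (rule ccontr)
  define z where "z = y + t *\<^sub>R (w - y)"
  assume "y + t *\<^sub>R (w - y) \<notin> M"
  then have zM: "z \<notin> M" by (simp add: z_def)
  have t0: "0 < t" using t y zM unfolding z_def by (cases "t = 0") auto
  define p where "p = closest_point M z"
  define n where "n = norm (z - p)"
  define v where "v = (1 / n) *\<^sub>R (z - p)"
  have pM: "p \<in> M" using M by (simp add: p_def compact_imp_closed closest_point_in_set)
  have n: "0 < n" using zM pM by (auto simp: n_def)
  have v: "norm v = 1" using n by (simp add: v_def n_def)
  have wy: "norm (w - y) \<le> 2 * \<rho>" using w x b \<rho> dist_triangle[of w y x] by (simp add: dist_norm norm_minus_commute)
  have zy: "norm (z - y) \<le> 2 * t * \<rho>" using mult_left_mono[OF wy t(1)] t by (simp add: z_def mult_ac)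
  have t\<rho>: "t * \<rho> \<le> \<rho>" using t \<rho> by (simp add: mult_left_le_one_le)
  have nz: "infdist z M = n" using closest_point_infdist[OF M, of z] by (simp add: p_def n_def dist_norm)
  have nle: "n \<le> 2 * t * \<rho>" using infdist_le[OF y, of z] zy nz by (simp add: dist_norm)
  have zp: "z - p = n *\<^sub>R v" using n by (simp add: v_def)
  have vv: "v \<bullet> v = 1" using v by (simp add: norm_eq_1)
  have nR: "n < R" using nle t\<rho> \<rho>(2) by linarith
  have bound: "2 * s * ((u - z) \<bullet> v) \<le> r\<^sup>2" if "u \<in> M" "norm (u - p) \<le> r" for u r
  proof -
    have "2 * s * ((u - p) \<bullet> (z - p)) \<le> n * (norm (u - p))\<^sup>2"
      using reach_inner_bound[OF M R _ s that(1), of z] nz nR by (simp add: p_def n_def)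
    then have "n * (2 * s * ((u - p) \<bullet> v)) \<le> n * (norm (u - p))\<^sup>2" unfolding zp by (simp add: mult_ac)
    then have "2 * s * ((u - p) \<bullet> v) \<le> (norm (u - p))\<^sup>2" using n by simp
    also have "\<dots> \<le> r\<^sup>2" using that(2) by (intro power_mono) auto
    also have "(u - p) \<bullet> v = (u - z) \<bullet> v + n"
      using arg_cong[OF zp, of "\<lambda>q. q \<bullet> v"] vv by (simp add: inner_diff_left)
    finally have "2 * s * ((u - z) \<bullet> v) + 2 * s * n \<le> r\<^sup>2" by (simp only: distrib_left)
    moreover have "0 \<le> 2 * s * n" using n s by simp
    ultimately show ?thesis by linarith
  qed
  have yp: "norm (y - p) \<le> 4 * t * \<rho>"
    using zy nle norm_triangle_ineq[of "y - z" "z - p"] by (simp add: n_def norm_minus_commute)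
  then have yp4: "norm (y - p) \<le> 4 * \<rho>" using t\<rho> by linarith
  have B1: "2 * s * ((y - z) \<bullet> v) \<le> (4 * t * \<rho>)\<^sup>2" by (rule bound[OF y yp])
  (* The point of the ball that is highest in direction v; it is in M and therefore below the
     empty ball. *)
  define w' where "w' = w + b *\<^sub>R v"
  have w'x: "dist w' x < 2 * b" using w v b dist_triangle[of w' x w]
    by (simp add: w'_def dist_norm norm_minus_commute)
  then have w'M: "w' \<in> M" using ball by (auto simp: dist_commute)
  have "norm (w' - p) \<le> 6 * \<rho>"
    using w'x x b yp4 dist_triangle[of w' p x] dist_triangle[of x p y] by (simp add: dist_norm)
  then have "2 * s * ((w' - z) \<bullet> v) \<le> (6 * \<rho>)\<^sup>2" by (rule bound[OF w'M])
  moreover have "(w' - z) \<bullet> v = (w - z) \<bullet> v + b" using vv by (simp add: w'_def inner_diff_left inner_add_left)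
  ultimately have "2 * s * ((w - z) \<bullet> v) + 2 * (s * b) \<le> 36 * \<rho>\<^sup>2"
    by (simp add: algebra_simps power2_eq_square)
  then have B2: "s * b \<le> - (2 * s * ((w - z) \<bullet> v))" using b(3) by linarith
  have "(1 - t) *\<^sub>R (y - z) + t *\<^sub>R (w - z) = 0" by (simp add: z_def algebra_simps)
  then have "((1 - t) *\<^sub>R (y - z) + t *\<^sub>R (w - z)) \<bullet> v = 0" by (simp only: inner_zero_left)
  then have "(1 - t) * ((y - z) \<bullet> v) = - t * ((w - z) \<bullet> v)"
    by (simp only: inner_add_left inner_scaleR_left)
  then have eq: "(1 - t) * (2 * s * ((y - z) \<bullet> v)) = t * - (2 * s * ((w - z) \<bullet> v))"
    by (metis mult.left_commute mult_minus_left mult_minus_right)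
  have "t * (s * b) \<le> t * - (2 * s * ((w - z) \<bullet> v))" using B2 t(1) by (rule mult_left_mono)
  also have "\<dots> = (1 - t) * (2 * s * ((y - z) \<bullet> v))" by (rule eq[symmetric])
  also have "\<dots> \<le> (1 - t) * (4 * t * \<rho>)\<^sup>2" using B1 t by (intro mult_left_mono) auto
  also have "\<dots> \<le> (4 * t * \<rho>)\<^sup>2" using t by (simp add: mult_left_le_one_le)
  also have "\<dots> = t * (16 * t * \<rho>\<^sup>2)" by (simp add: power2_eq_square)
  finally have "s * b \<le> 16 * t * \<rho>\<^sup>2" using t0 by simp
  also have "\<dots> \<le> 36 * \<rho>\<^sup>2" using t by (intro mult_right_mono) auto
  finally show False using b(3) by simp
qed

text \<open>The set of admissible \<open>z\<close> is the open cone with axis \<open>e\<close> and height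
  \<open>L\<close> in which the part of \<open>z\<close> orthogonal to \<open>e\<close> is shorter
  than \<open>\<beta> (z \<bullet> e)\<close>.\<close>

definition has_cone_at :: "'a::euclidean_space set \<Rightarrow> real \<Rightarrow> real \<Rightarrow> 'a \<Rightarrow> 'a \<Rightarrow> bool" where
  "has_cone_at M \<beta> L y e \<longleftrightarrow> norm e = 1 \<and>
     (\<forall>z. 0 < z \<bullet> e \<and> z \<bullet> e < L \<and> (norm z)\<^sup>2 < (1 + \<beta>\<^sup>2) * (z \<bullet> e)\<^sup>2 \<longrightarrow> y + z \<in> M)"

text \<open>The portion of \<open>M\<close> in a ball of radius \<open>\<rho>\<close> around
  \<open>y\<close> has volume comparable to that of the ball. Its centroid is therefore the centre
  of a ball of radius comparable to \<open>\<rho>\<close> inside \<open>M\<close>, once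
  \<open>\<rho>\<close> is small compared with the reach, and the hull of \<open>y\<close> and
  this ball contains a cone. All constants are independent of \<open>y\<close>.\<close>

lemma uniform_interior_cone:
  fixes M :: "'a::euclidean_space set"
  assumes M: "compact M" "M \<noteq> {}" and R: "projects_uniquely M R" "0 < R"
    and vol: "0 < c" "0 < \<rho>0" "\<And>y \<rho>. y \<in> M \<Longrightarrow> 0 < \<rho> \<Longrightarrow> \<rho> < \<rho>0 \<Longrightarrow> c * \<rho> ^ DIM('a) \<le> measure lborel (M \<inter> ball y \<rho>)"
  shows "\<exists>\<beta> L. 0 < \<beta> \<and> \<beta> \<le> 1 \<and> 0 < L \<and> (\<forall>y\<in>M. \<exists>e. has_cone_at M \<beta> L y e)"
proof -
  let ?d = "DIM('a)"
  let ?\<omega> = "unit_ball_vol (real ?d)"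
  (* m is the number of slabs needed to beat the volume bound. All lengths below are multiples
     of \<rho>, and \<rho> is chosen so small that quadratic terms in \<rho> are negligible
     against s times linear ones. *)
  obtain m0 :: nat where m0: "2 * (?\<omega> * 2 ^ ?d) / c < real m0" using reals_Archimedean2 by blast
  define m where "m = Suc m0"
  have m: "0 < m" "2 * (?\<omega> * 2 ^ ?d) < real m * c"
    using m0 vol(1) by (auto simp: m_def field_simps)
  define k where "k = 1 / (32 * real m)"
  have k: "0 < k" "k \<le> 1 / 32" using m(1) by (auto simp: k_def field_simps)
  define s where "s = R / 2"
  have s: "0 < s" "s < R" using R by (auto simp: s_def)
  define \<rho> where "\<rho> = min (\<rho>0 / 2) (min (R / 4) (s * k / 72))"
  have \<rho>: "0 < \<rho>" "\<rho> < \<rho>0" "2 * \<rho> < R" "72 * \<rho> \<le> s * k"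
  proof -
    have "0 < s * k" using s k by simp
    then show "0 < \<rho>" using vol(2) R by (simp add: \<rho>_def)
    have "\<rho> \<le> \<rho>0 / 2" "\<rho> \<le> R / 4" "\<rho> \<le> s * k / 72" by (simp_all add: \<rho>_def)
    then show "\<rho> < \<rho>0" "2 * \<rho> < R" "72 * \<rho> \<le> s * k" using vol(2) R by linarith+
  qed
  have \<rho>k: "36 * \<rho>\<^sup>2 < s * (k * \<rho>)"
  proof -
    have "36 * \<rho> < s * k" using \<rho> s k by linarith
    then have "36 * \<rho> * \<rho> < s * k * \<rho>" using \<rho>(1) by (simp only: mult_less_cancel_right_pos)
    then show ?thesis by (simp add: power2_eq_square mult_ac)
  qed
  have "\<exists>e. has_cone_at M (k / 4) (k * \<rho> / 4) y e" if y: "y \<in> M" for y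
  proof -
    let ?S = "M \<inter> ball y \<rho>"
    have "measure lborel (ball y (2 * \<rho>)) = ?\<omega> * (2 * \<rho>) ^ ?d"
      using \<rho>(1) by (simp add: content_ball)
    also have "2 * \<dots> = 2 * (?\<omega> * 2 ^ ?d) * \<rho> ^ ?d" by (simp add: power_mult_distrib)
    also have "\<dots> < real m * c * \<rho> ^ ?d" using m(2) \<rho>(1) by (intro mult_strict_right_mono) auto
    also have "\<dots> = real m * (c * \<rho> ^ ?d)" by simp
    also have "\<dots> \<le> real m * measure lborel ?S" using vol(3)[OF y \<rho>(1,2)] by (intro mult_left_mono) auto
    finally have big: "2 * measure lborel (ball y (2 * \<rho>)) < real m * measure lborel ?S" .
    have Sb: "?S \<in> sets borel" using M by (auto simp: compact_imp_closed)
    obtain x where x: "dist x y \<le> \<rho>"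
      and spread: "\<And>v. norm v = 1 \<Longrightarrow> \<exists>w\<in>?S. \<rho> / (4 * real m) \<le> (w - x) \<bullet> v"
      using centroid_spread[OF Sb _ \<rho>(1) m(1) big] by auto
    have ak: "\<rho> / (4 * real m) = 8 * k * \<rho>" by (simp add: k_def)
    have "ball x (8 * k * \<rho> / 4) \<subseteq> M"
    proof (rule ball_in_positive_reach[OF M R(1) s y \<rho>(1,3) x])
      show "0 < 8 * k * \<rho>" "8 * k * \<rho> \<le> \<rho>" using k \<rho>(1) by auto
      show "25 * \<rho>\<^sup>2 < s * (8 * k * \<rho>)"
      proof -
        have "s * (8 * k * \<rho>) = 8 * (s * (k * \<rho>))" by simp
        then show ?thesis using \<rho>k zero_le_power2[of \<rho>] by linarith
      qed
    qed (use spread ak in auto)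
    then have ball: "ball x (2 * (k * \<rho>)) \<subseteq> M" by (simp add: mult_ac)
    have seg: "y + t *\<^sub>R (w - y) \<in> M" if "w \<in> ball x (k * \<rho>)" "0 \<le> t" "t \<le> 1" for w t
      by (rule segments_to_ball_in_positive_reach[OF M R(1) s y \<rho>(1,3) x _ _ \<rho>k ball that])
        (use k \<rho>(1) in auto)
    (* The axis of the cone is the direction from y to x', so x' must not be too close to y. If
       the centroid x is, then the ball around it contains a neighbourhood of y, and x' can be
       taken in any direction. *)
    obtain x' where x': "k * \<rho> / 4 \<le> dist x' y" "dist x' y \<le> 2 * \<rho>" "ball x' (k * \<rho> / 2) \<subseteq> ball x (k * \<rho>)"
    proof (cases "k * \<rho> / 4 \<le> dist x y")
      case True
      then show ?thesis using that[of x] x k \<rho>(1) by (auto simp: subset_ball)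
    next
      case False
      obtain b :: 'a where b: "b \<in> Basis" using nonempty_Basis by blast
      have "ball (y + (k * \<rho> / 4) *\<^sub>R b) (k * \<rho> / 2) \<subseteq> ball x (k * \<rho>)"
      proof
        fix u assume "u \<in> ball (y + (k * \<rho> / 4) *\<^sub>R b) (k * \<rho> / 2)"
        moreover have "dist y (y + (k * \<rho> / 4) *\<^sub>R b) = k * \<rho> / 4" using b k \<rho>(1) by (simp add: dist_norm)
        ultimately show "u \<in> ball x (k * \<rho>)"
          using False dist_triangle[of x u y] dist_triangle[of y u "y + (k * \<rho> / 4) *\<^sub>R b"] by simp
      qed
      moreover have "dist (y + (k * \<rho> / 4) *\<^sub>R b) y = k * \<rho> / 4" using b k \<rho>(1) by (simp add: dist_norm)
      moreover have "k * \<rho> / 4 \<le> 2 * \<rho>" using k \<rho>(1) by simp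
      ultimately show ?thesis using that[of "y + (k * \<rho> / 4) *\<^sub>R b"] by auto
    qed
    define D where "D = dist x' y"
    define e where "e = (1 / D) *\<^sub>R (x' - y)"
    have "0 < k * \<rho> / 4" using k \<rho>(1) by simp
    then have D: "k * \<rho> / 4 \<le> D" "0 < D" "D \<le> 2 * \<rho>" using x' unfolding D_def by linarith+
    have e: "norm e = 1" using D(2) by (simp add: e_def D_def dist_norm)
    have ee: "e \<bullet> e = 1" using e by (simp add: norm_eq_1)
    have x'e: "x' = y + D *\<^sub>R e" using D(2) by (simp add: e_def)
    have "y + z \<in> M" if z: "0 < z \<bullet> e" "z \<bullet> e < k * \<rho> / 4" "(norm z)\<^sup>2 < (1 + (k / 4)\<^sup>2) * (z \<bullet> e)\<^sup>2" for z
    proof -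
      (* y + z is on the segment from y to the point w at the height of x'. *)
      define t where "t = (z \<bullet> e) / D"
      have t: "0 < t" "t \<le> 1" using z D by (auto simp: t_def)
      define w where "w = y + (1 / t) *\<^sub>R z"
      define q where "q = z - (z \<bullet> e) *\<^sub>R e"
      have "(norm q)\<^sup>2 = (norm z)\<^sup>2 - (z \<bullet> e)\<^sup>2"
        unfolding q_def power2_norm_eq_inner using ee
        by (simp add: inner_diff_left inner_diff_right inner_commute power2_eq_square)
      then have "(norm q)\<^sup>2 < (k / 4)\<^sup>2 * (z \<bullet> e)\<^sup>2" using z(3) unfolding distrib_right by linarith
      then have "(norm q)\<^sup>2 < ((k / 4) * (z \<bullet> e))\<^sup>2" by (simp only: power_mult_distrib)
      then have "norm q < (k / 4) * (z \<bullet> e)"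
        by (rule power_less_imp_less_base) (use z(1) k(1) in simp)
      also have "\<dots> = (k / 4) * (t * D)" using D by (simp add: t_def)
      finally have "norm q < t * (k / 4 * D)" by (simp add: mult_ac)
      then have "norm q / t < k / 4 * D" using t(1) by (simp add: divide_less_eq mult.commute)
      also have "k / 4 * D \<le> k / 4 * (2 * \<rho>)" using D k by (intro mult_left_mono) auto
      also have "k / 4 * (2 * \<rho>) = k * \<rho> / 2" by simp
      finally have "norm q / t < k * \<rho> / 2" .
      moreover have "(1 / t) * (z \<bullet> e) = D" using z(1) D by (simp add: t_def)
      then have "w - x' = (1 / t) *\<^sub>R q"
        unfolding w_def x'e q_def by (simp only: scaleR_diff_right scaleR_scaleR) simp
      ultimately have "dist x' w < k * \<rho> / 2" using t(1) by (simp add: dist_norm norm_minus_commute)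
      then have "w \<in> ball x (k * \<rho>)" using x'(3) by auto
      from seg[OF this, of t] t show ?thesis by (simp add: w_def)
    qed
    then show ?thesis using e unfolding has_cone_at_def by blast
  qed
  moreover have "0 < k / 4" "k / 4 \<le> 1" "0 < k * \<rho> / 4" using k \<rho>(1) by auto
  ultimately show ?thesis by blast
qed

section \<open>A vector field supported in a cone\<close>

text \<open>A \<open>C\<^sup>1\<close> cutoff, equal to \<open>0\<close> for \<open>x \<le> 0\<close> and to
  \<open>1\<close> for \<open>x \<ge> 1\<close>. Piecewise polynomials keep its derivative
  explicit.\<close>

definition smoothstep :: "real \<Rightarrow> real" where
  "smoothstep x = (max 0 (1 - (max 0 (1 - x))\<^sup>2))\<^sup>2"

definition smoothstep' :: "real \<Rightarrow> real" where
  "smoothstep' x = 4 * max 0 (1 - (max 0 (1 - x))\<^sup>2) * max 0 (1 - x)"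

lemma has_real_derivative_max_0_square:
  "((\<lambda>x::real. (max 0 x)\<^sup>2) has_real_derivative 2 * max 0 x) (at x)"
proof -
  consider "x < 0" | "x = 0" | "0 < x" by linarith
  then show ?thesis
  proof cases
    case 1
    have "((\<lambda>x::real. 0) has_real_derivative 0) (at x)" by simp
    then have "((\<lambda>x::real. (max 0 x)\<^sup>2) has_real_derivative 0) (at x)"
      by (rule has_field_derivative_transform_within_open[where S = "{..<0}"]) (use 1 in auto)
    then show ?thesis using 1 by simp
  next
    case 3
    have "((\<lambda>x::real. x\<^sup>2) has_real_derivative 2 * x) (at x)" by (auto intro!: derivative_eq_intros)
    then have "((\<lambda>x::real. (max 0 x)\<^sup>2) has_real_derivative 2 * x) (at x)"
      by (rule has_field_derivative_transform_within_open[where S = "{0<..}"]) (use 3 in auto)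
    then show ?thesis using 3 by simp
  next
    case 2
    have "((\<lambda>h::real. (max 0 h)\<^sup>2 / h) \<longlongrightarrow> 0) (at 0)"
    proof (rule Lim_null_comparison)
      show "\<forall>\<^sub>F h in at 0. norm ((max 0 h)\<^sup>2 / h) \<le> \<bar>h::real\<bar>"
        by (intro always_eventually allI) (auto simp: max_def power2_eq_square)
      show "((\<lambda>h::real. \<bar>h\<bar>) \<longlongrightarrow> 0) (at 0)" by (intro tendsto_eq_intros) auto
    qed
    then show ?thesis using 2 by (simp add: has_field_derivative_iff)
  qed
qed

lemma smoothstep_derivative: "(smoothstep has_real_derivative smoothstep' x) (at x)"
proof -
  have "((\<lambda>x. 1 - (max 0 (1 - x))\<^sup>2) has_real_derivative 2 * max 0 (1 - x)) (at x)"
  proof -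
    have "((\<lambda>x. (max 0 (1 - x))\<^sup>2) has_real_derivative 2 * max 0 (1 - x) * (- 1)) (at x)"
      by (rule DERIV_chain2[OF has_real_derivative_max_0_square]) (auto intro!: derivative_eq_intros)
    from DERIV_diff[OF DERIV_const this] show ?thesis by simp
  qed
  from DERIV_chain2[OF has_real_derivative_max_0_square this]
  show ?thesis unfolding smoothstep_def[abs_def] smoothstep'_def by (simp add: mult_ac)
qed

lemma continuous_smoothstep' [continuous_intros]:
  "continuous_on S f \<Longrightarrow> continuous_on S (\<lambda>x. smoothstep' (f x))"
  unfolding smoothstep'_def by (intro continuous_intros)

lemma continuous_smoothstep [continuous_intros]:
  "continuous_on S f \<Longrightarrow> continuous_on S (\<lambda>x. smoothstep (f x))"
  unfolding smoothstep_def by (intro continuous_intros)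

lemma smoothstep_bounds: "0 \<le> smoothstep x" "smoothstep x \<le> 1"
  by (auto simp: smoothstep_def power_le_one_iff max_def)

lemma smoothstep_0: "x \<le> 0 \<Longrightarrow> smoothstep x = 0"
proof -
  assume "x \<le> 0"
  then have "1 \<le> (1 - x)\<^sup>2" by (intro one_le_power) auto
  then show ?thesis using \<open>x \<le> 0\<close> by (simp add: smoothstep_def)
qed

lemma smoothstep_1: "1 \<le> x \<Longrightarrow> smoothstep x = 1"
  by (simp add: smoothstep_def)

lemma smoothstep'_0: "x \<le> 0 \<or> 1 \<le> x \<Longrightarrow> smoothstep' x = 0"
proof -
  have "1 \<le> (1 - x)\<^sup>2" if "x \<le> 0" using that by (intro one_le_power) auto
  then show "x \<le> 0 \<or> 1 \<le> x \<Longrightarrow> ?thesis" by (auto simp: smoothstep'_def)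
qed

lemma smoothstep'_bounds: "0 \<le> smoothstep' x" "smoothstep' x \<le> 4"
proof -
  show "0 \<le> smoothstep' x" by (simp add: smoothstep'_def)
  show "smoothstep' x \<le> 4"
  proof (cases "x \<le> 0 \<or> 1 \<le> x")
    case False
    then have "max 0 (1 - x) \<le> 1" "max 0 (1 - (max 0 (1 - x))\<^sup>2) \<le> 1" by auto
    then have "max 0 (1 - (max 0 (1 - x))\<^sup>2) * max 0 (1 - x) \<le> 1 * 1"
      by (intro mult_mono) auto
    then show ?thesis by (simp add: smoothstep'_def)
  qed (simp add: smoothstep'_0)
qed

lemma smoothstep'_lower: "1 / 4 \<le> x \<Longrightarrow> x \<le> 3 / 4 \<Longrightarrow> 7 / 16 \<le> smoothstep' x"
proof -
  assume x: "1 / 4 \<le> x" "x \<le> 3 / 4"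
  have "(1 - x)\<^sup>2 \<le> (3 / 4)\<^sup>2" using x by (intro power_mono) auto
  then have a: "7 / 16 \<le> 1 - (1 - x)\<^sup>2" by (simp add: power2_eq_square)
  have "7 / 16 * (1 / 4) \<le> (1 - (1 - x)\<^sup>2) * (1 - x)" by (intro mult_mono a) (use x a in auto)
  moreover have "smoothstep' x = 4 * ((1 - (1 - x)\<^sup>2) * (1 - x))" using x a by (simp add: smoothstep'_def)
  ultimately show "7 / 16 \<le> smoothstep' x" by linarith
qed

text \<open>The cutoff along the axis of the cone: it rises on \<open>[a, 2 a]\<close> and falls on
  \<open>[l, 2 l]\<close>.\<close>

definition profile :: "real \<Rightarrow> real \<Rightarrow> real \<Rightarrow> real" where
  "profile a l s = smoothstep ((s - a) / a) * smoothstep ((2 * l - s) / l)"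

definition profile' :: "real \<Rightarrow> real \<Rightarrow> real \<Rightarrow> real" where
  "profile' a l s = smoothstep' ((s - a) / a) / a * smoothstep ((2 * l - s) / l)
      - smoothstep ((s - a) / a) * (smoothstep' ((2 * l - s) / l) / l)"

text \<open>The cutoff in the angle, as a function of \<open>q = |z|\<^sup>2 / (z \<bullet>
  e)\<^sup>2\<close>: equal to \<open>1\<close> for \<open>q \<le> 1 + \<beta>\<^sup>2 / 4\<close>
  and to \<open>0\<close> for \<open>q \<ge> 1 + \<beta>\<^sup>2 / 2\<close>, so that it vanishes
  well inside the cone of opening \<open>\<beta>\<close>.\<close>

definition angular :: "real \<Rightarrow> real \<Rightarrow> real" where
  "angular \<beta> q = smoothstep ((1 + \<beta>\<^sup>2 / 2 - q) * (4 / \<beta>\<^sup>2))"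

definition angular' :: "real \<Rightarrow> real \<Rightarrow> real" where
  "angular' \<beta> q = - (4 / \<beta>\<^sup>2) * smoothstep' ((1 + \<beta>\<^sup>2 / 2 - q) * (4 / \<beta>\<^sup>2))"

lemma profile_derivative:
  assumes "a \<noteq> 0" "l \<noteq> 0" shows "(profile a l has_real_derivative profile' a l s) (at s)"
  unfolding profile_def[abs_def] profile'_def
  by (rule derivative_eq_intros DERIV_chain2[OF smoothstep_derivative] refl | use assms in \<open>simp add: field_simps\<close>)+

lemma angular_derivative: "(angular \<beta> has_real_derivative angular' \<beta> q) (at q)"
proof -
  have "((\<lambda>q. (1 + \<beta>\<^sup>2 / 2 - q) * (4 / \<beta>\<^sup>2)) has_real_derivative - (4 / \<beta>\<^sup>2)) (at q)"
    using DERIV_cmult_right[OF DERIV_diff[OF DERIV_const[of "1 + \<beta>\<^sup>2 / 2"] DERIV_ident], where c = "4 / \<beta>\<^sup>2"] by simp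
  from DERIV_chain2[OF smoothstep_derivative this] show ?thesis
    unfolding angular_def[abs_def] angular'_def by (simp only: mult.commute)
qed

text \<open>The vector field of interest is \<open>z \<mapsto> cone_scalar e \<beta> a l z *\<^sub>R
  z\<close>. Apart from the profile, the factor is homogeneous of degree \<open>- d\<close>; this
  makes the field divergence-free where the profile is constant.\<close>

definition cone_scalar :: "'a::euclidean_space \<Rightarrow> real \<Rightarrow> real \<Rightarrow> real \<Rightarrow> 'a \<Rightarrow> real" where
  "cone_scalar e \<beta> a l z =
     profile a l (z \<bullet> e) * angular \<beta> ((z \<bullet> z) / (z \<bullet> e)\<^sup>2) / (z \<bullet> e) ^ DIM('a)"

definition cone_gradient :: "'a::euclidean_space \<Rightarrow> real \<Rightarrow> real \<Rightarrow> real \<Rightarrow> 'a \<Rightarrow> 'a" where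
  "cone_gradient e \<beta> a l z =
     (let s = z \<bullet> e; q = (z \<bullet> z) / s\<^sup>2; d = DIM('a);
          g = profile a l s; g' = profile' a l s; t = angular \<beta> q; t' = angular' \<beta> q in
      (g' * t / s ^ d - 2 * g * t' * (z \<bullet> z) / s ^ (d + 3) - real d * g * t / s ^ (d + 1)) *\<^sub>R e
      + (2 * g * t' / s ^ (d + 2)) *\<^sub>R z)"

lemma profile_0: "s \<le> a \<Longrightarrow> 0 < a \<Longrightarrow> profile a l s = 0" "s \<le> a \<Longrightarrow> 0 < a \<Longrightarrow> profile' a l s = 0"
  by (simp_all add: profile_def profile'_def smoothstep_0 smoothstep'_0 divide_nonpos_pos)

text \<open>The product and quotient rules for \<open>cone_scalar\<close>, with \<open>P\<close> for the
  power of \<open>s = z \<bullet> e\<close>; separated so that the field arithmetic runs on real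
  variables only.\<close>

lemma cone_gradient_identity:
  fixes g t d ve P s t' zv n g' :: real
  assumes "s \<noteq> 0" "P \<noteq> 0"
  shows "g * t * (- d * ve / (P * s)) + (g * (t' * (2 * zv / s\<^sup>2 - 2 * n * ve / s ^ 3)) + g' * ve * t) * inverse P
    = (g' * t / P - 2 * g * t' * n / (P * s ^ 3) - d * g * t / (P * s)) * ve + (2 * g * t' / (P * s\<^sup>2)) * zv"
  using assms by (simp add: field_simps power2_eq_square power3_eq_cube)

lemma cone_divergence_identity:
  fixes g t d P s t' n g' :: real
  assumes "s \<noteq> 0" "P \<noteq> 0"
  shows "d * (g * t / (P * s)) + ((g' * t / (P * s) - 2 * g * t' * n / (P * s * s ^ 3) - d * g * t / (P * s * s)) * s
      + (2 * g * t' / (P * s * s\<^sup>2)) * n) = g' * t / P"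
  using assms by (simp add: field_simps power2_eq_square power3_eq_cube)

lemma cone_scalar_derivative:
  fixes e :: "'a::euclidean_space"
  assumes a: "0 < a" and l: "0 < l"
  shows "(cone_scalar e \<beta> a l has_derivative (\<lambda>v. cone_gradient e \<beta> a l z \<bullet> v)) (at z)"
proof (cases "z \<bullet> e < a")
  case True
  (* Near the vertex and behind it, everything vanishes; in particular the singularity at z
     \<bullet> e = 0. *)
  have "open {z. z \<bullet> e < a}" by (intro open_Collect_less continuous_intros)
  moreover have "cone_gradient e \<beta> a l z = 0" using True a by (simp add: cone_gradient_def profile_0)
  moreover have "((\<lambda>z. 0) has_derivative (\<lambda>v. 0 \<bullet> v)) (at z)" by simp
  ultimately show ?thesis
    using has_derivative_transform_within_open[of "\<lambda>z. 0" "\<lambda>v. 0 \<bullet> v" z UNIV "{z. z \<bullet> e < a}" "cone_scalar e \<beta> a l"] True a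
    by (auto simp: cone_scalar_def profile_0)
next
  case False
  define s where "s = z \<bullet> e"
  have s: "0 < s" using False a by (simp add: s_def)
  have D1: "((\<lambda>z. z \<bullet> e) has_derivative (\<lambda>v. v \<bullet> e)) (at z)" by (auto intro!: derivative_eq_intros)
  have D2: "((\<lambda>z. z \<bullet> z) has_derivative (\<lambda>v. 2 * (z \<bullet> v))) (at z)"
    by (auto intro!: derivative_eq_intros simp: inner_commute)
  have Dg: "((\<lambda>z. profile a l (z \<bullet> e)) has_derivative (\<lambda>v. profile' a l s * (v \<bullet> e))) (at z)"
    using has_derivative_compose[OF D1, of "profile a l" "\<lambda>h. profile' a l s * h"]
      profile_derivative[of a l s] a l by (simp add: has_field_derivative_def s_def)
  have Dq: "((\<lambda>z. (z \<bullet> z) / (z \<bullet> e)\<^sup>2) has_derivative (\<lambda>v. 2 * (z \<bullet> v) / s\<^sup>2 - 2 * (z \<bullet> z) * (v \<bullet> e) / s ^ 3)) (at z)"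
    by (rule has_derivative_eq_rhs, rule has_derivative_divide[OF D2 has_derivative_power[OF D1]])
      (use s in \<open>auto simp: s_def fun_eq_iff field_simps power2_eq_square power3_eq_cube\<close>)
  define q where "q = (z \<bullet> z) / s\<^sup>2"
  have Dt: "((\<lambda>z. angular \<beta> ((z \<bullet> z) / (z \<bullet> e)\<^sup>2)) has_derivative
     (\<lambda>v. angular' \<beta> q * (2 * (z \<bullet> v) / s\<^sup>2 - 2 * (z \<bullet> z) * (v \<bullet> e) / s ^ 3))) (at z)"
    using has_derivative_compose[OF Dq, of "angular \<beta>" "\<lambda>h. angular' \<beta> q * h"]
      angular_derivative[of \<beta> q] by (simp add: has_field_derivative_def s_def q_def)
  have Dp: "((\<lambda>z. inverse ((z \<bullet> e) ^ DIM('a))) has_derivative (\<lambda>v. - real DIM('a) * (v \<bullet> e) / s ^ (DIM('a) + 1))) (at z)"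
  proof (rule has_derivative_eq_rhs, rule Deriv.has_derivative_inverse[OF _ has_derivative_power[OF D1]])
    show "(z \<bullet> e) ^ DIM('a) \<noteq> 0" using s by (simp add: s_def)
    have "s ^ DIM('a) = s * s ^ (DIM('a) - 1)" using DIM_positive by (metis Suc_diff_1 power_Suc)
    then show "(\<lambda>x. - (inverse ((z \<bullet> e) ^ DIM('a)) * (of_nat DIM('a) * (x \<bullet> e) * (z \<bullet> e) ^ (DIM('a) - 1)) * inverse ((z \<bullet> e) ^ DIM('a))))
      = (\<lambda>v. - real DIM('a) * (v \<bullet> e) / s ^ (DIM('a) + 1))"
      using s unfolding s_def[symmetric] by (auto simp: fun_eq_iff field_simps)
  qed
  have "((\<lambda>z. profile a l (z \<bullet> e) * angular \<beta> ((z \<bullet> z) / (z \<bullet> e)\<^sup>2) * inverse ((z \<bullet> e) ^ DIM('a))) has_derivative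
     (\<lambda>v. cone_gradient e \<beta> a l z \<bullet> v)) (at z)"
  proof (rule has_derivative_eq_rhs, rule has_derivative_mult[OF has_derivative_mult[OF Dg Dt] Dp], rule ext)
    fix v
    let ?P = "s ^ DIM('a)"
    have P: "?P \<noteq> 0" "s \<noteq> 0" using s by auto
    show "profile a l (z \<bullet> e) * angular \<beta> ((z \<bullet> z) / (z \<bullet> e)\<^sup>2) * (- real DIM('a) * (v \<bullet> e) / s ^ (DIM('a) + 1)) +
         (profile a l (z \<bullet> e) * (angular' \<beta> q * (2 * (z \<bullet> v) / s\<^sup>2 - 2 * (z \<bullet> z) * (v \<bullet> e) / s ^ 3)) +
          profile' a l s * (v \<bullet> e) * angular \<beta> ((z \<bullet> z) / (z \<bullet> e)\<^sup>2)) * inverse ((z \<bullet> e) ^ DIM('a))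
        = cone_gradient e \<beta> a l z \<bullet> v"
      unfolding cone_gradient_def Let_def s_def[symmetric] q_def[symmetric] inner_add_left inner_scaleR_left
        inner_commute[of e v] power_add[of s "DIM('a)"] power_one_right
      by (rule cone_gradient_identity[OF P(2,1)])
  qed
  then show ?thesis by (simp add: cone_scalar_def[abs_def] divide_inverse)
qed

lemma continuous_cone_gradient:
  fixes e :: "'a::euclidean_space"
  assumes a: "0 < a" and l: "0 < l"
  shows "continuous_on UNIV (cone_gradient e \<beta> a l)"
proof -
  let ?S = "{z. z \<bullet> e < a}" and ?T = "{z. a / 2 < z \<bullet> e}"
  have "continuous_on ?S (cone_gradient e \<beta> a l)"
  proof -
    have "continuous_on ?S (\<lambda>z. 0)" by simp
    then show ?thesis by (rule continuous_on_eq) (use a in \<open>simp add: cone_gradient_def profile_0\<close>)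
  qed
  moreover have "continuous_on ?T (cone_gradient e \<beta> a l)"
    unfolding cone_gradient_def Let_def profile_def profile'_def angular_def angular'_def
    by (intro continuous_intros) (use a l in auto)
  moreover have "open ?S" "open ?T" by (intro open_Collect_less continuous_intros)+
  moreover have "?S \<union> ?T = UNIV" using a by (auto simp: not_less)
  ultimately show ?thesis using continuous_on_open_Un by metis
qed

text \<open>By homogeneity, Euler's identity cancels everything except the derivative of the profile.\<close>

lemma cone_divergence:
  fixes e :: "'a::euclidean_space"
  assumes a: "0 < a" and e: "norm e = 1"
  shows "(\<Sum>b\<in>Basis. (cone_scalar e \<beta> a l z *\<^sub>R b + (z \<bullet> b) *\<^sub>R cone_gradient e \<beta> a l z) \<bullet> b)
     = profile' a l (z \<bullet> e) * angular \<beta> ((z \<bullet> z) / (z \<bullet> e)\<^sup>2) / (z \<bullet> e) ^ (DIM('a) - 1)"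
proof -
  have "(\<Sum>b\<in>Basis. (cone_scalar e \<beta> a l z *\<^sub>R b + (z \<bullet> b) *\<^sub>R cone_gradient e \<beta> a l z) \<bullet> b)
     = real DIM('a) * cone_scalar e \<beta> a l z + z \<bullet> cone_gradient e \<beta> a l z"
    unfolding euclidean_inner[of z "cone_gradient e \<beta> a l z"]
    by (simp add: inner_add_left sum.distrib inner_Basis)
  also have "\<dots> = profile' a l (z \<bullet> e) * angular \<beta> ((z \<bullet> z) / (z \<bullet> e)\<^sup>2) / (z \<bullet> e) ^ (DIM('a) - 1)"
  proof (cases "z \<bullet> e \<le> a")
    case True then show ?thesis using a by (simp add: cone_scalar_def cone_gradient_def profile_0)
  next
    case False
    define s where "s = z \<bullet> e"
    have s: "0 < s" using False a by (simp add: s_def)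
    obtain n where n: "DIM('a) = Suc n" using DIM_positive by (metis Suc_pred)
    have P: "s ^ (DIM('a) - 1) \<noteq> 0" "s \<noteq> 0" and d: "s ^ DIM('a) = s ^ (DIM('a) - 1) * s"
      using s n by auto
    show ?thesis
      unfolding cone_scalar_def cone_gradient_def Let_def s_def[symmetric] inner_add_right inner_scaleR_right
        power_add[of s "DIM('a)"] power_one_right d
      by (rule cone_divergence_identity[OF P(2,1)])
  qed
  finally show ?thesis .
qed

section \<open>Averages over a cone and the gradient\<close>

lemma integrable_mult_L2:
  fixes F H :: "'b \<Rightarrow> real"
  assumes [measurable]: "F \<in> borel_measurable N" "H \<in> borel_measurable N"
    and I: "integrable N (\<lambda>x. (F x)\<^sup>2)" "integrable N (\<lambda>x. (H x)\<^sup>2)"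
  shows "integrable N (\<lambda>x. F x * H x)"
proof (rule Bochner_Integration.integrable_bound[OF Bochner_Integration.integrable_add[OF I]])
  show "AE x in N. norm (F x * H x) \<le> norm ((F x)\<^sup>2 + (H x)\<^sup>2)"
  proof (intro AE_I2)
    fix x
    have "0 \<le> (\<bar>F x\<bar> - \<bar>H x\<bar>)\<^sup>2" by simp
    then have "2 * (\<bar>F x\<bar> * \<bar>H x\<bar>) \<le> (F x)\<^sup>2 + (H x)\<^sup>2" by (simp add: power2_diff)
    moreover have "0 \<le> \<bar>F x\<bar> * \<bar>H x\<bar>" by simp
    ultimately have "\<bar>F x\<bar> * \<bar>H x\<bar> \<le> (F x)\<^sup>2 + (H x)\<^sup>2" by linarith
    then show "norm (F x * H x) \<le> norm ((F x)\<^sup>2 + (H x)\<^sup>2)" by (simp add: abs_mult)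
  qed
qed measurable

lemma Cauchy_Schwarz_integral:
  fixes F H :: "'b \<Rightarrow> real"
  assumes M: "F \<in> borel_measurable N" "H \<in> borel_measurable N"
    and I: "integrable N (\<lambda>x. (F x)\<^sup>2)" "integrable N (\<lambda>x. (H x)\<^sup>2)"
  shows "(\<integral>x. F x * H x \<partial>N)\<^sup>2 \<le> (\<integral>x. (F x)\<^sup>2 \<partial>N) * (\<integral>x. (H x)\<^sup>2 \<partial>N)"
proof -
  define A B C where "A = (\<integral>x. (F x)\<^sup>2 \<partial>N)" and "B = (\<integral>x. F x * H x \<partial>N)" and "C = (\<integral>x. (H x)\<^sup>2 \<partial>N)"
  note FH = integrable_mult_L2[OF M I]
  have quad: "0 \<le> A - 2 * t * B + t\<^sup>2 * C" for t
  proof -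
    have "0 \<le> (\<integral>x. (F x - t * H x)\<^sup>2 \<partial>N)" by simp
    also have "(\<lambda>x. (F x - t * H x)\<^sup>2) = (\<lambda>x. (F x)\<^sup>2 - 2 * t * (F x * H x) + t\<^sup>2 * (H x)\<^sup>2)"
      by (auto simp: power2_eq_square algebra_simps)
    also have "(\<integral>x. (F x)\<^sup>2 - 2 * t * (F x * H x) + t\<^sup>2 * (H x)\<^sup>2 \<partial>N) = A - 2 * t * B + t\<^sup>2 * C"
      using I FH unfolding A_def B_def C_def by simp
    finally show ?thesis .
  qed
  have "0 \<le> C" by (simp add: C_def)
  then have "B\<^sup>2 \<le> A * C"
  proof (cases "C = 0")
    case True
    have "B = 0"
    proof (rule ccontr)
      assume "B \<noteq> 0"
      then show False using quad[of "(A + 1) / (2 * B)"] True by simp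
    qed
    then show ?thesis using True by simp
  next
    case False
    then have "0 < C" using \<open>0 \<le> C\<close> by simp
    have "0 \<le> C * (A - 2 * (B / C) * B + (B / C)\<^sup>2 * C)"
      by (rule mult_nonneg_nonneg[OF less_imp_le[OF \<open>0 < C\<close>] quad])
    also have "\<dots> = A * C - B\<^sup>2" using \<open>0 < C\<close> by (simp add: field_simps power2_eq_square)
    finally show ?thesis by simp
  qed
  then show ?thesis unfolding A_def B_def C_def .
qed

lemma dyadic_scale_exists:
  fixes a s :: real
  assumes "a \<le> s" "s < 2 ^ K * a"
  shows "\<exists>k<K. 2 ^ k * a \<le> s \<and> s < 2 ^ Suc k * a"
  using assms
proof (induction K)
  case (Suc K)
  show ?case
  proof (cases "s < 2 ^ K * a")
    case True then show ?thesis using Suc by (meson less_SucI)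
  next
    case False then show ?thesis using Suc.prems by (intro exI[of _ K]) auto
  qed
qed simp

definition cone_field :: "'a::euclidean_space \<Rightarrow> real \<Rightarrow> real \<Rightarrow> real \<Rightarrow> 'a \<Rightarrow> 'a" where
  "cone_field e \<beta> a l z = cone_scalar e \<beta> a l z *\<^sub>R z"

text \<open>Up to sign, the part of the divergence of \<open>cone_field\<close> that comes from the decrease
  of the profile on \<open>[l, 2 l]\<close>. It does not depend on the inner scale
  \<open>a\<close>.\<close>

definition cone_weight :: "'a::euclidean_space \<Rightarrow> real \<Rightarrow> real \<Rightarrow> 'a \<Rightarrow> real" where
  "cone_weight e \<beta> l z =
     smoothstep' ((2 * l - z \<bullet> e) / l) / l * angular \<beta> ((z \<bullet> z) / (z \<bullet> e)\<^sup>2) / (z \<bullet> e) ^ (DIM('a) - 1)"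

lemma angular_0: "1 + \<beta>\<^sup>2 / 2 \<le> q \<Longrightarrow> 0 < \<beta> \<Longrightarrow> angular \<beta> q = 0"
  unfolding angular_def by (intro smoothstep_0 mult_nonpos_nonneg) auto

lemma angular_1: "q \<le> 1 + \<beta>\<^sup>2 / 4 \<Longrightarrow> 0 < \<beta> \<Longrightarrow> angular \<beta> q = 1"
  unfolding angular_def by (rule smoothstep_1) (simp add: field_simps)

lemma angular_bounds: "0 \<le> angular \<beta> q" "angular \<beta> q \<le> 1"
  by (simp_all add: angular_def smoothstep_bounds)

lemma profile_bounds: "0 \<le> profile a l s" "profile a l s \<le> 1"
  by (simp_all add: profile_def smoothstep_bounds mult_le_one)

lemma profile_large: "2 * l \<le> s \<Longrightarrow> 0 < l \<Longrightarrow> profile a l s = 0" "2 * l \<le> s \<Longrightarrow> 0 < l \<Longrightarrow> profile' a l s = 0"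
  by (simp_all add: profile_def profile'_def smoothstep_0 smoothstep'_0 divide_nonpos_pos)

lemma cone_scalar_support:
  assumes "0 < a" "0 < l" "0 < \<beta>" "cone_scalar e \<beta> a l z \<noteq> 0"
  shows "a < z \<bullet> e" "z \<bullet> e < 2 * l" "z \<bullet> z < (1 + \<beta>\<^sup>2 / 2) * (z \<bullet> e)\<^sup>2"
proof -
  show s: "a < z \<bullet> e" using assms profile_0(1)[of "z \<bullet> e" a l] by (force simp: cone_scalar_def not_le[symmetric])
  show "z \<bullet> e < 2 * l" using assms profile_large(1)[of l "z \<bullet> e" a] by (force simp: cone_scalar_def not_le[symmetric])
  have "(z \<bullet> z) / (z \<bullet> e)\<^sup>2 < 1 + \<beta>\<^sup>2 / 2"
    using assms angular_0[of \<beta> "(z \<bullet> z) / (z \<bullet> e)\<^sup>2"] by (force simp: cone_scalar_def not_le[symmetric])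
  then show "z \<bullet> z < (1 + \<beta>\<^sup>2 / 2) * (z \<bullet> e)\<^sup>2" using s assms(1) by (simp add: divide_less_eq)
qed

lemma continuous_cone_scalar:
  assumes "0 < a" "0 < l" shows "continuous_on UNIV (cone_scalar e \<beta> a l)"
  using cone_scalar_derivative[OF assms] by (meson has_derivative_continuous_on has_derivative_at_withinI)

lemma cone_field_measurable:
  assumes "0 < a" "0 < l" shows "cone_field e \<beta> a l \<in> borel_measurable borel"
  unfolding cone_field_def[abs_def]
  by (intro borel_measurable_continuous_onI continuous_intros continuous_cone_scalar assms)

lemma cone_norm_bound:
  assumes "\<beta> \<le> 1" "0 < \<beta>" "z \<bullet> z \<le> (1 + \<beta>\<^sup>2 / 2) * s\<^sup>2" "0 < s"
  shows "norm z < 2 * s" "(norm z)\<^sup>2 \<le> 2 * s\<^sup>2"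
proof -
  have b: "\<beta>\<^sup>2 \<le> 1" using assms by (simp add: power_le_one)
  have s2: "0 < s\<^sup>2" using assms by simp
  have "(1 + \<beta>\<^sup>2 / 2) * s\<^sup>2 \<le> 2 * s\<^sup>2" by (intro mult_right_mono) (use b in auto)
  then show n: "(norm z)\<^sup>2 \<le> 2 * s\<^sup>2" unfolding power2_norm_eq_inner using assms(3) by linarith
  also have "\<dots> < (2 * s)\<^sup>2" using s2 by (simp add: power_mult_distrib)
  finally show "norm z < 2 * s" by (rule power_less_imp_less_base) (use assms in simp)
qed

text \<open>At height \<open>s\<close> between \<open>2\<^sup>k a\<close> and twice this value, the field
  has size of order \<open>s\<^sup>1\<^sup>-\<^sup>d\<close>, and such points lie in a ball of
  radius \<open>4 (2\<^sup>k a)\<close>.\<close>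

lemma cone_field_square_le:
  fixes e :: "'a::euclidean_space"
  assumes a: "0 < a" and l: "0 < l" and \<beta>: "0 < \<beta>" "\<beta> \<le> 1" and K: "2 * l < 2 ^ K * a" and d: "2 \<le> DIM('a)"
  shows "(norm (cone_field e \<beta> a l z))\<^sup>2
     \<le> (\<Sum>k<K. 2 / (2 ^ k * a) ^ (2 * DIM('a) - 2) * indicator (ball 0 (4 * (2 ^ k * a))) z)"
proof (cases "cone_scalar e \<beta> a l z = 0")
  case True
  then show ?thesis using a by (auto simp: cone_field_def intro!: sum_nonneg)
next
  case False
  define s where "s = z \<bullet> e"
  note supp = cone_scalar_support[OF a l \<beta>(1) False, folded s_def]
  have s: "0 < s" using supp a by simp
  note nb = cone_norm_bound[OF \<beta>(2,1) less_imp_le[OF supp(3)] s]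
  obtain k where k: "k < K" "2 ^ k * a \<le> s" "s < 2 ^ Suc k * a"
    using dyadic_scale_exists[of a s K] supp K by auto
  have "\<bar>cone_scalar e \<beta> a l z\<bar> \<le> 1 / s ^ DIM('a)"
    using s profile_bounds[of a l s] angular_bounds[of \<beta> "(z \<bullet> z) / s\<^sup>2"]
    by (simp add: cone_scalar_def s_def[symmetric] abs_mult divide_right_mono mult_le_one)
  then have "(cone_scalar e \<beta> a l z)\<^sup>2 \<le> (1 / s ^ DIM('a))\<^sup>2"
    by (metis abs_ge_zero power2_abs power_mono)
  then have "(norm (cone_field e \<beta> a l z))\<^sup>2 \<le> (1 / s ^ DIM('a))\<^sup>2 * (2 * s\<^sup>2)"
    unfolding cone_field_def norm_scaleR power_mult_distrib power2_abs
    by (intro mult_mono nb) auto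
  also have "\<dots> = 2 / s ^ (2 * DIM('a) - 2)"
  proof -
    have "s ^ (2 * DIM('a)) = s ^ (2 * DIM('a) - 2) * s\<^sup>2"
    proof -
      have "2 * DIM('a) = (2 * DIM('a) - 2) + 2" using d by simp
      then show ?thesis by (metis power_add)
    qed
    then show ?thesis using s by (simp add: power_divide power_mult[symmetric] mult.commute field_simps)
  qed
  also have "\<dots> \<le> 2 / (2 ^ k * a) ^ (2 * DIM('a) - 2)"
    using k a s by (intro divide_left_mono power_mono mult_pos_pos) auto
  also have "\<dots> = 2 / (2 ^ k * a) ^ (2 * DIM('a) - 2) * indicator (ball 0 (4 * (2 ^ k * a))) z"
    using nb(1) k(3) by (simp add: indicator_def)
  also have "\<dots> \<le> (\<Sum>k<K. 2 / (2 ^ k * a) ^ (2 * DIM('a) - 2) * indicator (ball 0 (4 * (2 ^ k * a))) z)"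
    using k(1) a by (intro member_le_sum[of k]) auto
  finally show ?thesis .
qed

text \<open>Each dyadic shell contributes \<open>s\<^sup>2\<^sup>-\<^sup>2\<^sup>d s\<^sup>d =
  s\<^sup>2\<^sup>-\<^sup>d\<close>. Summed over the shells between \<open>a\<close> and \<open>2
  l\<close> this is the reciprocal of \<open>kappa\<close>: logarithmic in the plane, dominated by
  the smallest shell in higher dimensions.\<close>

lemma cone_field_L2:
  fixes e :: "'a::euclidean_space"
  assumes a: "0 < a" and l: "0 < l" and \<beta>: "0 < \<beta>" "\<beta> \<le> 1" and K: "2 * l < 2 ^ K * a" and d: "2 \<le> DIM('a)"
  shows "integrable lborel (\<lambda>z. (norm (cone_field e \<beta> a l z))\<^sup>2)"
    and "(\<integral>z. (norm (cone_field e \<beta> a l z))\<^sup>2 \<partial>lborel)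
      \<le> 2 * 4 ^ DIM('a) * unit_ball_vol (real DIM('a)) * (\<Sum>k<K. 1 / (2 ^ k * a) ^ (DIM('a) - 2))"
proof -
  let ?d = "DIM('a)"
  let ?B = "\<lambda>z::'a. \<Sum>k<K. 2 / (2 ^ k * a) ^ (2 * ?d - 2) * indicator (ball 0 (4 * (2 ^ k * a))) z"
  have ind: "integrable lborel (indicator (ball 0 (4 * (2 ^ k * a))) :: 'a \<Rightarrow> real)" for k
    by (rule integrable_real_indicator, simp, rule emeasure_bounded_finite, simp)
  have B: "integrable lborel ?B"
    by (intro Bochner_Integration.integrable_sum integrable_mult_right ind)
  note le = cone_field_square_le[OF a l \<beta> K d, of e]
  show I: "integrable lborel (\<lambda>z. (norm (cone_field e \<beta> a l z))\<^sup>2)"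
    by (rule Bochner_Integration.integrable_bound[OF B])
      (use le cone_field_measurable[OF a l, of e \<beta>] in \<open>auto intro: order_trans[OF _ abs_ge_self]\<close>)
  have "(\<integral>z. (norm (cone_field e \<beta> a l z))\<^sup>2 \<partial>lborel) \<le> integral\<^sup>L lborel ?B"
    by (intro integral_mono I B le)
  also have "\<dots> = (\<Sum>k<K. 2 / (2 ^ k * a) ^ (2 * ?d - 2) * measure lborel (ball (0::'a) (4 * (2 ^ k * a))))"
    by (subst Bochner_Integration.integral_sum) (auto intro!: integrable_mult_right ind)
  also have "\<dots> = (\<Sum>k<K. 2 * 4 ^ ?d * unit_ball_vol (real ?d) * (1 / (2 ^ k * a) ^ (?d - 2)))"
  proof (intro sum.cong refl)
    fix k
    let ?r = "2 ^ k * a"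
    have r: "0 < ?r" using a by simp
    have "?r ^ (2 * ?d - 2) = ?r ^ ?d * ?r ^ (?d - 2)" using d by (simp only: power_add[symmetric]) (rule arg_cong[of _ _ "\<lambda>n. ?r ^ n"], simp)
    then show "2 / ?r ^ (2 * ?d - 2) * measure lborel (ball (0::'a) (4 * ?r))
       = 2 * 4 ^ ?d * unit_ball_vol (real ?d) * (1 / ?r ^ (?d - 2))"
      using r a by (simp only: content_ball mult_nonneg_nonneg less_imp_le) (simp add: content_ball power_mult_distrib field_simps)
  qed
  finally show "(\<integral>z. (norm (cone_field e \<beta> a l z))\<^sup>2 \<partial>lborel)
      \<le> 2 * 4 ^ ?d * unit_ball_vol (real ?d) * (\<Sum>k<K. 1 / (2 ^ k * a) ^ (?d - 2))"
    by (simp add: sum_distrib_left)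
qed

lemma cone_weight_bounds:
  fixes e :: "'a::euclidean_space"
  assumes l: "0 < l" and \<beta>: "0 < \<beta>" "\<beta> \<le> 1"
  shows "0 \<le> cone_weight e \<beta> l z"
    and "cone_weight e \<beta> l z \<le> 4 / l / l ^ (DIM('a) - 1) * indicator (ball 0 (4 * l)) z"
    and "cone_weight e \<beta> l z \<noteq> 0 \<Longrightarrow> l < z \<bullet> e \<and> z \<bullet> e < 2 * l \<and> z \<bullet> z < (1 + \<beta>\<^sup>2 / 2) * (z \<bullet> e)\<^sup>2"
proof -
  define s where "s = z \<bullet> e"
  have supp: "l < s \<and> s < 2 * l \<and> z \<bullet> z < (1 + \<beta>\<^sup>2 / 2) * s\<^sup>2" if nz: "cone_weight e \<beta> l z \<noteq> 0"
  proof -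
    have "smoothstep' ((2 * l - s) / l) \<noteq> 0" "angular \<beta> ((z \<bullet> z) / s\<^sup>2) \<noteq> 0"
      using nz by (auto simp: cone_weight_def s_def)
    then have "0 < (2 * l - s) / l \<and> (2 * l - s) / l < 1" "(z \<bullet> z) / s\<^sup>2 < 1 + \<beta>\<^sup>2 / 2"
      using smoothstep'_0[of "(2 * l - s) / l"] angular_0[of \<beta> "(z \<bullet> z) / s\<^sup>2"] \<beta>(1) by (meson not_le)+
    then show ?thesis using l by (auto simp: field_simps)
  qed
  then show "cone_weight e \<beta> l z \<noteq> 0 \<Longrightarrow> l < z \<bullet> e \<and> z \<bullet> e < 2 * l \<and> z \<bullet> z < (1 + \<beta>\<^sup>2 / 2) * (z \<bullet> e)\<^sup>2"
    by (simp add: s_def)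
  have *: "0 \<le> cone_weight e \<beta> l z \<and> cone_weight e \<beta> l z \<le> 4 / l / l ^ (DIM('a) - 1) * indicator (ball 0 (4 * l)) z"
  proof (cases "cone_weight e \<beta> l z = 0")
    case True then show ?thesis using l by simp
  next
    case False
    note sp = supp[OF False]
    have s: "0 < s" using sp l by simp
    have "norm z < 2 * s" using cone_norm_bound(1)[OF \<beta>(2,1) _ s, of z] sp by simp
    then have "z \<in> ball 0 (4 * l)" using sp by simp
    moreover have "cone_weight e \<beta> l z \<le> 4 / l / l ^ (DIM('a) - 1)"
    proof -
      have "smoothstep' ((2 * l - s) / l) / l * angular \<beta> ((z \<bullet> z) / s\<^sup>2) \<le> 4 / l * 1"
        using smoothstep'_bounds[of "(2 * l - s) / l"] angular_bounds[of \<beta> "(z \<bullet> z) / s\<^sup>2"] l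
        by (intro mult_mono divide_right_mono) auto
      moreover have "l ^ (DIM('a) - 1) \<le> s ^ (DIM('a) - 1)" using sp l by (intro power_mono) auto
      ultimately show ?thesis unfolding cone_weight_def s_def[symmetric] using l s
        by (intro frac_le) auto
    qed
    moreover have "0 \<le> cone_weight e \<beta> l z"
      unfolding cone_weight_def s_def[symmetric]
      using smoothstep'_bounds[of "(2 * l - s) / l"] angular_bounds[of \<beta> "(z \<bullet> z) / s\<^sup>2"] l s by simp
    ultimately show ?thesis by simp
  qed
  then show "0 \<le> cone_weight e \<beta> l z"
    "cone_weight e \<beta> l z \<le> 4 / l / l ^ (DIM('a) - 1) * indicator (ball 0 (4 * l)) z" by auto
qed

lemma cone_weight_measurable [measurable]: "cone_weight e \<beta> l \<in> borel_measurable borel"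
proof -
  have [measurable]: "smoothstep \<in> borel_measurable borel" "smoothstep' \<in> borel_measurable borel"
    by (auto intro!: borel_measurable_continuous_onI continuous_intros)
  show ?thesis unfolding cone_weight_def[abs_def] angular_def by measurable
qed

text \<open>The weight is bounded below on a ball of radius \<open>\<beta> l / 4\<close> around the point of
  the axis at height \<open>3 l / 2\<close>.\<close>

lemma cone_weight_mass:
  fixes e :: "'a::euclidean_space"
  assumes l: "0 < l" and \<beta>: "0 < \<beta>" "\<beta> \<le> 1" and e: "norm e = 1"
  shows "7 / 16 / l / (2 * l) ^ (DIM('a) - 1) * measure lborel (ball (0::'a) (\<beta> * l / 4)) \<le> (\<integral>z. cone_weight e \<beta> l z \<partial>lborel)"
proof -
  let ?c = "(3 / 2 * l) *\<^sub>R e" and ?\<eta> = "\<beta> * l / 4"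
  let ?m = "7 / 16 / l / (2 * l) ^ (DIM('a) - 1)"
  have ee: "e \<bullet> e = 1" using e by (simp add: norm_eq_1)
  have low: "?m * indicator (ball ?c ?\<eta>) z \<le> cone_weight e \<beta> l z" for z
  proof (cases "z \<in> ball ?c ?\<eta>")
    case False then show ?thesis using cone_weight_bounds(1)[OF l \<beta>] by simp
  next
    case True
    define s where "s = z \<bullet> e"
    have \<eta>: "?\<eta> \<le> l / 4" using \<beta> l by simp
    have d: "norm (z - ?c) < ?\<eta>" using True by (simp add: dist_norm norm_minus_commute)
    have "\<bar>(z - ?c) \<bullet> e\<bar> \<le> norm (z - ?c)" using Cauchy_Schwarz_ineq2[of "z - ?c" e] e by simp
    then have "\<bar>s - 3 / 2 * l\<bar> < ?\<eta>" using d ee by (simp add: s_def inner_diff_left)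
    then have "\<bar>s - 3 / 2 * l\<bar> < l / 4" using \<eta> by linarith
    then have s: "5 / 4 * l \<le> s" "s \<le> 7 / 4 * l" "0 < s" using l unfolding abs_less_iff by linarith+
    have "z \<bullet> z - s\<^sup>2 = (norm (z - s *\<^sub>R e))\<^sup>2"
      unfolding power2_norm_eq_inner using ee
      by (simp add: inner_diff_left inner_diff_right inner_commute s_def power2_eq_square)
    also have "\<dots> \<le> (norm (z - ?c))\<^sup>2"
    proof -
      have "(norm (z - ?c))\<^sup>2 = (norm (z - s *\<^sub>R e))\<^sup>2 + (s - 3 / 2 * l)\<^sup>2"
        unfolding power2_norm_eq_inner using ee
        by (simp add: inner_diff_left inner_diff_right inner_commute s_def power2_eq_square algebra_simps)
      then show ?thesis by simp
    qed
    also have "\<dots> \<le> ?\<eta>\<^sup>2" using d by (intro power_mono) auto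
    also have "\<dots> \<le> \<beta>\<^sup>2 / 4 * s\<^sup>2"
    proof -
      have "l\<^sup>2 \<le> s\<^sup>2" using s l by (intro power_mono) auto
      then have "\<beta>\<^sup>2 * l\<^sup>2 \<le> \<beta>\<^sup>2 * s\<^sup>2" by (intro mult_left_mono) auto
      moreover have "0 \<le> \<beta>\<^sup>2 * s\<^sup>2" by simp
      ultimately have "\<beta>\<^sup>2 * l\<^sup>2 \<le> 4 * (\<beta>\<^sup>2 * s\<^sup>2)" by linarith
      then show ?thesis by (simp add: power_divide power_mult_distrib)
    qed
    finally have "(z \<bullet> z) / s\<^sup>2 \<le> 1 + \<beta>\<^sup>2 / 4" using s(3) by (simp add: divide_le_eq distrib_right)
    then have ang: "angular \<beta> ((z \<bullet> z) / s\<^sup>2) = 1" using \<beta>(1) by (rule angular_1)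
    have "7 / 16 \<le> smoothstep' ((2 * l - s) / l)"
      by (rule smoothstep'_lower) (use s l in \<open>auto simp: field_simps\<close>)
    moreover have "s ^ (DIM('a) - 1) \<le> (2 * l) ^ (DIM('a) - 1)" using s l by (intro power_mono) auto
    ultimately have "?m \<le> smoothstep' ((2 * l - s) / l) / l / s ^ (DIM('a) - 1)"
      using l s by (intro frac_le divide_right_mono) auto
    then show ?thesis using True ang by (simp add: cone_weight_def s_def[symmetric])
  qed
  have fb: "emeasure lborel (ball x r) < \<infinity>" for x :: 'a and r by (intro emeasure_bounded_finite) simp
  have I1: "integrable lborel (\<lambda>z. ?m * indicator (ball ?c ?\<eta>) z)"
    using fb by (intro integrable_mult_right integrable_real_indicator) auto
  have I3: "integrable lborel (\<lambda>z. 4 / l / l ^ (DIM('a) - 1) * indicator (ball (0::'a) (4 * l)) z)"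
    using fb by (intro integrable_mult_right integrable_real_indicator) auto
  have I2: "integrable lborel (cone_weight e \<beta> l)"
    by (rule Bochner_Integration.integrable_bound[OF I3])
      (use cone_weight_bounds(1,2)[OF l \<beta>, of e] l in auto)
  have "measure lborel (ball ?c ?\<eta>) = measure lborel (ball (0::'a) ?\<eta>)"
    using l \<beta> by (simp add: content_ball)
  then have "?m * measure lborel (ball (0::'a) ?\<eta>) = (\<integral>z. ?m * indicator (ball ?c ?\<eta>) z \<partial>lborel)" by simp
  also have "\<dots> \<le> (\<integral>z. cone_weight e \<beta> l z \<partial>lborel)" by (intro integral_mono I1 I2 low)
  finally show ?thesis .
qed

definition cone_support :: "'a::euclidean_space \<Rightarrow> real \<Rightarrow> real \<Rightarrow> real \<Rightarrow> 'a set" where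
  "cone_support e \<beta> a l = {z. a \<le> z \<bullet> e \<and> z \<bullet> e \<le> 2 * l \<and> z \<bullet> z \<le> (1 + \<beta>\<^sup>2 / 2) * (z \<bullet> e)\<^sup>2}"

lemma closed_cone_support: "closed (cone_support e \<beta> a l)"
  unfolding cone_support_def by (intro closed_Collect_conj closed_Collect_le continuous_intros)

lemma compact_cone_support:
  assumes "0 < a" "0 < \<beta>" "\<beta> \<le> 1" shows "compact (cone_support e \<beta> a l)"
proof -
  have "cone_support e \<beta> a l \<subseteq> ball 0 (4 * l)"
  proof
    fix z assume z: "z \<in> cone_support e \<beta> a l"
    then have "norm z < 2 * (z \<bullet> e)"
      using cone_norm_bound(1)[of \<beta> z "z \<bullet> e"] assms by (auto simp: cone_support_def)
    then show "z \<in> ball 0 (4 * l)" using z by (simp add: cone_support_def)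
  qed
  then show ?thesis using closed_cone_support bounded_subset[OF bounded_ball] compact_eq_bounded_closed by blast
qed

text \<open>The closed support of the field is contained in the open cone of the larger opening
  \<open>\<beta>\<close>, so that the field is an admissible test field for weak gradients on
  \<open>M\<close>.\<close>

lemma cone_support_interior:
  assumes cone: "has_cone_at M \<beta> L y e" and "0 < a" "0 < \<beta>" "2 * l < L"
  shows "(+) y ` cone_support e \<beta> a l \<subseteq> interior M"
proof -
  let ?C = "{z. 0 < z \<bullet> e \<and> z \<bullet> e < L \<and> z \<bullet> z < (1 + \<beta>\<^sup>2) * (z \<bullet> e)\<^sup>2}"
  have "open ?C" by (intro open_Collect_conj open_Collect_less continuous_intros)
  then have "open ((+) y ` ?C)" by (rule open_translation)
  moreover have "(+) y ` ?C \<subseteq> M" using cone by (auto simp: has_cone_at_def power2_norm_eq_inner)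
  ultimately have "(+) y ` ?C \<subseteq> interior M" by (rule interior_maximal[rotated])
  moreover have "cone_support e \<beta> a l \<subseteq> ?C"
  proof
    fix z assume z: "z \<in> cone_support e \<beta> a l"
    then have s: "0 < z \<bullet> e" using assms by (auto simp: cone_support_def)
    then have "(1 + \<beta>\<^sup>2 / 2) * (z \<bullet> e)\<^sup>2 < (1 + \<beta>\<^sup>2) * (z \<bullet> e)\<^sup>2"
      using assms by (intro mult_strict_right_mono) auto
    moreover have "z \<bullet> z \<le> (1 + \<beta>\<^sup>2 / 2) * (z \<bullet> e)\<^sup>2" using z by (simp add: cone_support_def)
    ultimately have "z \<bullet> z < (1 + \<beta>\<^sup>2) * (z \<bullet> e)\<^sup>2" by (rule le_less_trans[rotated])
    then show "z \<in> ?C" using z s assms(4) by (simp add: cone_support_def)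
  qed
  ultimately show ?thesis by blast
qed

lemma cone_scalar_outside:
  assumes "0 < a" "0 < l" "0 < \<beta>" "z \<notin> cone_support e \<beta> a l"
  shows "cone_scalar e \<beta> a l z = 0"
  using cone_scalar_support[OF assms(1-3), of e z] assms(4) by (force simp: cone_support_def)

lemma cone_gradient_outside:
  assumes "0 < a" "0 < l" "0 < \<beta>" "z \<notin> cone_support e \<beta> a l"
  shows "cone_gradient e \<beta> a l z = 0"
proof -
  have "(cone_scalar e \<beta> a l has_derivative (\<lambda>v. 0)) (at z)"
    using has_derivative_transform_within_open[of "\<lambda>z. 0" "\<lambda>v. 0" z UNIV "- cone_support e \<beta> a l" "cone_scalar e \<beta> a l"]
      closed_cone_support[of e \<beta> a l] cone_scalar_outside[OF assms(1-3)] assms(4) by auto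
  from has_derivative_unique[OF this cone_scalar_derivative[OF assms(1,2)]]
  have "cone_gradient e \<beta> a l z \<bullet> cone_gradient e \<beta> a l z = 0" by metis
  then show ?thesis by simp
qed

lemma integrable_compact_support:
  fixes F :: "'a::euclidean_space \<Rightarrow> real"
  assumes "compact K" "continuous_on UNIV F" "\<And>x. x \<notin> K \<Longrightarrow> F x = 0"
  shows "integrable lborel F"
proof -
  have "integrable lborel (\<lambda>x. indicator K x *\<^sub>R F x)"
    using borel_integrable_compact[OF assms(1) continuous_on_subset[OF assms(2)]] by simp
  moreover have "(\<lambda>x. indicator K x *\<^sub>R F x) = F" using assms(3) by (auto simp: indicator_def fun_eq_iff)
  ultimately show ?thesis by simp
qed

text \<open>Integration by parts against the field, summed over the coordinate directions. The hypothesis on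
  \<open>G\<close> concerns the interior of \<open>M\<close> only; outside it, the field vanishes.\<close>

lemma cone_flux:
  fixes M :: "'a::euclidean_space set"
  assumes wg: "weak_gradient M f G" and G2: "set_integrable lborel (interior M) (\<lambda>x. (norm (G x))\<^sup>2)"
    and f: "f \<in> borel_measurable borel" "\<And>x. \<bar>f x\<bar> \<le> B"
    and cone: "has_cone_at M \<beta> L y e" and \<beta>: "0 < \<beta>" "\<beta> \<le> 1" and a: "0 < a" and l: "0 < l" "2 * l < L"
  shows "(\<integral>x. f x * (profile' a l ((x - y) \<bullet> e) * angular \<beta> (((x - y) \<bullet> (x - y)) / ((x - y) \<bullet> e)\<^sup>2)
             / ((x - y) \<bullet> e) ^ (DIM('a) - 1)) \<partial>lborel)
     = - (\<integral>x. G x \<bullet> cone_field e \<beta> a l (x - y) \<partial>lborel)"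
proof -
  let ?cs = "cone_scalar e \<beta> a l" and ?cg = "cone_gradient e \<beta> a l"
  let ?K = "(+) y ` cone_support e \<beta> a l"
  define \<phi> where "\<phi> b x = ((x - y) \<bullet> b) * ?cs (x - y)" for b x
  define \<phi>' where "\<phi>' b x = ?cs (x - y) *\<^sub>R b + ((x - y) \<bullet> b) *\<^sub>R ?cg (x - y)" for b x
  have e: "norm e = 1" using cone by (simp add: has_cone_at_def)
  have K: "compact ?K" using compact_cone_support[OF a \<beta>, of e l] by (rule compact_translation)
  have KM: "?K \<subseteq> interior M" by (rule cone_support_interior[OF cone a \<beta>(1) l(2)])
  have out: "x - y \<notin> cone_support e \<beta> a l" if "x \<notin> ?K" for x
    using that by (metis add_diff_cancel_left' diff_add_cancel image_eqI add.commute)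
  have \<phi>0: "\<phi> b x = 0" if "x \<notin> ?K" for b x
    using cone_scalar_outside[OF a l(1) \<beta>(1) out[OF that]] by (simp add: \<phi>_def)
  have \<phi>'0: "\<phi>' b x = 0" if "x \<notin> ?K" for b x
    using cone_scalar_outside[OF a l(1) \<beta>(1) out[OF that]] cone_gradient_outside[OF a l(1) \<beta>(1) out[OF that]]
    by (simp add: \<phi>'_def)
  have ccs: "continuous_on UNIV (\<lambda>x. ?cs (x - y))" and ccg: "continuous_on UNIV (\<lambda>x. ?cg (x - y))"
    by (auto intro!: continuous_on_compose2[OF continuous_cone_scalar[OF a l(1)]]
        continuous_on_compose2[OF continuous_cone_gradient[OF a l(1)]] continuous_intros)
  have c\<phi>: "continuous_on UNIV (\<phi> b)" for b unfolding \<phi>_def by (intro continuous_intros ccs)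
  have c\<phi>': "continuous_on UNIV (\<phi>' b)" for b unfolding \<phi>'_def by (intro continuous_intros ccs ccg)
  have D: "(\<phi> b has_derivative (\<lambda>h. \<phi>' b x \<bullet> h)) (at x)" for b x
  proof -
    have 1: "((\<lambda>x. (x - y) \<bullet> b) has_derivative (\<lambda>h. h \<bullet> b)) (at x)" by (auto intro!: derivative_eq_intros)
    have 0: "((\<lambda>x. x - y) has_derivative (\<lambda>h. h)) (at x)" by (auto intro!: derivative_eq_intros)
    have 2: "((\<lambda>x. ?cs (x - y)) has_derivative (\<lambda>h. ?cg (x - y) \<bullet> h)) (at x)"
      by (rule has_derivative_compose[OF 0 cone_scalar_derivative[OF a l(1)]])
    show ?thesis unfolding \<phi>_def[abs_def]
      by (rule has_derivative_eq_rhs[OF has_derivative_mult[OF 1 2]])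
        (auto simp: \<phi>'_def inner_add_left inner_commute[of b])
  qed
  have flux: "(\<integral>x. f x * (\<phi>' b x \<bullet> b) \<partial>lborel) = - (\<integral>x. (G x \<bullet> b) * \<phi> b x \<partial>lborel)" if "b \<in> Basis" for b
  proof -
    have "(\<forall>x. (\<phi> b has_derivative (\<lambda>h. \<phi>' b x \<bullet> h)) (at x)) \<and> continuous_on UNIV (\<phi>' b) \<and>
        (\<exists>K. compact K \<and> K \<subseteq> interior M \<and> (\<forall>x. x \<notin> K \<longrightarrow> \<phi> b x = 0))"
      by (intro conjI allI D c\<phi>' exI[of _ ?K] K KM impI \<phi>0)
    from wg[unfolded weak_gradient_def, THEN conjunct2, THEN conjunct2, rule_format, OF this that]
    show ?thesis .
  qed
  have [measurable]: "f \<in> borel_measurable lborel" "G \<in> borel_measurable lborel"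
    using f(1) wg by (auto simp: weak_gradient_def)
  have [measurable]: "\<phi> b \<in> borel_measurable lborel" "\<phi>' b \<in> borel_measurable lborel" for b
    using c\<phi> c\<phi>' by (auto intro: borel_measurable_continuous_onI)
  have If: "integrable lborel (\<lambda>x. f x * (\<phi>' b x \<bullet> b))" for b
  proof (rule Bochner_Integration.integrable_bound)
    show "integrable lborel (\<lambda>x. B * \<bar>\<phi>' b x \<bullet> b\<bar>)"
      by (rule integrable_compact_support[OF K]) (auto intro!: continuous_intros c\<phi>' simp: \<phi>'0)
    have "0 \<le> B" using f(2)[of 0] by linarith
    then show "AE x in lborel. norm (f x * (\<phi>' b x \<bullet> b)) \<le> norm (B * \<bar>\<phi>' b x \<bullet> b\<bar>)"
      using f(2) by (auto simp: abs_mult intro!: mult_right_mono)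
  qed measurable
  have IG: "integrable lborel (\<lambda>x. (G x \<bullet> b) * \<phi> b x)" if b: "b \<in> Basis" for b
  proof -
    have 1: "integrable lborel (\<lambda>x. (indicator (interior M) x * (G x \<bullet> b))\<^sup>2)"
    proof (rule Bochner_Integration.integrable_bound[OF G2[unfolded set_integrable_def]])
      have "(G x \<bullet> b)\<^sup>2 \<le> (norm (G x))\<^sup>2" for x
        using Basis_le_norm[OF b, of "G x"] by (metis abs_ge_zero power2_abs power_mono)
      then show "AE x in lborel. norm ((indicator (interior M) x * (G x \<bullet> b))\<^sup>2) \<le> norm (indicator (interior M) x *\<^sub>R (norm (G x))\<^sup>2)"
        by (auto simp: indicator_def)
    qed measurable
    have 2: "integrable lborel (\<lambda>x. (\<phi> b x)\<^sup>2)"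
      by (rule integrable_compact_support[OF K]) (auto intro!: continuous_intros c\<phi> simp: \<phi>0)
    have "integrable lborel (\<lambda>x. (indicator (interior M) x * (G x \<bullet> b)) * \<phi> b x)"
      by (rule integrable_mult_L2[OF _ _ 1 2]) measurable
    moreover have "(\<lambda>x. (indicator (interior M) x * (G x \<bullet> b)) * \<phi> b x) = (\<lambda>x. (G x \<bullet> b) * \<phi> b x)"
      using \<phi>0 KM by (auto simp: indicator_def fun_eq_iff)
    ultimately show ?thesis by simp
  qed
  have "(\<integral>x. f x * (\<Sum>b\<in>Basis. \<phi>' b x \<bullet> b) \<partial>lborel) = (\<Sum>b\<in>Basis. \<integral>x. f x * (\<phi>' b x \<bullet> b) \<partial>lborel)"
    unfolding sum_distrib_left by (rule Bochner_Integration.integral_sum[OF If])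
  also have "\<dots> = - (\<Sum>b\<in>Basis. \<integral>x. (G x \<bullet> b) * \<phi> b x \<partial>lborel)"
    by (simp add: flux sum_negf)
  also have "(\<Sum>b\<in>Basis. \<integral>x. (G x \<bullet> b) * \<phi> b x \<partial>lborel) = (\<integral>x. (\<Sum>b\<in>Basis. (G x \<bullet> b) * \<phi> b x) \<partial>lborel)"
    by (rule Bochner_Integration.integral_sum[symmetric, OF IG])
  also have "(\<lambda>x. \<Sum>b\<in>Basis. (G x \<bullet> b) * \<phi> b x) = (\<lambda>x. G x \<bullet> cone_field e \<beta> a l (x - y))"
    unfolding cone_field_def inner_scaleR_right euclidean_inner[of _ "_ - y"] \<phi>_def
    by (auto simp: sum_distrib_left mult_ac fun_eq_iff)
  finally show ?thesis unfolding \<phi>'_def cone_divergence[OF a e] .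
qed

lemma integral_lborel_translation:
  fixes F :: "'a::euclidean_space \<Rightarrow> 'b::{banach, second_countable_topology}"
  assumes "F \<in> borel_measurable borel"
  shows "(\<integral>x. F (x - y) \<partial>lborel) = (\<integral>x. F x \<partial>lborel)"
proof -
  have "(\<integral>x. F x \<partial>lborel) = (\<integral>x. F x \<partial>distr lborel borel ((+) (- y)))"
    by (simp add: lborel_distr_plus)
  also have "\<dots> = (\<integral>x. F (x - y) \<partial>lborel)" using assms by (subst integral_distr) auto
  finally show ?thesis by simp
qed

lemma integrable_lborel_translation:
  fixes F :: "'a::euclidean_space \<Rightarrow> 'b::{banach, second_countable_topology}"
  assumes "integrable lborel F"
  shows "integrable lborel (\<lambda>x. F (x - y))"
proof -
  have "integrable (distr lborel borel ((+) (- y))) F" using assms by (simp add: lborel_distr_plus)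
  then show ?thesis using assms by (subst (asm) integrable_distr_eq) auto
qed

text \<open>A point of the cone with \<open>dist y x \<ge> 4 a\<close> has height at least \<open>2
  a\<close>, where the profile has stopped rising. So for \<open>f\<close> vanishing near
  \<open>y\<close> only the outer part of the divergence contributes, and the flux identity
  expresses the weighted average of \<open>f\<close> through its gradient.\<close>

lemma cone_average_bound:
  fixes M :: "'a::euclidean_space set"
  assumes wg: "weak_gradient M f G" and G2: "set_integrable lborel (interior M) (\<lambda>x. (norm (G x))\<^sup>2)"
    and f: "f \<in> borel_measurable borel" "\<And>x. \<bar>f x\<bar> \<le> B"
    and cone: "has_cone_at M \<beta> L y e" and \<beta>: "0 < \<beta>" "\<beta> \<le> 1" and a: "0 < a" "2 * a \<le> l" and l: "0 < l" "2 * l < L"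
    and f0: "\<And>x. x \<in> M \<Longrightarrow> dist y x < 4 * a \<Longrightarrow> f x = 0" and d: "2 \<le> DIM('a)"
  shows "(\<integral>x. f x * cone_weight e \<beta> l (x - y) \<partial>lborel)\<^sup>2
     \<le> (LINT x:interior M|lborel. (norm (G x))\<^sup>2) * (\<integral>z. (norm (cone_field e \<beta> a l z))\<^sup>2 \<partial>lborel)"
proof -
  let ?\<Phi> = "\<lambda>x. cone_field e \<beta> a l (x - y)"
  have eq: "f x * (profile' a l ((x - y) \<bullet> e) * angular \<beta> (((x - y) \<bullet> (x - y)) / ((x - y) \<bullet> e)\<^sup>2)
             / ((x - y) \<bullet> e) ^ (DIM('a) - 1)) = - (f x * cone_weight e \<beta> l (x - y))" for x
  proof -
    define z where "z = x - y"
    define s where "s = z \<bullet> e"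
    define q where "q = (z \<bullet> z) / s\<^sup>2"
    consider "angular \<beta> q = 0" | "s \<le> a" | "2 * l \<le> s" | "angular \<beta> q \<noteq> 0" "a < s" "s < 2 * l" by linarith
    then show ?thesis
    proof cases
      case 4
      then have "q < 1 + \<beta>\<^sup>2 / 2" using angular_0[of \<beta> q] \<beta>(1) by (meson not_le)
      then have zz: "z \<bullet> z < (1 + \<beta>\<^sup>2 / 2) * s\<^sup>2" using 4 a by (simp add: q_def divide_less_eq)
      then have "z \<in> cone_support e \<beta> a l" using 4 by (simp add: cone_support_def s_def)
      then have xM: "x \<in> M" using cone_support_interior[OF cone a(1) \<beta>(1) l(2)] interior_subset
        by (force simp: z_def)
      show ?thesis
      proof (cases "f x = 0")
        case False
        then have "4 * a \<le> norm z" using f0[OF xM] by (force simp: z_def dist_norm norm_minus_commute)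
        also have "norm z < 2 * s" using cone_norm_bound(1)[OF \<beta>(2,1), of z s] zz 4 a by simp
        finally have "1 \<le> (s - a) / a" using a by (simp add: field_simps)
        then show ?thesis
          by (simp add: profile'_def smoothstep'_0 smoothstep_1 cone_weight_def z_def[symmetric] s_def[symmetric] q_def[symmetric])
      qed simp
    next
      case 2
      then have "1 \<le> (2 * l - s) / l" using a l by (simp add: field_simps)
      then show ?thesis using 2 profile_0(2)[of s a l] a
        by (simp add: cone_weight_def smoothstep'_0 z_def[symmetric] s_def[symmetric])
    next
      case 3
      then have "(2 * l - s) / l \<le> 0" using l by (simp add: divide_nonpos_pos)
      then show ?thesis using 3 profile_large(2)[of l s a] l
        by (simp add: cone_weight_def smoothstep'_0 z_def[symmetric] s_def[symmetric])
    qed (simp_all add: cone_weight_def z_def[symmetric] s_def[symmetric] q_def[symmetric])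
  qed
  obtain K :: nat where "2 * l / a < 2 ^ K" using real_arch_pow[of 2 "2 * l / a"] by auto
  then have K: "2 * l < 2 ^ K * a" using a by (simp add: divide_less_eq)
  have \<Phi>2: "integrable lborel (\<lambda>x. (norm (?\<Phi> x))\<^sup>2)"
    by (rule integrable_lborel_translation[OF cone_field_L2(1)[OF a(1) l(1) \<beta> K d]])
  have [measurable]: "G \<in> borel_measurable borel" using wg by (simp add: weak_gradient_def)
  have [measurable]: "cone_field e \<beta> a l \<in> borel_measurable borel" by (rule cone_field_measurable[OF a(1) l(1)])
  have G2': "integrable lborel (\<lambda>x. (indicator (interior M) x * norm (G x))\<^sup>2)"
  proof -
    have "(\<lambda>x. (indicator (interior M) x * norm (G x))\<^sup>2) = (\<lambda>x. indicator (interior M) x *\<^sub>R (norm (G x))\<^sup>2)"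
      by (auto simp: indicator_def)
    then show ?thesis using G2 by (simp add: set_integrable_def)
  qed
  have \<Phi>0: "?\<Phi> x = 0" if "x \<notin> interior M" for x
  proof -
    have "x - y \<notin> cone_support e \<beta> a l"
      using cone_support_interior[OF cone a(1) \<beta>(1) l(2)] that by (metis add.commute diff_add_cancel image_subset_iff)
    then have "cone_scalar e \<beta> a l (x - y) = 0" by (rule cone_scalar_outside[OF a(1) l(1) \<beta>(1)])
    then show ?thesis by (simp add: cone_field_def)
  qed
  have GP: "integrable lborel (\<lambda>x. (indicator (interior M) x * norm (G x)) * norm (?\<Phi> x))"
    by (rule integrable_mult_L2[OF _ _ G2' \<Phi>2]) measurable
  have "\<bar>\<integral>x. f x * cone_weight e \<beta> l (x - y) \<partial>lborel\<bar> = \<bar>\<integral>x. G x \<bullet> ?\<Phi> x \<partial>lborel\<bar>"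
    using cone_flux[OF wg G2 f cone \<beta> a(1) l] unfolding eq by simp
  also have "\<dots> \<le> (\<integral>x. norm (G x \<bullet> ?\<Phi> x) \<partial>lborel)" using integral_norm_bound[of lborel "\<lambda>x. G x \<bullet> ?\<Phi> x"] by simp
  also have "\<dots> \<le> (\<integral>x. (indicator (interior M) x * norm (G x)) * norm (?\<Phi> x) \<partial>lborel)"
  proof (rule integral_mono')
    show "norm (G x \<bullet> ?\<Phi> x) \<le> (indicator (interior M) x * norm (G x)) * norm (?\<Phi> x)" for x
      using Cauchy_Schwarz_ineq2[of "G x" "?\<Phi> x"] \<Phi>0[of x] by (auto simp: indicator_def)
  qed (use GP in auto)
  finally have "\<bar>\<integral>x. f x * cone_weight e \<beta> l (x - y) \<partial>lborel\<bar>\<^sup>2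
      \<le> (\<integral>x. (indicator (interior M) x * norm (G x)) * norm (?\<Phi> x) \<partial>lborel)\<^sup>2"
    by (intro power_mono) auto
  also have "\<dots> \<le> (\<integral>x. (indicator (interior M) x * norm (G x))\<^sup>2 \<partial>lborel) * (\<integral>x. (norm (?\<Phi> x))\<^sup>2 \<partial>lborel)"
    by (rule Cauchy_Schwarz_integral[OF _ _ G2' \<Phi>2]) measurable
  also have "(\<integral>x. (norm (?\<Phi> x))\<^sup>2 \<partial>lborel) = (\<integral>z. (norm (cone_field e \<beta> a l z))\<^sup>2 \<partial>lborel)"
    using integral_lborel_translation[of "\<lambda>z. (norm (cone_field e \<beta> a l z))\<^sup>2" y] by simp
  also have "(\<lambda>x. (indicator (interior M) x * norm (G x))\<^sup>2) = (\<lambda>x. indicator (interior M) x *\<^sub>R (norm (G x))\<^sup>2)"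
    by (auto simp: indicator_def)
  finally show ?thesis by (simp add: set_lebesgue_integral_def)
qed

section \<open>Energy of functions that vanish on a small ball\<close>

text \<open>In the plane every term equals \<open>1\<close>, and there are about \<open>log (1 /
  \<epsilon>)\<close> of them; in higher dimensions the sum is dominated by a geometric series
  starting at \<open>(4 / \<epsilon>)\<^sup>d\<^sup>-\<^sup>2\<close>.\<close>

lemma dyadic_sum_kappa:
  assumes l: "0 < l" and d: "2 \<le> d"
  shows "\<exists>C \<epsilon>0. 0 < C \<and> 0 < \<epsilon>0 \<and> (\<forall>\<epsilon>. 0 < \<epsilon> \<and> \<epsilon> < \<epsilon>0 \<longrightarrow> 0 < kappa d \<epsilon> \<and> kappa d \<epsilon> \<le> 1 \<and>
     (\<exists>K. 2 * l < 2 ^ K * (\<epsilon> / 4) \<and> (\<Sum>k<K. 1 / (2 ^ k * (\<epsilon> / 4)) ^ (d - 2)) \<le> C / kappa d \<epsilon>))"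
proof -
  define \<epsilon>0 where "\<epsilon>0 = min (exp (- 1)) (8 * l)"
  define C where "C = max (2 + (\<bar>ln (8 * l)\<bar> + 1) / ln 2) (2 * 4 ^ (d - 2))"
  have \<epsilon>0: "0 < \<epsilon>0" using l by (simp add: \<epsilon>0_def)
  have C: "0 < C" by (simp add: C_def less_max_iff_disj)
  have main: "0 < kappa d \<epsilon> \<and> kappa d \<epsilon> \<le> 1 \<and> (\<exists>K. 2 * l < 2 ^ K * (\<epsilon> / 4) \<and> (\<Sum>k<K. 1 / (2 ^ k * (\<epsilon> / 4)) ^ (d - 2)) \<le> C / kappa d \<epsilon>)"
    if \<epsilon>: "0 < \<epsilon>" "\<epsilon> < \<epsilon>0" for \<epsilon>
  proof -
    have "exp (1::real) \<le> 1 / \<epsilon>" using \<epsilon> by (simp add: \<epsilon>0_def exp_minus field_simps)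
    then have ln1: "1 \<le> ln (1 / \<epsilon>)" using \<epsilon>(1) by (simp add: ln_ge_iff)
    have "exp (- 1) < (1::real)" by simp
    then have \<epsilon>1: "\<epsilon> < 1" using \<epsilon> unfolding \<epsilon>0_def by linarith
    define q where "q = 8 * l / \<epsilon>"
    have q: "1 < q" using \<epsilon> by (simp add: q_def \<epsilon>0_def)
    define K where "K = nat \<lceil>log 2 q\<rceil> + 1"
    have lq: "0 < log 2 q" using q by simp
    then have K: "log 2 q < real K" "real K \<le> log 2 q + 2" unfolding K_def by linarith+
    have "q = 2 powr (log 2 q)" using q by simp
    also have "\<dots> < 2 powr real K" using K(1) by simp
    also have "\<dots> = 2 ^ K" by (simp add: powr_realpow)
    finally have K2: "2 * l < 2 ^ K * (\<epsilon> / 4)" using \<epsilon>(1) by (simp add: q_def field_simps)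
    have "0 < kappa d \<epsilon> \<and> kappa d \<epsilon> \<le> 1"
      using ln1 \<epsilon>(1) \<epsilon>1 by (simp add: kappa_def inverse_le_1_iff power_le_one)
    moreover have "(\<Sum>k<K. 1 / (2 ^ k * (\<epsilon> / 4)) ^ (d - 2)) \<le> C / kappa d \<epsilon>"
    proof (cases "d = 2")
      case True
      have "log 2 q = (ln (8 * l) + ln (1 / \<epsilon>)) / ln 2"
        using l \<epsilon>(1) by (simp add: q_def log_def ln_div)
      also have "\<dots> \<le> (\<bar>ln (8 * l)\<bar> * ln (1 / \<epsilon>) + ln (1 / \<epsilon>)) / ln 2"
      proof (intro divide_right_mono add_right_mono)
        have "\<bar>ln (8 * l)\<bar> * 1 \<le> \<bar>ln (8 * l)\<bar> * ln (1 / \<epsilon>)" by (intro mult_left_mono ln1) auto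
        then show "ln (8 * l) \<le> \<bar>ln (8 * l)\<bar> * ln (1 / \<epsilon>)" by linarith
      qed simp
      finally have "real K \<le> (2 + (\<bar>ln (8 * l)\<bar> + 1) / ln 2) * ln (1 / \<epsilon>)"
        using K(2) ln1 by (simp add: distrib_right add_divide_distrib)
      also have "\<dots> \<le> C * ln (1 / \<epsilon>)" using ln1 by (intro mult_right_mono) (auto simp: C_def)
      finally have "real K \<le> C * ln (1 / \<epsilon>)" .
      moreover have "C / kappa d \<epsilon> = C * ln (1 / \<epsilon>)"
        unfolding kappa_def if_P[OF True] divide_inverse[of C] inverse_inverse_eq by (rule refl)
      moreover have "(\<Sum>k<K. 1 / (2 ^ k * (\<epsilon> / 4)) ^ (d - 2)) = real K" unfolding True by simp
      ultimately show ?thesis by (simp only:)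
    next
      case False
      let ?n = "d - 2" and ?a = "\<epsilon> / 4"
      have n: "1 \<le> ?n" using False d by simp
      have a: "0 < ?a" using \<epsilon> by simp
      have "1 / (2 ^ k * ?a) ^ ?n \<le> (1 / 2) ^ k * (1 / ?a ^ ?n)" for k
      proof -
        have "(2::real) ^ k \<le> (2 ^ k) ^ ?n" using n power_increasing[of 1 ?n "2 ^ k :: real"] by simp
        then have "1 / (2 ^ k) ^ ?n \<le> 1 / (2::real) ^ k" by (intro divide_left_mono) auto
        then have "1 / (2 ^ k) ^ ?n * (1 / ?a ^ ?n) \<le> 1 / 2 ^ k * (1 / ?a ^ ?n)"
          using a by (intro mult_right_mono) auto
        then show ?thesis by (simp add: power_mult_distrib power_divide)
      qed
      then have "(\<Sum>k<K. 1 / (2 ^ k * ?a) ^ ?n) \<le> (\<Sum>k<K. (1 / 2) ^ k * (1 / ?a ^ ?n))" by (rule sum_mono)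
      also have "\<dots> = (\<Sum>k<K. (1 / 2) ^ k) * (1 / ?a ^ ?n)" by (rule sum_distrib_right[symmetric])
      also have "(\<Sum>k<K. (1 / 2 :: real) ^ k) = 2 * (1 - (1 / 2) ^ K)" by (subst geometric_sum) auto
      also have "2 * (1 - (1 / 2) ^ K) * (1 / ?a ^ ?n) \<le> 2 * (1 / ?a ^ ?n)"
        using a by (intro mult_right_mono) auto
      also have "\<dots> = 2 * 4 ^ ?n / \<epsilon> ^ ?n" by (simp add: power_divide)
      also have "\<dots> \<le> C / \<epsilon> ^ ?n" using \<epsilon>(1) by (intro divide_right_mono) (auto simp: C_def)
      finally show ?thesis using False by (simp add: kappa_def)
    qed
    ultimately show ?thesis using K2 by blast
  qed
  then show ?thesis using \<epsilon>0 C by blast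
qed

text \<open>The part of the assumptions on a domain that makes normalized volume a probability measure.\<close>

locale compact_body =
  fixes M :: "'a::euclidean_space set"
  assumes compact_M: "compact M" and positive_volume: "0 < measure lborel M"
begin

abbreviation "\<mu> \<equiv> normalized_volume M"
abbreviation "vol \<equiv> measure lborel M"

lemma M_borel [measurable]: "M \<in> sets borel"
  using compact_M by (simp add: compact_imp_closed)

lemma emeasure_M: "emeasure lborel M = ennreal vol"
  using emeasure_bounded_finite[OF compact_imp_bounded[OF compact_M]]
  by (simp add: emeasure_eq_ennreal_measure less_top)

lemma normalized_volume_density: "\<mu> = density lborel (\<lambda>x. ennreal (indicator M x / vol))"
  unfolding uniform_measure_def emeasure_M using positive_volume
  by (intro density_cong) (auto simp: indicator_def divide_ennreal ennreal_1[symmetric] simp del: ennreal_1)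

lemma sets_\<mu> [simp, measurable_cong]: "sets \<mu> = sets borel"
  by (simp add: uniform_measure_def)

sublocale \<mu>: prob_space \<mu>
  by (rule prob_space_uniform_measure) (use positive_volume in \<open>auto simp: emeasure_M\<close>)

lemma prob_UNIV [simp]: "measure \<mu> UNIV = 1"
  using \<mu>.prob_space by simp

lemma AE_in_M: "AE x in \<mu>. x \<in> M"
  by (rule AE_uniform_measureI) auto

lemma integrable_\<mu>:
  fixes f :: "'a \<Rightarrow> real"
  assumes "f \<in> borel_measurable borel"
  shows "integrable \<mu> f \<longleftrightarrow> integrable lborel (\<lambda>x. indicator M x * f x)"
proof -
  have "integrable \<mu> f \<longleftrightarrow> integrable lborel (\<lambda>x. (1 / vol) * (indicator M x * f x))"
    unfolding normalized_volume_density using assms positive_volume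
    by (subst integrable_density) (auto intro!: AE_I2)
  also have "\<dots> \<longleftrightarrow> integrable lborel (\<lambda>x. indicator M x * f x)"
    using positive_volume by (subst integrable_mult_left_iff) auto
  finally show ?thesis .
qed

lemma integral_\<mu>:
  fixes f :: "'a \<Rightarrow> real"
  assumes "f \<in> borel_measurable borel"
  shows "(\<integral>x. f x \<partial>\<mu>) = (\<integral>x. indicator M x * f x \<partial>lborel) / vol"
  unfolding normalized_volume_density using assms positive_volume
  by (subst integral_density) (auto intro!: AE_I2)

lemma integrable_\<mu>_bounded:
  fixes f :: "'a \<Rightarrow> real"
  assumes "f \<in> borel_measurable borel" "\<And>x. \<bar>f x\<bar> \<le> B"
  shows "integrable \<mu> f"
  using assms by (intro \<mu>.integrable_const_bound[of _ B]) auto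

lemma L2_bounded:
  assumes "f \<in> borel_measurable borel" "\<And>x. \<bar>f x\<bar> \<le> B" shows "f \<in> L2 M"
  unfolding L2_def
proof safe
  have "(f x)\<^sup>2 \<le> B\<^sup>2" for x using assms(2)[of x] by (metis abs_ge_zero power2_abs power_mono)
  then show "integrable \<mu> (\<lambda>x. (f x)\<^sup>2)" using assms(1) by (intro integrable_\<mu>_bounded[of _ "B\<^sup>2"]) auto
qed (use assms in auto)

text \<open>The energy is an integral with respect to normalized volume of a gradient selected by choice;
  here it becomes a Lebesgue integral of some weak gradient.\<close>

lemma energy_weak_gradient:
  assumes "f \<in> H1 M"
  obtains G where "weak_gradient M f G" "set_integrable lborel (interior M) (\<lambda>x. (norm (G x))\<^sup>2)"
    "(LINT x:interior M|lborel. (norm (G x))\<^sup>2) = 2 * vol * energy M f f"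
proof -
  define G where "G = gradient M f"
  have wg: "weak_gradient M f G" using assms unfolding H1_def G_def gradient_def using someI_ex[of "weak_gradient M f"] by simp
  then have [measurable]: "G \<in> borel_measurable borel" by (simp add: weak_gradient_def)
  have eq: "(\<lambda>x. indicator M x * (indicator (interior M) x *\<^sub>R (norm (G x))\<^sup>2)) = (\<lambda>x. indicator (interior M) x *\<^sub>R (norm (G x))\<^sup>2)"
    using interior_subset[of M] by (auto simp: indicator_def fun_eq_iff)
  have "integrable \<mu> (\<lambda>x. indicator (interior M) x *\<^sub>R (norm (G x))\<^sup>2)"
    using wg by (simp add: weak_gradient_def set_integrable_def)
  then have "set_integrable lborel (interior M) (\<lambda>x. (norm (G x))\<^sup>2)"
    using integrable_\<mu>[of "\<lambda>x. indicator (interior M) x *\<^sub>R (norm (G x))\<^sup>2"] eq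
    by (simp add: set_integrable_def)
  moreover have "energy M f f = 1 / 2 * ((LINT x:interior M|lborel. (norm (G x))\<^sup>2) / vol)"
    using integral_\<mu>[of "\<lambda>x. indicator (interior M) x *\<^sub>R (norm (G x))\<^sup>2"] eq
    by (simp add: energy_def set_lebesgue_integral_def G_def[symmetric] power2_norm_eq_inner)
  ultimately show ?thesis using that[OF wg] positive_volume by simp
qed

text \<open>Restricted to bounded functions, which makes all integrals finite; the functions that occur
  later are survival probabilities.\<close>

definition has_poincare :: "real \<Rightarrow> bool" where
  "has_poincare C \<longleftrightarrow> (\<forall>f B. f \<in> H1 M \<and> (\<forall>x. \<bar>f x\<bar> \<le> B) \<longrightarrow>
     L2_inner M (\<lambda>x. f x - (\<integral>x. f x \<partial>\<mu>)) (\<lambda>x. f x - (\<integral>x. f x \<partial>\<mu>)) \<le> C * energy M f f)"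

text \<open>Write \<open>f = m + (f - m)\<close> with \<open>m\<close> the mean. The average of
  \<open>f\<close> with respect to the cone weight is controlled by the flux, that of \<open>f -
  m\<close> by the Poincare inequality, and the weight has mass bounded below. So
  \<open>m\<^sup>2\<close> is at most a multiple of \<open>energy / kappa\<close>, and
  \<open>\<parallel>f\<parallel>\<^sup>2 = \<parallel>f - m\<parallel>\<^sup>2 +
  m\<^sup>2\<close>.\<close>

theorem dirichlet_eigenvalue_bound:
  assumes poincare: "has_poincare CP" "0 < CP"
    and cones: "0 < \<beta>" "\<beta> \<le> 1" "0 < L" "\<And>y. y \<in> M \<Longrightarrow> \<exists>e. has_cone_at M \<beta> L y e" and d: "2 \<le> DIM('a)"
  shows "\<exists>c \<epsilon>0. 0 < c \<and> 0 < \<epsilon>0 \<and> (\<forall>\<epsilon> y f B. 0 < \<epsilon> \<and> \<epsilon> < \<epsilon>0 \<and> y \<in> M \<and> f \<in> H1 M \<and> (\<forall>x. \<bar>f x\<bar> \<le> B) \<and>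
      (\<forall>x\<in>M. dist y x < \<epsilon> \<longrightarrow> f x = 0) \<longrightarrow> c * kappa DIM('a) \<epsilon> * L2_inner M f f \<le> energy M f f)"
proof -
  define l where "l = L / 4"
  have l: "0 < l" "2 * l < L" using cones(3) by (auto simp: l_def)
  obtain C2 \<epsilon>1 where C2: "0 < C2" "0 < \<epsilon>1" and dyadic: "\<And>\<epsilon>. 0 < \<epsilon> \<Longrightarrow> \<epsilon> < \<epsilon>1 \<Longrightarrow>
      0 < kappa DIM('a) \<epsilon> \<and> kappa DIM('a) \<epsilon> \<le> 1 \<and>
      (\<exists>K. 2 * l < 2 ^ K * (\<epsilon> / 4) \<and> (\<Sum>k<K. 1 / (2 ^ k * (\<epsilon> / 4)) ^ (DIM('a) - 2)) \<le> C2 / kappa DIM('a) \<epsilon>)"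
    using dyadic_sum_kappa[OF l(1) d] by blast
  define \<epsilon>0 where "\<epsilon>0 = min \<epsilon>1 l"
  define C1 where "C1 = 2 * 4 ^ DIM('a) * unit_ball_vol (real DIM('a))"
  have C1: "0 \<le> C1" by (simp add: C1_def)
  define cw where "cw = 7 / 16 / l / (2 * l) ^ (DIM('a) - 1) * measure lborel (ball (0::'a) (\<beta> * l / 4))"
  have cw: "0 < cw" using l cones by (simp add: cw_def content_ball_pos)
  define bw where "bw = 4 / l / l ^ (DIM('a) - 1)"
  define Cw where "Cw = bw\<^sup>2 * measure lborel (ball (0::'a) (4 * l))"
  have Cw: "0 \<le> Cw" by (simp add: Cw_def)
  (* Q collects the bounds for the variance of f (CP), for the flux through the dyadic shells
     (C1, C2) and for the weighted average of f - m (CP, Cw); cw is the mass of the weight. *)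
  define Q where "Q = CP + (4 * vol * C1 * C2 + 2 * vol * CP * Cw) / cw\<^sup>2"
  have Q: "0 < Q" using poincare C1 C2 Cw cw positive_volume
    by (auto simp: Q_def intro!: add_pos_nonneg divide_nonneg_pos mult_nonneg_nonneg)
  have main: "1 / Q * kappa DIM('a) \<epsilon> * L2_inner M f f \<le> energy M f f"
    if \<epsilon>: "0 < \<epsilon>" "\<epsilon> < \<epsilon>0" and y: "y \<in> M" and f: "f \<in> H1 M" "\<And>x. \<bar>f x\<bar> \<le> B"
      and f0: "\<And>x. x \<in> M \<Longrightarrow> dist y x < \<epsilon> \<Longrightarrow> f x = 0" for \<epsilon> y f B
  proof -
    let ?\<kappa> = "kappa DIM('a) \<epsilon>"
    obtain e where cone: "has_cone_at M \<beta> L y e" using cones(4)[OF y] by blast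
    then have e: "norm e = 1" by (simp add: has_cone_at_def)
    obtain K where K: "2 * l < 2 ^ K * (\<epsilon> / 4)"
      and SK: "(\<Sum>k<K. 1 / (2 ^ k * (\<epsilon> / 4)) ^ (DIM('a) - 2)) \<le> C2 / ?\<kappa>" and \<kappa>: "0 < ?\<kappa>" "?\<kappa> \<le> 1"
      using dyadic[of \<epsilon>] \<epsilon> by (auto simp: \<epsilon>0_def)
    (* The inner scale of the field is \<epsilon> / 4: the profile has stopped rising when the
       cone leaves the ball of radius \<epsilon>. *)
    have a: "0 < \<epsilon> / 4" "2 * (\<epsilon> / 4) \<le> l" using \<epsilon> by (auto simp: \<epsilon>0_def)
    obtain G where wg: "weak_gradient M f G" and G2: "set_integrable lborel (interior M) (\<lambda>x. (norm (G x))\<^sup>2)"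
      and en: "(LINT x:interior M|lborel. (norm (G x))\<^sup>2) = 2 * vol * energy M f f"
      using energy_weak_gradient[OF f(1)] by blast
    have [measurable]: "f \<in> borel_measurable borel" using f(1) by (simp add: H1_def L2_def)
    define w where "w x = cone_weight e \<beta> l (x - y)" for x
    have [measurable]: "w \<in> borel_measurable borel" unfolding w_def[abs_def] by measurable
    define en where "en = energy M f f"
    have en0: "0 \<le> en"
    proof -
      have "0 \<le> 2 * vol * energy M f f" unfolding en[symmetric] set_lebesgue_integral_def by simp
      then show ?thesis using positive_volume by (simp add: en_def zero_le_mult_iff)
    qed
    define W where "W = (\<integral>x. f x * w x \<partial>lborel)"
    have W: "W\<^sup>2 \<le> 2 * vol * en * (C1 * (C2 / ?\<kappa>))"
    proof -
      have "W\<^sup>2 \<le> 2 * vol * en * (\<integral>z. (norm (cone_field e \<beta> (\<epsilon> / 4) l z))\<^sup>2 \<partial>lborel)"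
        using cone_average_bound[OF wg G2 _ f(2) cone cones(1,2) a l _ d] f0 unfolding en_def en[symmetric] W_def w_def by simp
      also have "\<dots> \<le> 2 * vol * en * (C1 * (C2 / ?\<kappa>))"
      proof (rule mult_left_mono)
        show "(\<integral>z. (norm (cone_field e \<beta> (\<epsilon> / 4) l z))\<^sup>2 \<partial>lborel) \<le> C1 * (C2 / ?\<kappa>)"
          using cone_field_L2(2)[OF a(1) l(1) cones(1,2) K d, of e] mult_left_mono[OF SK C1] unfolding C1_def by linarith
        show "0 \<le> 2 * vol * en" using en0 by simp
      qed
      finally show ?thesis .
    qed
    define m where "m = (\<integral>x. f x \<partial>\<mu>)"
    note wb = cone_weight_bounds[OF l(1) cones(1,2), of e]
    have wM: "x \<in> M" if "w x \<noteq> 0" for x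
    proof -
      have "x - y \<in> cone_support e \<beta> (\<epsilon> / 4) l" using wb(3)[of "x - y"] that a l(1)
        by (simp add: w_def cone_support_def)
      then have "x \<in> interior M" using cone_support_interior[OF cone a(1) cones(1) l(2)]
        by (metis add.commute diff_add_cancel image_subset_iff)
      then show ?thesis using interior_subset by blast
    qed
    have wbd: "0 \<le> w x" "w x \<le> bw * indicator (ball y (4 * l)) x" for x
      using wb(1,2)[of "x - y"] by (auto simp: w_def bw_def indicator_def dist_norm norm_minus_commute)
    have ball: "integrable lborel (\<lambda>x. c * indicator (ball y (4 * l)) x :: real)" for c
      by (intro integrable_mult_right integrable_real_indicator emeasure_bounded_finite) auto
    have Iw: "integrable lborel w"
      by (rule Bochner_Integration.integrable_bound[OF ball[of bw]]) (use wbd in \<open>auto intro: order_trans[OF _ abs_ge_self]\<close>)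
    have w2le: "(w x)\<^sup>2 \<le> bw\<^sup>2 * indicator (ball y (4 * l)) x" for x
    proof -
      have "(w x)\<^sup>2 \<le> (bw * indicator (ball y (4 * l)) x)\<^sup>2" using wbd by (intro power_mono) auto
      then show ?thesis by (auto simp: indicator_def)
    qed
    have Iw2: "integrable lborel (\<lambda>x. (w x)\<^sup>2)"
      by (rule Bochner_Integration.integrable_bound[OF ball[of "bw\<^sup>2"]]) (use w2le in \<open>auto intro: order_trans[OF _ abs_ge_self]\<close>)
    have w2: "(\<integral>x. (w x)\<^sup>2 \<partial>lborel) \<le> Cw"
    proof -
      have "(\<integral>x. (w x)\<^sup>2 \<partial>lborel) \<le> (\<integral>x. bw\<^sup>2 * indicator (ball y (4 * l)) x \<partial>lborel)"
        by (intro integral_mono Iw2 ball w2le)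
      also have "\<dots> = Cw" using l by (simp add: Cw_def content_ball)
      finally show ?thesis .
    qed
    have mass: "cw \<le> (\<integral>x. w x \<partial>lborel)"
      using cone_weight_mass[OF l(1) cones(1,2) e] integral_lborel_translation[of "cone_weight e \<beta> l" y]
      by (simp add: cw_def w_def[abs_def])
    define h where "h x = indicator M x * (f x - m)" for x
    have [measurable]: "h \<in> borel_measurable borel" unfolding h_def[abs_def] by measurable
    have fm: "\<bar>f x - m\<bar> \<le> B + \<bar>m\<bar>" for x using f(2)[of x] by linarith
    have fm2: "integrable \<mu> (\<lambda>x. (f x - m)\<^sup>2)"
      using L2_bounded[of "\<lambda>x. f x - m", OF _ fm] by (simp add: L2_def)
    have h2eq: "(\<lambda>x. (h x)\<^sup>2) = (\<lambda>x. indicator M x * (f x - m)\<^sup>2)" by (auto simp: h_def indicator_def)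
    have Ih2: "integrable lborel (\<lambda>x. (h x)\<^sup>2)" unfolding h2eq using fm2 by (subst (asm) integrable_\<mu>) auto
    define D where "D = L2_inner M (\<lambda>x. f x - m) (\<lambda>x. f x - m)"
    have D: "D \<le> CP * en" using poincare(1) f unfolding has_poincare_def D_def m_def en_def by blast
    have h2: "(\<integral>x. (h x)\<^sup>2 \<partial>lborel) = vol * D"
      unfolding h2eq D_def L2_inner_def power2_eq_square[symmetric] using positive_volume by (subst integral_\<mu>) auto
    have Ihw: "integrable lborel (\<lambda>x. h x * w x)" by (rule integrable_mult_L2[OF _ _ Ih2 Iw2]) measurable
    have "m * (\<integral>x. w x \<partial>lborel) = W - (\<integral>x. h x * w x \<partial>lborel)"
    proof -
      have "(\<lambda>x. f x * w x) = (\<lambda>x. m * w x + h x * w x)"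
        using wM by (auto simp: h_def fun_eq_iff algebra_simps indicator_def)
      then have "W = (\<integral>x. m * w x + h x * w x \<partial>lborel)" by (simp add: W_def)
      also have "\<dots> = m * (\<integral>x. w x \<partial>lborel) + (\<integral>x. h x * w x \<partial>lborel)" using Iw Ihw by simp
      finally show ?thesis by simp
    qed
    then have "(m * (\<integral>x. w x \<partial>lborel))\<^sup>2 \<le> 2 * W\<^sup>2 + 2 * (\<integral>x. h x * w x \<partial>lborel)\<^sup>2"
      using zero_le_power2[of "W + (\<integral>x. h x * w x \<partial>lborel)"] by (simp add: power2_diff power2_sum)
    moreover have "(\<integral>x. h x * w x \<partial>lborel)\<^sup>2 \<le> vol * (CP * en) * Cw"
    proof -
      have "(\<integral>x. h x * w x \<partial>lborel)\<^sup>2 \<le> vol * D * (\<integral>x. (w x)\<^sup>2 \<partial>lborel)"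
        using Cauchy_Schwarz_integral[OF _ _ Ih2 Iw2] h2 by simp
      also have "\<dots> \<le> vol * (CP * en) * Cw"
        using w2 D en0 poincare(2) by (intro mult_mono mult_left_mono) auto
      finally show ?thesis .
    qed
    moreover have "(m * cw)\<^sup>2 \<le> (m * (\<integral>x. w x \<partial>lborel))\<^sup>2"
      unfolding power_mult_distrib using mass cw by (intro mult_left_mono power_mono) auto
    ultimately have "m\<^sup>2 * cw\<^sup>2 \<le> 2 * (2 * vol * en * (C1 * (C2 / ?\<kappa>))) + 2 * (vol * (CP * en) * Cw)"
      using W unfolding power_mult_distrib by linarith
    also have "2 * (vol * (CP * en) * Cw) \<le> 2 * (vol * (CP * en) * Cw) / ?\<kappa>"
      using \<kappa> en0 poincare(2) Cw by (simp add: le_divide_eq mult_left_le)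
    finally have "m\<^sup>2 * cw\<^sup>2 \<le> (4 * vol * C1 * C2 + 2 * vol * CP * Cw) * en / ?\<kappa>"
      by (simp add: algebra_simps add_divide_distrib)
    then have "m\<^sup>2 \<le> (4 * vol * C1 * C2 + 2 * vol * CP * Cw) * en / ?\<kappa> / cw\<^sup>2"
      using cw by (subst pos_le_divide_eq) simp_all
    also have "\<dots> = (4 * vol * C1 * C2 + 2 * vol * CP * Cw) / cw\<^sup>2 * en / ?\<kappa>"
      by (simp only: times_divide_eq_left divide_divide_eq_left mult.commute[of "cw\<^sup>2" ?\<kappa>])
    finally have m2: "m\<^sup>2 \<le> (4 * vol * C1 * C2 + 2 * vol * CP * Cw) / cw\<^sup>2 * en / ?\<kappa>" .
    have "L2_inner M f f = D + m\<^sup>2"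
    proof -
      have If: "integrable \<mu> f" by (rule integrable_\<mu>_bounded[OF _ f(2)]) simp
      have "L2_inner M f f = (\<integral>x. (f x - m)\<^sup>2 + 2 * m * (f x - m) + m\<^sup>2 \<partial>\<mu>)"
        unfolding L2_inner_def by (rule Bochner_Integration.integral_cong) (auto simp: power2_eq_square algebra_simps)
      also have "\<dots> = (\<integral>x. (f x - m)\<^sup>2 \<partial>\<mu>) + 2 * m * (\<integral>x. f x - m \<partial>\<mu>) + m\<^sup>2"
        using fm2 If by (simp add: \<mu>.prob_space)
      also have "(\<integral>x. f x - m \<partial>\<mu>) = 0" using If by (simp add: m_def \<mu>.prob_space)
      finally show ?thesis by (simp add: D_def L2_inner_def power2_eq_square)
    qed
    also have "\<dots> \<le> CP * en / ?\<kappa> + (4 * vol * C1 * C2 + 2 * vol * CP * Cw) / cw\<^sup>2 * en / ?\<kappa>"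
    proof (intro add_mono m2)
      have "CP * en \<le> CP * en / ?\<kappa>" using \<kappa> en0 poincare(2) by (simp add: le_divide_eq mult_left_le)
      then show "D \<le> CP * en / ?\<kappa>" using D by linarith
    qed
    also have "\<dots> = Q * en / ?\<kappa>" by (simp add: Q_def distrib_right add_divide_distrib)
    finally have "L2_inner M f f * ?\<kappa> \<le> Q * en" using \<kappa> by (simp add: le_divide_eq)
    then have "1 / Q * (L2_inner M f f * ?\<kappa>) \<le> 1 / Q * (Q * en)" using Q by (intro mult_left_mono) auto
    then show ?thesis using Q by (simp add: en_def mult_ac)
  qed
  have "0 < \<epsilon>0" using C2 l by (simp add: \<epsilon>0_def)
  moreover have "0 < 1 / Q" using Q by simp
  ultimately show ?thesis using main by (intro exI[of _ "1 / Q"] exI[of _ \<epsilon>0]) blast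
qed

end

section \<open>Reflected Brownian motion and its semigroup\<close>

lemma space_natural_filtration [simp]: "space (natural_filtration Om X t) = space Om"
  by (simp add: natural_filtration_def space_measure_of_conv)

lemma space_right_filtration [simp]: "space (right_filtration Om X t) = space Om"
  by (simp add: right_filtration_def space_measure_of_conv)

lemma sets_natural_filtration:
  "sets (natural_filtration Om X t) =
     sigma_sets (space Om) {X s -` B \<inter> space Om | s B. 0 \<le> s \<and> s \<le> t \<and> B \<in> sets borel}"
  unfolding natural_filtration_def by (rule sets_measure_of) auto

lemma sets_right_filtration:
  "sets (right_filtration Om X t) = sigma_sets (space Om) (\<Inter>u\<in>{t<..}. sets (natural_filtration Om X u))"
proof -
  have "(\<Inter>u\<in>{t<..}. sets (natural_filtration Om X u)) \<subseteq> sets (natural_filtration Om X (t + 1))" by auto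
  also have "\<dots> \<subseteq> Pow (space Om)" using sets.space_closed[of "natural_filtration Om X (t + 1)"] by simp
  finally show ?thesis unfolding right_filtration_def by (rule sets_measure_of)
qed

lemma filtration_right_filtration: "filtration (space Om) (right_filtration Om X)"
proof
  fix i j :: real assume "i \<le> j"
  then have "{j<..} \<subseteq> {i<..}" by auto
  then show "sets (right_filtration Om X i) \<subseteq> sets (right_filtration Om X j)"
    unfolding sets_right_filtration by (intro sigma_sets_mono' INF_superset_mono order_refl)
qed simp

text \<open>Events of the past belong to every later natural \<open>\<sigma>\<close>-algebra, hence to the
  right limit.\<close>

lemma vimage_in_right_filtration:
  assumes "0 \<le> s" "s \<le> t" "B \<in> sets borel"
  shows "{\<omega>\<in>space Om. X s \<omega> \<in> B} \<in> sets (right_filtration Om X t)"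
proof -
  have "{\<omega>\<in>space Om. X s \<omega> \<in> B} \<in> sets (natural_filtration Om X u)" if "t < u" for u
    unfolding sets_natural_filtration using assms that
    by (intro sigma_sets.Basic) (force simp: vimage_def)
  then show ?thesis unfolding sets_right_filtration by (intro sigma_sets.Basic) auto
qed

lemma sets_right_filtration_le:
  assumes "\<And>s. 0 \<le> s \<Longrightarrow> X s \<in> borel_measurable Om" shows "sets (right_filtration Om X t) \<subseteq> sets Om"
proof -
  have n: "sets (natural_filtration Om X u) \<subseteq> sets Om" for u
    unfolding sets_natural_filtration using assms by (intro sets.sigma_sets_subset) (auto intro: measurable_sets)
  have "(\<Inter>u\<in>{t<..}. sets (natural_filtration Om X u)) \<subseteq> sets (natural_filtration Om X (t + 1))" by auto
  then show ?thesis unfolding sets_right_filtration using n[of "t + 1"] by (intro sets.sigma_sets_subset) (rule order_trans)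
qed

text \<open>Deterministic times are stopping times, so that the strong Markov property contains the simple
  one.\<close>

lemma const_pre_sigma:
  assumes "A \<in> sets (right_filtration Om X t)"
  shows "A \<in> sets (filtration.pre_sigma (space Om) (right_filtration Om X) (\<lambda>_. t))"
proof -
  interpret filtration "space Om" "right_filtration Om X" by (rule filtration_right_filtration)
  have "{\<omega>\<in>A. t \<le> u} \<in> sets (right_filtration Om X u)" for u
    using sets_F_mono[of t u] assms by (cases "t \<le> u") auto
  then show ?thesis by (intro sets_pre_sigmaI stopping_time_const)
qed

definition bounded_borel :: "('a::topological_space \<Rightarrow> real) \<Rightarrow> bool" where
  "bounded_borel f \<longleftrightarrow> f \<in> borel_measurable borel \<and> (\<exists>B. \<forall>x. \<bar>f x\<bar> \<le> B)"

lemma bounded_borelI: "f \<in> borel_measurable borel \<Longrightarrow> (\<And>x. \<bar>f x\<bar> \<le> B) \<Longrightarrow> bounded_borel f"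
  by (auto simp: bounded_borel_def)

lemma bounded_borel_measurable [measurable_dest]: "bounded_borel f \<Longrightarrow> f \<in> borel_measurable borel"
  by (simp add: bounded_borel_def)

lemma bounded_borel_const [simp]: "bounded_borel (\<lambda>_. c)"
  by (rule bounded_borelI[of _ "\<bar>c\<bar>"]) auto

lemma bounded_borel_add: "bounded_borel f \<Longrightarrow> bounded_borel g \<Longrightarrow> bounded_borel (\<lambda>x. f x + g x)"
proof -
  assume "bounded_borel f" "bounded_borel g"
  then obtain B C where *: "f \<in> borel_measurable borel" "g \<in> borel_measurable borel"
    "\<And>x. \<bar>f x\<bar> \<le> B" "\<And>x. \<bar>g x\<bar> \<le> C" by (auto simp: bounded_borel_def)
  have "\<bar>f x + g x\<bar> \<le> B + C" for x using *(3,4)[of x] by linarith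
  then show ?thesis using * by (intro bounded_borelI[of _ "B + C"]) auto
qed

lemma bounded_borel_mult: "bounded_borel f \<Longrightarrow> bounded_borel g \<Longrightarrow> bounded_borel (\<lambda>x. f x * g x)"
proof -
  assume "bounded_borel f" "bounded_borel g"
  then obtain B C where *: "f \<in> borel_measurable borel" "g \<in> borel_measurable borel"
    "\<And>x. \<bar>f x\<bar> \<le> B" "\<And>x. \<bar>g x\<bar> \<le> C" by (auto simp: bounded_borel_def)
  have "\<bar>f x * g x\<bar> \<le> B * C" for x using *(3,4)[of x] unfolding abs_mult by (intro mult_mono) auto
  then show ?thesis using * by (intro bounded_borelI[of _ "B * C"]) auto
qed

lemma bounded_borel_diff: "bounded_borel f \<Longrightarrow> bounded_borel g \<Longrightarrow> bounded_borel (\<lambda>x. f x - g x)"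
  using bounded_borel_add[of f "\<lambda>x. (-1) * g x"] bounded_borel_mult[of "\<lambda>_. -1" g] by simp

lemma bounded_borel_indicator: "A \<in> sets borel \<Longrightarrow> bounded_borel (indicator A)"
  by (rule bounded_borelI[of _ 1]) (auto simp: indicator_def)

lemma bounded_borel_range: "bounded_borel f \<Longrightarrow> bounded (range f)"
  by (auto simp: bounded_borel_def bounded_iff)

text \<open>The processes are kept general here, since the results are used both for an arbitrary
  realization and for the canonical process on path space.\<close>

locale rbm = compact_body M for M :: "'a::euclidean_space set" +
  fixes Om :: "'w measure" and X :: "real \<Rightarrow> 'w \<Rightarrow> 'a" and P :: "'a \<Rightarrow> 'w measure"
  assumes RBM: "reflected_brownian_motion M Om X P"
begin

lemma hunt_process: "continuous_hunt_process M Om X P" and process_symmetric: "symmetric_process M X P"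
  and form_associated: "associated_with_neumann_form M X P"
  using RBM by (auto simp: reflected_brownian_motion_def)

lemma X_meas: "0 \<le> t \<Longrightarrow> X t \<in> borel_measurable Om"
  using hunt_process by (simp add: continuous_hunt_process_def)

lemma X_in_M: "0 \<le> t \<Longrightarrow> \<omega> \<in> space Om \<Longrightarrow> X t \<omega> \<in> M"
  using hunt_process by (simp add: continuous_hunt_process_def)

lemma P_prob: "z \<in> M \<Longrightarrow> prob_space (P z)" and P_sets: "z \<in> M \<Longrightarrow> sets (P z) = sets Om"
  and P_start: "z \<in> M \<Longrightarrow> AE \<omega> in P z. X 0 \<omega> = z"
  using hunt_process by (auto simp: continuous_hunt_process_def)

lemma P_space: "z \<in> M \<Longrightarrow> space (P z) = space Om"
  using P_sets by (rule sets_eq_imp_space_eq)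

lemma X_measP: "z \<in> M \<Longrightarrow> 0 \<le> t \<Longrightarrow> X t \<in> borel_measurable (P z)"
  using X_meas[of t] measurable_cong_sets[OF P_sets[of z] refl, of "borel :: 'a measure"] by simp

abbreviation "S \<equiv> semigroup M X P"

definition kernel :: "real \<Rightarrow> 'a \<Rightarrow> 'a measure" where
  "kernel t x = distr (P x) borel (X t)"

lemma kernel_prob: "x \<in> M \<Longrightarrow> 0 \<le> t \<Longrightarrow> prob_space (kernel t x)"
  unfolding kernel_def by (rule prob_space.prob_space_distr[OF P_prob X_measP])

lemma kernel_sets [simp, measurable_cong]: "sets (kernel t x) = sets borel"
  by (simp add: kernel_def)

lemma kernel_space [simp]: "space (kernel t x) = UNIV"
  by (simp add: kernel_def)

lemma kernel_measure:
  assumes "x \<in> M" "0 \<le> t" "B \<in> sets borel"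
  shows "measure (kernel t x) B = measure (P x) {\<omega>\<in>space Om. X t \<omega> \<in> B}"
  unfolding kernel_def using assms X_measP P_space
  by (subst measure_distr) (auto intro!: arg_cong[of _ _ "measure (P x)"])

text \<open>Measurability of transition probabilities is only known on \<open>M\<close>, whence the
  restricted space.\<close>

lemma kernel_measurable: "0 \<le> t \<Longrightarrow> kernel t \<in> restrict_space borel M \<rightarrow>\<^sub>M subprob_algebra borel"
proof (rule measurable_subprob_algebra)
  assume t: "0 \<le> t"
  show "subprob_space (kernel t a)" if "a \<in> space (restrict_space borel M)" for a
    using kernel_prob[OF _ t, of a] that by (auto simp: space_restrict_space intro: prob_space_imp_subprob_space)
  show "sets (kernel t a) = sets borel" for a by simp
  fix B :: "'a set" assume B: "B \<in> sets borel"
  have "(\<lambda>a. ennreal (measure (P a) {\<omega>\<in>space Om. X t \<omega> \<in> B})) \<in> borel_measurable (restrict_space borel M)"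
    using hunt_process t B by (simp add: continuous_hunt_process_def)
  then show "(\<lambda>a. emeasure (kernel t a) B) \<in> borel_measurable (restrict_space borel M)"
  proof (rule measurable_cong[THEN iffD1, rotated])
    fix a assume "a \<in> space (restrict_space borel M)"
    then have a: "a \<in> M" by (simp add: space_restrict_space)
    interpret prob_space "kernel t a" by (rule kernel_prob[OF a t])
    show "ennreal (measure (P a) {\<omega>\<in>space Om. X t \<omega> \<in> B}) = emeasure (kernel t a) B"
      using kernel_measure[OF a t B] by (simp add: emeasure_eq_measure)
  qed
qed

lemma S_kernel: "f \<in> borel_measurable borel \<Longrightarrow> x \<in> M \<Longrightarrow> 0 \<le> t \<Longrightarrow> S t f x = (\<integral>y. f y \<partial>kernel t x)"
  unfolding semigroup_def kernel_def using X_measP by (subst integral_distr) auto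

lemma S_outside: "x \<notin> M \<Longrightarrow> S t f x = 0"
  by (simp add: semigroup_def)

lemma S_measurable:
  assumes f: "f \<in> borel_measurable borel" and t: "0 \<le> t" shows "S t f \<in> borel_measurable borel"
proof -
  have "(\<lambda>x. \<integral>y. f y \<partial>kernel t x) \<in> borel_measurable (restrict_space borel M)"
    by (rule measurable_compose[OF kernel_measurable[OF t] integral_measurable_subprob_algebra[OF f]])
  then have "(\<lambda>x. indicator M x *\<^sub>R (\<integral>y. f y \<partial>kernel t x)) \<in> borel_measurable borel"
    by (subst (asm) borel_measurable_restrict_space_iff) auto
  moreover have "(\<lambda>x. indicator M x *\<^sub>R (\<integral>y. f y \<partial>kernel t x)) = S t f"
    using S_kernel[OF f _ t] S_outside by (auto simp: fun_eq_iff indicator_def)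
  ultimately show ?thesis by simp
qed

lemma integrable_kernel: "bounded_borel f \<Longrightarrow> x \<in> M \<Longrightarrow> 0 \<le> t \<Longrightarrow> integrable (kernel t x) f"
proof -
  assume f: "bounded_borel f" and x: "x \<in> M" "0 \<le> t"
  interpret prob_space "kernel t x" by (rule kernel_prob[OF x])
  obtain B where "f \<in> borel_measurable borel" "\<And>x. \<bar>f x\<bar> \<le> B" using f by (auto simp: bounded_borel_def)
  then show ?thesis by (intro integrable_const_bound[of _ B]) auto
qed

lemma S_bounded:
  assumes "\<And>x. \<bar>f x\<bar> \<le> B" "f \<in> borel_measurable borel" "0 \<le> t" shows "\<bar>S t f x\<bar> \<le> B"
proof (cases "x \<in> M")
  case True
  interpret prob_space "kernel t x" by (rule kernel_prob[OF True assms(3)])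
  have I: "integrable (kernel t x) f" using integrable_kernel[OF bounded_borelI[OF assms(2,1)] True assms(3)] .
  have "f y \<le> B \<and> - B \<le> f y" for y using assms(1)[of y] by linarith
  then have "(\<integral>y. f y \<partial>kernel t x) \<le> B" "- B \<le> (\<integral>y. f y \<partial>kernel t x)"
    using integral_le_const[OF I, of B] integral_ge_const[OF I, of "- B"] by auto
  then show ?thesis using S_kernel[OF assms(2) True assms(3)] by linarith
next
  case False
  then show ?thesis using assms(1)[of x] S_outside by simp
qed

lemma S_bounded_borel: "bounded_borel f \<Longrightarrow> 0 \<le> t \<Longrightarrow> bounded_borel (S t f)"
proof -
  assume "bounded_borel f" and t: "0 \<le> t"
  then obtain B where f: "f \<in> borel_measurable borel" "\<And>x. \<bar>f x\<bar> \<le> B" by (auto simp: bounded_borel_def)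
  show ?thesis by (rule bounded_borelI[OF S_measurable[OF f(1) t] S_bounded[OF f(2,1) t]])
qed

lemma S_add: "bounded_borel f \<Longrightarrow> bounded_borel g \<Longrightarrow> 0 \<le> t \<Longrightarrow> S t (\<lambda>x. f x + g x) y = S t f y + S t g y"
  using integrable_kernel[of f y t] integrable_kernel[of g y t]
  by (cases "y \<in> M") (auto simp: S_outside S_kernel bounded_borel_measurable)

lemma S_cmult: "bounded_borel f \<Longrightarrow> 0 \<le> t \<Longrightarrow> S t (\<lambda>x. c * f x) y = c * S t f y"
  by (cases "y \<in> M") (auto simp: S_outside S_kernel bounded_borel_measurable)

lemma S_mono:
  assumes "bounded_borel f" "bounded_borel g" "0 \<le> t" "\<And>x. x \<in> M \<Longrightarrow> f x \<le> g x" shows "S t f y \<le> S t g y"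
proof (cases "y \<in> M")
  case True
  have Y: "X t \<in> borel_measurable (P y)" using X_measP True assms by blast
  interpret prob_space "P y" by (rule P_prob[OF True])
  have I: "integrable (P y) (\<lambda>\<omega>. h (X t \<omega>))" if h: "bounded_borel h" for h
  proof -
    obtain B where "h \<in> borel_measurable borel" "\<And>x. \<bar>h x\<bar> \<le> B" using h by (auto simp: bounded_borel_def)
    then show ?thesis using Y by (intro integrable_const_bound[of _ B]) auto
  qed
  show ?thesis using True I assms X_in_M P_space unfolding semigroup_def by (auto intro!: integral_mono)
next
  case False then show ?thesis by (simp add: S_outside)
qed

lemma S_const: "0 \<le> t \<Longrightarrow> S t (\<lambda>_. c) x = (if x \<in> M then c else 0)"
  using prob_space.prob_space[OF P_prob, of x] by (auto simp: semigroup_def)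

lemma S_0: "f \<in> borel_measurable borel \<Longrightarrow> x \<in> M \<Longrightarrow> S 0 f x = f x"
proof -
  assume f: "f \<in> borel_measurable borel" and x: "x \<in> M"
  interpret prob_space "P x" by (rule P_prob[OF x])
  have "(\<integral>\<omega>. f (X 0 \<omega>) \<partial>P x) = (\<integral>\<omega>. f x \<partial>P x)"
    using P_start[OF x] f X_measP[OF x, of 0] by (intro integral_cong_AE) (auto elim: eventually_mono)
  then show ?thesis using x by (simp add: semigroup_def prob_space)
qed

lemma markov_sets:
  assumes z: "z \<in> M" and t: "0 \<le> t" "0 \<le> s" and A: "A \<in> sets (right_filtration Om X t)" and B: "B \<in> sets borel"
  shows "measure (P z) {\<omega>\<in>A. X (t + s) \<omega> \<in> B} = (\<integral>\<omega>. indicator A \<omega> * measure (kernel s (X t \<omega>)) B \<partial>P z)"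
proof -
  have "strong_markov M Om X P" using hunt_process by (simp add: continuous_hunt_process_def)
  from this[unfolded strong_markov_def, rule_format, of z "\<lambda>_. t" A s B] z t A B const_pre_sigma[OF A]
  have "measure (P z) {\<omega>\<in>A. X (t + s) \<omega> \<in> B} =
      (\<integral>\<omega>. indicator A \<omega> * measure (P (X t \<omega>)) {\<omega>'\<in>space Om. X s \<omega>' \<in> B} \<partial>P z)"
    by (simp add: stopping_time_const)
  also have "\<dots> = (\<integral>\<omega>. indicator A \<omega> * measure (kernel s (X t \<omega>)) B \<partial>P z)"
    using kernel_measure[OF X_in_M[OF t(1)] t(2) B] P_space[OF z] by (intro Bochner_Integration.integral_cong) auto
  finally show ?thesis .
qed

text \<open>From sets to functions: both sides integrate \<open>g\<close> with respect to a finite measure,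
  the law of \<open>X (t + s)\<close> on \<open>A\<close> and the mixture of the kernels over
  \<open>A\<close>, and the Markov property for sets says that the two measures agree.\<close>

lemma markov:
  assumes z: "z \<in> M" and t: "0 \<le> t" "0 \<le> s" and A: "A \<in> sets (right_filtration Om X t)" and g: "bounded_borel g"
  shows "(\<integral>\<omega>. indicator A \<omega> * g (X (t + s) \<omega>) \<partial>P z) = (\<integral>\<omega>. indicator A \<omega> * S s g (X t \<omega>) \<partial>P z)"
proof -
  interpret prob_space "P z" by (rule P_prob[OF z])
  have A': "A \<in> sets (P z)" using A sets_right_filtration_le[of X Om t] X_meas P_sets[OF z] by auto
  have Xt: "X t \<in> P z \<rightarrow>\<^sub>M restrict_space borel M"
    using X_measP[OF z t(1)] X_in_M[OF t(1)] P_space[OF z] by (intro measurable_restrict_space2) auto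
  have Xts [measurable]: "X (t + s) \<in> borel_measurable (P z)" using X_measP[OF z] t by simp
  have Kt: "(\<lambda>\<omega>. kernel s (X t \<omega>)) \<in> P z \<rightarrow>\<^sub>M subprob_algebra borel"
    by (rule measurable_compose[OF Xt kernel_measurable[OF t(2)]])
  (* The law of X (t + s) on A, and what the Markov property says it is. *)
  define N1 where "N1 = distr (density (P z) (indicator A)) borel (X (t + s))"
  define N2 where "N2 = bind (density (P z) (indicator A)) (\<lambda>\<omega>. kernel s (X t \<omega>))"
  have dsp: "space (density (P z) (indicator A)) \<noteq> {}" using not_empty by simp
  have Kd: "(\<lambda>\<omega>. kernel s (X t \<omega>)) \<in> density (P z) (indicator A) \<rightarrow>\<^sub>M subprob_algebra borel"
    using Kt by simp
  have "N1 = N2"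
  proof (rule measure_eqI)
    show "sets N1 = sets N2" unfolding N1_def N2_def using sets_bind_measurable[OF Kd dsp] by simp
    fix B assume "B \<in> sets N1"
    then have B [measurable]: "B \<in> sets borel" by (simp add: N1_def)
    have em: "(\<lambda>\<omega>. emeasure (kernel s (X t \<omega>)) B) \<in> borel_measurable (P z)"
      using measurable_compose[OF Kt measurable_emeasure_subprob_algebra[OF B]] .
    then have m: "(\<lambda>\<omega>. measure (kernel s (X t \<omega>)) B) \<in> borel_measurable (P z)"
      unfolding measure_def by measurable
    have le: "indicator A \<omega> * measure (kernel s (X t \<omega>)) B \<le> 1" if "\<omega> \<in> space (P z)" for \<omega>
      using prob_space.prob_le_1[OF kernel_prob[OF X_in_M[OF t(1)] t(2)], of \<omega> B] that P_space[OF z]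
      by (auto simp: indicator_def)
    have "emeasure N1 B = emeasure (density (P z) (indicator A)) (X (t + s) -` B \<inter> space (P z))"
      unfolding N1_def by (subst emeasure_distr) auto
    also have "\<dots> = emeasure (P z) {\<omega>\<in>A. X (t + s) \<omega> \<in> B}"
    proof -
      have s: "X (t + s) -` B \<inter> space (P z) \<in> sets (P z)" by measurable
      have "A \<inter> (X (t + s) -` B \<inter> space (P z)) = {\<omega>\<in>A. X (t + s) \<omega> \<in> B}"
        using sets.sets_into_space[OF A'] by auto
      then show ?thesis using s A' by (simp add: emeasure_density indicator_inter_arith[symmetric] nn_integral_indicator sets.Int)
    qed
    also have "\<dots> = ennreal (measure (P z) {\<omega>\<in>A. X (t + s) \<omega> \<in> B})" by (rule emeasure_eq_measure)
    also have "\<dots> = ennreal (\<integral>\<omega>. indicator A \<omega> * measure (kernel s (X t \<omega>)) B \<partial>P z)"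
      by (simp add: markov_sets[OF z t A B])
    also have "\<dots> = (\<integral>\<^sup>+\<omega>. ennreal (indicator A \<omega> * measure (kernel s (X t \<omega>)) B) \<partial>P z)"
      using m A' le by (intro nn_integral_eq_integral[symmetric] integrable_const_bound[of _ 1]) (auto intro!: AE_I2)
    also have "\<dots> = (\<integral>\<^sup>+\<omega>. indicator A \<omega> * emeasure (kernel s (X t \<omega>)) B \<partial>P z)"
    proof (rule nn_integral_cong)
      fix \<omega> assume "\<omega> \<in> space (P z)"
      then interpret K: prob_space "kernel s (X t \<omega>)" using kernel_prob[OF X_in_M[OF t(1)] t(2)] P_space[OF z] by auto
      show "ennreal (indicator A \<omega> * measure (kernel s (X t \<omega>)) B) = indicator A \<omega> * emeasure (kernel s (X t \<omega>)) B"
        by (simp add: K.emeasure_eq_measure indicator_def)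
    qed
    also have "\<dots> = (\<integral>\<^sup>+\<omega>. emeasure (kernel s (X t \<omega>)) B \<partial>density (P z) (indicator A))"
      using A' em by (subst nn_integral_density) auto
    also have "\<dots> = emeasure N2 B"
      unfolding N2_def by (rule emeasure_bind[OF dsp Kd B, symmetric])
    finally show "emeasure N1 B = emeasure N2 B" .
  qed
  obtain B where B: "\<And>x. \<bar>g x\<bar> \<le> B" and gm [measurable]: "g \<in> borel_measurable borel"
    using g by (auto simp: bounded_borel_def)
  have Smeas: "(\<lambda>\<omega>. S s g (X t \<omega>)) \<in> borel_measurable (P z)"
    by (rule measurable_compose[OF X_measP[OF z t(1)] S_measurable[OF gm t(2)]])
  have d: "density (P z) (indicator A) = density (P z) (\<lambda>x. ennreal (indicator A x))"
    by (simp add: ennreal_indicator)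
  have "(\<integral>\<omega>. indicator A \<omega> * g (X (t + s) \<omega>) \<partial>P z) = (\<integral>\<omega>. g (X (t + s) \<omega>) \<partial>density (P z) (indicator A))"
    unfolding d using A' by (subst integral_density) auto
  also have "\<dots> = (\<integral>y. g y \<partial>N1)" unfolding N1_def by (subst integral_distr) auto
  also have "\<dots> = (\<integral>y. g y \<partial>N2)" by (simp add: \<open>N1 = N2\<close>)
  also have "\<dots> = (\<integral>\<omega>. (\<integral>y. g y \<partial>kernel s (X t \<omega>)) \<partial>density (P z) (indicator A))"
    unfolding N2_def
  proof (rule integral_bind[of _ "borel" B _ _ 1])
    show "finite_measure (density (P z) (indicator A))"
    proof
      show "emeasure (density (P z) (indicator A)) (space (density (P z) (indicator A))) \<noteq> \<infinity>"
        using A' by (simp add: emeasure_density nn_integral_indicator emeasure_eq_measure indicator_inter_arith[symmetric])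
    qed
    show "AE x in density (P z) (indicator A). emeasure (kernel s (X t x)) (space (kernel s (X t x))) \<le> ennreal 1"
    proof (rule AE_I2)
      fix x assume "x \<in> space (density (P z) (indicator A))"
      then have "x \<in> space Om" by (simp add: P_space[OF z])
      from prob_space.emeasure_space_1[OF kernel_prob[OF X_in_M[OF t(1) this] t(2)]]
      show "emeasure (kernel s (X t x)) (space (kernel s (X t x))) \<le> ennreal 1" by simp
    qed
  qed (use Kd B dsp in auto)
  also have "\<dots> = (\<integral>\<omega>. S s g (X t \<omega>) \<partial>density (P z) (indicator A))"
    using S_kernel[OF gm X_in_M[OF t(1)] t(2)] P_space[OF z] by (intro Bochner_Integration.integral_cong) auto
  also have "\<dots> = (\<integral>\<omega>. indicator A \<omega> * S s g (X t \<omega>) \<partial>P z)"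
    unfolding d using A' Smeas by (subst integral_density) auto
  finally show ?thesis .
qed

lemma S_semigroup:
  assumes g: "bounded_borel g" and t: "0 \<le> t" "0 \<le> s"
  shows "S (t + s) g x = S t (S s g) x"
proof (cases "x \<in> M")
  case True
  have "space Om \<in> sets (right_filtration Om X t)" using sets.top[of "right_filtration Om X t"] by simp
  from markov[OF True t this g] have "(\<integral>\<omega>. g (X (t + s) \<omega>) \<partial>P x) = (\<integral>\<omega>. S s g (X t \<omega>) \<partial>P x)"
    by (simp add: P_space[OF True, symmetric] cong: Bochner_Integration.integral_cong)
  then show ?thesis using True by (simp add: semigroup_def[of _ _ _ "t + s"] semigroup_def[of _ _ _ t])
qed (simp add: S_outside)

end

section \<open>The Dirichlet form of the semigroup\<close>

text \<open>If the function increased somewhere by \<open>\<eta>\<close>, convexity would force it to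
  increase by at least \<open>\<eta>\<close> on each following step of the same length, against
  boundedness.\<close>

lemma midpoint_convex_antimono:
  fixes \<psi> :: "real \<Rightarrow> real"
  assumes mid: "\<And>a b. 0 \<le> a \<Longrightarrow> 0 \<le> b \<Longrightarrow> 2 * \<psi> ((a + b) / 2) \<le> \<psi> a + \<psi> b"
    and bound: "\<And>t. 0 \<le> t \<Longrightarrow> \<bar>\<psi> t\<bar> \<le> B" and ab: "0 \<le> a" "a \<le> b"
  shows "\<psi> b \<le> \<psi> a"
proof (rule ccontr)
  assume "\<not> \<psi> b \<le> \<psi> a"
  define d where "d = b - a"
  define \<eta> where "\<eta> = \<psi> b - \<psi> a"
  have \<eta>: "0 < \<eta>" using \<open>\<not> \<psi> b \<le> \<psi> a\<close> by (simp add: \<eta>_def)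
  have d: "0 \<le> d" using ab by (simp add: d_def)
  have inc: "\<eta> \<le> \<psi> (a + real (Suc n) * d) - \<psi> (a + real n * d)" for n
  proof (induction n)
    case (Suc n)
    have eq: "(a + real n * d + (a + real (Suc (Suc n)) * d)) / 2 = a + real (Suc n) * d"
      by (simp add: field_simps)
    have "2 * \<psi> (a + real (Suc n) * d) \<le> \<psi> (a + real n * d) + \<psi> (a + real (Suc (Suc n)) * d)"
      by (rule mid[of "a + real n * d" "a + real (Suc (Suc n)) * d", unfolded eq]) (use ab d in auto)
    then show ?case using Suc by linarith
  qed (simp add: \<eta>_def d_def)
  have "\<psi> a + real n * \<eta> \<le> \<psi> (a + real n * d)" for n
  proof (induction n)
    case (Suc n) then show ?case using inc[of n] by (simp add: distrib_right)
  qed simp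
  moreover obtain n where "2 * B / \<eta> < real n" using reals_Archimedean2 by blast
  then have "2 * B < real n * \<eta>" using \<eta> by (simp add: divide_less_eq)
  moreover have "\<bar>\<psi> a\<bar> \<le> B" "\<bar>\<psi> (a + real n * d)\<bar> \<le> B" using bound ab d by auto
  ultimately show False by (smt (verit))
qed

text \<open>The slopes at \<open>0\<close> of a convex function increase. No continuity is available here,
  so the comparison is made on the grid of mesh \<open>h / N\<close>, where \<open>k\<close> is
  reached up to one step by monotonicity, and then \<open>N\<close> tends to infinity.\<close>

lemma midpoint_convex_slope:
  fixes \<psi> :: "real \<Rightarrow> real"
  assumes mid: "\<And>a b. 0 \<le> a \<Longrightarrow> 0 \<le> b \<Longrightarrow> 2 * \<psi> ((a + b) / 2) \<le> \<psi> a + \<psi> b"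
    and bound: "\<And>t. 0 \<le> t \<Longrightarrow> \<bar>\<psi> t\<bar> \<le> B" and hk: "0 < h" "h \<le> k"
  shows "(\<psi> 0 - \<psi> k) / k \<le> (\<psi> 0 - \<psi> h) / h"
proof -
  define c where "c = (\<psi> 0 - \<psi> h) / h"
  have anti: "\<psi> b \<le> \<psi> a" if "0 \<le> a" "a \<le> b" for a b
    by (rule midpoint_convex_antimono[of \<psi> B]) (use mid bound that in auto)
  have c: "0 \<le> c" using anti[of 0 h] hk by (simp add: c_def)
  have "\<psi> 0 - \<psi> k \<le> (k + h / real N) * c" if N: "1 \<le> N" for N :: nat
  proof -
    define \<delta> where "\<delta> = h / real N"
    have \<delta>: "0 < \<delta>" "h = real N * \<delta>" using hk N by (auto simp: \<delta>_def)
    define u where "u n = \<psi> (real n * \<delta>)" for n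
    have conv: "u n - u (Suc n) \<ge> u (Suc n) - u (Suc (Suc n))" for n
    proof -
      have eq: "(real n * \<delta> + real (Suc (Suc n)) * \<delta>) / 2 = real (Suc n) * \<delta>" by (simp add: field_simps)
      have "2 * \<psi> (real (Suc n) * \<delta>) \<le> \<psi> (real n * \<delta>) + \<psi> (real (Suc (Suc n)) * \<delta>)"
        by (rule mid[of "real n * \<delta>" "real (Suc (Suc n)) * \<delta>", unfolded eq]) (use \<delta>(1) in auto)
      then show ?thesis unfolding u_def by linarith
    qed
    have decr: "u n - u (Suc n) \<le> u m - u (Suc m)" if "m \<le> n" for m n
      using that
    proof (induction n rule: dec_induct)
      case (step n) then show ?case using conv[of n] by linarith
    qed simp
    have tele: "u m - u (m + j) = (\<Sum>i<j. u (m + i) - u (Suc (m + i)))" for m j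
      by (induction j) auto
    have slope: "real N * (u 0 - u n) \<le> real n * (u 0 - u N)" if "N \<le> n" for n
      using that
    proof (induction n rule: dec_induct)
      case (step n)
      have "u 0 - u N \<ge> (\<Sum>i<N. u n - u (Suc n))"
        unfolding tele[of 0 N, simplified] by (intro sum_mono decr) (use step in auto)
      then have "real N * (u n - u (Suc n)) \<le> u 0 - u N" by simp
      then show ?case using step.IH by (simp add: algebra_simps)
    qed simp
    define n where "n = nat \<lfloor>k / \<delta>\<rfloor>"
    have kd: "0 \<le> k / \<delta>" using hk \<delta> by simp
    have n: "real n \<le> k / \<delta>" "k / \<delta> < real (Suc n)" using kd unfolding n_def by linarith+
    have nk: "real n * \<delta> \<le> k" "k \<le> real (Suc n) * \<delta>" using n \<delta> by (simp_all add: field_simps)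
    have "real N \<le> k / \<delta>" using hk \<delta> by (simp add: field_simps)
    then have "N \<le> Suc n" using n by linarith
    from slope[OF this] have "real N * (u 0 - u (Suc n)) \<le> real (Suc n) * (h * c)"
      using hk \<delta> by (simp add: c_def u_def)
    also have "\<dots> = real N * (real (Suc n) * \<delta> * c)" using \<delta> by simp
    finally have "u 0 - u (Suc n) \<le> real (Suc n) * \<delta> * c" using N by simp
    also have "\<dots> \<le> (k + \<delta>) * c" using nk c by (intro mult_right_mono) (auto simp: distrib_right)
    finally have "u 0 - u (Suc n) \<le> (k + \<delta>) * c" .
    moreover have "\<psi> (real (Suc n) * \<delta>) \<le> \<psi> k" by (rule anti[OF _ nk(2)]) (use hk in simp)
    ultimately show ?thesis by (simp add: u_def \<delta>_def)
  qed
  then have "\<forall>\<^sub>F N in sequentially. \<psi> 0 - \<psi> k \<le> (k + h / real N) * c"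
    by (auto simp: eventually_sequentially)
  moreover have "(\<lambda>N. (k + h / real N) * c) \<longlonglongrightarrow> (k + 0) * c"
    by (intro tendsto_intros lim_const_over_n)
  ultimately have "\<psi> 0 - \<psi> k \<le> (k + 0) * c"
    by (intro tendsto_lowerbound[of _ _ sequentially]) auto
  then show ?thesis using hk by (simp add: c_def divide_le_eq mult.commute)
qed

context compact_body
begin

lemma integrable_bounded_borel: "bounded_borel f \<Longrightarrow> integrable \<mu> f"
  unfolding bounded_borel_def using integrable_\<mu>_bounded by blast

lemma integrable_bounded_borel_mult: "bounded_borel f \<Longrightarrow> bounded_borel g \<Longrightarrow> integrable \<mu> (\<lambda>x. f x * g x)"
  by (intro integrable_bounded_borel bounded_borel_mult)

lemma L2_inner_commute: "L2_inner M f g = L2_inner M g f"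
  by (simp add: L2_inner_def mult.commute)

lemma L2_inner_diff: "bounded_borel f \<Longrightarrow> bounded_borel g \<Longrightarrow> bounded_borel h \<Longrightarrow>
    L2_inner M (\<lambda>x. f x - g x) h = L2_inner M f h - L2_inner M g h"
  by (simp add: L2_inner_def left_diff_distrib integrable_bounded_borel_mult)

lemma L2_inner_square_diff: "bounded_borel f \<Longrightarrow> bounded_borel g \<Longrightarrow>
    L2_inner M (\<lambda>x. f x - g x) (\<lambda>x. f x - g x) = L2_inner M f f - 2 * L2_inner M f g + L2_inner M g g"
  using L2_inner_diff[of f g "\<lambda>x. f x - g x"] L2_inner_diff[of f g f] L2_inner_diff[of f g g]
    L2_inner_commute[of f "\<lambda>x. f x - g x"] L2_inner_commute[of g "\<lambda>x. f x - g x"] L2_inner_commute[of g f]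
  by (simp add: bounded_borel_diff)

lemma L2_inner_nonneg: "0 \<le> L2_inner M f f"
  by (simp add: L2_inner_def)

lemma L2_inner_mono: "bounded_borel f \<Longrightarrow> bounded_borel g \<Longrightarrow> bounded_borel h \<Longrightarrow> bounded_borel k \<Longrightarrow>
   (\<And>x. x \<in> M \<Longrightarrow> f x * g x \<le> h x * k x) \<Longrightarrow> L2_inner M f g \<le> L2_inner M h k"
  unfolding L2_inner_def using AE_in_M
  by (intro integral_mono_AE integrable_bounded_borel_mult) (auto elim: eventually_mono)

lemma L2_inner_cong: "(\<And>x. x \<in> M \<Longrightarrow> f x * g x = h x * k x) \<Longrightarrow>
    bounded_borel f \<Longrightarrow> bounded_borel g \<Longrightarrow> bounded_borel h \<Longrightarrow> bounded_borel k \<Longrightarrow> L2_inner M f g = L2_inner M h k"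
  by (intro antisym L2_inner_mono) auto

lemma L2_inner_bounded:
  assumes "f \<in> borel_measurable borel" "g \<in> borel_measurable borel" "\<And>x. \<bar>f x\<bar> \<le> B" "\<And>x. \<bar>g x\<bar> \<le> C"
  shows "\<bar>L2_inner M f g\<bar> \<le> B * C"
proof -
  have b: "\<bar>f x * g x\<bar> \<le> B * C" for x unfolding abs_mult using assms(3,4)[of x] by (intro mult_mono) auto
  then have *: "f x * g x \<le> B * C" "- (B * C) \<le> f x * g x" for x using abs_le_iff[of "f x * g x" "B * C"] by auto
  have I: "integrable \<mu> (\<lambda>x. f x * g x)" using assms b by (intro integrable_\<mu>_bounded) auto
  show ?thesis unfolding L2_inner_def
    using \<mu>.integral_le_const[OF I, of "B * C"] \<mu>.integral_ge_const[OF I, of "- (B * C)"] * by auto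
qed

end

context rbm
begin

lemma S_symmetric:
  assumes "bounded_borel f" "bounded_borel g" "0 \<le> t"
  shows "L2_inner M f (S t g) = L2_inner M (S t f) g"
proof (cases "t = 0")
  case True
  show ?thesis unfolding True
    by (rule L2_inner_cong) (use assms S_0 in \<open>auto intro: S_bounded_borel simp: bounded_borel_measurable\<close>)
next
  case False
  then show ?thesis using process_symmetric[unfolded symmetric_process_def, rule_format, of t f g] assms
    by (simp add: bounded_borel_range bounded_borel_measurable)
qed

text \<open>Symmetry and the semigroup property turn \<open>\<langle>S\<^sub>t f, f\<rangle>\<close> into
  \<open>\<parallel>S\<^sub>t\<^sub>/\<^sub>2 f\<parallel>\<^sup>2\<close>. This replaces the
  spectral theorem in what follows.\<close>

lemma S_inner_split:
  assumes f: "bounded_borel f" and t: "0 \<le> a" "0 \<le> b"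
  shows "L2_inner M (S (a + b) f) f = L2_inner M (S a f) (S b f)"
proof -
  have "S (a + b) f = S a (S b f)" using S_semigroup[OF f t] by auto
  then show ?thesis
    using S_symmetric[OF f S_bounded_borel[OF f t(2)] t(1)] by (simp add: L2_inner_commute)
qed

lemma approx_form_eq:
  assumes f: "bounded_borel f" and t: "0 \<le> t"
  shows "approx_form M X P t f f = (L2_inner M (S 0 f) f - L2_inner M (S t f) f) / t"
proof -
  have "L2_inner M (S 0 f) f = L2_inner M f f"
    by (rule L2_inner_cong) (use f S_0 in \<open>auto intro: S_bounded_borel simp: bounded_borel_measurable\<close>)
  then show ?thesis using f t by (simp add: approx_form_def L2_inner_diff S_bounded_borel)
qed

text \<open>Expand \<open>0 \<le> \<parallel>S\<^sub>a\<^sub>/\<^sub>2 f - S\<^sub>b\<^sub>/\<^sub>2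
  f\<parallel>\<^sup>2\<close>.\<close>

lemma S_inner_midpoint_convex:
  assumes f: "bounded_borel f" and t: "0 \<le> a" "0 \<le> b"
  shows "2 * L2_inner M (S ((a + b) / 2) f) f \<le> L2_inner M (S a f) f + L2_inner M (S b f) f"
proof -
  have b: "bounded_borel (S (a / 2) f)" "bounded_borel (S (b / 2) f)" using f t by (auto intro: S_bounded_borel)
  have "0 \<le> L2_inner M (\<lambda>x. S (a / 2) f x - S (b / 2) f x) (\<lambda>x. S (a / 2) f x - S (b / 2) f x)"
    by (rule L2_inner_nonneg)
  also have "\<dots> = L2_inner M (S (a / 2 + a / 2) f) f - 2 * L2_inner M (S (a / 2 + b / 2) f) f + L2_inner M (S (b / 2 + b / 2) f) f"
    unfolding L2_inner_square_diff[OF b] using f t by (simp only: S_inner_split divide_nonneg_nonneg zero_le_numeral)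
  finally show ?thesis by (simp add: add_divide_distrib)
qed

lemma S_inner_bound:
  assumes f: "f \<in> borel_measurable borel" "\<And>x. \<bar>f x\<bar> \<le> B" and t: "0 \<le> t"
  shows "\<bar>L2_inner M (S t f) f\<bar> \<le> B * B"
  by (intro L2_inner_bounded S_measurable f t S_bounded)

lemma S_inner_antimono:
  assumes f: "bounded_borel f" and t: "0 \<le> a" "a \<le> b"
  shows "L2_inner M (S b f) f \<le> L2_inner M (S a f) f"
proof -
  obtain B where B: "f \<in> borel_measurable borel" "\<And>x. \<bar>f x\<bar> \<le> B" using f by (auto simp: bounded_borel_def)
  show ?thesis
    by (rule midpoint_convex_antimono[of "\<lambda>t. L2_inner M (S t f) f" "B * B"])
      (use S_inner_midpoint_convex[OF f] S_inner_bound[OF B] t in auto)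
qed

text \<open>The approximating form is minus the slope at \<open>0\<close> of the convex function \<open>t
  \<mapsto> \<langle>S\<^sub>t f, f\<rangle>\<close>.\<close>

lemma approx_form_antimono:
  assumes f: "bounded_borel f" and t: "0 < h" "h \<le> k"
  shows "approx_form M X P k f f \<le> approx_form M X P h f f"
proof -
  obtain B where B: "f \<in> borel_measurable borel" "\<And>x. \<bar>f x\<bar> \<le> B" using f by (auto simp: bounded_borel_def)
  have "(L2_inner M (S 0 f) f - L2_inner M (S k f) f) / k \<le> (L2_inner M (S 0 f) f - L2_inner M (S h f) f) / h"
    by (rule midpoint_convex_slope[of "\<lambda>t. L2_inner M (S t f) f" "B * B"])
      (use S_inner_midpoint_convex[OF f] S_inner_bound[OF B] t in auto)
  then show ?thesis using t by (simp add: approx_form_eq[OF f])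
qed

lemma approx_form_le_energy:
  assumes f: "bounded_borel f" "f \<in> H1 M" and t: "0 < t"
  shows "approx_form M X P t f f \<le> energy M f f"
proof (rule tendsto_lowerbound)
  show "((\<lambda>t. approx_form M X P t f f) \<longlongrightarrow> energy M f f) (at_right 0)"
    using form_associated f(2) unfolding associated_with_neumann_form_def by blast
  show "\<forall>\<^sub>F h in at_right 0. approx_form M X P t f f \<le> approx_form M X P h f f"
    unfolding eventually_at_right_field using t approx_form_antimono[OF f(1)] by (intro exI[of _ t]) auto
qed simp

text \<open>Approximating forms increase as the time decreases, so a bound makes them converge; by the
  association with the Neumann form the function is then in \<open>H1\<close> and the limit is its
  energy.\<close>

lemma bounded_form_domain:
  assumes f: "bounded_borel f" and D: "\<And>h. 0 < h \<Longrightarrow> approx_form M X P h f f \<le> D"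
  shows "f \<in> H1 M" "energy M f f \<le> D"
proof -
  define a where "a h = approx_form M X P h f f" for h
  define l where "l = Sup (a ` {0<..})"
  have bdd: "bdd_above (a ` {0<..})" using D by (auto simp: a_def intro!: bdd_aboveI2[of _ _ D])
  have lim: "(a \<longlongrightarrow> l) (at_right 0)"
  proof (rule order_tendstoI)
    fix y assume "y < l"
    then obtain h0 where h0: "0 < h0" "y < a h0"
      unfolding l_def by (subst (asm) less_cSup_iff) (use bdd in auto)
    then show "\<forall>\<^sub>F h in at_right 0. y < a h"
      unfolding eventually_at_right_field using approx_form_antimono[OF f]
      by (intro exI[of _ h0]) (auto simp: a_def intro: less_le_trans)
  next
    fix y assume "l < y"
    have "a h \<le> l" if "0 < h" for h unfolding l_def using that bdd by (intro cSup_upper) auto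
    then show "\<forall>\<^sub>F h in at_right 0. a h < y"
      unfolding eventually_at_right_field using \<open>l < y\<close> by (intro exI[of _ 1]) (auto intro: le_less_trans)
  qed
  have "f \<in> L2 M" using f unfolding bounded_borel_def using L2_bounded by blast
  then show H1: "f \<in> H1 M" using form_associated lim unfolding associated_with_neumann_form_def a_def by blast
  then have "(a \<longlongrightarrow> energy M f f) (at_right 0)"
    using form_associated unfolding associated_with_neumann_form_def a_def by blast
  moreover have "\<forall>\<^sub>F h in at_right 0. a h \<le> D"
    unfolding eventually_at_right_field using D by (intro exI[of _ 1]) (auto simp: a_def)
  ultimately show "energy M f f \<le> D" by (intro tendsto_upperbound[of a _ "at_right 0"]) auto
qed

section \<open>Decay of survival probabilities\<close>

text \<open>One observation after time \<open>h\<close>: the process starts in \<open>A\<close>, moves for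
  time \<open>h\<close> and collects \<open>g\<close>. Iterates applied to functions supported in
  \<open>A\<close> observe the process at all multiples of \<open>h\<close>.\<close>

definition killed :: "'a set \<Rightarrow> real \<Rightarrow> ('a \<Rightarrow> real) \<Rightarrow> 'a \<Rightarrow> real" where
  "killed A h g = (\<lambda>x. indicator A x * S h g x)"

lemma killed_bounded_borel: "A \<in> sets borel \<Longrightarrow> bounded_borel g \<Longrightarrow> 0 \<le> h \<Longrightarrow> bounded_borel (killed A h g)"
  unfolding killed_def by (intro bounded_borel_mult bounded_borel_indicator S_bounded_borel)

lemma killed_pow_bounded_borel: "A \<in> sets borel \<Longrightarrow> bounded_borel g \<Longrightarrow> 0 \<le> h \<Longrightarrow> bounded_borel ((killed A h ^^ k) g)"
  by (induction k) (auto intro: killed_bounded_borel)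

lemma S_nonneg: "bounded_borel g \<Longrightarrow> 0 \<le> h \<Longrightarrow> (\<And>x. x \<in> M \<Longrightarrow> 0 \<le> g x) \<Longrightarrow> 0 \<le> S h g y"
  using S_mono[of "\<lambda>_. 0" g h y] S_const[of h 0 y] by (auto split: if_splits)

lemma killed_nonneg: "bounded_borel g \<Longrightarrow> 0 \<le> h \<Longrightarrow> (\<And>x. 0 \<le> g x) \<Longrightarrow> 0 \<le> killed A h g y"
  unfolding killed_def by (auto intro!: mult_nonneg_nonneg S_nonneg)

lemma killed_mono: "bounded_borel f \<Longrightarrow> bounded_borel g \<Longrightarrow> 0 \<le> h \<Longrightarrow> (\<And>x. f x \<le> g x) \<Longrightarrow> killed A h f y \<le> killed A h g y"
  unfolding killed_def by (intro mult_left_mono S_mono) auto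

lemma killed_pow_nonneg:
  "A \<in> sets borel \<Longrightarrow> bounded_borel g \<Longrightarrow> 0 \<le> h \<Longrightarrow> (\<And>x. 0 \<le> g x) \<Longrightarrow> 0 \<le> (killed A h ^^ k) g y"
  by (induction k arbitrary: y) (auto intro: killed_nonneg killed_pow_bounded_borel)

lemma killed_pow_outside: "(\<And>x. x \<notin> A \<Longrightarrow> g x = 0) \<Longrightarrow> x \<notin> A \<Longrightarrow> (killed A h ^^ k) g x = 0"
  by (cases k) (auto simp: killed_def)

lemma killed_symmetric:
  assumes A: "A \<in> sets borel" and b: "bounded_borel f" "bounded_borel g" and h: "0 \<le> h"
    and 0: "\<And>x. x \<notin> A \<Longrightarrow> f x = 0" "\<And>x. x \<notin> A \<Longrightarrow> g x = 0"
  shows "L2_inner M (killed A h f) g = L2_inner M f (killed A h g)"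
proof -
  have "L2_inner M (killed A h f) g = L2_inner M (S h f) g"
    by (rule L2_inner_cong) (use assms in \<open>auto simp: killed_def indicator_def killed_bounded_borel[unfolded killed_def indicator_def] S_bounded_borel\<close>)
  also have "\<dots> = L2_inner M f (S h g)" using S_symmetric[OF b h] by simp
  also have "\<dots> = L2_inner M f (killed A h g)"
    by (rule L2_inner_cong) (use assms in \<open>auto simp: killed_def indicator_def killed_bounded_borel[unfolded killed_def indicator_def] S_bounded_borel\<close>)
  finally show ?thesis .
qed

text \<open>Dropping the observations at intermediate times can only increase the survival probability.\<close>

lemma killed_pow_le_killed:
  assumes A: "A \<in> sets borel" and g: "bounded_borel g" "\<And>x. 0 \<le> g x" and h: "0 \<le> h"
  shows "(killed A h ^^ Suc j) g y \<le> killed A (real (Suc j) * h) g y"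
proof (induction j arbitrary: y)
  case (Suc j)
  have b: "bounded_borel ((killed A h ^^ Suc j) g)" by (rule killed_pow_bounded_borel[OF A g(1) h])
  have Sb: "bounded_borel (S (real (Suc j) * h) g)" using S_bounded_borel[OF g(1)] h by simp
  have Sn: "0 \<le> S (real (Suc j) * h) g x" for x using S_nonneg[OF g(1)] g(2) h by simp
  have "(killed A h ^^ Suc (Suc j)) g y = killed A h ((killed A h ^^ Suc j) g) y" by simp
  also have "\<dots> \<le> killed A h (S (real (Suc j) * h) g) y"
  proof (rule killed_mono[OF b Sb h])
    show "(killed A h ^^ Suc j) g x \<le> S (real (Suc j) * h) g x" for x
    proof (cases "x \<in> A")
      case True
      then have "killed A (real (Suc j) * h) g x = S (real (Suc j) * h) g x" by (simp add: killed_def)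
      then show ?thesis using Suc[of x] by simp
    next
      case False
      then have "(killed A h ^^ Suc j) g x = 0" by (simp add: killed_def)
      then show ?thesis using Sn[of x] by simp
    qed
  qed
  also have "\<dots> = killed A (h + real (Suc j) * h) g y"
    using S_semigroup[OF g(1) h, of "real (Suc j) * h"] h by (simp add: killed_def)
  also have "h + real (Suc j) * h = real (Suc (Suc j)) * h" by (simp add: algebra_simps)
  finally show ?case .
qed simp

text \<open>The probability to be in \<open>A\<close> at the times \<open>0, h, \<dots>, k h\<close>, as a
  function of the starting point.\<close>

definition survival :: "'a set \<Rightarrow> real \<Rightarrow> nat \<Rightarrow> 'a \<Rightarrow> real" where
  "survival A h k = (killed A h ^^ k) (indicator A)"

lemma survival_bounded_borel: "A \<in> sets borel \<Longrightarrow> 0 \<le> h \<Longrightarrow> bounded_borel (survival A h k)"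
  unfolding survival_def by (intro killed_pow_bounded_borel bounded_borel_indicator)

lemma survival_nonneg: "A \<in> sets borel \<Longrightarrow> 0 \<le> h \<Longrightarrow> 0 \<le> survival A h k x"
  unfolding survival_def by (intro killed_pow_nonneg bounded_borel_indicator) auto

lemma survival_outside: "x \<notin> A \<Longrightarrow> survival A h k x = 0"
  unfolding survival_def by (rule killed_pow_outside) auto

lemma survival_le_1: "A \<in> sets borel \<Longrightarrow> 0 \<le> h \<Longrightarrow> survival A h k x \<le> 1"
proof (induction k arbitrary: x)
  case (Suc k)
  have "\<bar>S h (survival A h k) x\<bar> \<le> 1"
    by (rule S_bounded) (use Suc survival_nonneg survival_bounded_borel bounded_borel_measurable in auto)
  then show ?case by (auto simp: survival_def killed_def indicator_def)
qed (simp add: survival_def)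

text \<open>Symmetry of the killed operator moves all steps to one side.\<close>

lemma survival_inner:
  assumes A: "A \<in> sets borel" and h: "0 \<le> h"
  shows "L2_inner M (survival A h j) (survival A h k) = L2_inner M (indicator A) (survival A h (j + k))"
proof (induction j arbitrary: k)
  case (Suc j)
  have "survival A h (Suc n) = killed A h (survival A h n)" for n by (simp add: survival_def)
  then have "L2_inner M (survival A h (Suc j)) (survival A h k) = L2_inner M (survival A h j) (survival A h (Suc k))"
    using killed_symmetric[OF A survival_bounded_borel[OF A h] survival_bounded_borel[OF A h] h] survival_outside by simp
  then show ?case using Suc[of "Suc k"] by simp
qed (simp add: survival_def)

lemma survival_refine:
  assumes A: "A \<in> sets borel" and h: "0 \<le> h" and N: "0 < N"
  shows "survival A (h / real N) (N * k) x \<le> survival A h k x"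
proof (induction k arbitrary: x)
  case (Suc k)
  obtain N' where N': "N = Suc N'" using N by (cases N) auto
  have h': "0 \<le> h / real N" using h by simp
  let ?D = "survival A (h / real N) (N * k)"
  note bD = survival_bounded_borel[OF A h', of "N * k"]
  have "survival A (h / real N) (N * Suc k) x = (killed A (h / real N) ^^ Suc N') ?D x"
    unfolding survival_def N' by (simp add: funpow_add)
  also have "\<dots> \<le> killed A (real (Suc N') * (h / real N)) ?D x"
    by (rule killed_pow_le_killed[OF A bD survival_nonneg[OF A h'] h'])
  also have "real (Suc N') * (h / real N) = h" unfolding N' by simp
  also have "killed A h ?D x \<le> killed A h (survival A h k) x"
    by (rule killed_mono[OF bD survival_bounded_borel[OF A h] h Suc])
  finally show ?case by (simp add: survival_def)
qed (simp add: survival_def)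

text \<open>Observation of the time interval \<open>[0, j / 2\<^sup>i]\<close> with mesh
  \<open>2\<^sup>-\<^sup>i\<^sup>-\<^sup>m\<close>; refining the mesh means increasing
  \<open>m\<close>.\<close>

definition dyadic_survival :: "'a set \<Rightarrow> nat \<Rightarrow> nat \<Rightarrow> nat \<Rightarrow> 'a \<Rightarrow> real" where
  "dyadic_survival A i j m = survival A ((1 / 2) ^ (i + m)) (j * 2 ^ m)"

text \<open>The survival probability \<open>q\<^sub>t\<close> at the dyadic time \<open>t = j /
  2\<^sup>i\<close>, observed at all dyadic times.\<close>

definition limit_survival :: "'a set \<Rightarrow> nat \<Rightarrow> nat \<Rightarrow> 'a \<Rightarrow> real" where
  "limit_survival A i j x = lim (\<lambda>m. dyadic_survival A i j m x)"

lemma dyadic_survival_tendsto: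
  assumes A: "A \<in> sets borel"
  shows "(\<lambda>m. dyadic_survival A i j m x) \<longlonglongrightarrow> limit_survival A i j x"
proof -
  have "dyadic_survival A i j (Suc m) x \<le> dyadic_survival A i j m x" for m
    using survival_refine[OF A, of "(1 / 2) ^ (i + m)" 2 "j * 2 ^ m" x]
    by (simp add: dyadic_survival_def mult_ac)
  then have "decseq (\<lambda>m. dyadic_survival A i j m x)" by (rule decseq_SucI)
  moreover have "0 \<le> dyadic_survival A i j m x" for m by (simp add: dyadic_survival_def survival_nonneg[OF A])
  ultimately have "convergent (\<lambda>m. dyadic_survival A i j m x)" using decseq_convergent by (metis convergent_def)
  then show ?thesis unfolding limit_survival_def by (rule convergent_LIMSEQ_iff[THEN iffD1])
qed

lemma dyadic_survival_bounds:
  assumes A: "A \<in> sets borel" shows "0 \<le> dyadic_survival A i j m x" "dyadic_survival A i j m x \<le> 1"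
  by (simp_all add: dyadic_survival_def survival_nonneg[OF A] survival_le_1[OF A])

lemma dyadic_survival_bounded_borel: "A \<in> sets borel \<Longrightarrow> bounded_borel (dyadic_survival A i j m)"
  by (simp add: dyadic_survival_def survival_bounded_borel)

lemma limit_survival_bounds:
  assumes A: "A \<in> sets borel" shows "0 \<le> limit_survival A i j x" "limit_survival A i j x \<le> 1"
  using dyadic_survival_bounds[OF A] dyadic_survival_tendsto[OF A, of i j x]
  by (auto intro: LIMSEQ_le_const LIMSEQ_le_const2)

lemma limit_survival_outside:
  assumes A: "A \<in> sets borel" and x: "x \<notin> A" shows "limit_survival A i j x = 0"
proof -
  have "dyadic_survival A i j m x = 0" for m using x by (simp add: dyadic_survival_def survival_outside)
  then show ?thesis using dyadic_survival_tendsto[OF A, of i j x] LIMSEQ_unique[of "\<lambda>_. 0"] by auto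
qed

lemma limit_survival_bounded_borel:
  assumes A: "A \<in> sets borel" shows "bounded_borel (limit_survival A i j)"
proof (rule bounded_borelI[of _ 1])
  show "limit_survival A i j \<in> borel_measurable borel"
    by (rule borel_measurable_LIMSEQ_metric[OF _ dyadic_survival_tendsto[OF A]])
      (simp add: bounded_borel_measurable dyadic_survival_bounded_borel[OF A])
  show "\<bar>limit_survival A i j x\<bar> \<le> 1" for x using limit_survival_bounds[OF A, of i j x] by simp
qed

text \<open>Both sides are limits along the same sequence of meshes.\<close>

lemma limit_survival_rescale: "A \<in> sets borel \<Longrightarrow> limit_survival A (i + p) (j * 2 ^ p) = limit_survival A i j"
proof
  fix x assume A: "A \<in> sets borel"
  have "dyadic_survival A (i + p) (j * 2 ^ p) m x = dyadic_survival A i j (m + p) x" for m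
    by (simp add: dyadic_survival_def power_add mult_ac add_ac)
  then have "(\<lambda>m. dyadic_survival A (i + p) (j * 2 ^ p) m x) \<longlonglongrightarrow> limit_survival A i j x"
    using LIMSEQ_ignore_initial_segment[OF dyadic_survival_tendsto[OF A, of i j x], of p] by simp
  then show "limit_survival A (i + p) (j * 2 ^ p) x = limit_survival A i j x"
    using dyadic_survival_tendsto[OF A] LIMSEQ_unique by blast
qed

text \<open>The function \<open>\<phi>(n / 2\<^sup>i) = \<langle>1\<^sub>A, q\<^sub>t\<rangle>\<close> with
  \<open>t = n / 2\<^sup>i\<close>.\<close>

definition survival_mass :: "'a set \<Rightarrow> nat \<Rightarrow> nat \<Rightarrow> real" where
  "survival_mass A i n = L2_inner M (indicator A) (limit_survival A i n)"

lemma dyadic_inner_tendsto: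
  assumes A: "A \<in> sets borel"
  shows "(\<lambda>m. L2_inner M (dyadic_survival A i j m) (dyadic_survival A i k m)) \<longlonglongrightarrow>
     L2_inner M (limit_survival A i j) (limit_survival A i k)"
  unfolding L2_inner_def
proof (rule integral_dominated_convergence[where w = "\<lambda>_. 1"])
  have m: "dyadic_survival A i j m \<in> borel_measurable borel" "limit_survival A i j \<in> borel_measurable borel" for j m
    using dyadic_survival_bounded_borel[OF A] limit_survival_bounded_borel[OF A] by (auto simp: bounded_borel_measurable)
  show "(\<lambda>x. limit_survival A i j x * limit_survival A i k x) \<in> borel_measurable \<mu>"
    "(\<lambda>x. dyadic_survival A i j m x * dyadic_survival A i k m x) \<in> borel_measurable \<mu>" for m
    using m by auto
  show "AE x in \<mu>. norm (dyadic_survival A i j m x * dyadic_survival A i k m x) \<le> 1" for m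
    using dyadic_survival_bounds[OF A] by (auto simp: abs_mult intro!: mult_le_one)
  show "AE x in \<mu>. (\<lambda>m. dyadic_survival A i j m x * dyadic_survival A i k m x) \<longlonglongrightarrow> limit_survival A i j x * limit_survival A i k x"
    by (intro AE_I2 tendsto_mult dyadic_survival_tendsto A)
qed simp

lemma survival_mass_tendsto:
  assumes A: "A \<in> sets borel"
  shows "(\<lambda>m. L2_inner M (indicator A) (dyadic_survival A i n m)) \<longlonglongrightarrow> survival_mass A i n"
  unfolding survival_mass_def L2_inner_def
proof (rule integral_dominated_convergence[where w = "\<lambda>_. 1"])
  have m: "dyadic_survival A i j m \<in> borel_measurable borel" "limit_survival A i j \<in> borel_measurable borel" for j m
    using dyadic_survival_bounded_borel[OF A] limit_survival_bounded_borel[OF A] by (auto simp: bounded_borel_measurable)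
  show "(\<lambda>x. indicator A x * limit_survival A i n x) \<in> borel_measurable \<mu>"
    "(\<lambda>x. indicator A x * dyadic_survival A i n m x) \<in> borel_measurable \<mu>" for m
    using m A by auto
  show "AE x in \<mu>. norm (indicator A x * dyadic_survival A i n m x :: real) \<le> 1" for m
    using dyadic_survival_bounds[OF A] by (auto simp: indicator_def)
  show "AE x in \<mu>. (\<lambda>m. indicator A x * dyadic_survival A i n m x) \<longlonglongrightarrow> indicator A x * limit_survival A i n x"
    by (intro AE_I2 tendsto_mult tendsto_const dyadic_survival_tendsto A)
qed simp

text \<open>The identity \<open>\<langle>q\<^sub>s, q\<^sub>t\<rangle> = \<phi>(s + t)\<close>, inherited
  from the symmetry of the killed operator in the limit of vanishing mesh.\<close>

lemma limit_survival_inner: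
  assumes A: "A \<in> sets borel"
  shows "L2_inner M (limit_survival A i j) (limit_survival A i k) = survival_mass A i (j + k)"
proof -
  have "L2_inner M (dyadic_survival A i j m) (dyadic_survival A i k m) = L2_inner M (indicator A) (dyadic_survival A i (j + k) m)" for m
    using survival_inner[OF A, of "(1 / 2) ^ (i + m)" "j * 2 ^ m" "k * 2 ^ m"]
    by (simp add: dyadic_survival_def distrib_right)
  then show ?thesis using dyadic_inner_tendsto[OF A, of i j k] survival_mass_tendsto[OF A, of i "j + k"] LIMSEQ_unique by simp
qed

lemma survival_mass_rescale: "A \<in> sets borel \<Longrightarrow> survival_mass A (i + p) (n * 2 ^ p) = survival_mass A i n"
  by (simp add: survival_mass_def limit_survival_rescale)

text \<open>Midpoint convexity of \<open>\<phi>\<close>, from \<open>0 \<le> \<parallel>q\<^sub>s -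
  q\<^sub>t\<parallel>\<^sup>2 = \<phi>(2 s) - 2 \<phi>(s + t) + \<phi>(2 t)\<close> with half
  steps.\<close>

lemma survival_mass_convex:
  assumes A: "A \<in> sets borel"
  shows "survival_mass A i (Suc k) - survival_mass A i (Suc (Suc k)) \<le> survival_mass A i k - survival_mass A i (Suc k)"
proof -
  let ?f = "limit_survival A (i + 1) k" and ?g = "limit_survival A (i + 1) (k + 2)"
  have r: "survival_mass A (i + 1) (n * 2) = survival_mass A i n" for n
    using survival_mass_rescale[OF A, of i 1 n] by simp
  have "0 \<le> L2_inner M (\<lambda>x. ?f x - ?g x) (\<lambda>x. ?f x - ?g x)" by (rule L2_inner_nonneg)
  also have "\<dots> = survival_mass A (i + 1) (k + k) - 2 * survival_mass A (i + 1) (k + (k + 2)) + survival_mass A (i + 1) ((k + 2) + (k + 2))"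
    unfolding L2_inner_square_diff[OF limit_survival_bounded_borel[OF A] limit_survival_bounded_borel[OF A]]
      limit_survival_inner[OF A] by (rule refl)
  also have "\<dots> = survival_mass A i k - 2 * survival_mass A i (Suc k) + survival_mass A i (Suc (Suc k))"
    using r[of k] r[of "Suc k"] r[of "Suc (Suc k)"] by (simp add: mult_2_right)
  finally show ?thesis by simp
qed

text \<open>By convexity, the slope of \<open>\<phi>\<close> after time \<open>n + 1\<close> is at most the
  average slope on \<open>[n, n + 1]\<close>.\<close>

lemma survival_mass_slope:
  assumes A: "A \<in> sets borel"
  shows "2 ^ i * (survival_mass A i (Suc n * 2 ^ i) - survival_mass A i (Suc (Suc n * 2 ^ i))) \<le> survival_mass A 0 n - survival_mass A 0 (Suc n)"
proof -
  let ?\<delta> = "\<lambda>k. survival_mass A i k - survival_mass A i (Suc k)"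
  have anti: "?\<delta> k' \<le> ?\<delta> k" if "k \<le> k'" for k k'
    using that
  proof (induction k' rule: dec_induct)
    case (step n) then show ?case using survival_mass_convex[OF A, of i n] by linarith
  qed simp
  have tele: "survival_mass A i m - survival_mass A i (m + j) = (\<Sum>l<j. ?\<delta> (m + l))" for m j
    by (induction j) auto
  have "2 ^ i * ?\<delta> (Suc n * 2 ^ i) = (\<Sum>l<(2::nat) ^ i. ?\<delta> (Suc n * 2 ^ i))" by simp
  also have "\<dots> \<le> (\<Sum>l<(2::nat) ^ i. ?\<delta> (n * 2 ^ i + l))" by (intro sum_mono anti) auto
  also have "\<dots> = survival_mass A i (n * 2 ^ i) - survival_mass A i (n * 2 ^ i + 2 ^ i)" by (rule tele[symmetric])
  also have "n * 2 ^ i + 2 ^ i = Suc n * 2 ^ i" by simp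
  also have "survival_mass A i (n * 2 ^ i) - survival_mass A i (Suc n * 2 ^ i) = survival_mass A 0 n - survival_mass A 0 (Suc n)"
    using survival_mass_rescale[OF A, of 0 i n] survival_mass_rescale[OF A, of 0 i "Suc n"] by simp
  finally show ?thesis .
qed

text \<open>The Markov property at time \<open>h = 2\<^sup>-\<^sup>i\<close>, where the constraint on
  \<open>(0, h)\<close> is dropped: \<open>q\<^sub>t\<^sub>+\<^sub>h \<le> S\<^sub>h
  q\<^sub>t\<close> on \<open>A\<close>.\<close>

lemma S_limit_survival:
  assumes A: "A \<in> sets borel" and x: "x \<in> A" "A \<subseteq> M"
  shows "limit_survival A i (Suc j) x \<le> S ((1 / 2) ^ i) (limit_survival A i j) x"
proof -
  let ?h = "(1 / 2 :: real) ^ i"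
  have xM: "x \<in> M" using x by auto
  interpret K: prob_space "kernel ?h x" by (rule kernel_prob[OF xM]) simp
  have m: "dyadic_survival A i j m \<in> borel_measurable borel" "limit_survival A i j \<in> borel_measurable borel" for m
    using dyadic_survival_bounded_borel[OF A] limit_survival_bounded_borel[OF A] by (auto simp: bounded_borel_measurable)
  have "(\<lambda>m. \<integral>y. dyadic_survival A i j m y \<partial>kernel ?h x) \<longlonglongrightarrow> (\<integral>y. limit_survival A i j y \<partial>kernel ?h x)"
  proof (rule integral_dominated_convergence[where w = "\<lambda>_. 1"])
    show "AE y in kernel ?h x. norm (dyadic_survival A i j m y) \<le> 1" for m using dyadic_survival_bounds[OF A] by auto
    show "AE y in kernel ?h x. (\<lambda>m. dyadic_survival A i j m y) \<longlonglongrightarrow> limit_survival A i j y"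
      by (intro AE_I2 dyadic_survival_tendsto A)
  qed (use m in auto)
  then have lim: "(\<lambda>m. S ?h (dyadic_survival A i j m) x) \<longlonglongrightarrow> S ?h (limit_survival A i j) x"
    using S_kernel[OF m(1) xM, of ?h] S_kernel[OF m(2) xM, of ?h] by simp
  have "dyadic_survival A i (Suc j) m x \<le> S ?h (dyadic_survival A i j m) x" for m
  proof -
    obtain N where N: "2 ^ m = Suc N" by (metis Suc_pred zero_less_power zero_less_numeral)
    have rN: "real (Suc N) = 2 ^ m" using arg_cong[OF N, of real] by simp
    let ?h' = "(1 / 2 :: real) ^ (i + m)"
    have "dyadic_survival A i (Suc j) m x = (killed A ?h' ^^ Suc N) (dyadic_survival A i j m) x"
      unfolding dyadic_survival_def survival_def mult_Suc N[symmetric] funpow_add by simp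
    also have "\<dots> \<le> killed A (real (Suc N) * ?h') (dyadic_survival A i j m) x"
      by (rule killed_pow_le_killed[OF A dyadic_survival_bounded_borel[OF A] dyadic_survival_bounds(1)[OF A]]) simp
    also have "real (Suc N) * ?h' = ?h" unfolding rN by (simp add: power_add power_one_over)
    finally show ?thesis using x(1) by (simp add: killed_def)
  qed
  then show ?thesis using dyadic_survival_tendsto[OF A, of i "Suc j" x] lim by (intro LIMSEQ_le) auto
qed

text \<open>Take \<open>f = q\<^sub>t\<close> with \<open>t = (n + 1) / 2\<close>, so that
  \<open>\<parallel>f\<parallel>\<^sup>2 = \<phi>(n + 1)\<close>. For dyadic \<open>h\<close>,
  \<open>\<langle>S\<^sub>h f, f\<rangle> \<ge> \<langle>q\<^sub>t\<^sub>+\<^sub>h,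
  q\<^sub>t\<rangle> = \<phi>(n + 1 + h)\<close>, so the approximating forms of \<open>f\<close>
  are at most the slope of \<open>\<phi>\<close> at \<open>n + 1\<close>, hence at most
  \<open>\<phi>(n) - \<phi>(n + 1)\<close>. Therefore \<open>f\<close> is in \<open>H1\<close>
  with energy at most this difference, and the gap inequality gives \<open>\<eta> \<phi>(n + 1)
  \<le> \<phi>(n) - \<phi>(n + 1)\<close>.\<close>

theorem survival_mass_decay:
  assumes A: "A \<in> sets borel" "A \<subseteq> M" and \<eta>: "0 < \<eta>"
    and gap: "\<And>f. bounded_borel f \<Longrightarrow> f \<in> H1 M \<Longrightarrow> (\<And>x. x \<notin> A \<Longrightarrow> f x = 0) \<Longrightarrow> \<eta> * L2_inner M f f \<le> energy M f f"
  shows "survival_mass A 0 n \<le> (1 / (1 + \<eta>)) ^ n"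
proof (induction n)
  case 0
  have "survival_mass A 0 0 \<le> L2_inner M (\<lambda>_. 1) (\<lambda>_. 1)"
    unfolding survival_mass_def
    by (rule L2_inner_mono) (use limit_survival_bounds[OF A(1)] in \<open>auto simp: bounded_borel_indicator[OF A(1)]
      limit_survival_bounded_borel[OF A(1)] indicator_def\<close>)
  also have "\<dots> = 1" by (simp add: L2_inner_def)
  finally show ?case by simp
next
  case (Suc n)
  define D where "D = survival_mass A 0 n - survival_mass A 0 (Suc n)"
  define f where "f = limit_survival A 1 (Suc n)"
  have fb: "bounded_borel f" unfolding f_def by (rule limit_survival_bounded_borel[OF A(1)])
  have ff: "L2_inner M f f = survival_mass A 0 (Suc n)"
    unfolding f_def limit_survival_inner[OF A(1)]
    using survival_mass_rescale[OF A(1), of 0 1 "Suc n"] by (simp add: mult_2_right)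
  (* The time (n + 1) / 2 is ?j / 2 ^ ?i with ?h = 1 / 2 ^ ?i. *)
  have dy: "approx_form M X P ((1 / 2) ^ Suc p) f f \<le> D" for p
  proof -
    let ?i = "1 + p" and ?j = "Suc n * 2 ^ p" and ?h = "(1 / 2 :: real) ^ Suc p"
    have fi: "f = limit_survival A ?i ?j" unfolding f_def using limit_survival_rescale[OF A(1), of 1 p "Suc n"] by simp
    let ?g = "limit_survival A ?i (Suc ?j)"
    have gb: "bounded_borel ?g" by (rule limit_survival_bounded_borel[OF A(1)])
    have "Suc n * 2 ^ ?i = 2 * ?j" by simp
    then have "Suc (Suc n * 2 ^ ?i) = Suc ?j + ?j" by linarith
    then have "survival_mass A ?i (Suc (Suc n * 2 ^ ?i)) = L2_inner M ?g f"
      unfolding fi limit_survival_inner[OF A(1)] by (simp only:)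
    also have "\<dots> \<le> L2_inner M (S ?h f) f"
    proof (rule L2_inner_mono[OF gb fb S_bounded_borel[OF fb] fb])
      fix x assume "x \<in> M"
      show "?g x * f x \<le> S ?h f x * f x"
      proof (cases "x \<in> A")
        case True
        have "?g x \<le> S ?h f x" using S_limit_survival[OF A(1) True A(2), of ?i ?j] by (simp add: fi)
        then show ?thesis using limit_survival_bounds(1)[OF A(1)] by (intro mult_right_mono) (auto simp: fi)
      next
        case False
        then show ?thesis using limit_survival_outside[OF A(1)] by (simp add: fi)
      qed
    qed simp
    finally have "survival_mass A ?i (Suc (Suc n * 2 ^ ?i)) \<le> L2_inner M (S ?h f) f" .
    moreover have "survival_mass A ?i (Suc n * 2 ^ ?i) = L2_inner M (S 0 f) f"
    proof -
      have "L2_inner M (S 0 f) f = L2_inner M f f"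
        by (rule L2_inner_cong) (use fb S_0 in \<open>auto intro: S_bounded_borel simp: bounded_borel_measurable\<close>)
      then show ?thesis using ff survival_mass_rescale[OF A(1), of 0 ?i "Suc n"] by simp
    qed
    ultimately have "2 ^ ?i * (L2_inner M (S 0 f) f - L2_inner M (S ?h f) f) \<le>
        2 ^ ?i * (survival_mass A ?i (Suc n * 2 ^ ?i) - survival_mass A ?i (Suc (Suc n * 2 ^ ?i)))"
      by (intro mult_left_mono) auto
    also have "\<dots> \<le> D" unfolding D_def by (rule survival_mass_slope[OF A(1)])
    finally show ?thesis by (simp add: approx_form_eq[OF fb] power_one_over field_simps)
  qed
  have appr: "approx_form M X P h f f \<le> D" if h: "0 < h" for h
  proof -
    obtain p where "(1 / 2 :: real) ^ p < h" using real_arch_pow_inv[OF h, of "1 / 2"] by auto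
    moreover have "(1 / 2 :: real) ^ Suc p \<le> (1 / 2) ^ p" by simp
    ultimately have ph: "(1 / 2 :: real) ^ Suc p \<le> h" by linarith
    have "approx_form M X P h f f \<le> approx_form M X P ((1 / 2) ^ Suc p) f f"
      by (rule approx_form_antimono[OF fb _ ph]) simp
    then show ?thesis using dy[of p] by (rule order_trans)
  qed
  have dom: "f \<in> H1 M" "energy M f f \<le> D" using bounded_form_domain[OF fb, of D] appr by auto
  have "\<eta> * L2_inner M f f \<le> energy M f f"
    by (rule gap[OF fb dom(1)]) (unfold f_def, rule limit_survival_outside[OF A(1)])
  with dom(2) ff have "(1 + \<eta>) * survival_mass A 0 (Suc n) \<le> survival_mass A 0 n"
    by (simp add: D_def distrib_right)
  then have "survival_mass A 0 (Suc n) \<le> survival_mass A 0 n / (1 + \<eta>)" using \<eta> by (simp add: field_simps)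
  also have "\<dots> \<le> (1 / (1 + \<eta>)) ^ n / (1 + \<eta>)" using Suc \<eta> by (intro divide_right_mono) auto
  finally show ?case by simp
qed

end

section \<open>Survival probabilities of the process\<close>

context rbm
begin

lemma survival_event_filtration:
  assumes A: "A \<in> sets borel" and t: "0 \<le> t0" "0 \<le> h"
  shows "{\<omega>\<in>space Om. \<forall>k\<le>K. X (t0 + real k * h) \<omega> \<in> A} \<in> sets (right_filtration Om X (t0 + real K * h))"
proof -
  have "{\<omega>\<in>space Om. X (t0 + real k * h) \<omega> \<in> A} \<in> sets (right_filtration Om X (t0 + real K * h))" if "k \<le> K" for k
    using that t A by (intro vimage_in_right_filtration) (auto intro!: mult_right_mono)
  then have "(\<Inter>k\<in>{..K}. {\<omega>\<in>space Om. X (t0 + real k * h) \<omega> \<in> A}) \<in> sets (right_filtration Om X (t0 + real K * h))"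
    by (intro sets.finite_INT) auto
  moreover have "(\<Inter>k\<in>{..K}. {\<omega>\<in>space Om. X (t0 + real k * h) \<omega> \<in> A}) = {\<omega>\<in>space Om. \<forall>k\<le>K. X (t0 + real k * h) \<omega> \<in> A}"
    by auto
  ultimately show ?thesis by (simp only:)
qed

text \<open>Induction on the number of observations: the Markov property at the last but one time replaces
  the last factor by one application of the killed operator.\<close>

lemma survival_expectation:
  assumes z: "z \<in> M" and A: "A \<in> sets borel" and t: "0 \<le> t0" "0 \<le> h" and g: "bounded_borel g"
  shows "(\<integral>\<omega>. indicator {\<omega>\<in>space Om. \<forall>k\<le>K. X (t0 + real k * h) \<omega> \<in> A} \<omega> * g (X (t0 + real K * h) \<omega>) \<partial>P z)
     = (\<integral>\<omega>. (killed A h ^^ K) (\<lambda>x. indicator A x * g x) (X t0 \<omega>) \<partial>P z)"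
  using g
proof (induction K arbitrary: g)
  case 0
  show ?case
    by (rule Bochner_Integration.integral_cong) (auto simp: indicator_def P_space[OF z])
next
  case (Suc K)
  let ?E = "\<lambda>K. {\<omega>\<in>space Om. \<forall>k\<le>K. X (t0 + real k * h) \<omega> \<in> A}"
  let ?s = "t0 + real K * h"
  have s: "0 \<le> ?s" using t by simp
  have Ag: "bounded_borel (\<lambda>x. indicator A x * g x)" using Suc.prems A by (intro bounded_borel_mult bounded_borel_indicator)
  have step: "t0 + real (Suc K) * h = ?s + h" by (simp add: algebra_simps)
  have "(\<integral>\<omega>. indicator (?E (Suc K)) \<omega> * g (X (t0 + real (Suc K) * h) \<omega>) \<partial>P z)
      = (\<integral>\<omega>. indicator (?E K) \<omega> * (indicator A (X (?s + h) \<omega>) * g (X (?s + h) \<omega>)) \<partial>P z)"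
    unfolding step
    by (rule Bochner_Integration.integral_cong) (auto simp: indicator_def le_Suc_eq step[unfolded of_nat_Suc] all_conj_distrib)
  also have "\<dots> = (\<integral>\<omega>. indicator (?E K) \<omega> * S h (\<lambda>x. indicator A x * g x) (X ?s \<omega>) \<partial>P z)"
    by (rule markov[OF z s t(2) survival_event_filtration[OF A t] Ag])
  also have "\<dots> = (\<integral>\<omega>. (killed A h ^^ K) (\<lambda>x. indicator A x * S h (\<lambda>x. indicator A x * g x) x) (X t0 \<omega>) \<partial>P z)"
    by (rule Suc.IH[OF S_bounded_borel[OF Ag t(2)]])
  also have "(\<lambda>x. indicator A x * S h (\<lambda>x. indicator A x * g x) x) = killed A h (\<lambda>x. indicator A x * g x)"
    by (simp add: killed_def)
  finally show ?case by (simp only: funpow_Suc_right comp_apply)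
qed

text \<open>The bound on the density at time \<open>t0\<close> reduces the start at \<open>z\<close> to a
  start distributed like \<open>\<mu>\<close>; then the mesh of the observations tends to
  \<open>0\<close>.\<close>

theorem survival_probability:
  assumes z: "z \<in> M" and A: "A \<in> sets borel" and t: "0 \<le> t0"
    and dens: "distr (P z) borel (X t0) = density \<mu> (\<lambda>y. ennreal (p y))" "p \<in> borel_measurable borel"
    and p: "\<And>y. y \<in> M \<Longrightarrow> 0 \<le> p y" "\<And>y. y \<in> M \<Longrightarrow> p y \<le> a"
  shows "measure (P z) {\<omega>\<in>space Om. \<forall>m. \<forall>k\<le>n * 2 ^ m. X (t0 + real k * (1 / 2) ^ m) \<omega> \<in> A} \<le> a * survival_mass A 0 n"
proof -
  interpret prob_space "P z" by (rule P_prob[OF z])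
  let ?E = "\<lambda>m. {\<omega>\<in>space Om. \<forall>k\<le>n * 2 ^ m. X (t0 + real k * (1 / 2) ^ m) \<omega> \<in> A}"
  have Em: "?E m \<in> sets (P z)" for m
    unfolding P_sets[OF z]
    by (rule subsetD[OF sets_right_filtration_le[OF X_meas] survival_event_filtration[OF A t]]) auto
  have bound: "measure (P z) (?E m) \<le> a * L2_inner M (indicator A) (dyadic_survival A 0 n m)" for m
  proof -
    let ?h = "(1 / 2 :: real) ^ m" and ?K = "n * 2 ^ m"
    let ?D = "survival A ?h ?K"
    have Db: "bounded_borel ?D" by (rule survival_bounded_borel[OF A]) simp
    note [measurable] = bounded_borel_measurable[OF Db] dens(2)
    have Dle: "\<bar>?D x\<bar> \<le> 1" for x using survival_nonneg[OF A, of ?h ?K x] survival_le_1[OF A, of ?h ?K x] by simp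
    have ind: "measure (P z) E = (\<integral>\<omega>. indicator E \<omega> * (\<lambda>_. 1) (X (t0 + real ?K * ?h) \<omega>) \<partial>P z)" if "E \<in> sets (P z)" for E
      using that by simp
    have "measure (P z) (?E m) = (\<integral>\<omega>. indicator (?E m) \<omega> * (\<lambda>_. 1) (X (t0 + real ?K * ?h) \<omega>) \<partial>P z)"
      by (rule ind[OF Em])
    also have "\<dots> = (\<integral>\<omega>. (killed A ?h ^^ ?K) (\<lambda>x. indicator A x * 1) (X t0 \<omega>) \<partial>P z)"
      by (rule survival_expectation[OF z A t]) auto
    also have "\<dots> = (\<integral>\<omega>. ?D (X t0 \<omega>) \<partial>P z)" by (simp add: survival_def)
    also have "\<dots> = (\<integral>y. ?D y \<partial>distr (P z) borel (X t0))"
      using X_measP[OF z t] by (subst integral_distr) auto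
    also have "\<dots> = (\<integral>y. p y * ?D y \<partial>\<mu>)"
      unfolding dens(1) using AE_in_M p(1) by (subst integral_density) (auto elim: eventually_mono)
    also have "\<dots> \<le> (\<integral>y. a * (indicator A y * ?D y) \<partial>\<mu>)"
    proof (rule integral_mono_AE)
      show "integrable \<mu> (\<lambda>y. p y * ?D y)"
      proof (rule \<mu>.integrable_const_bound[of _ "a * 1"])
        show "AE x in \<mu>. norm (p x * ?D x) \<le> a * 1"
          using AE_in_M
        proof (rule eventually_mono)
          fix x assume x: "x \<in> M"
          have "\<bar>p x\<bar> * \<bar>?D x\<bar> \<le> a * 1" using p[OF x] Dle[of x] by (intro mult_mono) auto
          then show "norm (p x * ?D x) \<le> a * 1" by (simp add: abs_mult)
        qed
      qed measurable
      show "integrable \<mu> (\<lambda>y. a * (indicator A y * ?D y))"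
        using Db A by (intro integrable_bounded_borel bounded_borel_mult bounded_borel_indicator) auto
      show "AE x in \<mu>. p x * ?D x \<le> a * (indicator A x * ?D x)"
        using AE_in_M
      proof (rule eventually_mono)
        fix x assume x: "x \<in> M"
        have eq: "indicator A x * ?D x = ?D x" using survival_outside[of x A ?h ?K] by (auto simp: indicator_def)
        show "p x * ?D x \<le> a * (indicator A x * ?D x)"
          unfolding eq using p(2)[OF x] survival_nonneg[OF A, of ?h ?K x] by (simp add: mult_right_mono)
      qed
    qed
    also have "\<dots> = a * L2_inner M (indicator A) (dyadic_survival A 0 n m)"
      by (simp add: L2_inner_def dyadic_survival_def)
    finally show ?thesis .
  qed
  have "measure (P z) {\<omega>\<in>space Om. \<forall>m. \<forall>k\<le>n * 2 ^ m. X (t0 + real k * (1 / 2) ^ m) \<omega> \<in> A} \<le> measure (P z) (?E m)" for m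
    by (intro finite_measure_mono Em) auto
  then have "measure (P z) {\<omega>\<in>space Om. \<forall>m. \<forall>k\<le>n * 2 ^ m. X (t0 + real k * (1 / 2) ^ m) \<omega> \<in> A} \<le>
      a * L2_inner M (indicator A) (dyadic_survival A 0 n m)" for m
    using bound[of m] by (rule order_trans)
  moreover have "(\<lambda>m. a * L2_inner M (indicator A) (dyadic_survival A 0 n m)) \<longlonglongrightarrow> a * survival_mass A 0 n"
    by (intro tendsto_mult tendsto_const survival_mass_tendsto A)
  ultimately show ?thesis by (intro LIMSEQ_le_const) auto
qed

end

section \<open>The Poincare inequality\<close>

context rbm
begin

text \<open>The measure \<open>\<mu>\<close> is invariant under the transition kernels, by symmetry and
  conservativeness. The extension to unbounded functions is by truncation and monotone
  convergence.\<close>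

lemma kernel_invariant_nn:
  assumes g: "g \<in> borel_measurable borel" and t: "0 \<le> t"
  shows "(\<integral>\<^sup>+x. (\<integral>\<^sup>+y. ennreal \<bar>g y\<bar> \<partial>kernel t x) * indicator M x \<partial>\<mu>) = (\<integral>\<^sup>+x. ennreal \<bar>g x\<bar> \<partial>\<mu>)"
proof -
  define G where "G n x = min \<bar>g x\<bar> (real n)" for n :: nat and x
  have Gb: "bounded_borel (G n)" for n
    using g by (intro bounded_borelI[of _ "real n"]) (auto simp: G_def[abs_def])
  have Gm [measurable]: "G n \<in> borel_measurable borel" for n using Gb by (rule bounded_borel_measurable)
  have G0: "0 \<le> G n x" for n x by (simp add: G_def)
  have inc: "incseq (\<lambda>n. ennreal (G n x))" for x
    by (auto simp: incseq_def G_def intro!: ennreal_leI)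
  have sup: "(SUP n. ennreal (G n x)) = ennreal \<bar>g x\<bar>" for x
  proof -
    obtain n0 :: nat where n0: "\<bar>g x\<bar> \<le> real n0" using real_arch_simple by blast
    show ?thesis
    proof (intro antisym SUP_least)
      show "ennreal (G n x) \<le> ennreal \<bar>g x\<bar>" for n by (simp add: G_def ennreal_leI)
      have "ennreal \<bar>g x\<bar> = ennreal (G n0 x)" using n0 by (simp add: G_def)
      also have "\<dots> \<le> (SUP n. ennreal (G n x))" by (rule SUP_upper) simp
      finally show "ennreal \<bar>g x\<bar> \<le> (SUP n. ennreal (G n x))" .
    qed
  qed
  have fin: "(\<integral>\<^sup>+x. (\<integral>\<^sup>+y. ennreal (G n y) \<partial>kernel t x) * indicator M x \<partial>\<mu>) = (\<integral>\<^sup>+x. ennreal (G n x) \<partial>\<mu>)" for n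
  proof -
    have "(\<integral>\<^sup>+x. (\<integral>\<^sup>+y. ennreal (G n y) \<partial>kernel t x) * indicator M x \<partial>\<mu>) = (\<integral>\<^sup>+x. ennreal (S t (G n) x) \<partial>\<mu>)"
    proof (rule nn_integral_cong)
      fix x
      show "(\<integral>\<^sup>+y. ennreal (G n y) \<partial>kernel t x) * indicator M x = ennreal (S t (G n) x)"
      proof (cases "x \<in> M")
        case True
        then show ?thesis
          using S_kernel[OF Gm True t] integrable_kernel[OF Gb True t] G0 by (simp add: nn_integral_eq_integral)
      qed (simp add: S_outside)
    qed
    also have "\<dots> = ennreal (\<integral>x. S t (G n) x \<partial>\<mu>)"
      by (rule nn_integral_eq_integral) (auto intro!: integrable_bounded_borel S_bounded_borel Gb t AE_I2 S_nonneg G0)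
    also have "(\<integral>x. S t (G n) x \<partial>\<mu>) = L2_inner M (S t (G n)) (\<lambda>_. 1)" by (simp add: L2_inner_def)
    also have "\<dots> = L2_inner M (G n) (S t (\<lambda>_. 1))" by (rule S_symmetric[symmetric, OF Gb _ t]) simp
    also have "\<dots> = L2_inner M (G n) (\<lambda>_. 1)"
      by (rule L2_inner_cong) (use t in \<open>auto simp: S_const Gb intro: S_bounded_borel\<close>)
    also have "\<dots> = (\<integral>x. G n x \<partial>\<mu>)" by (simp add: L2_inner_def)
    also have "ennreal \<dots> = (\<integral>\<^sup>+x. ennreal (G n x) \<partial>\<mu>)"
      by (rule nn_integral_eq_integral[symmetric]) (auto intro!: integrable_bounded_borel Gb AE_I2 G0)
    finally show ?thesis .
  qed
  have mk: "(\<lambda>x. (\<integral>\<^sup>+y. ennreal (G n y) \<partial>kernel t x) * indicator M x) \<in> borel_measurable borel" for n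
  proof -
    have "(\<lambda>x. \<integral>\<^sup>+y. ennreal (G n y) \<partial>kernel t x) \<in> borel_measurable (restrict_space borel M)"
      by (rule measurable_compose[OF kernel_measurable[OF t] nn_integral_measurable_subprob_algebra]) simp
    then show ?thesis by (subst (asm) borel_measurable_restrict_space_iff_ennreal) auto
  qed
  have "(\<integral>\<^sup>+x. (\<integral>\<^sup>+y. ennreal \<bar>g y\<bar> \<partial>kernel t x) * indicator M x \<partial>\<mu>)
      = (\<integral>\<^sup>+x. (SUP n. (\<integral>\<^sup>+y. ennreal (G n y) \<partial>kernel t x) * indicator M x) \<partial>\<mu>)"
  proof (rule nn_integral_cong)
    fix x
    have "(\<integral>\<^sup>+y. ennreal \<bar>g y\<bar> \<partial>kernel t x) = (SUP n. \<integral>\<^sup>+y. ennreal (G n y) \<partial>kernel t x)"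
      unfolding sup[symmetric]
      by (rule nn_integral_monotone_convergence_SUP) (use inc in \<open>auto simp: incseq_def le_fun_def\<close>)
    then show "(\<integral>\<^sup>+y. ennreal \<bar>g y\<bar> \<partial>kernel t x) * indicator M x = (SUP n. (\<integral>\<^sup>+y. ennreal (G n y) \<partial>kernel t x) * indicator M x)"
      by (simp add: SUP_mult_right_ennreal)
  qed
  also have "\<dots> = (SUP n. \<integral>\<^sup>+x. (\<integral>\<^sup>+y. ennreal (G n y) \<partial>kernel t x) * indicator M x \<partial>\<mu>)"
    using mk inc by (intro nn_integral_monotone_convergence_SUP)
      (auto simp: incseq_def le_fun_def intro!: mult_right_mono nn_integral_mono)
  also have "\<dots> = (SUP n. \<integral>\<^sup>+x. ennreal (G n x) \<partial>\<mu>)" by (simp add: fin)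
  also have "\<dots> = (\<integral>\<^sup>+x. (SUP n. ennreal (G n x)) \<partial>\<mu>)"
    by (rule nn_integral_monotone_convergence_SUP[symmetric]) (use inc in \<open>auto simp: incseq_def le_fun_def\<close>)
  finally show ?thesis by (simp add: sup)
qed

text \<open>Jensen's inequality for the kernels and invariance of \<open>\<mu>\<close>. One of the functions
  is only assumed square integrable, since a limit in \<open>L2\<close> of bounded functions has
  to be inserted.\<close>

lemma S_L2_contraction:
  assumes u: "bounded_borel u" and h: "h \<in> L2 M" and t: "0 \<le> t"
  shows "(\<integral>\<^sup>+x. ennreal ((S t u x - S t h x)\<^sup>2) \<partial>\<mu>) \<le> (\<integral>\<^sup>+x. ennreal ((u x - h x)\<^sup>2) \<partial>\<mu>)"
proof -
  have hm [measurable]: "h \<in> borel_measurable borel" and h2: "integrable \<mu> (\<lambda>x. (h x)\<^sup>2)" using h by (auto simp: L2_def)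
  note [measurable] = bounded_borel_measurable[OF u]
  have "(\<integral>\<^sup>+x. (\<integral>\<^sup>+y. ennreal \<bar>(h y)\<^sup>2\<bar> \<partial>kernel t x) * indicator M x \<partial>\<mu>) = (\<integral>\<^sup>+x. ennreal \<bar>(h x)\<^sup>2\<bar> \<partial>\<mu>)"
    by (rule kernel_invariant_nn[OF _ t]) simp
  also have "\<dots> < \<infinity>" using h2 by (simp add: integrable_iff_bounded)
  finally have fin: "(\<integral>\<^sup>+x. (\<integral>\<^sup>+y. ennreal \<bar>(h y)\<^sup>2\<bar> \<partial>kernel t x) * indicator M x \<partial>\<mu>) \<noteq> \<infinity>" by simp
  have mk: "(\<lambda>x. (\<integral>\<^sup>+y. ennreal \<bar>(h y)\<^sup>2\<bar> \<partial>kernel t x) * indicator M x) \<in> borel_measurable \<mu>"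
  proof -
    have "(\<lambda>x. \<integral>\<^sup>+y. ennreal \<bar>(h y)\<^sup>2\<bar> \<partial>kernel t x) \<in> borel_measurable (restrict_space borel M)"
      by (rule measurable_compose[OF kernel_measurable[OF t] nn_integral_measurable_subprob_algebra]) simp
    then show ?thesis by (subst (asm) borel_measurable_restrict_space_iff_ennreal) auto
  qed
  have AEfin: "AE x in \<mu>. (\<integral>\<^sup>+y. ennreal \<bar>(h y)\<^sup>2\<bar> \<partial>kernel t x) * indicator M x \<noteq> \<infinity>"
    using nn_integral_noteq_infinite[OF mk fin] by simp
  have "(\<integral>\<^sup>+x. ennreal ((S t u x - S t h x)\<^sup>2) \<partial>\<mu>) \<le>
      (\<integral>\<^sup>+x. (\<integral>\<^sup>+y. ennreal \<bar>(u y - h y)\<^sup>2\<bar> \<partial>kernel t x) * indicator M x \<partial>\<mu>)"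
  proof (rule nn_integral_mono_AE)
    show "AE x in \<mu>. ennreal ((S t u x - S t h x)\<^sup>2) \<le> (\<integral>\<^sup>+y. ennreal \<bar>(u y - h y)\<^sup>2\<bar> \<partial>kernel t x) * indicator M x"
      using AEfin AE_in_M
    proof eventually_elim
      fix x assume f: "(\<integral>\<^sup>+y. ennreal \<bar>(h y)\<^sup>2\<bar> \<partial>kernel t x) * indicator M x \<noteq> \<infinity>" and x: "x \<in> M"
      interpret K: prob_space "kernel t x" by (rule kernel_prob[OF x t])
      have ih2: "integrable (kernel t x) (\<lambda>y. (h y)\<^sup>2)"
        using f x by (simp add: integrable_iff_bounded less_top)
      have iu: "integrable (kernel t x) u" by (rule integrable_kernel[OF u x t])
      have iu2: "integrable (kernel t x) (\<lambda>y. (u y)\<^sup>2)"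
        using integrable_kernel[OF bounded_borel_mult[OF u u] x t] by (simp add: power2_eq_square)
      have ih: "integrable (kernel t x) h"
        using integrable_mult_L2[of "h" "kernel t x" "\<lambda>_. 1"] ih2 by simp
      have iuh: "integrable (kernel t x) (\<lambda>y. u y * h y)" by (rule integrable_mult_L2[OF _ _ iu2 ih2]) measurable
      have id2: "integrable (kernel t x) (\<lambda>y. (u y - h y)\<^sup>2)"
        using iu2 ih2 iuh by (simp add: power2_diff mult.assoc)
      have "(S t u x - S t h x)\<^sup>2 = (\<integral>y. (u y - h y) * 1 \<partial>kernel t x)\<^sup>2"
        using iu ih by (simp add: S_kernel[OF _ x t])
      also have "\<dots> \<le> (\<integral>y. (u y - h y)\<^sup>2 \<partial>kernel t x) * (\<integral>y. 1\<^sup>2 \<partial>kernel t x)"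
        by (rule Cauchy_Schwarz_integral[OF _ _ id2]) auto
      also have "\<dots> = (\<integral>y. (u y - h y)\<^sup>2 \<partial>kernel t x)" using K.prob_space by simp
      finally have "ennreal ((S t u x - S t h x)\<^sup>2) \<le> ennreal (\<integral>y. (u y - h y)\<^sup>2 \<partial>kernel t x)" by (rule ennreal_leI)
      also have "\<dots> = (\<integral>\<^sup>+y. ennreal \<bar>(u y - h y)\<^sup>2\<bar> \<partial>kernel t x)"
        using nn_integral_eq_integral[OF id2] by simp
      finally show "ennreal ((S t u x - S t h x)\<^sup>2) \<le> (\<integral>\<^sup>+y. ennreal \<bar>(u y - h y)\<^sup>2\<bar> \<partial>kernel t x) * indicator M x"
        using x by simp
    qed
  qed
  also have "\<dots> = (\<integral>\<^sup>+x. ennreal \<bar>(u x - h x)\<^sup>2\<bar> \<partial>\<mu>)"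
    by (rule kernel_invariant_nn[OF _ t]) simp
  finally show ?thesis by simp
qed

text \<open>Expanding the square, \<open>\<parallel>u - S\<^sub>t u\<parallel>\<^sup>2 \<le> \<langle>u -
  S\<^sub>t u, u\<rangle>\<close>, because \<open>\<parallel>S\<^sub>t u\<parallel>\<^sup>2 =
  \<langle>S\<^sub>2\<^sub>t u, u\<rangle> \<le> \<langle>S\<^sub>t u, u\<rangle>\<close>.\<close>

lemma S_difference_bound:
  assumes u: "bounded_borel u" and t: "0 \<le> t"
  shows "L2_inner M (\<lambda>x. u x - S t u x) (\<lambda>x. u x - S t u x) \<le> t * approx_form M X P t u u"
proof (cases "t = 0")
  case True
  have "L2_inner M (\<lambda>x. u x - S 0 u x) (\<lambda>x. u x - S 0 u x) = L2_inner M (\<lambda>_. 0) (\<lambda>_. 0)"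
    by (rule L2_inner_cong) (use u S_0 in \<open>auto intro!: bounded_borel_diff S_bounded_borel simp: bounded_borel_measurable\<close>)
  then show ?thesis by (simp add: True L2_inner_def)
next
  case False
  have b: "bounded_borel (S t u)" by (rule S_bounded_borel[OF u t])
  have "L2_inner M (S t u) (S t u) = L2_inner M (S (t + t) u) u" using S_inner_split[OF u t t] by simp
  also have "\<dots> \<le> L2_inner M (S t u) u" using S_inner_antimono[OF u t, of "t + t"] t by simp
  finally have "L2_inner M (\<lambda>x. u x - S t u x) (\<lambda>x. u x - S t u x) \<le> L2_inner M u u - L2_inner M (S t u) u"
    unfolding L2_inner_square_diff[OF u b] using L2_inner_commute[of u "S t u"] by simp
  also have "L2_inner M u u = L2_inner M (S 0 u) u"
    by (rule L2_inner_cong) (use u S_0 in \<open>auto intro: S_bounded_borel simp: bounded_borel_measurable\<close>)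
  finally show ?thesis using False by (simp add: approx_form_eq[OF u t])
qed

text \<open>Constants are invariant, so the form does not see them.\<close>

lemma approx_form_shift:
  assumes f: "bounded_borel f" and t: "0 \<le> t"
  shows "approx_form M X P t (\<lambda>x. c * (f x - m)) (\<lambda>x. c * (f x - m)) = c\<^sup>2 * approx_form M X P t f f"
proof -
  have fm: "bounded_borel (\<lambda>x. f x - m)" using f by (intro bounded_borel_diff) auto
  have Sf: "bounded_borel (S t f)" by (rule S_bounded_borel[OF f t])
  have D: "bounded_borel (\<lambda>x. f x - S t f x)" by (rule bounded_borel_diff[OF f Sf])
  have eq: "c * (f x - m) - S t (\<lambda>x. c * (f x - m)) x = c * (f x - S t f x)" if "x \<in> M" for x
  proof -
    have "S t (\<lambda>x. f x - m) x = S t f x - m"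
      using S_add[OF f bounded_borel_const t, of "- m" x] S_const[OF t, of "- m" x] that by simp
    then show ?thesis unfolding S_cmult[OF fm t, of c x] by (simp add: right_diff_distrib)
  qed
  have "L2_inner M (\<lambda>x. c * (f x - m) - S t (\<lambda>x. c * (f x - m)) x) (\<lambda>x. c * (f x - m))
      = L2_inner M (\<lambda>x. f x - S t f x) (\<lambda>x. c\<^sup>2 * (f x - m))"
    by (rule L2_inner_cong)
      (use eq in \<open>auto simp: power2_eq_square intro!: D bounded_borel_diff bounded_borel_mult S_bounded_borel fm f t bounded_borel_const\<close>)
  also have "\<dots> = c\<^sup>2 * (L2_inner M (\<lambda>x. f x - S t f x) f - m * L2_inner M (\<lambda>x. f x - S t f x) (\<lambda>_. 1))"
  proof -
    have "L2_inner M (\<lambda>x. f x - S t f x) (\<lambda>x. c\<^sup>2 * (f x - m))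
        = (\<integral>x. c\<^sup>2 * ((f x - S t f x) * f x - m * ((f x - S t f x) * 1)) \<partial>\<mu>)"
      unfolding L2_inner_def
    proof (rule Bochner_Integration.integral_cong[OF refl])
      fix x show "(f x - S t f x) * (c\<^sup>2 * (f x - m)) = c\<^sup>2 * ((f x - S t f x) * f x - m * ((f x - S t f x) * 1))"
        by (simp add: right_diff_distrib left_diff_distrib mult.commute mult.left_commute)
    qed
    then show ?thesis
      using integrable_bounded_borel_mult[OF D f] integrable_bounded_borel[OF D]
      unfolding L2_inner_def by simp
  qed
  also have "L2_inner M (\<lambda>x. f x - S t f x) (\<lambda>_. 1) = 0"
  proof -
    have "L2_inner M (S t f) (\<lambda>_. 1) = L2_inner M f (S t (\<lambda>_. 1))" by (rule S_symmetric[symmetric, OF f _ t]) simp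
    also have "\<dots> = L2_inner M f (\<lambda>_. 1)"
      by (rule L2_inner_cong) (use t in \<open>auto simp: S_const f intro: S_bounded_borel\<close>)
    finally show ?thesis using L2_inner_diff[OF f Sf, of "\<lambda>_. 1"] by simp
  qed
  finally show ?thesis by (simp add: approx_form_def)
qed

text \<open>If no constant works, there are bounded \<open>u\<^sub>n\<close> of mean \<open>0\<close> and
  norm \<open>1\<close> with energy tending to \<open>0\<close>. Compactness of
  \<open>S\<^sub>1\<close> gives a subsequence with \<open>S\<^sub>1 u\<^sub>n\<close> converging
  to some \<open>h\<close>. Small energy makes \<open>u\<^sub>n - S\<^sub>t u\<^sub>n\<close>
  small, so \<open>u\<^sub>n\<close> converges to \<open>h\<close> as well and \<open>S\<^sub>t h
  = h\<close> for all \<open>t\<close>. Thus \<open>h\<close> is in the kernel of the Neumann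
  operator and constant, which is incompatible with mean \<open>0\<close> and norm
  \<open>1\<close> of the \<open>u\<^sub>n\<close>.\<close>

theorem poincare_inequality:
  assumes compact: "compact_semigroup M X P" and gap: "neumann_spectral_gap M"
  shows "\<exists>C>0. has_poincare C"
proof (rule ccontr)
  assume contr: "\<not> ?thesis"
  have "\<exists>f. bounded_borel f \<and> f \<in> H1 M \<and> real (Suc n) * energy M f f <
      L2_inner M (\<lambda>x. f x - (\<integral>x. f x \<partial>\<mu>)) (\<lambda>x. f x - (\<integral>x. f x \<partial>\<mu>))" for n
  proof -
    have "\<not> has_poincare (real (Suc n))" using contr by (metis of_nat_0_less_iff zero_less_Suc)
    then obtain f B where f: "f \<in> H1 M" "\<And>x. \<bar>f x\<bar> \<le> B"
      "\<not> L2_inner M (\<lambda>x. f x - (\<integral>x. f x \<partial>\<mu>)) (\<lambda>x. f x - (\<integral>x. f x \<partial>\<mu>)) \<le> real (Suc n) * energy M f f"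
      unfolding has_poincare_def by blast
    then show ?thesis by (intro exI[of _ f]) (auto simp: H1_def L2_def intro!: bounded_borelI)
  qed
  then obtain f where f: "\<And>n. bounded_borel (f n)" "\<And>n. f n \<in> H1 M" and
    big: "\<And>n. real (Suc n) * energy M (f n) (f n) < L2_inner M (\<lambda>x. f n x - (\<integral>x. f n x \<partial>\<mu>)) (\<lambda>x. f n x - (\<integral>x. f n x \<partial>\<mu>))"
    by metis
  define m where "m n = (\<integral>x. f n x \<partial>\<mu>)" for n
  define N where "N n = L2_inner M (\<lambda>x. f n x - m n) (\<lambda>x. f n x - m n)" for n
  have e0: "0 \<le> energy M (f n) (f n)" for n
    by (simp add: energy_def set_lebesgue_integral_def)
  have N: "0 < N n" "real (Suc n) * energy M (f n) (f n) < N n" for n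
    using big[of n] e0[of n] mult_nonneg_nonneg[of "real (Suc n)" "energy M (f n) (f n)"]
    unfolding N_def m_def by linarith+
  define c where "c n = 1 / sqrt (N n)" for n
  have c2: "(c n)\<^sup>2 = 1 / N n" for n using N(1)[of n] by (simp add: c_def power_divide)
  (* Counterexamples to the constants n + 1, normalized to mean 0 and norm 1. *)
  define u where "u n = (\<lambda>x. c n * (f n x - m n))" for n
  have ub: "bounded_borel (u n)" for n unfolding u_def
    by (intro bounded_borel_mult bounded_borel_diff f bounded_borel_const)
  have um [measurable]: "u n \<in> borel_measurable borel" for n using ub by (rule bounded_borel_measurable)
  have u1: "L2_inner M (u n) (u n) = 1" for n
  proof -
    have "L2_inner M (u n) (u n) = (c n)\<^sup>2 * N n"
      unfolding u_def N_def L2_inner_def by (simp add: power2_eq_square mult_ac flip: integral_mult_right_zero)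
    then show ?thesis using N(1)[of n] by (simp add: c2)
  qed
  have umean: "(\<integral>x. u n x \<partial>\<mu>) = 0" for n
    using integrable_bounded_borel[OF f(1)[of n]] by (simp add: u_def m_def)
  have form: "approx_form M X P t (u n) (u n) \<le> 1 / real (Suc n)" if t: "0 < t" for t n
  proof -
    have "approx_form M X P t (u n) (u n) = (c n)\<^sup>2 * approx_form M X P t (f n) (f n)"
      unfolding u_def by (rule approx_form_shift[OF f(1)]) (use t in simp)
    also have "\<dots> \<le> 1 / N n * energy M (f n) (f n)"
      unfolding c2 using approx_form_le_energy[OF f t, of n] N(1)[of n] by (intro mult_left_mono) auto
    also have "\<dots> \<le> 1 / real (Suc n)" using N[of n] by (simp add: field_simps)
    finally show ?thesis .
  qed
  have uL2: "u n \<in> L2 M" for n using ub[of n] unfolding bounded_borel_def using L2_bounded by blast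
  obtain h r where h: "h \<in> L2 M" and r: "strict_mono r"
    and lim: "(\<lambda>n. \<integral>x. (S 1 (u (r n)) x - h x)\<^sup>2 \<partial>\<mu>) \<longlonglongrightarrow> 0"
    using compact[unfolded compact_semigroup_def, rule_format, of 1 u] uL2 u1 by auto
  have hm [measurable]: "h \<in> borel_measurable borel" and h2: "integrable \<mu> (\<lambda>x. (h x)\<^sup>2)" using h by (auto simp: L2_def)
  have sq: "integrable \<mu> (\<lambda>x. (g x)\<^sup>2)" if "bounded_borel g" for g
    using integrable_bounded_borel_mult[OF that that] by (simp add: power2_eq_square)
  have diff2: "integrable \<mu> (\<lambda>x. (g x - h x)\<^sup>2)" if g: "bounded_borel g" for g
  proof -
    have "integrable \<mu> (\<lambda>x. g x * h x)"
      by (rule integrable_mult_L2[OF _ _ sq[OF g] h2]) (use g in \<open>auto simp: bounded_borel_measurable\<close>)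
    then show ?thesis using sq[OF g] h2 by (simp add: power2_diff mult.assoc)
  qed
  have St_small: "(\<lambda>n. \<integral>x. (u (r n) x - S t (u (r n)) x)\<^sup>2 \<partial>\<mu>) \<longlonglongrightarrow> 0" if t: "0 < t" for t
  proof (rule tendsto_sandwich[where f = "\<lambda>_. 0" and h = "\<lambda>n. t * (1 / real (Suc n))"])
    have "(\<integral>x. (u (r n) x - S t (u (r n)) x)\<^sup>2 \<partial>\<mu>) \<le> t * (1 / real (Suc n))" for n
    proof -
      have "(\<integral>x. (u (r n) x - S t (u (r n)) x)\<^sup>2 \<partial>\<mu>) \<le> t * approx_form M X P t (u (r n)) (u (r n))"
        using S_difference_bound[OF ub, of t "r n"] t by (simp add: L2_inner_def power2_eq_square)
      also have "\<dots> \<le> t * (1 / real (Suc (r n)))" using form[OF t] t by (intro mult_left_mono) auto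
      also have "\<dots> \<le> t * (1 / real (Suc n))"
        using t seq_suble[OF r, of n] by (intro mult_left_mono divide_left_mono) auto
      finally show ?thesis .
    qed
    then show "\<forall>\<^sub>F n in sequentially. (\<integral>x. (u (r n) x - S t (u (r n)) x)\<^sup>2 \<partial>\<mu>) \<le> t * (1 / real (Suc n))" by simp
    show "(\<lambda>n. t * (1 / real (Suc n))) \<longlonglongrightarrow> 0" using tendsto_mult_right_zero[OF LIMSEQ_inverse_real_of_nat, of t]
      by (simp add: inverse_eq_divide)
  qed auto
  have triangle: "(\<integral>x. (g1 x - h x)\<^sup>2 \<partial>\<mu>) \<le> 2 * (\<integral>x. (g1 x - g2 x)\<^sup>2 \<partial>\<mu>) + 2 * (\<integral>x. (g2 x - h x)\<^sup>2 \<partial>\<mu>)"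
    if g: "bounded_borel g1" "bounded_borel g2" for g1 g2
  proof -
    have "(\<integral>x. (g1 x - h x)\<^sup>2 \<partial>\<mu>) \<le> (\<integral>x. 2 * (g1 x - g2 x)\<^sup>2 + 2 * (g2 x - h x)\<^sup>2 \<partial>\<mu>)"
    proof (rule integral_mono)
      show "(g1 x - h x)\<^sup>2 \<le> 2 * (g1 x - g2 x)\<^sup>2 + 2 * (g2 x - h x)\<^sup>2" for x
        using zero_le_power2[of "(g1 x - g2 x) - (g2 x - h x)"] by (simp add: power2_eq_square algebra_simps)
    qed (use diff2[OF g(1)] diff2[OF g(2)] sq[OF bounded_borel_diff[OF g]] in auto)
    also have "\<dots> = 2 * (\<integral>x. (g1 x - g2 x)\<^sup>2 \<partial>\<mu>) + 2 * (\<integral>x. (g2 x - h x)\<^sup>2 \<partial>\<mu>)"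
      using diff2[OF g(2)] sq[OF bounded_borel_diff[OF g]] by simp
    finally show ?thesis .
  qed
  have u_lim: "(\<lambda>n. \<integral>x. (u (r n) x - h x)\<^sup>2 \<partial>\<mu>) \<longlonglongrightarrow> 0"
  proof (rule tendsto_sandwich[where f = "\<lambda>_. 0"])
    show "\<forall>\<^sub>F n in sequentially. (\<integral>x. (u (r n) x - h x)\<^sup>2 \<partial>\<mu>) \<le>
       2 * (\<integral>x. (u (r n) x - S 1 (u (r n)) x)\<^sup>2 \<partial>\<mu>) + 2 * (\<integral>x. (S 1 (u (r n)) x - h x)\<^sup>2 \<partial>\<mu>)"
      using triangle[OF ub S_bounded_borel[OF ub]] by simp
    show "(\<lambda>n. 2 * (\<integral>x. (u (r n) x - S 1 (u (r n)) x)\<^sup>2 \<partial>\<mu>) + 2 * (\<integral>x. (S 1 (u (r n)) x - h x)\<^sup>2 \<partial>\<mu>)) \<longlonglongrightarrow> 0"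
      using tendsto_add[OF tendsto_mult_right_zero[OF St_small[of 1], of 2] tendsto_mult_right_zero[OF lim, of 2]] by simp
  qed auto
  have fixed: "AE x in \<mu>. S t h x = h x" if t: "0 < t" for t
  proof -
    have "(\<integral>\<^sup>+x. ennreal ((S t h x - h x)\<^sup>2) \<partial>\<mu>) \<le> ennreal (2 * e)" if e: "0 < e" for e
    proof -
      have "\<forall>\<^sub>F n in sequentially. (\<integral>x. (u (r n) x - h x)\<^sup>2 \<partial>\<mu>) < e / 8 \<and> (\<integral>x. (u (r n) x - S t (u (r n)) x)\<^sup>2 \<partial>\<mu>) < e / 8"
        using order_tendstoD(2)[OF u_lim, of "e / 8"] order_tendstoD(2)[OF St_small[OF t], of "e / 8"] e
        by (intro eventually_conj) auto
      then obtain n where n: "(\<integral>x. (u (r n) x - h x)\<^sup>2 \<partial>\<mu>) < e / 8" "(\<integral>x. (u (r n) x - S t (u (r n)) x)\<^sup>2 \<partial>\<mu>) < e / 8"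
        using eventually_happens'[OF sequentially_bot] by blast
      let ?u = "u (r n)" and ?S = "S t (u (r n))"
      have t0: "0 \<le> t" using t by simp
      have Sm [measurable]: "S t h \<in> borel_measurable borel" "?S \<in> borel_measurable borel"
        using S_measurable[OF _ t0] by auto
      have "(\<integral>\<^sup>+x. ennreal ((S t h x - h x)\<^sup>2) \<partial>\<mu>) \<le>
         (\<integral>\<^sup>+x. ennreal 2 * ennreal ((?S x - S t h x)\<^sup>2) + ennreal 2 * ennreal ((?S x - h x)\<^sup>2) \<partial>\<mu>)"
      proof (rule nn_integral_mono)
        fix x
        have "(S t h x - h x)\<^sup>2 \<le> 2 * (?S x - S t h x)\<^sup>2 + 2 * (?S x - h x)\<^sup>2"
          using zero_le_power2[of "(?S x - S t h x) + (?S x - h x)"] by (simp add: power2_eq_square algebra_simps)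
        then show "ennreal ((S t h x - h x)\<^sup>2) \<le> ennreal 2 * ennreal ((?S x - S t h x)\<^sup>2) + ennreal 2 * ennreal ((?S x - h x)\<^sup>2)"
          by (metis (no_types) ennreal_leI ennreal_mult' ennreal_plus mult_nonneg_nonneg zero_le_numeral zero_le_power2)
      qed
      also have "\<dots> = ennreal 2 * (\<integral>\<^sup>+x. ennreal ((?S x - S t h x)\<^sup>2) \<partial>\<mu>) + ennreal 2 * (\<integral>\<^sup>+x. ennreal ((?S x - h x)\<^sup>2) \<partial>\<mu>)"
        by (subst nn_integral_add) (auto simp: nn_integral_cmult)
      also have "\<dots> \<le> ennreal 2 * ennreal (e / 8) + ennreal 2 * ennreal (e / 2)"
      proof (intro add_mono mult_left_mono)
        have "(\<integral>\<^sup>+x. ennreal ((?S x - S t h x)\<^sup>2) \<partial>\<mu>) \<le> (\<integral>\<^sup>+x. ennreal ((?u x - h x)\<^sup>2) \<partial>\<mu>)"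
          by (rule S_L2_contraction[OF ub h t0])
        also have "\<dots> = ennreal (\<integral>x. (?u x - h x)\<^sup>2 \<partial>\<mu>)" by (rule nn_integral_eq_integral[OF diff2[OF ub]]) simp
        also have "\<dots> \<le> ennreal (e / 8)" using n(1) by (intro ennreal_leI) simp
        finally show "(\<integral>\<^sup>+x. ennreal ((?S x - S t h x)\<^sup>2) \<partial>\<mu>) \<le> ennreal (e / 8)" .
        have sb: "bounded_borel ?S" by (rule S_bounded_borel[OF ub t0])
        have "(\<integral>x. (?S x - h x)\<^sup>2 \<partial>\<mu>) \<le> 2 * (\<integral>x. (?S x - ?u x)\<^sup>2 \<partial>\<mu>) + 2 * (\<integral>x. (?u x - h x)\<^sup>2 \<partial>\<mu>)"
          by (rule triangle[OF sb ub])
        also have "(\<integral>x. (?S x - ?u x)\<^sup>2 \<partial>\<mu>) = (\<integral>x. (?u x - ?S x)\<^sup>2 \<partial>\<mu>)" by (simp add: power2_commute)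
        finally have "(\<integral>x. (?S x - h x)\<^sup>2 \<partial>\<mu>) \<le> e / 2" using n by simp
        then show "(\<integral>\<^sup>+x. ennreal ((?S x - h x)\<^sup>2) \<partial>\<mu>) \<le> ennreal (e / 2)"
          by (subst nn_integral_eq_integral[OF diff2[OF sb]]) (auto intro: ennreal_leI)
      qed auto
      also have "\<dots> \<le> ennreal (2 * e)"
      proof -
        have "ennreal 2 * ennreal (e / 8) + ennreal 2 * ennreal (e / 2) = ennreal (2 * (e / 8)) + ennreal (2 * (e / 2))"
          using e by (simp only: ennreal_mult' zero_le_numeral)
        also have "\<dots> = ennreal (2 * (e / 8) + 2 * (e / 2))"
          by (rule ennreal_plus[symmetric]) (use e in auto)
        also have "\<dots> \<le> ennreal (2 * e)" by (rule ennreal_leI) (use e in auto)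
        finally show ?thesis .
      qed
      finally show ?thesis .
    qed
    note small = this
    have "(\<integral>\<^sup>+x. ennreal ((S t h x - h x)\<^sup>2) \<partial>\<mu>) \<le> 0"
    proof (rule ennreal_le_epsilon)
      fix e :: real assume "0 < e"
      then show "(\<integral>\<^sup>+x. ennreal ((S t h x - h x)\<^sup>2) \<partial>\<mu>) \<le> 0 + ennreal e" using small[of "e / 2"] by simp
    qed
    then have "(\<integral>\<^sup>+x. ennreal ((S t h x - h x)\<^sup>2) \<partial>\<mu>) = 0" by simp
    then have "AE x in \<mu>. ennreal ((S t h x - h x)\<^sup>2) = 0"
      using S_measurable[OF hm, of t] t by (subst (asm) nn_integral_0_iff_AE) auto
    then show ?thesis by (rule eventually_mono) (simp add: ennreal_eq_0_iff)
  qed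
  have zero_form: "approx_form M X P t h g = 0" if "0 < t" for t g
  proof -
    have "L2_inner M (\<lambda>x. h x - S t h x) g = 0"
      unfolding L2_inner_def
      by (rule integral_eq_zero_AE) (use fixed[OF that] in \<open>auto elim: eventually_mono\<close>)
    then show ?thesis by (simp add: approx_form_def)
  qed
  have zlim: "((\<lambda>t. approx_form M X P t h g) \<longlongrightarrow> 0) (at_right 0)" for g
    by (rule tendsto_eventually) (auto simp: eventually_at_right_field zero_form intro!: exI[of _ 1])
  have hH1: "h \<in> H1 M" using form_associated h zlim[of h] unfolding associated_with_neumann_form_def by blast
  have "energy M h v = 0" if v: "v \<in> H1 M" for v
  proof -
    have "((\<lambda>t. approx_form M X P t h v) \<longlongrightarrow> energy M h v) (at_right 0)"
      using form_associated hH1 v unfolding associated_with_neumann_form_def by blast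
    then show ?thesis using tendsto_unique[OF _ _ zlim[of v]] by simp
  qed
  then have "h \<in> neumann_eigenspace M 0"
    using hH1 L2_bounded[of "\<lambda>_. 0" 0] by (simp add: neumann_eigenspace_def neumann_op_def L2_inner_def)
  then obtain k where k: "AE x in \<mu>. h x = k" using gap unfolding neumann_spectral_gap_def by blast
  (* A constant k is at square distance 1 + k\<^sup>2 from any function of mean 0 and norm 1. *)
  have eqk: "(\<integral>x. (u (r n) x - h x)\<^sup>2 \<partial>\<mu>) = 1 + k\<^sup>2" for n
  proof -
    have "(\<integral>x. (u (r n) x - h x)\<^sup>2 \<partial>\<mu>) = (\<integral>x. (u (r n) x - k)\<^sup>2 \<partial>\<mu>)"
      using k by (intro integral_cong_AE) (auto elim: eventually_mono)
    also have "\<dots> = (\<integral>x. (u (r n) x)\<^sup>2 \<partial>\<mu>) - 2 * k * (\<integral>x. u (r n) x \<partial>\<mu>) + k\<^sup>2"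
      using sq[OF ub, of "r n"] integrable_bounded_borel[OF ub, of "r n"] by (simp add: power2_diff)
    also have "(\<integral>x. (u (r n) x)\<^sup>2 \<partial>\<mu>) = 1" using u1[of "r n"] by (simp add: L2_inner_def power2_eq_square)
    finally show ?thesis by (simp add: umean)
  qed
  have "1 + k\<^sup>2 = 0" using u_lim unfolding eqk by (simp add: LIMSEQ_const_iff)
  moreover have "0 \<le> k\<^sup>2" by simp
  ultimately show False by linarith
qed

end

section \<open>The law on path space\<close>

text \<open>A continuous path is evaluated at a random time through the dyadic approximations of this time
  from below, which have countably many values.\<close>

lemma measurable_eval_random_time:
  fixes X :: "real \<Rightarrow> 'w \<Rightarrow> 'a::metric_space"
  assumes X: "\<And>t. 0 \<le> t \<Longrightarrow> X t \<in> borel_measurable N"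
    and cont: "\<And>\<omega>. \<omega> \<in> space N \<Longrightarrow> continuous_on {0..} (\<lambda>t. X t \<omega>)"
    and \<sigma> [measurable]: "\<sigma> \<in> borel_measurable N" and nonneg: "\<And>\<omega>. \<omega> \<in> space N \<Longrightarrow> 0 \<le> \<sigma> \<omega>"
  shows "(\<lambda>\<omega>. X (\<sigma> \<omega>) \<omega>) \<in> borel_measurable N"
proof (rule borel_measurable_LIMSEQ_metric)
  fix n :: nat
  have "(\<lambda>\<omega>. nat \<lfloor>\<sigma> \<omega> * 2 ^ n\<rfloor>) \<in> N \<rightarrow>\<^sub>M count_space UNIV" by measurable
  from measurable_compose_countable[OF X this, of "\<lambda>i. real i / 2 ^ n"]
  show "(\<lambda>\<omega>. X (real (nat \<lfloor>\<sigma> \<omega> * 2 ^ n\<rfloor>) / 2 ^ n) \<omega>) \<in> borel_measurable N" by simp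
next
  fix \<omega> assume \<omega>: "\<omega> \<in> space N"
  have s: "0 \<le> \<sigma> \<omega>" by (rule nonneg[OF \<omega>])
  have near: "\<bar>real (nat \<lfloor>\<sigma> \<omega> * 2 ^ n\<rfloor>) / 2 ^ n - \<sigma> \<omega>\<bar> \<le> (1 / 2) ^ n" for n :: nat
  proof -
    have "0 \<le> \<lfloor>\<sigma> \<omega> * 2 ^ n\<rfloor>" using s by simp
    then have "\<bar>real (nat \<lfloor>\<sigma> \<omega> * 2 ^ n\<rfloor>) - \<sigma> \<omega> * 2 ^ n\<bar> \<le> 1" by (simp add: abs_le_iff) linarith
    then have "\<bar>real (nat \<lfloor>\<sigma> \<omega> * 2 ^ n\<rfloor>) - \<sigma> \<omega> * 2 ^ n\<bar> / 2 ^ n \<le> 1 / 2 ^ n" by (intro divide_right_mono) auto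
    also have "\<bar>real (nat \<lfloor>\<sigma> \<omega> * 2 ^ n\<rfloor>) - \<sigma> \<omega> * 2 ^ n\<bar> / 2 ^ n
        = \<bar>(real (nat \<lfloor>\<sigma> \<omega> * 2 ^ n\<rfloor>) - \<sigma> \<omega> * 2 ^ n) / 2 ^ n\<bar>" by (rule abs_div_pos) simp
    also have "\<dots> = \<bar>real (nat \<lfloor>\<sigma> \<omega> * 2 ^ n\<rfloor>) / 2 ^ n - \<sigma> \<omega>\<bar>" by (simp add: diff_divide_distrib)
    finally show ?thesis by (simp add: power_one_over)
  qed
  have "(\<lambda>n. (1 / 2 :: real) ^ n) \<longlonglongrightarrow> 0" by (rule LIMSEQ_realpow_zero) auto
  then have "(\<lambda>n. real (nat \<lfloor>\<sigma> \<omega> * 2 ^ n\<rfloor>) / 2 ^ n - \<sigma> \<omega>) \<longlonglongrightarrow> 0"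
    by (rule tendsto_rabs_zero_cancel[OF tendsto_sandwich[OF _ _ tendsto_const, rotated 2]]) (use near in auto)
  then have "(\<lambda>n. real (nat \<lfloor>\<sigma> \<omega> * 2 ^ n\<rfloor>) / 2 ^ n) \<longlonglongrightarrow> \<sigma> \<omega>" by (simp add: LIM_zero_iff)
  from continuous_on_tendsto_compose[OF cont[OF \<omega>] this]
  show "(\<lambda>n. X (real (nat \<lfloor>\<sigma> \<omega> * 2 ^ n\<rfloor>) / 2 ^ n) \<omega>) \<longlonglongrightarrow> X (\<sigma> \<omega>) \<omega>" using s by simp
qed

lemma space_path_space:
  "space (path_space M) = {w. continuous_on {0..} w \<and> (\<forall>t\<ge>0. w t \<in> M) \<and> w \<in> extensional {0..}}"
  by (auto simp: path_space_def space_restrict_space space_PiM PiE_def)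

lemma measurable_coordinate: "0 \<le> t \<Longrightarrow> coordinate t \<in> borel_measurable (path_space M)"
  unfolding path_space_def coordinate_def by (intro measurable_restrict_space1 measurable_component_singleton) auto

context rbm begin

text \<open>Paths are restricted to nonnegative times, as the elements of the product space are.\<close>

definition path_of :: "'w \<Rightarrow> real \<Rightarrow> 'a" where "path_of \<omega> = restrict (\<lambda>t. X t \<omega>) {0..}"

definition law :: "'a \<Rightarrow> (real \<Rightarrow> 'a) measure" where "law z = distr (P z) (path_space M) path_of"

lemma X_continuous: "\<omega> \<in> space Om \<Longrightarrow> continuous_on {0..} (\<lambda>t. X t \<omega>)"
  using hunt_process by (simp add: continuous_hunt_process_def)

lemma coordinate_path_of [simp]: "0 \<le> t \<Longrightarrow> coordinate t (path_of \<omega>) = X t \<omega>"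
  by (simp add: coordinate_def path_of_def)

lemma path_of_in_space: "\<omega> \<in> space Om \<Longrightarrow> path_of \<omega> \<in> space (path_space M)"
  using X_continuous[of \<omega>] X_in_M[of _ \<omega>]
  by (auto simp: space_path_space path_of_def cong: continuous_on_cong_simp)

lemma measurable_path_of: "path_of \<in> Om \<rightarrow>\<^sub>M path_space M"
  unfolding path_space_def
proof (rule measurable_restrict_space2)
  show "path_of \<in> space Om \<rightarrow> {w. continuous_on {0..} w \<and> (\<forall>t\<ge>0. w t \<in> M)}"
    using path_of_in_space by (auto simp: space_path_space)
  show "path_of \<in> Om \<rightarrow>\<^sub>M Pi\<^sub>M {0..} (\<lambda>_. borel)"
    unfolding path_of_def by (rule measurable_restrict) (use X_meas in auto)
qed

lemma measurable_path_ofP: "z \<in> M \<Longrightarrow> path_of \<in> P z \<rightarrow>\<^sub>M path_space M"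
  using measurable_path_of measurable_cong_sets[OF P_sets[of z] refl, of "path_space M"] by simp

lemma sets_law [simp]: "sets (law z) = sets (path_space M)" and space_law [simp]: "space (law z) = space (path_space M)"
  by (simp_all add: law_def)

lemma measure_law:
  "z \<in> M \<Longrightarrow> A \<in> sets (path_space M) \<Longrightarrow> measure (law z) A = measure (P z) {\<omega>\<in>space Om. path_of \<omega> \<in> A}"
  unfolding law_def using measurable_path_ofP[of z] P_space[of z]
  by (subst measure_distr) (auto intro!: arg_cong[of _ _ "measure (P z)"])

lemma integral_law:
  fixes f :: "_ \<Rightarrow> real"
  shows "z \<in> M \<Longrightarrow> f \<in> borel_measurable (path_space M) \<Longrightarrow> (\<integral>w. f w \<partial>law z) = (\<integral>\<omega>. f (path_of \<omega>) \<partial>P z)"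
  unfolding law_def using measurable_path_ofP[of z] by (intro integral_distr) auto

lemma law_marginal: "z \<in> M \<Longrightarrow> 0 \<le> t \<Longrightarrow> distr (law z) borel (coordinate t) = distr (P z) borel (X t)"
  unfolding law_def using measurable_path_ofP[of z] measurable_coordinate[of t M]
  by (subst distr_distr) (auto simp: comp_def intro!: distr_cong)

lemma coordinate_event: "0 \<le> t \<Longrightarrow> B \<in> sets borel \<Longrightarrow> {w\<in>space (path_space M). coordinate t w \<in> B} \<in> sets (path_space M)"
  using measurable_sets[OF measurable_coordinate[of t M], of B] by (simp add: vimage_def Int_def conj_commute)

lemma law_event:
  "z \<in> M \<Longrightarrow> 0 \<le> t \<Longrightarrow> B \<in> sets borel \<Longrightarrow>
    measure (law z) {w\<in>space (path_space M). coordinate t w \<in> B} = measure (P z) {\<omega>\<in>space Om. X t \<omega> \<in> B}"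
  by (subst measure_law) (auto simp: coordinate_event path_of_in_space intro!: arg_cong[of _ _ "measure (P z)"])

lemma path_of_natural_filtration:
  "path_of \<in> natural_filtration Om X t \<rightarrow>\<^sub>M natural_filtration (path_space M) coordinate t"
proof (rule measurable_sigma_sets[OF sets_natural_filtration])
  show "path_of \<in> space (natural_filtration Om X t) \<rightarrow> space (path_space M)"
    by (auto simp: path_of_in_space)
  fix A assume "A \<in> {coordinate s -` B \<inter> space (path_space M) | s B. 0 \<le> s \<and> s \<le> t \<and> B \<in> sets borel}"
  then obtain s B where A: "A = coordinate s -` B \<inter> space (path_space M)" "0 \<le> s" "s \<le> t" "B \<in> sets borel" by blast
  then have "path_of -` A \<inter> space (natural_filtration Om X t) = X s -` B \<inter> space Om"
    by (auto simp: path_of_in_space)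
  then show "path_of -` A \<inter> space (natural_filtration Om X t) \<in> sets (natural_filtration Om X t)"
    unfolding sets_natural_filtration using A by (auto intro!: sigma_sets.Basic)
qed auto

text \<open>Stopping times and events of their past pull back along a map that respects the filtrations.\<close>

lemma path_of_right_filtration:
  "path_of \<in> right_filtration Om X t \<rightarrow>\<^sub>M right_filtration (path_space M) coordinate t"
proof (rule measurable_sigma_sets[OF sets_right_filtration])
  show "path_of \<in> space (right_filtration Om X t) \<rightarrow> space (path_space M)"
    by (auto simp: path_of_in_space)
  have "(\<Inter>u\<in>{t<..}. sets (natural_filtration (path_space M) coordinate u)) \<subseteq> sets (natural_filtration (path_space M) coordinate (t + 1))"
    by auto
  also have "\<dots> \<subseteq> Pow (space (path_space M))" using sets.space_closed[of "natural_filtration (path_space M) coordinate (t + 1)"] by simp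
  finally show "(\<Inter>u\<in>{t<..}. sets (natural_filtration (path_space M) coordinate u)) \<subseteq> Pow (space (path_space M))" .
  fix A assume A: "A \<in> (\<Inter>u\<in>{t<..}. sets (natural_filtration (path_space M) coordinate u))"
  have "path_of -` A \<inter> space Om \<in> sets (natural_filtration Om X u)" if "t < u" for u
    using measurable_sets[OF path_of_natural_filtration[of u], of A] A that by auto
  then show "path_of -` A \<inter> space (right_filtration Om X t) \<in> sets (right_filtration Om X t)"
    unfolding sets_right_filtration by (auto intro!: sigma_sets.Basic)
qed

text \<open>Given a stopping time on path space, the strong Markov property of \<open>X\<close> is applied
  to its pullback. Integrals and probabilities are then transported to path space; this requires
  measurability of the position at a random time.\<close>

lemma strong_markov_law: "strong_markov M (path_space M) coordinate law"
  unfolding strong_markov_def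
proof (intro ballI allI impI)
  fix z \<tau> A and s :: real and B :: "'a set"
  assume z: "z \<in> M" and \<tau>: "stopping_time (right_filtration (path_space M) coordinate) \<tau> \<and> (\<forall>\<omega>\<in>space (path_space M). 0 \<le> \<tau> \<omega>)"
    and A: "A \<in> sets (filtration.pre_sigma (space (path_space M)) (right_filtration (path_space M) coordinate) \<tau>)"
    and s: "0 \<le> s" and B: "B \<in> sets borel"
  interpret W: filtration "space (path_space M)" "right_filtration (path_space M) coordinate" by (rule filtration_right_filtration)
  interpret F: filtration "space Om" "right_filtration Om X" by (rule filtration_right_filtration)
  have \<tau>1: "stopping_time (right_filtration (path_space M) coordinate) \<tau>" and \<tau>0: "\<And>w. w \<in> space (path_space M) \<Longrightarrow> 0 \<le> \<tau> w"
    using \<tau> by auto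
  have fs: "sets (right_filtration (path_space M) coordinate t) \<subseteq> sets (path_space M)" for t
    by (rule sets_right_filtration_le[OF measurable_coordinate])
  have \<tau>m [measurable]: "\<tau> \<in> borel_measurable (path_space M)"
    by (rule measurable_stopping_time[OF \<tau>1]) (use fs in auto)
  have At: "{w\<in>A. \<tau> w \<le> t} \<in> sets (right_filtration (path_space M) coordinate t)" for t
    by (rule W.sets_pre_sigmaD[OF \<tau>1 A])
  (* Measurability of A itself, from its parts with bounded \<tau>. *)
  have "A = (\<Union>n. {w\<in>A. \<tau> w \<le> real n})" using real_arch_simple by auto
  also have "\<dots> \<in> sets (path_space M)" using At fs by (intro sets.countable_UN) blast
  finally have Am [measurable]: "A \<in> sets (path_space M)" .
  have AW: "A \<subseteq> space (path_space M)" by (rule sets.sets_into_space[OF Am])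
  let ?\<tau> = "\<lambda>\<omega>. \<tau> (path_of \<omega>)" and ?A = "{\<omega>\<in>space Om. path_of \<omega> \<in> A}"
  have \<tau>': "stopping_time (right_filtration Om X) ?\<tau>"
    unfolding stopping_time_def by (intro allI measurable_compose[OF path_of_right_filtration] stopping_timeD[OF \<tau>1])
  have A': "?A \<in> sets (F.pre_sigma ?\<tau>)"
  proof (rule F.sets_pre_sigmaI[OF \<tau>'])
    fix t
    have "{\<omega>\<in>?A. ?\<tau> \<omega> \<le> t} = path_of -` {w\<in>A. \<tau> w \<le> t} \<inter> space (right_filtration Om X t)" by auto
    also have "\<dots> \<in> sets (right_filtration Om X t)" by (rule measurable_sets[OF path_of_right_filtration At])
    finally show "{\<omega>\<in>?A. ?\<tau> \<omega> \<le> t} \<in> sets (right_filtration Om X t)" .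
  qed
  have eval: "(\<lambda>w. coordinate (\<sigma> w) w) \<in> borel_measurable (path_space M)"
    if "\<sigma> \<in> borel_measurable (path_space M)" "\<And>w. w \<in> space (path_space M) \<Longrightarrow> 0 \<le> \<sigma> w" for \<sigma>
    by (rule measurable_eval_random_time[OF measurable_coordinate _ that])
       (auto simp: space_path_space coordinate_def)
  have ev: "{w\<in>A. coordinate (\<tau> w + s) w \<in> B} \<in> sets (path_space M)"
  proof -
    have "(\<lambda>w. coordinate (\<tau> w + s) w) \<in> borel_measurable (path_space M)" using \<tau>0 s by (intro eval) (auto intro: add_nonneg_nonneg)
    from measurable_sets[OF this B] Am have "((\<lambda>w. coordinate (\<tau> w + s) w) -` B \<inter> space (path_space M)) \<inter> A \<in> sets (path_space M)" by auto
    also have "((\<lambda>w. coordinate (\<tau> w + s) w) -` B \<inter> space (path_space M)) \<inter> A = {w\<in>A. coordinate (\<tau> w + s) w \<in> B}" using AW by auto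
    finally show ?thesis .
  qed
  have "measure (law z) {w\<in>A. coordinate (\<tau> w + s) w \<in> B} = measure (P z) {\<omega>\<in>space Om. path_of \<omega> \<in> {w\<in>A. coordinate (\<tau> w + s) w \<in> B}}"
    by (rule measure_law[OF z ev])
  also have "\<dots> = measure (P z) {\<omega>\<in>?A. X (?\<tau> \<omega> + s) \<omega> \<in> B}"
    using s \<tau>0 path_of_in_space by (intro arg_cong[of _ _ "measure (P z)"]) (auto simp: add_nonneg_nonneg)
  also have "\<dots> = (\<integral>\<omega>. indicator ?A \<omega> * measure (P (X (?\<tau> \<omega>) \<omega>)) {\<omega>'\<in>space Om. X s \<omega>' \<in> B} \<partial>P z)"
  proof -
    have "strong_markov M Om X P" using hunt_process by (simp add: continuous_hunt_process_def)
    then show ?thesis unfolding strong_markov_def using z \<tau>' A' s B \<tau>0 path_of_in_space by blast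
  qed
  also have "\<dots> = (\<integral>\<omega>. indicator A (path_of \<omega>) * measure (kernel s (coordinate (\<tau> (path_of \<omega>)) (path_of \<omega>))) B \<partial>P z)"
  proof (rule Bochner_Integration.integral_cong[OF refl])
    fix \<omega> assume "\<omega> \<in> space (P z)"
    then have \<omega>: "\<omega> \<in> space Om" using P_space[OF z] by simp
    have t0: "0 \<le> ?\<tau> \<omega>" by (rule \<tau>0[OF path_of_in_space[OF \<omega>]])
    show "indicator ?A \<omega> * measure (P (X (?\<tau> \<omega>) \<omega>)) {\<omega>'\<in>space Om. X s \<omega>' \<in> B}
        = indicator A (path_of \<omega>) * measure (kernel s (coordinate (\<tau> (path_of \<omega>)) (path_of \<omega>))) B"
      using \<omega> t0 kernel_measure[OF X_in_M[OF t0 \<omega>] s B] by (simp add: indicator_def)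
  qed
  also have "\<dots> = (\<integral>w. indicator A w * measure (kernel s (coordinate (\<tau> w) w)) B \<partial>law z)"
  proof (rule integral_law[OF z, symmetric])
    have "(\<lambda>w. coordinate (\<tau> w) w) \<in> path_space M \<rightarrow>\<^sub>M restrict_space borel M"
    proof (rule measurable_restrict_space2)
      show "(\<lambda>w. coordinate (\<tau> w) w) \<in> space (path_space M) \<rightarrow> M" using \<tau>0 by (auto simp: space_path_space coordinate_def)
    qed (use eval \<tau>0 in auto)
    from measurable_compose[OF measurable_compose[OF this kernel_measurable[OF s]] measurable_emeasure_subprob_algebra[OF B]]
    show "(\<lambda>w. indicator A w * measure (kernel s (coordinate (\<tau> w) w)) B) \<in> borel_measurable (path_space M)"
      unfolding measure_def by measurable
  qed
  also have "\<dots> = (\<integral>w. indicator A w * measure (law (coordinate (\<tau> w) w)) {w'\<in>space (path_space M). coordinate s w' \<in> B} \<partial>law z)"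
  proof (rule Bochner_Integration.integral_cong[OF refl])
    fix w assume "w \<in> space (law z)"
    then have w: "w \<in> space (path_space M)" by simp
    then have "coordinate (\<tau> w) w \<in> M" using \<tau>0[OF w] by (simp add: space_path_space coordinate_def)
    then show "indicator A w * measure (kernel s (coordinate (\<tau> w) w)) B
        = indicator A w * measure (law (coordinate (\<tau> w) w)) {w'\<in>space (path_space M). coordinate s w' \<in> B}"
      using law_event[OF _ s B] kernel_measure[OF _ s B] by simp
  qed
  finally show "measure (law z) {w\<in>A. coordinate (\<tau> w + s) w \<in> B} =
     (\<integral>w. indicator A w * measure (law (coordinate (\<tau> w) w)) {w'\<in>space (path_space M). coordinate s w' \<in> B} \<partial>law z)" .
qed

lemma semigroup_law:
  assumes "f \<in> borel_measurable borel" "0 \<le> t" shows "semigroup M coordinate law t f = S t f"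
proof
  fix x show "semigroup M coordinate law t f x = S t f x"
    using assms measurable_compose[OF measurable_coordinate[of t M] assms(1)]
    by (cases "x \<in> M") (simp_all add: semigroup_def integral_law)
qed

text \<open>All conditions in the definition of reflected Brownian motion are conditions on the law on path
  space.\<close>

theorem canonical_law: "canonical_reflected_brownian_motion M law"
  unfolding reflected_brownian_motion_def
proof (intro conjI)
  show "continuous_hunt_process M (path_space M) coordinate law"
    unfolding continuous_hunt_process_def
  proof (intro conjI allI ballI impI)
    fix t :: real assume t: "0 \<le> t"
    show "coordinate t \<in> borel_measurable (path_space M)" by (rule measurable_coordinate[OF t])
    show "coordinate t w \<in> M" if "w \<in> space (path_space M)" for w
      using that t by (simp add: space_path_space coordinate_def)
    fix B :: "'a set" assume B: "B \<in> sets borel"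
    have "(\<lambda>z. measure (P z) {\<omega> \<in> space Om. X t \<omega> \<in> B}) \<in> borel_measurable (restrict_space borel M)"
      using hunt_process t B by (simp add: continuous_hunt_process_def)
    then show "(\<lambda>z. measure (law z) {w \<in> space (path_space M). coordinate t w \<in> B}) \<in> borel_measurable (restrict_space borel M)"
      by (rule measurable_cong[THEN iffD2, rotated]) (use law_event[OF _ t B] in \<open>auto simp: space_restrict_space\<close>)
  next
    fix w assume "w \<in> space (path_space M)"
    then show "continuous_on {0..} (\<lambda>t. coordinate t w)" by (simp add: space_path_space coordinate_def)
  next
    fix z assume z: "z \<in> M"
    show "prob_space (law z)" unfolding law_def by (rule prob_space.prob_space_distr[OF P_prob[OF z] measurable_path_ofP[OF z]])
    show "sets (law z) = sets (path_space M)" by simp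
    have "{w \<in> space (path_space M). coordinate 0 w = z} \<in> sets (path_space M)"
      using coordinate_event[of 0 "{z}"] by simp
    then show "AE w in law z. coordinate 0 w = z"
      unfolding law_def using P_start[OF z] by (subst AE_distr_iff[OF measurable_path_ofP[OF z]]) auto
  qed (rule strong_markov_law)
  show "symmetric_process M coordinate law"
    using process_symmetric unfolding symmetric_process_def by (simp add: semigroup_law)
  show "associated_with_neumann_form M coordinate law"
  proof -
    have "((\<lambda>t. approx_form M coordinate law t f g) \<longlongrightarrow> l) (at_right 0) \<longleftrightarrow> ((\<lambda>t. approx_form M X P t f g) \<longlongrightarrow> l) (at_right 0)"
      if "f \<in> L2 M" for f g l
      by (rule filterlim_cong[OF refl refl])
         (use that in \<open>auto simp: eventually_at_right_field approx_form_def semigroup_law L2_def intro!: exI[of _ 1]\<close>)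
    then show ?thesis using form_associated unfolding associated_with_neumann_form_def by (auto simp: H1_def)
  qed
  show "\<forall>z\<in>M. \<forall>t>0. absolutely_continuous \<mu> (distr (law z) borel (coordinate t))"
    using RBM by (simp add: reflected_brownian_motion_def law_marginal)
qed

text \<open>Both the law of \<open>X\<close> and the canonical process that carries the heat kernel are
  canonical reflected Brownian motions, hence equal by uniqueness.\<close>

theorem marginal_density:
  assumes unique: "\<And>Q. canonical_reflected_brownian_motion M Q \<Longrightarrow> \<forall>z\<in>M. Q z = P0 z"
    and p: "neumann_heat_kernel M p" and t: "0 < t" and z: "z \<in> M"
  shows "distr (P z) borel (X t) = density \<mu> (\<lambda>y. ennreal (p t z y))"
proof -
  obtain Q where Q: "canonical_reflected_brownian_motion M Q" "symmetric_transition_density M coordinate Q p"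
    using p unfolding neumann_heat_kernel_def by blast
  have "law z = Q z" using unique[OF canonical_law] unique[OF Q(1)] z by simp
  then have "distr (P z) borel (X t) = distr (Q z) borel (coordinate t)" using law_marginal[OF z, of t] t by simp
  then show ?thesis using Q(2) t z unfolding symmetric_transition_density_def by simp
qed

end

section \<open>Homotopy invariance of homology with field coefficients\<close>

text \<open>The linear extension, over the field of coefficients, of a map that assigns integral chains to
  generators. Boundary operators, induced maps and homotopy operators are all of this form, so
  identities between integral chains carry over by \<open>coeff_extend_compose\<close>.\<close>

definition coeff_extend :: "('b \<Rightarrow> ('a \<Rightarrow>\<^sub>0 int)) \<Rightarrow> ('b \<Rightarrow>\<^sub>0 'k::field) \<Rightarrow> ('a \<Rightarrow>\<^sub>0 'k)" where
  "coeff_extend F c = (\<Sum>\<sigma>\<in>Poly_Mapping.keys c. Poly_Mapping.map (\<lambda>n. Poly_Mapping.lookup c \<sigma> * of_int n) (F \<sigma>))"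

lemma lookup_map_zero:
  "f 0 = 0 \<Longrightarrow> Poly_Mapping.lookup (Poly_Mapping.map f c) x = f (Poly_Mapping.lookup c x)"
  by (simp add: Poly_Mapping.map.rep_eq when_def)

lemma lookup_chain_scale [simp]: "Poly_Mapping.lookup (chain_scale a c) \<sigma> = a * Poly_Mapping.lookup c \<sigma>"
  by (simp add: chain_scale_def lookup_map_zero)

lemma lookup_coeff_extend:
  assumes "finite A" "Poly_Mapping.keys c \<subseteq> A"
  shows "Poly_Mapping.lookup (coeff_extend F c) \<tau> =
    (\<Sum>\<sigma>\<in>A. Poly_Mapping.lookup c \<sigma> * of_int (Poly_Mapping.lookup (F \<sigma>) \<tau>))"
  unfolding coeff_extend_def lookup_sum
  by (rule sum.mono_neutral_cong_left) (use assms in \<open>auto simp: lookup_map_zero in_keys_iff\<close>)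

lemma keys_coeff_extend:
  "Poly_Mapping.keys (coeff_extend F c) \<subseteq> (\<Union>\<sigma>\<in>Poly_Mapping.keys c. Poly_Mapping.keys (F \<sigma>))"
proof
  fix \<tau> assume "\<tau> \<in> Poly_Mapping.keys (coeff_extend F c)"
  then have "(\<Sum>\<sigma>\<in>Poly_Mapping.keys c. Poly_Mapping.lookup c \<sigma> * of_int (Poly_Mapping.lookup (F \<sigma>) \<tau>)) \<noteq> 0"
    by (simp add: in_keys_iff lookup_coeff_extend[OF finite_keys subset_refl])
  then obtain \<sigma> where "\<sigma> \<in> Poly_Mapping.keys c" "Poly_Mapping.lookup (F \<sigma>) \<tau> \<noteq> 0"
    by (metis (no_types, lifting) mult_zero_right of_int_0 sum.neutral)
  then show "\<tau> \<in> (\<Union>\<sigma>\<in>Poly_Mapping.keys c. Poly_Mapping.keys (F \<sigma>))" by (auto simp: in_keys_iff)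
qed

lemma coeff_extend_0 [simp]: "coeff_extend F 0 = 0"
  by (simp add: coeff_extend_def)

lemma coeff_extend_add: "coeff_extend F (c + d) = coeff_extend F c + coeff_extend F d"
proof (rule poly_mapping_eqI)
  fix \<tau>
  let ?A = "Poly_Mapping.keys c \<union> Poly_Mapping.keys d"
  have f: "finite ?A" "Poly_Mapping.keys c \<subseteq> ?A" "Poly_Mapping.keys d \<subseteq> ?A" by auto
  show "Poly_Mapping.lookup (coeff_extend F (c + d)) \<tau> = Poly_Mapping.lookup (coeff_extend F c + coeff_extend F d) \<tau>"
    unfolding lookup_add lookup_coeff_extend[OF f(1,2)] lookup_coeff_extend[OF f(1,3)]
      lookup_coeff_extend[OF f(1) keys_add]
    by (simp add: distrib_right sum.distrib)
qed

lemma coeff_extend_scale: "coeff_extend F (chain_scale a c) = chain_scale a (coeff_extend F c)"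
proof (rule poly_mapping_eqI)
  fix \<tau>
  have k: "Poly_Mapping.keys (chain_scale a c) \<subseteq> Poly_Mapping.keys c" by (auto simp: in_keys_iff)
  show "Poly_Mapping.lookup (coeff_extend F (chain_scale a c)) \<tau> = Poly_Mapping.lookup (chain_scale a (coeff_extend F c)) \<tau>"
    unfolding lookup_chain_scale lookup_coeff_extend[OF finite_keys k] lookup_coeff_extend[where c = c, OF finite_keys subset_refl]
    by (simp add: sum_distrib_left mult.assoc)
qed

lemma coeff_extend_minus: "coeff_extend F (- c) = - coeff_extend F c"
  using coeff_extend_add[of F "- c" c] by (simp add: eq_neg_iff_add_eq_0)

lemma coeff_extend_diff: "coeff_extend F (c - d) = coeff_extend F c - coeff_extend F d"
  using coeff_extend_add[of F c "- d"] by (simp add: coeff_extend_minus)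

lemma coeff_extend_diff_fun:
  "coeff_extend (\<lambda>\<sigma>. F \<sigma> - G \<sigma>) c = coeff_extend F c - coeff_extend G c"
  by (rule poly_mapping_eqI)
    (simp add: lookup_minus lookup_coeff_extend[OF finite_keys subset_refl] algebra_simps sum_subtractf)

lemma coeff_extend_cong:
  "(\<And>\<sigma>. \<sigma> \<in> Poly_Mapping.keys c \<Longrightarrow> F \<sigma> = G \<sigma>) \<Longrightarrow> coeff_extend F c = coeff_extend G c"
  unfolding coeff_extend_def by (intro sum.cong) auto

lemma coeff_extend_of [simp]: "coeff_extend frag_of c = c"
proof (rule poly_mapping_eqI)
  fix \<tau>
  have "(\<Sum>\<sigma>\<in>Poly_Mapping.keys c. Poly_Mapping.lookup c \<sigma> * of_int (Poly_Mapping.lookup (frag_of \<sigma>) \<tau>))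
      = (\<Sum>\<sigma>\<in>Poly_Mapping.keys c. if \<sigma> = \<tau> then Poly_Mapping.lookup c \<sigma> else 0)"
    by (intro sum.cong) (auto simp: lookup_single when_def)
  then show "Poly_Mapping.lookup (coeff_extend frag_of c) \<tau> = Poly_Mapping.lookup c \<tau>"
    by (simp add: lookup_coeff_extend[OF finite_keys subset_refl] in_keys_iff)
qed

lemma lookup_frag_extend:
  assumes "finite A" "Poly_Mapping.keys x \<subseteq> A"
  shows "Poly_Mapping.lookup (frag_extend b x) \<tau> =
    (\<Sum>\<rho>\<in>A. Poly_Mapping.lookup x \<rho> * Poly_Mapping.lookup (b \<rho>) \<tau>)"
  unfolding frag_extend_def lookup_sum
  by (rule sum.mono_neutral_cong_left) (use assms in \<open>auto simp: in_keys_iff\<close>)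

lemma coeff_extend_compose:
  "coeff_extend G (coeff_extend F c) = coeff_extend (\<lambda>\<sigma>. frag_extend G (F \<sigma>)) c"
proof (rule poly_mapping_eqI)
  fix \<tau>
  let ?A = "\<Union>\<sigma>\<in>Poly_Mapping.keys c. Poly_Mapping.keys (F \<sigma>)"
  have f: "finite ?A" by simp
  have "Poly_Mapping.lookup (coeff_extend G (coeff_extend F c)) \<tau>
      = (\<Sum>\<rho>\<in>?A. \<Sum>\<sigma>\<in>Poly_Mapping.keys c. Poly_Mapping.lookup c \<sigma> *
            of_int (Poly_Mapping.lookup (F \<sigma>) \<rho>) * of_int (Poly_Mapping.lookup (G \<rho>) \<tau>))"
    unfolding lookup_coeff_extend[OF f keys_coeff_extend] lookup_coeff_extend[where c = c, OF finite_keys subset_refl]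
    by (simp add: sum_distrib_right)
  also have "\<dots> = (\<Sum>\<sigma>\<in>Poly_Mapping.keys c. Poly_Mapping.lookup c \<sigma> *
            of_int (\<Sum>\<rho>\<in>?A. Poly_Mapping.lookup (F \<sigma>) \<rho> * Poly_Mapping.lookup (G \<rho>) \<tau>))"
    by (subst sum.swap) (simp add: sum_distrib_left mult.assoc)
  also have "\<dots> = (\<Sum>\<sigma>\<in>Poly_Mapping.keys c. Poly_Mapping.lookup c \<sigma> *
            of_int (Poly_Mapping.lookup (frag_extend G (F \<sigma>)) \<tau>))"
    by (intro sum.cong refl) (subst lookup_frag_extend[OF f], auto)
  finally show "Poly_Mapping.lookup (coeff_extend G (coeff_extend F c)) \<tau> =
      Poly_Mapping.lookup (coeff_extend (\<lambda>\<sigma>. frag_extend G (F \<sigma>)) c) \<tau>"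
    by (simp add: lookup_coeff_extend[OF finite_keys subset_refl])
qed

lemma coeff_boundary_extend:
  "coeff_boundary q c = coeff_extend (\<lambda>\<sigma>. chain_boundary q (frag_of \<sigma>)) c"
proof (rule poly_mapping_eqI)
  fix \<tau>
  have "Poly_Mapping.lookup c f * of_int ((- 1) ^ k * Poly_Mapping.lookup (frag_of g) \<tau>)
     = Poly_Mapping.lookup (Poly_Mapping.single g ((-1) ^ k * Poly_Mapping.lookup c f)) \<tau>"
    for f and g :: "(nat \<Rightarrow> real) \<Rightarrow> 'a" and k :: nat
    by (auto simp: lookup_single when_def)
  then show "Poly_Mapping.lookup (coeff_boundary q c) \<tau> =
      Poly_Mapping.lookup (coeff_extend (\<lambda>\<sigma>. chain_boundary q (frag_of \<sigma>)) c) \<tau>"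
    by (simp add: coeff_boundary_def chain_boundary_of lookup_coeff_extend[OF finite_keys subset_refl]
        lookup_sum sum_distrib_left)
qed

lemma coeff_chains_extend:
  assumes "c \<in> coeff_chains p X" "\<And>\<sigma>. singular_simplex p X \<sigma> \<Longrightarrow> singular_chain q Y (F \<sigma>)"
  shows "coeff_extend F c \<in> coeff_chains q Y"
  using assms keys_coeff_extend[of F c] unfolding coeff_chains_def singular_chain_def by blast

definition coeff_chain_map :: "nat \<Rightarrow> ('a \<Rightarrow> 'b) \<Rightarrow> ('a, 'k::field) coeff_chain \<Rightarrow> ('b, 'k) coeff_chain" where
  "coeff_chain_map q f = coeff_extend (\<lambda>\<sigma>. frag_of (simplex_map q f \<sigma>))"

lemma coeff_chain_map_chains:
  "c \<in> coeff_chains q X \<Longrightarrow> continuous_map X Y f \<Longrightarrow> coeff_chain_map q f c \<in> coeff_chains q Y"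
  unfolding coeff_chain_map_def
  by (rule coeff_chains_extend) (auto simp: singular_chain_of singular_simplex_simplex_map)

lemma coeff_boundary_chain_map:
  assumes "c \<in> coeff_chains q X"
  shows "coeff_boundary q (coeff_chain_map q f c) = coeff_chain_map (q - 1) f (coeff_boundary q c)"
  unfolding coeff_boundary_extend coeff_chain_map_def coeff_extend_compose
proof (rule coeff_extend_cong)
  fix \<sigma> assume "\<sigma> \<in> Poly_Mapping.keys c"
  then have "singular_chain q X (frag_of \<sigma>)" using assms by (auto simp: coeff_chains_def singular_chain_of)
  from chain_boundary_chain_map[OF this, of f]
  show "frag_extend (\<lambda>\<sigma>. chain_boundary q (frag_of \<sigma>)) (frag_of (simplex_map q f \<sigma>)) =
         frag_extend (\<lambda>\<sigma>. frag_of (simplex_map (q - 1) f \<sigma>)) (chain_boundary q (frag_of \<sigma>))"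
    by (simp add: chain_map_def comp_def)
qed

lemma coeff_chain_map_id:
  assumes "c \<in> coeff_chains q X" "\<And>x. x \<in> topspace X \<Longrightarrow> f x = x"
  shows "coeff_chain_map q f c = c"
proof -
  have "coeff_chain_map q f c = coeff_extend frag_of c" unfolding coeff_chain_map_def
    by (rule coeff_extend_cong) (use assms simplex_map_id_gen in \<open>force simp: coeff_chains_def\<close>)
  then show ?thesis by simp
qed

abbreviation simplex_space :: "nat \<Rightarrow> (nat \<Rightarrow> real) topology" where
  "simplex_space p \<equiv> subtopology (powertop_real UNIV) (standard_simplex p)"

abbreviation cylinder :: "'a topology \<Rightarrow> (real \<times> 'a) topology" where
  "cylinder X \<equiv> prod_topology (top_of_set {0..1::real}) X"

abbreviation identity_simplex :: "nat \<Rightarrow> (nat \<Rightarrow> real) \<Rightarrow> nat \<Rightarrow> real" where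
  "identity_simplex p \<equiv> restrict id (standard_simplex p)"

lemma singular_identity_simplex: "singular_simplex p (simplex_space p) (identity_simplex p)"
  unfolding singular_simplex_def by (simp add: continuous_map_eq[OF continuous_map_id])

lemma contractible_simplex_space: "contractible_space (simplex_space p)"
proof -
  let ?a = "\<lambda>j::nat. if j = 0 then 1 else (0::real)"
  let ?h = "\<lambda>(t, x). \<lambda>i. (1 - t) * x i + t * ?a i"
  have a: "?a \<in> standard_simplex p" by simp
  have "continuous_map (cylinder (simplex_space p)) (powertop_real UNIV) ?h"
    unfolding continuous_map_componentwise_UNIV
  proof
    fix i
    have 1: "continuous_map (cylinder (simplex_space p)) euclideanreal fst"
      using continuous_map_fst continuous_map_into_fulltopology by blast
    have "continuous_map (cylinder (simplex_space p)) (powertop_real UNIV) snd"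
      using continuous_map_snd continuous_map_into_fulltopology by blast
    then have 2: "continuous_map (cylinder (simplex_space p)) euclideanreal (\<lambda>z. snd z i)"
      unfolding continuous_map_componentwise_UNIV by (auto simp: comp_def)
    have "continuous_map (cylinder (simplex_space p)) euclideanreal (\<lambda>z. (1 - fst z) * snd z i + fst z * ?a i)"
      by (intro continuous_intros 1 2 continuous_map_const[THEN iffD2]) auto
    then show "continuous_map (cylinder (simplex_space p)) euclideanreal (\<lambda>x. ?h x i)"
      by (simp add: case_prod_beta')
  qed
  moreover have "?h (t, x) \<in> standard_simplex p" if "t \<in> {0..1}" "x \<in> standard_simplex p" for t x
    using convex_standard_simplex[OF that(2) a, of t] that(1) by simp
  ultimately have c: "continuous_map (cylinder (simplex_space p)) (simplex_space p) ?h"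
    by (auto simp: continuous_map_in_subtopology)
  show ?thesis unfolding contractible_space_def homotopic_with_def
    by (intro exI[of _ ?a] exI[of _ ?h]) (use c in auto)
qed

text \<open>The identity is homotopic to a constant map, and cycles of positive degree at a point are
  boundaries.\<close>

lemma contractible_cycle_bounds:
  assumes X: "contractible_space X" and p: "1 \<le> p" and c: "singular_relcycle p X {} c"
  shows "\<exists>d. singular_chain (Suc p) X d \<and> chain_boundary (Suc p) d = c"
proof -
  obtain a where h: "homotopic_with (\<lambda>x. True) X X id (\<lambda>x. a)"
    using X unfolding contractible_space_def by blast
  show ?thesis
  proof (cases "topspace X = {}")
    case True
    then have "c = 0" using c by (simp add: singular_cycle singular_chain_empty)
    then show ?thesis by (intro exI[of _ 0]) simp
  next
    case False
    then have a: "a \<in> topspace X" using homotopic_with_imp_continuous_maps[OF h] by (simp add: continuous_map_const)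
    have h': "homotopic_with (\<lambda>f. f \<in> {} \<rightarrow> {}) X X id (\<lambda>x. a)" using h by simp
    have "homologous_rel p X {} (chain_map p id c) (chain_map p (\<lambda>x. a) c)"
      by (rule homotopic_imp_homologous_rel_chain_maps[OF h' c])
    moreover have "chain_map p id c = c" using c chain_map_ident unfolding singular_cycle by blast
    moreover have "singular_relboundary p X {} (chain_map p (\<lambda>x. a) c)"
    proof -
      let ?S = "subtopology X {a}"
      have t: "topspace ?S = {a}" using a by auto
      have "continuous_map X ?S (\<lambda>x. a)" using a by (simp add: continuous_map_in_subtopology)
      then have "singular_relcycle p ?S {} (chain_map p (\<lambda>x. a) c)"
        using singular_relcycle_chain_map[OF c, of ?S "\<lambda>x. a" "{}"] by auto
      then have "singular_relboundary p ?S {} (chain_map p (\<lambda>x. a) c)"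
        using singular_boundary_eq_cycle_singleton[OF t p] by blast
      then show ?thesis using singular_boundary_mono[of "{a}" UNIV p X] by simp
    qed
    ultimately have "singular_relboundary p X {} (c - chain_map p (\<lambda>x. a) c + chain_map p (\<lambda>x. a) c)"
      unfolding homologous_rel_def by (metis singular_relboundary_add)
    then show ?thesis by (simp add: singular_boundary)
  qed
qed

abbreviation cylinder_map :: "('a \<Rightarrow> 'b) \<Rightarrow> real \<times> 'a \<Rightarrow> real \<times> 'b" where
  "cylinder_map \<sigma> \<equiv> \<lambda>(t, x). (t, \<sigma> x)"

text \<open>What the boundary of a prism over the standard simplex has to be: top minus bottom minus the
  prisms over the faces, where \<open>d\<close> is the model in one dimension less.\<close>

abbreviation prism_boundary :: "nat \<Rightarrow> (real \<times> (nat \<Rightarrow> real)) chain \<Rightarrow> (real \<times> (nat \<Rightarrow> real)) chain" where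
  "prism_boundary p d \<equiv>
     chain_map p (\<lambda>x. (1, x)) (frag_of (identity_simplex p)) - chain_map p (\<lambda>x. (0, x)) (frag_of (identity_simplex p))
     - frag_extend (\<lambda>\<sigma>. chain_map p (cylinder_map \<sigma>) d) (chain_boundary p (frag_of (identity_simplex p)))"

text \<open>Chains on the cylinder over the standard simplex, chosen recursively by the method of acyclic
  models instead of an explicit triangulation.\<close>

primrec model_prism :: "nat \<Rightarrow> (real \<times> (nat \<Rightarrow> real)) chain" where
  "model_prism 0 = (SOME d. singular_chain 1 (cylinder (simplex_space 0)) d \<and> chain_boundary 1 d = prism_boundary 0 0)"
| "model_prism (Suc p) = (SOME d. singular_chain (Suc (Suc p)) (cylinder (simplex_space (Suc p))) d \<and>
      chain_boundary (Suc (Suc p)) d = prism_boundary (Suc p) (model_prism p))"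

definition is_prism :: "nat \<Rightarrow> bool" where
  "is_prism p \<longleftrightarrow> singular_chain (Suc p) (cylinder (simplex_space p)) (model_prism p) \<and>
     chain_boundary (Suc p) (model_prism p) = prism_boundary p (model_prism (p - 1))"

text \<open>The prism over an arbitrary simplex \<open>\<sigma>\<close>, followed by the homotopy
  \<open>h\<close>: the image of the model under \<open>(t, x) \<mapsto> h (t, \<sigma>
  x)\<close>.\<close>

definition prism_of :: "(real \<times> 'a \<Rightarrow> 'b) \<Rightarrow> nat \<Rightarrow> ((nat \<Rightarrow> real) \<Rightarrow> 'a) \<Rightarrow> 'b chain" where
  "prism_of h p \<sigma> = chain_map (Suc p) (h \<circ> cylinder_map \<sigma>) (model_prism p)"

lemma continuous_cylinder_map:
  assumes "continuous_map X Y f" shows "continuous_map (cylinder X) (cylinder Y) (cylinder_map f)"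
proof -
  have "cylinder_map f = (\<lambda>z. (fst z, (f \<circ> snd) z))" by auto
  then show ?thesis
    by (simp only:) (intro continuous_map_pairedI continuous_map_fst continuous_map_compose[OF continuous_map_snd assms])
qed

lemma singular_chain_prism_of:
  assumes "is_prism p" "singular_simplex p X \<sigma>" "continuous_map (cylinder X) Y h"
  shows "singular_chain (Suc p) Y (prism_of h p \<sigma>)"
proof -
  have "continuous_map (cylinder (simplex_space p)) Y (h \<circ> cylinder_map \<sigma>)"
    using assms continuous_cylinder_map unfolding singular_simplex_def by (blast intro: continuous_map_compose)
  then show ?thesis using assms(1) unfolding prism_of_def is_prism_def by (blast intro: singular_chain_chain_map)
qed

lemma chain_boundary_frag_extend:
  "chain_boundary p (frag_extend f c) = frag_extend (\<lambda>\<sigma>. chain_boundary p (f \<sigma>)) c"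
  by (induction c rule: frag_induction[OF subset_UNIV]) (auto simp: frag_extend_diff chain_boundary_diff)

lemma chain_map_frag_extend:
  "chain_map p g (frag_extend f c) = frag_extend (\<lambda>\<sigma>. chain_map p g (f \<sigma>)) c"
  by (induction c rule: frag_induction[OF subset_UNIV]) (auto simp: frag_extend_diff chain_map_diff)

lemma frag_extend_frag_extend:
  "frag_extend g (frag_extend f c) = frag_extend (\<lambda>\<sigma>. frag_extend g (f \<sigma>)) c"
  by (induction c rule: frag_induction[OF subset_UNIV]) (auto simp: frag_extend_diff)

text \<open>Naturality: the boundary formula on the model is mapped to \<open>\<sigma>\<close>. The sides
  match because the faces of \<open>\<sigma>\<close> are the composites of \<open>\<sigma>\<close>
  with the faces of the identity simplex.\<close>

lemma chain_boundary_prism_of: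
  assumes p: "is_prism p" "0 < p \<Longrightarrow> is_prism (p - 1)" and \<sigma>: "singular_simplex p X \<sigma>"
  shows "chain_boundary (Suc p) (prism_of h p \<sigma>) =
     frag_of (simplex_map p (\<lambda>x. h (1, x)) \<sigma>) - frag_of (simplex_map p (\<lambda>x. h (0, x)) \<sigma>)
     - frag_extend (prism_of h (p - 1)) (chain_boundary p (frag_of \<sigma>))"
proof -
  let ?H = "h \<circ> cylinder_map \<sigma>" and ?\<iota> = "identity_simplex p"
  have id: "chain_map p \<sigma> (frag_of ?\<iota>) = frag_of \<sigma>" using singular_simplex_chain_map_id[OF \<sigma>] .
  have \<iota>: "singular_chain p (simplex_space p) (frag_of ?\<iota>)"
    using singular_identity_simplex by (simp add: singular_chain_of)
  have end_eq: "chain_map p ?H (chain_map p (\<lambda>x. (t, x)) (frag_of ?\<iota>)) = frag_of (simplex_map p (\<lambda>x. h (t, x)) \<sigma>)" for t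
  proof -
    have "chain_map p ?H (chain_map p (\<lambda>x. (t, x)) (frag_of ?\<iota>)) = chain_map p (?H \<circ> (\<lambda>x. (t, x))) (frag_of ?\<iota>)"
      by (simp only: chain_map_compose comp_apply)
    also have "?H \<circ> (\<lambda>x. (t, x)) = (\<lambda>x. h (t, x)) \<circ> \<sigma>" by auto
    also have "chain_map p ((\<lambda>x. h (t, x)) \<circ> \<sigma>) (frag_of ?\<iota>) = chain_map p (\<lambda>x. h (t, x)) (frag_of \<sigma>)"
      using id by (simp only: chain_map_compose comp_apply)
    finally show ?thesis by (simp only: chain_map_of)
  qed
  have side: "frag_extend (\<lambda>\<tau>. chain_map p ?H (chain_map p (cylinder_map \<tau>) (model_prism (p - 1)))) (chain_boundary p (frag_of ?\<iota>))
     = frag_extend (prism_of h (p - 1)) (chain_boundary p (frag_of \<sigma>))"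
  proof (cases "p = 0")
    case True then show ?thesis by (simp add: chain_boundary_def)
  next
    case False
    then have sp: "Suc (p - 1) = p" by simp
    have "chain_boundary p (frag_of \<sigma>) = chain_map (p - 1) \<sigma> (chain_boundary p (frag_of ?\<iota>))"
      using chain_boundary_chain_map[OF \<iota>, of \<sigma>] id by simp
    also have "\<dots> = frag_extend (\<lambda>\<tau>. frag_of (simplex_map (p - 1) \<sigma> \<tau>)) (chain_boundary p (frag_of ?\<iota>))"
      by (simp add: chain_map_def comp_def)
    finally have "frag_extend (prism_of h (p - 1)) (chain_boundary p (frag_of \<sigma>)) =
        frag_extend (\<lambda>\<tau>. prism_of h (p - 1) (simplex_map (p - 1) \<sigma> \<tau>)) (chain_boundary p (frag_of ?\<iota>))"
      by (simp add: frag_extend_frag_extend)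
    also have "(\<lambda>\<tau>. prism_of h (p - 1) (simplex_map (p - 1) \<sigma> \<tau>)) =
        (\<lambda>\<tau>. chain_map p ?H (chain_map p (cylinder_map \<tau>) (model_prism (p - 1))))"
    proof
      fix \<tau>
      have "chain_map p ?H (chain_map p (cylinder_map \<tau>) (model_prism (p - 1)))
          = chain_map p (?H \<circ> cylinder_map \<tau>) (model_prism (p - 1))"
        by (simp only: chain_map_compose comp_apply)
      also have "\<dots> = chain_map p (h \<circ> cylinder_map (simplex_map (p - 1) \<sigma> \<tau>)) (model_prism (p - 1))"
        using p(2) False unfolding is_prism_def sp
        by (intro chain_map_eq[of _ "cylinder (simplex_space (p - 1))"]) (auto simp: simplex_map_def)
      finally show "prism_of h (p - 1) (simplex_map (p - 1) \<sigma> \<tau>) =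
        chain_map p ?H (chain_map p (cylinder_map \<tau>) (model_prism (p - 1)))"
        unfolding prism_of_def sp by simp
    qed
    finally show ?thesis by (rule sym)
  qed
  have "chain_boundary (Suc p) (prism_of h p \<sigma>) = chain_map p ?H (chain_boundary (Suc p) (model_prism p))"
    using p(1) unfolding prism_of_def is_prism_def
    by (metis chain_boundary_chain_map diff_Suc_Suc minus_nat.diff_0)
  also have "\<dots> = chain_map p ?H (prism_boundary p (model_prism (p - 1)))"
    using p(1) by (simp add: is_prism_def)
  also have "\<dots> = frag_of (simplex_map p (\<lambda>x. h (1, x)) \<sigma>) - frag_of (simplex_map p (\<lambda>x. h (0, x)) \<sigma>)
     - frag_extend (prism_of h (p - 1)) (chain_boundary p (frag_of \<sigma>))"
    by (simp only: chain_map_diff end_eq chain_map_frag_extend side)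
  finally show ?thesis .
qed

lemma chain_boundary_prism_of_chain:
  assumes p: "is_prism p" "0 < p \<Longrightarrow> is_prism (p - 1)" and c: "singular_chain p X c"
  shows "chain_boundary (Suc p) (frag_extend (prism_of h p) c) =
     chain_map p (\<lambda>x. h (1, x)) c - chain_map p (\<lambda>x. h (0, x)) c
     - frag_extend (prism_of h (p - 1)) (chain_boundary p c)"
  using c unfolding singular_chain_def
proof (induction rule: frag_induction)
  case (one \<sigma>)
  then show ?case using chain_boundary_prism_of[OF p, of X \<sigma> h] by simp
next
  case (diff a b)
  then show ?case by (simp add: frag_extend_diff chain_boundary_diff chain_map_diff)
qed simp

text \<open>The required boundary is a cycle, by the formula in one dimension less, and the cylinder over a
  simplex is contractible. In dimension \<open>0\<close> cycles need not bound; there the two ends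
  are homologous because they are homotopic.\<close>

lemma is_prism_all: "is_prism p"
proof (induction p rule: less_induct)
  case (less p)
  let ?W = "cylinder (simplex_space p)" and ?\<iota> = "identity_simplex p"
  have W: "contractible_space ?W"
    by (simp add: contractible_space_prod_topology contractible_simplex_space convex_imp_contractible)
  have \<iota>: "singular_chain p (simplex_space p) (frag_of ?\<iota>)"
    using singular_identity_simplex by (simp add: singular_chain_of)
  have cj: "continuous_map (simplex_space p) ?W (\<lambda>x. (t, x))" if "t \<in> {0..1}" for t
    using that by (intro continuous_map_pairedI) auto
  have ch: "singular_chain p ?W (chain_map p (\<lambda>x. (t, x)) (frag_of ?\<iota>))" if "t \<in> {0..1}" for t
    using singular_chain_chain_map[OF \<iota> cj[OF that]] .
  show ?case
  proof (cases p)
    case 0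
    (* The trivial side condition puts the homotopy in the form used for relative homology with
       empty subspaces. *)
    have "homotopic_with (\<lambda>f. f \<in> {} \<rightarrow> {}) (simplex_space p) ?W (\<lambda>x. (1, x)) (\<lambda>x. (0, x))"
      unfolding homotopic_with_def
      by (intro exI[of _ "\<lambda>(t, x). (1 - t, x)"])
        (auto simp: case_prod_beta' intro!: continuous_map_pairedI continuous_map_snd
          continuous_map_into_subtopology continuous_intros continuous_map_into_fulltopology[OF continuous_map_fst])
    moreover have "singular_relcycle p (simplex_space p) {} (frag_of ?\<iota>)"
      using \<iota> 0 by (simp add: singular_cycle chain_boundary_def)
    ultimately have "homologous_rel p ?W {} (chain_map p (\<lambda>x. (1, x)) (frag_of ?\<iota>)) (chain_map p (\<lambda>x. (0, x)) (frag_of ?\<iota>))"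
      by (rule homotopic_imp_homologous_rel_chain_maps)
    then have "\<exists>d. singular_chain 1 ?W d \<and> chain_boundary 1 d = prism_boundary 0 0"
      using 0 by (simp add: homologous_rel_def singular_boundary chain_boundary_def)
    from someI_ex[OF this[unfolded 0]] show ?thesis
      unfolding 0 is_prism_def by (simp add: chain_boundary_def)
  next
    case (Suc q)
    have q: "is_prism q" "0 < q \<Longrightarrow> is_prism (q - 1)" using less Suc by auto
    let ?d = "frag_extend (prism_of id q) (chain_boundary p (frag_of ?\<iota>))"
    have eqd: "prism_boundary p (model_prism q) = chain_map p (\<lambda>x. (1, x)) (frag_of ?\<iota>) - chain_map p (\<lambda>x. (0, x)) (frag_of ?\<iota>) - ?d"
      using Suc by (simp add: prism_of_def[abs_def])
    have b: "singular_chain q (simplex_space p) (chain_boundary p (frag_of ?\<iota>))"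
      using singular_chain_boundary[OF \<iota>] Suc by simp
    have "singular_chain p ?W ?d"
      using singular_chain_prism_of[OF q(1), of "simplex_space p" _ ?W id] b Suc
      unfolding singular_chain_def[of q] by (intro singular_chain_extend) auto
    then have Z: "singular_chain p ?W (prism_boundary p (model_prism q))"
      unfolding eqd by (intro singular_chain_diff ch) auto
    have "chain_boundary p ?d = chain_map q (\<lambda>x. (1, x)) (chain_boundary p (frag_of ?\<iota>))
        - chain_map q (\<lambda>x. (0, x)) (chain_boundary p (frag_of ?\<iota>))"
      using chain_boundary_prism_of_chain[OF q b, of id] Suc chain_boundary_boundary[OF \<iota>] by simp
    then have "chain_boundary p (prism_boundary p (model_prism q)) = 0"
      unfolding eqd chain_boundary_diff chain_boundary_chain_map[OF \<iota>] using Suc by simp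
    then have "singular_relcycle p ?W {} (prism_boundary p (model_prism q))"
      using Z by (simp add: singular_cycle)
    from contractible_cycle_bounds[OF W _ this] Suc
    have "\<exists>d. singular_chain (Suc p) ?W d \<and> chain_boundary (Suc p) d = prism_boundary p (model_prism q)" by simp
    from someI_ex[OF this[unfolded Suc]] show ?thesis
      unfolding Suc is_prism_def by simp
  qed
qed

text \<open>The linear extension of the prism operator is a chain homotopy.\<close>

lemma coeff_homotopy:
  fixes c :: "('a, 'k::field) coeff_chain"
  assumes h: "continuous_map (cylinder X) Y h" and c: "c \<in> coeff_cycles q X"
  shows "coeff_chain_map q (\<lambda>x. h (1, x)) c - coeff_chain_map q (\<lambda>x. h (0, x)) c \<in> coeff_boundaries q Y"
proof -
  have cc: "c \<in> coeff_chains q X" and c0: "coeff_boundary q c = 0" using c by (auto simp: coeff_cycles_def)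
  let ?D = "coeff_extend (prism_of h q) c"
  have D: "?D \<in> coeff_chains (Suc q) Y"
    by (rule coeff_chains_extend[OF cc]) (rule singular_chain_prism_of[OF is_prism_all _ h])
  have "coeff_boundary (Suc q) ?D = coeff_extend (\<lambda>\<sigma>. chain_boundary (Suc q) (prism_of h q \<sigma>)) c"
    unfolding coeff_boundary_extend coeff_extend_compose
    by (rule coeff_extend_cong) (metis chain_boundary_frag_extend coeff_extend_of frag_extend_of frag_expansion)
  also have "\<dots> = coeff_extend (\<lambda>\<sigma>. frag_of (simplex_map q (\<lambda>x. h (1, x)) \<sigma>) - frag_of (simplex_map q (\<lambda>x. h (0, x)) \<sigma>)
     - frag_extend (prism_of h (q - 1)) (chain_boundary q (frag_of \<sigma>))) c"
    by (rule coeff_extend_cong)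
      (use cc in \<open>auto simp: coeff_chains_def intro!: chain_boundary_prism_of[OF is_prism_all is_prism_all, unfolded One_nat_def]\<close>)
  also have "\<dots> = coeff_chain_map q (\<lambda>x. h (1, x)) c - coeff_chain_map q (\<lambda>x. h (0, x)) c
      - coeff_extend (prism_of h (q - 1)) (coeff_boundary q c)"
    by (simp add: coeff_extend_diff_fun coeff_chain_map_def coeff_boundary_extend coeff_extend_compose)
  finally have "coeff_chain_map q (\<lambda>x. h (1, x)) c - coeff_chain_map q (\<lambda>x. h (0, x)) c = coeff_boundary (Suc q) ?D"
    using c0 by simp
  then show ?thesis unfolding coeff_boundaries_def using D by (rule image_eqI)
qed

lemma coeff_chain_map_cong:
  assumes "c \<in> coeff_chains q X" "\<And>x. x \<in> topspace X \<Longrightarrow> f x = g x"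
  shows "coeff_chain_map q f c = coeff_chain_map q g c"
  unfolding coeff_chain_map_def
proof (rule coeff_extend_cong)
  fix \<sigma> assume "\<sigma> \<in> Poly_Mapping.keys c"
  then have "singular_simplex q X \<sigma>" using assms(1) by (auto simp: coeff_chains_def)
  then show "frag_of (simplex_map q f \<sigma>) = frag_of (simplex_map q g \<sigma>)"
    using simplex_map_eq[of q X \<sigma> f g] assms(2) by simp
qed

lemma coeff_chain_map_compose:
  "coeff_chain_map q g (coeff_chain_map q f c) = coeff_chain_map q (g \<circ> f) c"
  by (simp add: coeff_chain_map_def coeff_extend_compose simplex_map_compose)

lemma coeff_chains_0 [simp]: "0 \<in> coeff_chains q X"
  by (simp add: coeff_chains_def)

lemma coeff_chains_diff: "a \<in> coeff_chains q X \<Longrightarrow> b \<in> coeff_chains q X \<Longrightarrow> a - b \<in> coeff_chains q X"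
  using keys_diff[of a b] by (auto simp: coeff_chains_def)

lemma coeff_chains_add: "a \<in> coeff_chains q X \<Longrightarrow> b \<in> coeff_chains q X \<Longrightarrow> a + b \<in> coeff_chains q X"
  using keys_add[of a b] by (auto simp: coeff_chains_def)

lemma coeff_chains_scale: "a \<in> coeff_chains q X \<Longrightarrow> chain_scale k a \<in> coeff_chains q X"
  by (auto simp: coeff_chains_def in_keys_iff subset_iff)

lemma coeff_boundaries_0: "0 \<in> coeff_boundaries q X"
  unfolding coeff_boundaries_def by (rule image_eqI[of _ _ 0]) (simp_all add: coeff_boundary_extend)

lemma coeff_boundaries_diff:
  assumes "a \<in> coeff_boundaries q X" "b \<in> coeff_boundaries q X" shows "a - b \<in> coeff_boundaries q X"
proof -
  from assms obtain c d where "c \<in> coeff_chains (Suc q) X" "d \<in> coeff_chains (Suc q) X"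
    "a = coeff_boundary (Suc q) c" "b = coeff_boundary (Suc q) d" by (auto simp: coeff_boundaries_def)
  then show ?thesis unfolding coeff_boundaries_def
    by (intro image_eqI[of _ _ "c - d"]) (simp_all add: coeff_boundary_extend coeff_extend_diff coeff_chains_diff)
qed

lemma coeff_boundaries_add:
  assumes "a \<in> coeff_boundaries q X" "b \<in> coeff_boundaries q X" shows "a + b \<in> coeff_boundaries q X"
proof -
  from assms obtain c d where "c \<in> coeff_chains (Suc q) X" "d \<in> coeff_chains (Suc q) X"
    "a = coeff_boundary (Suc q) c" "b = coeff_boundary (Suc q) d" by (auto simp: coeff_boundaries_def)
  then show ?thesis unfolding coeff_boundaries_def
    by (intro image_eqI[of _ _ "c + d"]) (simp_all add: coeff_boundary_extend coeff_extend_add coeff_chains_add)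
qed

lemma coeff_boundaries_scale:
  assumes "a \<in> coeff_boundaries q X" shows "chain_scale k a \<in> coeff_boundaries q X"
proof -
  from assms obtain c where "c \<in> coeff_chains (Suc q) X" "a = coeff_boundary (Suc q) c"
    by (auto simp: coeff_boundaries_def)
  then show ?thesis unfolding coeff_boundaries_def
    by (intro image_eqI[of _ _ "chain_scale k c"]) (simp_all add: coeff_boundary_extend coeff_extend_scale coeff_chains_scale)
qed

lemma coeff_cycles_diff: "a \<in> coeff_cycles q X \<Longrightarrow> b \<in> coeff_cycles q X \<Longrightarrow> a - b \<in> coeff_cycles q X"
  by (auto simp: coeff_cycles_def coeff_chains_diff coeff_boundary_extend coeff_extend_diff)

lemma chain_scale_add: "chain_scale k (a + b) = chain_scale k a + chain_scale k b"
  by (rule poly_mapping_eqI) (simp add: lookup_add distrib_left)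

lemma coeff_chain_map_cycles:
  assumes "continuous_map X Y f" "c \<in> coeff_cycles q X" shows "coeff_chain_map q f c \<in> coeff_cycles q Y"
proof -
  have c: "c \<in> coeff_chains q X" "coeff_boundary q c = 0" using assms by (auto simp: coeff_cycles_def)
  have "coeff_boundary q (coeff_chain_map q f c) = 0"
    using coeff_boundary_chain_map[OF c(1), of f] c(2) by (simp add: coeff_chain_map_def)
  then show ?thesis using coeff_chain_map_chains[OF c(1) assms(1)] by (simp add: coeff_cycles_def)
qed

lemma coeff_chain_map_boundaries:
  assumes "continuous_map X Y f" "c \<in> coeff_boundaries q X" shows "coeff_chain_map q f c \<in> coeff_boundaries q Y"
proof -
  obtain d where d: "d \<in> coeff_chains (Suc q) X" "c = coeff_boundary (Suc q) d"
    using assms by (auto simp: coeff_boundaries_def)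
  have "coeff_chain_map q f c = coeff_boundary (Suc q) (coeff_chain_map (Suc q) f d)"
    using coeff_boundary_chain_map[OF d(1), of f] d(2) by simp
  then show ?thesis using coeff_chain_map_chains[OF d(1) assms(1)] by (auto simp: coeff_boundaries_def)
qed

lemma homology_class_eq_iff:
  "(+) z ` coeff_boundaries q X = (+) z' ` coeff_boundaries q X \<longleftrightarrow> z - z' \<in> coeff_boundaries q X"
    (is "?L = ?R \<longleftrightarrow> _")
proof
  assume "?L = ?R"
  moreover have "z + 0 \<in> ?L" using coeff_boundaries_0 by blast
  ultimately obtain b where "b \<in> coeff_boundaries q X" "z + 0 = z' + b" by auto
  then show "z - z' \<in> coeff_boundaries q X" by (simp add: diff_eq_eq add.commute)
next
  assume d: "z - z' \<in> coeff_boundaries q X"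
  have "z + b = z' + ((z - z') + b)" "z' + b = z + (b - (z - z'))" for b by auto
  then show "?L = ?R"
    using coeff_boundaries_add[OF d] coeff_boundaries_diff[OF _ d] by (metis (no_types, lifting) image_cong image_eqI subsetI subset_antisym image_iff)
qed

text \<open>The map induced by \<open>f\<close> on classes is linear by construction, onto because \<open>f
  \<circ> g\<close> is the identity, and injective because \<open>g \<circ> f\<close> is homotopic
  to the identity.\<close>

theorem coeff_homology_deformation:
  assumes f: "continuous_map X Y f" and g: "continuous_map Y X g"
    and fg: "\<And>y. y \<in> topspace Y \<Longrightarrow> f (g y) = y"
    and h: "continuous_map (cylinder X) X h"
    and h0: "\<And>x. x \<in> topspace X \<Longrightarrow> h (0, x) = x" and h1: "\<And>x. x \<in> topspace X \<Longrightarrow> h (1, x) = g (f x)"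
  shows "linearly_isomorphic (coeff_homology q X :: ('k::field, ('a, 'k) coeff_chain set) module) (coeff_homology q Y)"
proof -
  let ?ZX = "coeff_cycles q X :: ('a, 'k) coeff_chain set" and ?BX = "coeff_boundaries q X :: ('a, 'k) coeff_chain set"
  let ?ZY = "coeff_cycles q Y :: ('b, 'k) coeff_chain set" and ?BY = "coeff_boundaries q Y :: ('b, 'k) coeff_chain set"
  let ?cX = "\<lambda>z. (+) z ` ?BX" and ?cY = "\<lambda>z. (+) z ` ?BY"
  let ?F = "coeff_chain_map q f :: ('a, 'k) coeff_chain \<Rightarrow> _"
  let ?G = "coeff_chain_map q g :: ('b, 'k) coeff_chain \<Rightarrow> _"
  define \<phi> where "\<phi> U = {?F u + b | u b. u \<in> U \<and> b \<in> ?BY}" for U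
  have F_add: "?F (a + b) = ?F a + ?F b" and F_diff: "?F (a - b) = ?F a - ?F b"
    and F_scale: "?F (chain_scale k a) = chain_scale k (?F a)" for a b k
    by (simp_all add: coeff_chain_map_def coeff_extend_add coeff_extend_diff coeff_extend_scale)
  have FB: "?F b \<in> ?BY" if "b \<in> ?BX" for b using coeff_chain_map_boundaries[OF f that] .
  have \<phi>: "\<phi> (?cX z) = ?cY (?F z)" for z
  proof
    show "\<phi> (?cX z) \<subseteq> ?cY (?F z)"
      by (auto simp: \<phi>_def F_add add.assoc intro!: imageI coeff_boundaries_add FB)
    show "?cY (?F z) \<subseteq> \<phi> (?cX z)"
      using coeff_boundaries_0[of q X] unfolding \<phi>_def by (auto intro!: exI[of _ z] image_eqI[of _ _ 0])
  qed
  have add: "{u + v | u v. u \<in> (+) z ` coeff_boundaries q W \<and> v \<in> (+) z' ` coeff_boundaries q W}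
      = (+) (z + z') ` coeff_boundaries q W"
    for z z' :: "('c, 'k) coeff_chain" and W
  proof safe
    fix b b' :: "('c, 'k) coeff_chain" assume "b \<in> coeff_boundaries q W" "b' \<in> coeff_boundaries q W"
    then show "(z + b) + (z' + b') \<in> (+) (z + z') ` coeff_boundaries q W"
      by (intro image_eqI[of _ _ "b + b'"] coeff_boundaries_add) (auto simp: add_ac)
  next
    fix b :: "('c, 'k) coeff_chain" assume "b \<in> coeff_boundaries q W"
    then show "\<exists>u v. (z + z') + b = u + v \<and> u \<in> (+) z ` coeff_boundaries q W \<and> v \<in> (+) z' ` coeff_boundaries q W"
      using coeff_boundaries_0[of q W]
      by (intro exI[of _ "z + b"] exI[of _ "z' + 0"]) (auto simp: add_ac)
  qed
  have scale: "{chain_scale k u + b | u b. u \<in> (+) z ` coeff_boundaries q W \<and> b \<in> coeff_boundaries q W}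
      = (+) (chain_scale k z) ` coeff_boundaries q W"
    for z :: "('c, 'k) coeff_chain" and W k
  proof safe
    fix b b' :: "('c, 'k) coeff_chain" assume "b \<in> coeff_boundaries q W" "b' \<in> coeff_boundaries q W"
    then show "chain_scale k (z + b') + b \<in> (+) (chain_scale k z) ` coeff_boundaries q W"
      by (intro image_eqI[of _ _ "chain_scale k b' + b"] coeff_boundaries_add coeff_boundaries_scale)
        (auto simp: chain_scale_add add_ac)
  next
    fix b :: "('c, 'k) coeff_chain" assume "b \<in> coeff_boundaries q W"
    then show "\<exists>u b'. chain_scale k z + b = chain_scale k u + b' \<and> u \<in> (+) z ` coeff_boundaries q W \<and> b' \<in> coeff_boundaries q W"
      using coeff_boundaries_0[of q W]
      by (intro exI[of _ "z + 0"] exI[of _ b]) (auto intro: image_eqI[of _ _ 0])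
  qed
  have "inj_on \<phi> (?cX ` ?ZX)"
  proof (rule inj_onI, clarsimp simp: \<phi>)
    fix z z' assume z: "z \<in> ?ZX" "z' \<in> ?ZX" and "?cY (?F z) = ?cY (?F z')"
    then have "?F (z - z') \<in> ?BY" by (simp add: homology_class_eq_iff F_diff)
    then have "?G (?F (z - z')) \<in> ?BX" by (rule coeff_chain_map_boundaries[OF g])
    moreover have w: "z - z' \<in> ?ZX" using z by (rule coeff_cycles_diff)
    then have wc: "z - z' \<in> coeff_chains q X" by (simp add: coeff_cycles_def)
    have "coeff_chain_map q (\<lambda>x. h (1, x)) (z - z') = ?G (?F (z - z'))"
      unfolding coeff_chain_map_compose by (rule coeff_chain_map_cong[OF wc]) (simp add: h1)
    moreover have "coeff_chain_map q (\<lambda>x. h (0, x)) (z - z') = z - z'"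
      by (rule coeff_chain_map_id[OF wc h0])
    ultimately have "?G (?F (z - z')) - (z - z') \<in> ?BX"
      using coeff_homotopy[OF h w] by simp
    then have "?G (?F (z - z')) - (?G (?F (z - z')) - (z - z')) \<in> ?BX"
      using coeff_boundaries_diff \<open>?G (?F (z - z')) \<in> ?BX\<close> by blast
    then show "?cX z = ?cX z'" by (simp add: homology_class_eq_iff)
  qed
  moreover have "\<phi> ` (?cX ` ?ZX) = ?cY ` ?ZY"
  proof
    show "\<phi> ` (?cX ` ?ZX) \<subseteq> ?cY ` ?ZY" by (auto simp: \<phi> intro!: imageI coeff_chain_map_cycles[OF f])
    show "?cY ` ?ZY \<subseteq> \<phi> ` (?cX ` ?ZX)"
    proof clarsimp
      fix y assume y: "y \<in> ?ZY"
      have "?F (?G y) = y" unfolding coeff_chain_map_compose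
        by (rule coeff_chain_map_id[of _ _ Y]) (use y fg in \<open>auto simp: coeff_cycles_def\<close>)
      then have "?cY y = \<phi> (?cX (?G y))" by (simp add: \<phi>)
      then show "?cY y \<in> \<phi> ` (?cX ` ?ZX)" using coeff_chain_map_cycles[OF g y] by blast
    qed
  qed
  ultimately have "bij_betw \<phi> (carrier (coeff_homology q X)) (carrier (coeff_homology q Y))"
    by (simp add: bij_betw_def coeff_homology_def)
  moreover have "\<phi> (u \<oplus>\<^bsub>coeff_homology q X\<^esub> v) = \<phi> u \<oplus>\<^bsub>coeff_homology q Y\<^esub> \<phi> v"
    if uv: "u \<in> carrier (coeff_homology q X)" "v \<in> carrier (coeff_homology q X)" for u v
  proof -
    obtain z z' where "u = ?cX z" "v = ?cX z'" using uv by (auto simp: coeff_homology_def)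
    then show ?thesis by (simp only: coeff_homology_def ring_record_simps add \<phi> F_add)
  qed
  moreover have "\<phi> (k \<odot>\<^bsub>coeff_homology q X\<^esub> u) = k \<odot>\<^bsub>coeff_homology q Y\<^esub> \<phi> u"
    if u: "u \<in> carrier (coeff_homology q X)" for u k
  proof -
    obtain z where "u = ?cX z" using u by (auto simp: coeff_homology_def)
    then show ?thesis by (simp only: coeff_homology_def module.simps scale \<phi> F_scale)
  qed
  ultimately show ?thesis unfolding linearly_isomorphic_def by blast
qed

corollary coeff_homology_segment_retract:
  fixes S M :: "'a::real_normed_vector set"
  assumes MS: "M \<subseteq> S" and c: "continuous_on S \<pi>" and im: "\<pi> ` S \<subseteq> M" and retr: "\<And>x. x \<in> M \<Longrightarrow> \<pi> x = x"
    and seg: "\<And>x. x \<in> S \<Longrightarrow> closed_segment x (\<pi> x) \<subseteq> S"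
  shows "linearly_isomorphic (coeff_homology q (top_of_set S) :: ('k::field, ('a, 'k) coeff_chain set) module)
    (coeff_homology q (top_of_set M))"
proof (rule coeff_homology_deformation)
  show "continuous_map (top_of_set S) (top_of_set M) \<pi>" using c im by auto
  show "continuous_map (top_of_set M) (top_of_set S) id" using MS by auto
  let ?h = "\<lambda>p. (1 - fst p) *\<^sub>R snd p + fst p *\<^sub>R \<pi> (snd p)"
  have "continuous_on ({0..1} \<times> S) ?h"
    by (intro continuous_intros continuous_on_compose2[OF c]) auto
  moreover have "?h p \<in> S" if "p \<in> {0..1} \<times> S" for p
    using that seg[of "snd p"] by (force simp: closed_segment_def)
  moreover have "cylinder (top_of_set S) = top_of_set ({0..1} \<times> S)" by (simp add: prod_topology_subtopology_eu)
  ultimately show "continuous_map (cylinder (top_of_set S)) (top_of_set S) ?h"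
    by (simp only:) auto
qed (use retr im in auto)

section \<open>Covers, waiting times and sampled trajectories\<close>

lemma dist_le_curve_length: "ereal (dist (\<gamma> 0) (\<gamma> 1)) \<le> curve_length \<gamma>"
proof -
  let ?t = "\<lambda>i::nat. if i = 0 then 0 else 1 :: real"
  have "mono_on {..1::nat} ?t \<and> ?t ` {..1} \<subseteq> {0..1}" by (auto simp: mono_on_def)
  moreover have "ereal (dist (\<gamma> 0) (\<gamma> 1)) = ereal (\<Sum>i<1. dist (\<gamma> (?t i)) (\<gamma> (?t (Suc i))))" by simp
  ultimately show ?thesis unfolding curve_length_def
    by (intro Sup_upper CollectI exI[of _ "1::nat"] exI[of _ ?t] conjI) simp_all
qed

lemma dist_le_intrinsic_dist: "ereal (dist x y) \<le> intrinsic_dist M x y"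
  unfolding intrinsic_dist_def
proof (rule Inf_greatest)
  fix l assume "l \<in> {curve_length \<gamma> |\<gamma>. path \<gamma> \<and> path_image \<gamma> \<subseteq> M \<and> pathstart \<gamma> = x \<and> pathfinish \<gamma> = y \<and> curve_length \<gamma> < \<infinity>}"
  then show "ereal (dist x y) \<le> l" using dist_le_curve_length by (auto simp: pathstart_def pathfinish_def)
qed

text \<open>Curves are at least as long as the distance of their ends.\<close>

lemma intrinsic_ball_subset: "intrinsic_ball M x \<epsilon> \<subseteq> M \<inter> ball x \<epsilon>"
proof
  fix y assume "y \<in> intrinsic_ball M x \<epsilon>"
  then have "y \<in> M" "intrinsic_dist M x y < ereal \<epsilon>" by (auto simp: intrinsic_ball_def)
  then show "y \<in> M \<inter> ball x \<epsilon>" using le_less_trans[OF dist_le_intrinsic_dist[of x y M], of "ereal \<epsilon>"] by simp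
qed

text \<open>Intrinsic balls contain Euclidean balls of a comparable radius, so compactness provides some
  finite cover; the least number is then attained.\<close>

lemma intrinsic_cover:
  fixes M :: "'a::metric_space set"
  assumes M: "compact M" and c: "1 \<le> c" "0 < \<rho>"
    and le: "\<And>x y. x \<in> M \<Longrightarrow> y \<in> M \<Longrightarrow> dist x y < \<rho> \<Longrightarrow> intrinsic_dist M x y \<le> ereal (c * dist x y)"
    and \<epsilon>: "0 < \<epsilon>"  "\<epsilon> < \<rho>"
  shows "\<exists>x. (\<forall>i<covering_number M \<epsilon>. x i \<in> M) \<and> M \<subseteq> (\<Union>i<covering_number M \<epsilon>. intrinsic_ball M (x i) \<epsilon>)"
proof -
  have sub: "M \<inter> ball x (\<epsilon> / c) \<subseteq> intrinsic_ball M x \<epsilon>" if x: "x \<in> M" for x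
  proof
    fix y assume y: "y \<in> M \<inter> ball x (\<epsilon> / c)"
    then have d: "c * dist x y < \<epsilon>" using c by (simp add: field_simps)
    have "dist x y \<le> c * dist x y" using c mult_right_mono[of 1 c "dist x y"] by simp
    then have "intrinsic_dist M x y \<le> ereal (c * dist x y)" using d \<epsilon> x y by (intro le) auto
    also have "\<dots> < ereal \<epsilon>" using d by simp
    finally show "y \<in> intrinsic_ball M x \<epsilon>" using y by (simp add: intrinsic_ball_def)
  qed
  have "M \<subseteq> (\<Union>x\<in>M. ball x (\<epsilon> / c))" using \<epsilon> c by (auto intro!: bexI)
  then obtain K where K: "K \<subseteq> M" "finite K" "M \<subseteq> (\<Union>x\<in>K. ball x (\<epsilon> / c))"
    by (rule compactE_image[OF M open_ball])
  obtain h where h: "bij_betw h {..<card K} K"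
    using ex_bij_betw_nat_finite[OF K(2)] by (auto simp: atLeast0LessThan)
  have hK: "h ` {..<card K} = K" using h by (simp add: bij_betw_def)
  have "\<exists>x. (\<forall>i<card K. x i \<in> M) \<and> M \<subseteq> (\<Union>i<card K. intrinsic_ball M (x i) \<epsilon>)"
  proof (intro exI[of _ h] conjI allI impI subsetI)
    show "h i \<in> M" if "i < card K" for i using that hK K(1) by auto
    fix y assume y: "y \<in> M"
    then obtain k where k: "k \<in> K" "y \<in> ball k (\<epsilon> / c)" using K(3) by auto
    then have "y \<in> M \<inter> ball k (\<epsilon> / c)" "k \<in> M" using y K(1) by auto
    then have "y \<in> intrinsic_ball M k \<epsilon>" using sub by blast
    moreover have "k \<in> h ` {..<card K}" using hK k(1) by simp
    ultimately show "y \<in> (\<Union>i<card K. intrinsic_ball M (h i) \<epsilon>)" by blast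
  qed
  then show ?thesis unfolding covering_number_def by (rule LeastI)
qed

text \<open>This keeps \<open>ln (covering_number M \<epsilon>)\<close> away from \<open>0\<close> for small
  \<open>\<epsilon>\<close>, so that it absorbs additive constants in the waiting time.\<close>

lemma covering_at_least_two:
  fixes M :: "'a::metric_space set" and N :: nat
  assumes "M \<subseteq> (\<Union>i<N. intrinsic_ball M (x i) \<epsilon>)" and uv: "u \<in> M" "v \<in> M" "2 * \<epsilon> \<le> dist u v"
  shows "2 \<le> N"
proof (rule ccontr)
  assume "\<not> 2 \<le> N"
  moreover have "N \<noteq> 0" using assms by auto
  ultimately have "N = 1" by linarith
  then have "M \<subseteq> ball (x 0) \<epsilon>" using assms(1) intrinsic_ball_subset[of M "x 0" \<epsilon>] by auto
  then have "dist (x 0) u < \<epsilon>" "dist (x 0) v < \<epsilon>" using uv by auto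
  then show False using uv(3) dist_triangle3[of u v "x 0"] by linarith
qed

text \<open>The offset retracts to \<open>M\<close> along the segments to the nearest points. A radius up to
  a quarter of the reach leaves room for the empty balls of radius \<open>2 r\<close>.\<close>

lemma sampled_offset_homology:
  fixes M S :: "'a::euclidean_space set"
  assumes M: "compact M" "M \<noteq> {}" and S: "compact S" "S \<noteq> {}" "S \<subseteq> M"
    and dense: "\<And>y. y \<in> M \<Longrightarrow> infdist y S \<le> \<eta>"
    and r: "0 < r" "2 * \<eta> \<le> r" "ereal r \<le> ereal (1 / 4) * reach M"
  shows "linearly_isomorphic (coeff_homology q (top_of_set (offset S r)) :: ('k::field, ('a, 'k) coeff_chain set) module)
    (coeff_homology q (top_of_set M))"
proof -
  have "ereal (2 * r) < reach M"
  proof (cases "reach M")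
    case (real x) then show ?thesis using r by simp
  qed (use r in auto)
  then obtain R where R: "2 * r < R" "ereal R < reach M" using ereal_dense2 less_ereal.simps(1) by metis
  have u: "projects_uniquely M R" by (rule reach_projects_uniquely[OF M R(2)])
  have cl: "closed M" using M by (simp add: compact_imp_closed)
  have near: "infdist z M < R" if "z \<in> offset S r" for z
  proof -
    have "infdist z M \<le> infdist z S" by (rule infdist_mono[OF S(3,2)])
    also have "\<dots> \<le> r" using that by (simp add: offset_def)
    finally show ?thesis using R r by linarith
  qed
  show ?thesis
  proof (rule coeff_homology_segment_retract)
    show "M \<subseteq> offset S r"
    proof
      fix y assume y: "y \<in> M"
      have "infdist y S \<le> r" using dense[OF y] r infdist_nonneg[of y S] by linarith
      then show "y \<in> offset S r" by (simp add: offset_def)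
    qed
    show "continuous_on (offset S r) (closest_point M)"
      by (rule continuous_on_closest_point_reach[OF M u near])
    show "closest_point M ` offset S r \<subseteq> M" using closest_point_in_set[OF cl M(2)] by auto
    show "closest_point M x = x" if "x \<in> M" for x by (rule closest_point_self[OF that])
    show "closed_segment x (closest_point M x) \<subseteq> offset S r" if "x \<in> offset S r" for x
      by (rule offset_segment_to_projection[OF M u S dense r(1) _ R(1) that]) (use r in auto)
  qed
qed

lemma kappa_bounds: "0 < \<epsilon> \<Longrightarrow> \<epsilon> < exp (- 1) \<Longrightarrow> 0 < kappa d \<epsilon> \<and> kappa d \<epsilon> \<le> 1"
proof -
  assume \<epsilon>: "0 < \<epsilon>" "\<epsilon> < exp (- 1)"
  then have "ln \<epsilon> < -1" by (metis exp_less_cancel_iff exp_ln)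
  then have "1 < ln (1 / \<epsilon>)" using \<epsilon> by (simp add: ln_div)
  moreover have "\<epsilon> < 1" using \<epsilon> exp_less_one_iff[of "-1::real"] by linarith
  ultimately show ?thesis using \<epsilon> by (auto simp: kappa_def power_le_one inverse_le_1_iff)
qed

text \<open>Replacing the intrinsic radius by a Euclidean one costs a constant factor only; in the plane
  this needs \<open>ln c \<le> ln (1 / \<epsilon>)\<close>.\<close>

lemma kappa_rescale:
  assumes "1 \<le> c" "0 < \<epsilon>" "\<epsilon> < exp (- 1)" "\<epsilon> \<le> 1 / c"
  shows "kappa d \<epsilon> / (2 * c ^ (d - 2)) \<le> kappa d (\<epsilon> / c)"
proof (cases "d = 2")
  case True
  have "ln \<epsilon> < -1" using assms by (metis exp_less_cancel_iff exp_ln)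
  then have l: "1 < ln (1 / \<epsilon>)" using assms by (simp add: ln_div)
  have "c \<le> 1 / \<epsilon>" using assms by (simp add: field_simps)
  then have "ln c \<le> ln (1 / \<epsilon>)" using assms by (subst ln_le_cancel_iff) auto
  moreover have "ln (1 / (\<epsilon> / c)) = ln (1 / \<epsilon>) + ln c" using assms by (simp add: ln_div)
  moreover have "0 \<le> ln c" using assms by simp
  ultimately have "inverse (2 * ln (1 / \<epsilon>)) \<le> inverse (ln (1 / (\<epsilon> / c)))"
    using l by (intro le_imp_inverse_le) auto
  then show ?thesis using True by (simp add: kappa_def field_simps)
next
  case False
  have "0 < c ^ (d - 2)" using assms by simp
  then show ?thesis using False assms by (simp add: kappa_def power_divide frac_le)
qed

text \<open>With \<open>\<eta> = b \<kappa> \<le> 1\<close> one has \<open>1 + \<eta> \<ge> exp (\<eta> /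
  2)\<close>, so it is enough that \<open>\<eta> n / 2 \<ge> \<Lambda> + ln a\<close> with
  \<open>\<Lambda> = ln N + ln (1 / \<delta>)\<close> and \<open>n = \<lfloor>T -
  s0\<rfloor>\<close>. The three summands of \<open>C\<close> pay for \<open>s0\<close>, for the
  rounding in \<open>n\<close> and for the decay; since \<open>\<Lambda> \<ge> ln 2\<close>,
  constants are multiples of \<open>\<Lambda>\<close>.\<close>

lemma waiting_time_suffices:
  fixes \<kappa> b a s0 N \<delta> T :: real
  defines "C \<equiv> 1 + 1 / ln 2 + 2 / b * (1 + ln a / ln 2)"
  assumes \<kappa>: "0 < \<kappa>" "\<kappa> \<le> 1" and b: "0 < b" "b \<le> 1" and a: "1 \<le> a" and s0: "0 < s0" and N: "2 \<le> N" and \<delta>: "0 < \<delta>" "\<delta> < 1"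
    and T: "C * (s0 + inverse \<kappa> * (ln N + ln (1 / \<delta>))) \<le> T"
  shows "s0 \<le> T" "N * (a * (1 / (1 + b * \<kappa>)) ^ nat \<lfloor>T - s0\<rfloor>) \<le> \<delta>"
proof -
  define \<Lambda> where "\<Lambda> = ln N + ln (1 / \<delta>)"
  define W where "W = inverse \<kappa> * \<Lambda>"
  have l2: "0 < ln (2::real)" by simp
  have la: "0 \<le> ln a" using a by simp
  have "ln 2 \<le> ln N" using N by simp
  moreover have "0 < ln (1 / \<delta>)" using \<delta> by simp
  ultimately have \<Lambda>: "ln 2 \<le> \<Lambda>" by (simp add: \<Lambda>_def)
  have \<Lambda>0: "0 \<le> \<Lambda>" using \<Lambda> l2 by linarith
  have "1 * \<Lambda> \<le> inverse \<kappa> * \<Lambda>" using \<kappa> \<Lambda>0 by (intro mult_right_mono) (auto simp: one_le_inverse_iff)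
  then have W: "ln 2 \<le> W" using \<Lambda> by (simp add: W_def)
  then have W1: "1 \<le> W / ln 2" by simp
  have C1: "1 \<le> C" unfolding C_def using b la l2 by (simp add: add_nonneg_nonneg)
  have "1 * s0 + C * W \<le> C * s0 + C * W" using C1 s0 by (intro add_right_mono mult_right_mono) auto
  also have "\<dots> \<le> T" using T by (simp add: W_def \<Lambda>_def distrib_left)
  finally have CW: "C * W \<le> T - s0" by simp
  have W0: "0 \<le> W" using W l2 by linarith
  then have "0 \<le> C * W" using C1 by simp
  then show "s0 \<le> T" using CW by simp
  let ?n = "nat \<lfloor>T - s0\<rfloor>"
  have "T - s0 - 1 \<le> real ?n" by linarith
  then have "C * W - W / ln 2 \<le> real ?n" using CW W1 by linarith
  moreover have "2 / b * (1 + ln a / ln 2) * W \<le> C * W - W / ln 2"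
    using W0 by (simp add: C_def distrib_right)
  ultimately have n: "2 / b * (1 + ln a / ln 2) * W \<le> real ?n" by linarith
  define \<eta> where "\<eta> = b * \<kappa>"
  have \<eta>: "0 < \<eta>" "\<eta> \<le> 1" using b \<kappa> by (auto simp: \<eta>_def mult_le_one)
  have "\<eta> / 2 * (2 / b * (1 + ln a / ln 2) * W) \<le> \<eta> / 2 * real ?n" using n \<eta> by (intro mult_left_mono) auto
  moreover have "\<eta> / 2 * (2 / b * (1 + ln a / ln 2) * W) = (1 + ln a / ln 2) * \<Lambda>"
  proof -
    have "b * \<kappa> / 2 * (2 / b * q * (inverse \<kappa> * \<Lambda>)) = q * \<Lambda>" for q using b \<kappa> by (simp add: field_simps)
    then show ?thesis by (simp only: \<eta>_def W_def)
  qed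
  moreover have "\<Lambda> + ln a \<le> (1 + ln a / ln 2) * \<Lambda>"
    using mult_left_mono[OF \<Lambda>, of "ln a / ln 2"] la l2 by (simp add: distrib_right)
  ultimately have "\<Lambda> + ln a \<le> \<eta> / 2 * real ?n" by linarith
  then have big: "ln N + ln (1 / \<delta>) + ln a \<le> \<eta> / 2 * real ?n" by (simp only: \<Lambda>_def)
  have "exp (\<eta> / 2) \<le> 1 + \<eta> / 2 + (\<eta> / 2)\<^sup>2" using \<eta> by (intro exp_bound) auto
  also have "(\<eta> / 2)\<^sup>2 \<le> \<eta> / 2" using \<eta> mult_left_le[of \<eta> \<eta>] by (simp add: power2_eq_square)
  finally have "exp (\<eta> / 2) \<le> 1 + \<eta>" by simp
  then have "exp (\<eta> / 2) ^ ?n \<le> (1 + \<eta>) ^ ?n" by (rule power_mono) simp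
  moreover have "exp (\<eta> / 2) ^ ?n = exp (\<eta> / 2 * real ?n)" by (simp add: exp_of_nat_mult[symmetric] mult.commute)
  moreover have "exp (ln N + ln (1 / \<delta>) + ln a) \<le> exp (\<eta> / 2 * real ?n)" using big by simp
  moreover have "exp (ln N + ln (1 / \<delta>) + ln a) = N * a / \<delta>" using N \<delta> a by (simp add: exp_add)
  ultimately have "N * a / \<delta> \<le> (1 + \<eta>) ^ ?n" by linarith
  then have "N * a \<le> \<delta> * (1 + \<eta>) ^ ?n" using \<delta> by (simp add: field_simps)
  then have "N * a / (1 + \<eta>) ^ ?n \<le> \<delta>" using \<eta> by (subst pos_divide_le_eq) auto
  then show "N * (a * (1 / (1 + b * \<kappa>)) ^ ?n) \<le> \<delta>"
    by (simp add: \<eta>_def power_divide)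
qed

text \<open>The last sampling time before \<open>t\<close> is at most \<open>\<Delta>\<close> earlier.\<close>

lemma sampled_trajectory_dense:
  fixes X :: "real \<Rightarrow> 'w \<Rightarrow> 'a::metric_space"
  assumes M: "bounded M" and XM: "\<And>t. 0 \<le> t \<Longrightarrow> X t \<omega> \<in> M" and \<Delta>: "0 < \<Delta>"
    and modulus: "path_modulus X T \<Delta> \<omega> \<le> \<epsilon>" and t: "0 \<le> t" "t \<le> T"
  shows "infdist (X t \<omega>) (sampled_trajectory X T \<Delta> \<omega>) \<le> \<epsilon>"
proof -
  define k where "k = nat \<lfloor>t / \<Delta>\<rfloor>"
  have "real k \<le> t / \<Delta>" "t / \<Delta> \<le> real k + 1" using t \<Delta> by (auto simp: k_def)
  then have k: "real k * \<Delta> \<le> t" "t \<le> real k * \<Delta> + \<Delta>" using \<Delta> by (auto simp: field_simps)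
  let ?D = "{dist (X t \<omega>) (X s \<omega>) | s t. \<bar>t - s\<bar> \<le> \<Delta> \<and> 0 \<le> s \<and> s \<le> T \<and> 0 \<le> t \<and> t \<le> T}"
  have "bdd_above ?D"
    using diameter_bounded_bound[OF M] XM by (auto intro!: bdd_aboveI[of _ "diameter M"])
  moreover have "dist (X t \<omega>) (X (real k * \<Delta>) \<omega>) \<in> ?D" using k t \<Delta> by (intro CollectI exI[of _ "real k * \<Delta>"] exI[of _ t] conjI refl) auto
  ultimately have "dist (X t \<omega>) (X (real k * \<Delta>) \<omega>) \<le> path_modulus X T \<Delta> \<omega>"
    unfolding path_modulus_def by (intro cSup_upper)
  moreover have "X (real k * \<Delta>) \<omega> \<in> sampled_trajectory X T \<Delta> \<omega>"
    using k t by (auto simp: sampled_trajectory_def)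
  ultimately show ?thesis using infdist_le[of "X (real k * \<Delta>) \<omega>" "sampled_trajectory X T \<Delta> \<omega>" "X t \<omega>"] modulus by linarith
qed

lemma finite_sampled_trajectory:
  assumes "0 < \<Delta>" "0 \<le> T" shows "finite (sampled_trajectory X T \<Delta> \<omega>)" "sampled_trajectory X T \<Delta> \<omega> \<noteq> {}"
proof -
  have "k \<le> nat \<lfloor>T / \<Delta>\<rfloor>" if "real k * \<Delta> \<le> T" for k
  proof -
    have "real k \<le> T / \<Delta>" using that assms by (simp add: field_simps)
    then show ?thesis by (simp add: le_nat_floor)
  qed
  then have "sampled_trajectory X T \<Delta> \<omega> \<subseteq> (\<lambda>k. X (real k * \<Delta>) \<omega>) ` {..nat \<lfloor>T / \<Delta>\<rfloor>}"
    by (auto simp: sampled_trajectory_def)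
  then show "finite (sampled_trajectory X T \<Delta> \<omega>)" by (rule finite_subset) simp
  have "X (real 0 * \<Delta>) \<omega> \<in> sampled_trajectory X T \<Delta> \<omega>"
    unfolding sampled_trajectory_def using assms by (intro CollectI exI[of _ 0]) auto
  then show "sampled_trajectory X T \<Delta> \<omega> \<noteq> {}" by blast
qed

section \<open>Visits to small balls and the homology of the offset\<close>

lemma (in compact_body) ball_volume_bound:
  assumes vol: "c * \<epsilon> ^ k \<le> measure \<mu> (intrinsic_ball M x \<epsilon>)"
  shows "c * vol * \<epsilon> ^ k \<le> measure lborel (M \<inter> ball x \<epsilon>)"
proof -
  have "c * \<epsilon> ^ k \<le> measure \<mu> (M \<inter> ball x \<epsilon>)"
    using vol \<mu>.finite_measure_mono[OF intrinsic_ball_subset[of M x \<epsilon>]] by simp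
  also have "\<dots> = measure lborel (M \<inter> (M \<inter> ball x \<epsilon>)) / vol"
    using emeasure_M positive_volume by (intro measure_uniform_measure) auto
  also have "M \<inter> (M \<inter> ball x \<epsilon>) = M \<inter> ball x \<epsilon>" by blast
  finally show ?thesis using positive_volume by (simp add: field_simps)
qed

context rbm begin

text \<open>The event that the ball is avoided at all dyadic times of \<open>[t0, t0 + n]\<close>.
  Restricting to dyadic times makes it measurable at once, and a visit at a dyadic time is still a
  visit.\<close>

definition missing :: "real \<Rightarrow> nat \<Rightarrow> 'a \<Rightarrow> real \<Rightarrow> 'w set" where
  "missing t0 n y \<rho> = {\<omega>\<in>space Om. \<forall>m. \<forall>k\<le>n * 2 ^ m. X (t0 + real k * (1 / 2) ^ m) \<omega> \<in> M - ball y \<rho>}"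

lemma missing_sets: "0 \<le> t0 \<Longrightarrow> missing t0 n y \<rho> \<in> sets Om"
proof -
  assume t0: "0 \<le> t0"
  have [measurable]: "X (t0 + real k * (1 / 2) ^ m) \<in> borel_measurable Om" for k m
    using t0 by (intro X_meas) simp
  have [measurable]: "M - ball y \<rho> \<in> sets borel" by simp
  show ?thesis unfolding missing_def by measurable
qed

text \<open>Survival in the complement of the ball: the gap inequality for functions vanishing on the ball
  gives the decay.\<close>

lemma missing_probability:
  assumes z: "z \<in> M" and \<eta>: "0 < \<eta>" and t0: "0 \<le> t0"
    and gap: "\<And>f B. f \<in> H1 M \<Longrightarrow> (\<And>x. \<bar>f x\<bar> \<le> B) \<Longrightarrow> (\<And>x. x \<in> M \<Longrightarrow> dist y x < \<rho> \<Longrightarrow> f x = 0) \<Longrightarrow>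
      \<eta> * L2_inner M f f \<le> energy M f f"
    and dens: "distr (P z) borel (X t0) = density \<mu> (\<lambda>y. ennreal (p y))" "p \<in> borel_measurable borel"
    and p: "\<And>y. y \<in> M \<Longrightarrow> 0 \<le> p y" "\<And>y. y \<in> M \<Longrightarrow> p y \<le> a" "0 \<le> a"
  shows "measure (P z) (missing t0 n y \<rho>) \<le> a * (1 / (1 + \<eta>)) ^ n"
proof -
  have A: "M - ball y \<rho> \<in> sets borel" "M - ball y \<rho> \<subseteq> M" by auto
  have "measure (P z) (missing t0 n y \<rho>) \<le> a * survival_mass (M - ball y \<rho>) 0 n"
    unfolding missing_def by (rule survival_probability[OF z A(1) t0 dens p(1,2)])
  also have "\<dots> \<le> a * (1 / (1 + \<eta>)) ^ n"
  proof (intro mult_left_mono survival_mass_decay[OF A \<eta>])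
    fix f assume f: "bounded_borel f" "f \<in> H1 M" and off: "\<And>x. x \<notin> M - ball y \<rho> \<Longrightarrow> f x = 0"
    obtain B where "\<And>x. \<bar>f x\<bar> \<le> B" using f(1) by (auto simp: bounded_borel_def)
    then show "\<eta> * L2_inner M f f \<le> energy M f f" using f(2) off by (intro gap) auto
  qed (use p in simp)
  finally show ?thesis .
qed

lemma not_missing:
  assumes "0 \<le> t0" "t0 \<le> T" and \<omega>: "\<omega> \<in> space Om - missing t0 (nat \<lfloor>T - t0\<rfloor>) y \<rho>"
  shows "\<exists>t. 0 \<le> t \<and> t \<le> T \<and> X t \<omega> \<in> ball y \<rho>"
proof -
  obtain m k where k: "k \<le> nat \<lfloor>T - t0\<rfloor> * 2 ^ m" "X (t0 + real k * (1 / 2) ^ m) \<omega> \<notin> M - ball y \<rho>"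
    using \<omega> unfolding missing_def by blast
  have "real k \<le> real (nat \<lfloor>T - t0\<rfloor> * 2 ^ m)" using k(1) by (simp only: of_nat_le_iff)
  also have "\<dots> \<le> (T - t0) * 2 ^ m" using assms by simp
  finally have "real k * (1 / 2) ^ m \<le> T - t0" by (simp add: power_one_over field_simps)
  moreover have "X (t0 + real k * (1 / 2) ^ m) \<omega> \<in> M" using assms by (intro X_in_M) auto
  ultimately show ?thesis using k(2) assms(1) by (intro exI[of _ "t0 + real k * (1 / 2) ^ m"]) auto
qed

end

text \<open>The two inputs of the eigenvalue bound: cones from positive reach and volume, the Poincare
  inequality from the canonical process.\<close>

lemma admissible_dirichlet_bound:
  fixes M :: "(real ^ 'n) set"
  assumes body: "compact_body M" and d: "2 \<le> CARD('n)" and reach: "0 < reach M"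
    and vol: "0 < c" "0 < \<rho>" "\<forall>x\<in>M. \<forall>\<epsilon>. 0 < \<epsilon> \<and> \<epsilon> < \<rho> \<longrightarrow> c * \<epsilon> ^ CARD('n) \<le> measure (normalized_volume M) (intrinsic_ball M x \<epsilon>)"
    and admissible: "admissible_reflecting_domain M \<rho>_ch L_ch"
  shows "\<exists>b \<epsilon>0. 0 < b \<and> 0 < \<epsilon>0 \<and> (\<forall>\<epsilon> y f B. 0 < \<epsilon> \<and> \<epsilon> < \<epsilon>0 \<and> y \<in> M \<and> f \<in> H1 M \<and> (\<forall>x. \<bar>f x\<bar> \<le> B) \<and>
      (\<forall>x\<in>M. dist y x < \<epsilon> \<longrightarrow> f x = 0) \<longrightarrow> b * kappa CARD('n) \<epsilon> * L2_inner M f f \<le> energy M f f)"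
proof -
  interpret compact_body M by (rule body)
  have ne: "M \<noteq> {}" using positive_volume by auto
  obtain R where R: "ereal 0 < ereal R" "ereal R < reach M" using ereal_dense2[of "ereal 0" "reach M"] reach by (auto simp: zero_ereal_def)
  have "0 < c * vol" using vol(1) positive_volume by simp
  from uniform_interior_cone[OF compact_M ne reach_projects_uniquely[OF compact_M ne R(2)] _ this vol(2)]
  obtain \<beta> L where cones: "0 < \<beta>" "\<beta> \<le> 1" "0 < L" "\<And>y. y \<in> M \<Longrightarrow> \<exists>e. has_cone_at M \<beta> L y e"
    using ball_volume_bound[OF vol(3)[rule_format]] R(1) by auto
  obtain Q where Q: "canonical_reflected_brownian_motion M Q" "compact_semigroup M coordinate Q"
    using admissible unfolding admissible_reflecting_domain_def by blast
  interpret Q: rbm M "path_space M" coordinate Q by unfold_locales (rule Q(1))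
  obtain CP where "0 < CP" "has_poincare CP"
    using Q.poincare_inequality[OF Q(2)] admissible unfolding admissible_reflecting_domain_def by blast
  from dirichlet_eigenvalue_bound[OF this(2,1) cones] d show ?thesis by simp
qed

lemma closure_domain_body:
  fixes M :: "'a::euclidean_space set"
  assumes "open U" "bounded U" "U \<noteq> {}" "M = closure U"
  shows "compact_body M"
proof
  show c: "compact M" using assms by simp
  obtain x e where e: "0 < e" "ball x e \<subseteq> U" using assms(1,3) open_contains_ball by blast
  have "ball x e \<subseteq> M" using e assms(4) closure_subset by blast
  then have "measure lborel (ball x e) \<le> measure lborel M"
    using fmeasurable_compact[OF c] by (intro measure_mono_fmeasurable) auto
  then show "0 < measure lborel M" using content_ball_pos[OF e(1), of x] by linarith
qed

theorem corollary8p2: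
  fixes M :: "(real ^ 'n) set"
    and p :: "real \<Rightarrow> real ^ 'n \<Rightarrow> real ^ 'n \<Rightarrow> real"
    and c_ie \<rho>_ie c_vol C_vol \<rho>_vol \<rho>_ch L_ch s0 a_hk :: real
  assumes dimension: "CARD('n) \<ge> 2"
    and domain: "\<exists>U. open U \<and> connected U \<and> bounded U \<and> U \<noteq> {} \<and> M = closure U"
    and positive_reach: "0 < reach M"
    and intrinsic: "1 \<le> c_ie" "0 < \<rho>_ie"
      "\<And>x y. x \<in> M \<Longrightarrow> y \<in> M \<Longrightarrow> dist x y < \<rho>_ie \<Longrightarrow> intrinsic_dist M x y \<le> ereal (c_ie * dist x y)"
    and volume: "0 < c_vol" "0 < C_vol" "0 < \<rho>_vol"
      "\<And>x \<epsilon>. x \<in> M \<Longrightarrow> 0 < \<epsilon> \<Longrightarrow> \<epsilon> < \<rho>_vol \<Longrightarrow>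
         c_vol * \<epsilon> ^ CARD('n) \<le> measure (normalized_volume M) (intrinsic_ball M x \<epsilon>) \<and>
         measure (normalized_volume M) (intrinsic_ball M x \<epsilon>) \<le> C_vol * \<epsilon> ^ CARD('n)"
    and admissible: "admissible_reflecting_domain M \<rho>_ch L_ch"
    and heat_kernel: "0 < s0" "1 \<le> a_hk" "neumann_heat_kernel M p"
      "\<And>t x y. s0 \<le> t \<Longrightarrow> x \<in> M \<Longrightarrow> y \<in> M \<Longrightarrow> p t x y \<le> a_hk"
  shows "\<exists>C C_low C_up \<epsilon>0 c. 0 < C \<and> 0 < C_low \<and> 0 < C_up \<and> 0 < \<epsilon>0 \<and> 0 < c \<and>
    (\<forall>(Om :: 'w measure) X P. reflected_brownian_motion M Om X P \<longrightarrow>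
      (\<forall>\<epsilon> \<delta> z \<Delta> T.
        0 < \<epsilon> \<and> \<epsilon> < \<epsilon>0 \<and> 0 < \<delta> \<and> \<delta> < 1 \<and> z \<in> M \<and> 0 < \<Delta> \<and>
        T \<ge> C * (s0 + inverse (kappa CARD('n) \<epsilon>) *
                       (ln (real (covering_number M \<epsilon>)) + ln (1 / \<delta>))) \<longrightarrow>
        (\<exists>E\<in>sets (P z). measure (P z) E \<ge> 1 - \<delta> \<and>
          (\<forall>\<omega>\<in>E. path_modulus X T \<Delta> \<omega> \<le> c * \<epsilon> \<longrightarrow>
            (\<forall>q\<le>CARD('n). \<forall>r. C_low * \<epsilon> \<le> r \<and> ereal r \<le> ereal C_up * reach M \<longrightarrow>
              linearly_isomorphic
                (coeff_homology q (top_of_set (offset (sampled_trajectory X T \<Delta> \<omega>) r))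
                   :: ('k::field, (real ^ 'n, 'k) coeff_chain set) module)
                (coeff_homology q (top_of_set M)))))))"
proof -
  obtain U where U: "open U" "bounded U" "U \<noteq> {}" "M = closure U" using domain by blast
  have body: "compact_body M" by (rule closure_domain_body[OF U])
  interpret compact_body M by (rule body)
  have ne: "M \<noteq> {}" using positive_volume by auto
  obtain P0 where unique: "\<And>Q. canonical_reflected_brownian_motion M Q \<Longrightarrow> \<forall>z\<in>M. Q z = P0 z"
    using admissible unfolding admissible_reflecting_domain_def by blast
  obtain p_kernel where dens: "symmetric_transition_density M coordinate p_kernel p"
    using heat_kernel(3) unfolding neumann_heat_kernel_def by blast
  have p_meas: "p s0 z \<in> borel_measurable borel" for z
  proof -
    have "(\<lambda>(x, y). p s0 x y) \<in> borel_measurable (borel \<Otimes>\<^sub>M borel)"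
      using dens heat_kernel(1) unfolding symmetric_transition_density_def by blast
    from measurable_compose[OF measurable_Pair1'[of z borel borel] this] show ?thesis by simp
  qed
  have p_nonneg: "0 \<le> p s0 z y" if "z \<in> M" "y \<in> M" for z y
    using dens heat_kernel(1) that unfolding symmetric_transition_density_def by blast
  have "\<forall>x\<in>M. \<forall>\<epsilon>. 0 < \<epsilon> \<and> \<epsilon> < \<rho>_vol \<longrightarrow> c_vol * \<epsilon> ^ CARD('n) \<le> measure \<mu> (intrinsic_ball M x \<epsilon>)"
    using volume(4) by simp
  from admissible_dirichlet_bound[OF body dimension positive_reach volume(1,3) this admissible]
  obtain b \<epsilon>1 where b: "0 < b" "0 < \<epsilon>1" and bound: "\<forall>\<epsilon> y f B. 0 < \<epsilon> \<and> \<epsilon> < \<epsilon>1 \<and> y \<in> M \<and> f \<in> H1 M \<and>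
      (\<forall>x. \<bar>f x\<bar> \<le> B) \<and> (\<forall>x\<in>M. dist y x < \<epsilon> \<longrightarrow> f x = 0) \<longrightarrow> b * kappa CARD('n) \<epsilon> * L2_inner M f f \<le> energy M f f"
    by (elim exE conjE)
  have gap: "b * kappa CARD('n) \<epsilon> * L2_inner M f f \<le> energy M f f"
    if "0 < \<epsilon>" "\<epsilon> < \<epsilon>1" "y \<in> M" "f \<in> H1 M" "\<And>x. \<bar>f x\<bar> \<le> B" "\<And>x. x \<in> M \<Longrightarrow> dist y x < \<epsilon> \<Longrightarrow> f x = 0"
    for \<epsilon> y f B
    using bound[rule_format, of \<epsilon> y f B] that by blast
  obtain u v where uv: "u \<in> M" "v \<in> M" "u \<noteq> v"
  proof -
    have "\<not> M \<subseteq> {a}" for a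
    proof
      assume "M \<subseteq> {a}"
      then have "finite M" by (rule finite_subset) simp
      then show False using positive_volume by (simp add: finite_imp_null_set_lborel null_setsD1 measure_def)
    qed
    then show thesis using ne that by blast
  qed
  (* The loss from passing to balls of radius \<epsilon> / c_ie. Capping b at 1 keeps the rate
     b' \<kappa> at most 1. *)
  define q where "q = 1 / (2 * c_ie ^ (CARD('n) - 2))"
  have "0 < 1 / (2 * w) \<and> 1 / (2 * w) \<le> 1" if "1 \<le> w" for w :: real using that by (auto simp: field_simps)
  from this[OF one_le_power[OF intrinsic(1)]] have q: "0 < q" "q \<le> 1" unfolding q_def by blast+
  define b' where "b' = min b 1 * q"
  have b': "0 < b'" "b' \<le> 1" "b' \<le> b * q" using b(1) q by (auto simp: b'_def mult_le_one)
  define C where "C = 1 + 1 / ln 2 + 2 / b' * (1 + ln a_hk / ln 2)"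
  have C: "0 < C" unfolding C_def using b' heat_kernel(2) by (intro add_pos_nonneg) auto
  (* In order: the eigenvalue bound, comparison of the two metrics, \<kappa> \<le> 1, rescaling
     of \<kappa>, and at least two balls in every cover. *)
  define \<epsilon>0 where "\<epsilon>0 = Min {\<epsilon>1, \<rho>_ie, exp (- 1), 1 / c_ie, dist u v / 2}"
  have \<epsilon>0: "0 < \<epsilon>0" using b(2) intrinsic(1,2) uv(3) by (simp add: \<epsilon>0_def)
  show ?thesis
  proof (rule exI[of _ C], rule exI[of _ 6], rule exI[of _ "1 / 4"], rule exI[of _ \<epsilon>0], rule exI[of _ 1],
      intro conjI allI impI C \<epsilon>0)
    fix Om :: "'w measure" and X P and \<epsilon> \<delta> :: real and z and \<Delta> T :: real
    assume RBM: "reflected_brownian_motion M Om X P"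
    assume asm: "0 < \<epsilon> \<and> \<epsilon> < \<epsilon>0 \<and> 0 < \<delta> \<and> \<delta> < 1 \<and> z \<in> M \<and> 0 < \<Delta> \<and>
        C * (s0 + inverse (kappa CARD('n) \<epsilon>) * (ln (real (covering_number M \<epsilon>)) + ln (1 / \<delta>))) \<le> T"
    interpret rbm M Om X P by unfold_locales (rule RBM)
    have \<epsilon>: "0 < \<epsilon>" "\<epsilon> < \<epsilon>1" "\<epsilon> < \<rho>_ie" "\<epsilon> < exp (- 1)" "\<epsilon> < 1 / c_ie" "\<epsilon> < dist u v / 2"
      and z: "z \<in> M" using asm by (auto simp: \<epsilon>0_def)
    let ?N = "covering_number M \<epsilon>" and ?n = "nat \<lfloor>T - s0\<rfloor>" and ?\<kappa> = "kappa CARD('n) \<epsilon>" and ?\<rho> = "\<epsilon> / c_ie"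
    obtain x where x: "\<And>i. i < ?N \<Longrightarrow> x i \<in> M" and cover: "M \<subseteq> (\<Union>i<?N. intrinsic_ball M (x i) \<epsilon>)"
      using intrinsic_cover[OF compact_M intrinsic \<epsilon>(1,3)] by blast
    have N2: "2 \<le> ?N" by (rule covering_at_least_two[OF cover uv(1,2)]) (use \<epsilon> in simp)
    have \<kappa>: "0 < ?\<kappa>" "?\<kappa> \<le> 1" using kappa_bounds[OF \<epsilon>(1,4)] by auto
    have time: "s0 \<le> T" "real ?N * (a_hk * (1 / (1 + b' * ?\<kappa>)) ^ ?n) \<le> \<delta>"
      using waiting_time_suffices[OF \<kappa> b'(1,2) heat_kernel(2,1), of "real ?N" \<delta> T] N2 asm by (auto simp: C_def)
    have \<rho>: "0 < ?\<rho>" "?\<rho> \<le> \<epsilon>" using \<epsilon>(1) intrinsic(1) by (auto simp: field_simps)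
    have bk: "b' * ?\<kappa> \<le> b * kappa CARD('n) ?\<rho>"
    proof -
      have "b' * ?\<kappa> \<le> b * q * ?\<kappa>" using b' \<kappa> by (intro mult_right_mono) auto
      also have "\<dots> \<le> b * kappa CARD('n) ?\<rho>"
        using mult_left_mono[OF kappa_rescale[OF intrinsic(1) \<epsilon>(1,4), of "CARD('n)"], of b] \<epsilon>(5) b(1) by (simp add: q_def)
      finally show ?thesis .
    qed
    define bad where "bad i = missing s0 ?n (x i) ?\<rho>" for i
    have bad: "bad i \<in> sets Om" for i unfolding bad_def using heat_kernel(1) by (intro missing_sets) simp
    have bad_prob: "measure (P z) (bad i) \<le> a_hk * (1 / (1 + b' * ?\<kappa>)) ^ ?n" if i: "i < ?N" for i
      unfolding bad_def
    proof (rule missing_probability[OF z _ _ _ marginal_density[OF unique heat_kernel(3,1) z] p_meas])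
      show "0 < b' * ?\<kappa>" using b' \<kappa> by simp
      fix f B assume f: "f \<in> H1 M" "\<And>x. \<bar>f x\<bar> \<le> B" "\<And>y. y \<in> M \<Longrightarrow> dist (x i) y < ?\<rho> \<Longrightarrow> f y = 0"
      have "b' * ?\<kappa> * L2_inner M f f \<le> b * kappa CARD('n) ?\<rho> * L2_inner M f f"
        by (rule mult_right_mono[OF bk]) (simp add: L2_inner_def)
      also have "\<dots> \<le> energy M f f" using \<rho> \<epsilon> f by (intro gap[OF _ _ x[OF i]]) auto
      finally show "b' * ?\<kappa> * L2_inner M f f \<le> energy M f f" .
    qed (use heat_kernel z p_nonneg in auto)
    interpret Pz: prob_space "P z" by (rule P_prob[OF z])
    have sets: "sets (P z) = sets Om" by (rule P_sets[OF z])
    define E where "E = space (P z) - (\<Union>i<?N. bad i)"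
    have U: "(\<Union>i<?N. bad i) \<in> sets (P z)" using bad sets by auto
    have "measure (P z) (\<Union>i<?N. bad i) \<le> (\<Sum>i<?N. measure (P z) (bad i))"
      by (rule Pz.finite_measure_subadditive_finite) (use bad sets in auto)
    also have "\<dots> \<le> real ?N * (a_hk * (1 / (1 + b' * ?\<kappa>)) ^ ?n)"
      using sum_bounded_above[of "{..<?N}" "\<lambda>i. measure (P z) (bad i)"] bad_prob by simp
    also have "\<dots> \<le> \<delta>" by (rule time(2))
    finally have PE: "1 - \<delta> \<le> measure (P z) E" unfolding E_def using Pz.prob_compl[OF U] by simp
    show "\<exists>E\<in>sets (P z). measure (P z) E \<ge> 1 - \<delta> \<and>
          (\<forall>\<omega>\<in>E. path_modulus X T \<Delta> \<omega> \<le> 1 * \<epsilon> \<longrightarrow>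
            (\<forall>q\<le>CARD('n). \<forall>r. 6 * \<epsilon> \<le> r \<and> ereal r \<le> ereal (1 / 4) * reach M \<longrightarrow>
              linearly_isomorphic
                (coeff_homology q (top_of_set (offset (sampled_trajectory X T \<Delta> \<omega>) r))
                   :: ('k::field, (real ^ 'n, 'k) coeff_chain set) module)
                (coeff_homology q (top_of_set M))))"
    proof (intro bexI[of _ E] conjI PE ballI impI allI)
      show "E \<in> sets (P z)" unfolding E_def using U by auto
      fix \<omega> q r assume \<omega>E: "\<omega> \<in> E" and modulus: "path_modulus X T \<Delta> \<omega> \<le> 1 * \<epsilon>"
        and r: "6 * \<epsilon> \<le> r \<and> ereal r \<le> ereal (1 / 4) * reach M"
      let ?S = "sampled_trajectory X T \<Delta> \<omega>"
      have \<omega>: "\<omega> \<in> space Om" using \<omega>E P_space[OF z] by (simp add: E_def)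
      have T: "0 \<le> T" using time(1) heat_kernel(1) by linarith
      have \<Delta>: "0 < \<Delta>" using asm by simp
      have fin: "finite ?S" "?S \<noteq> {}" by (rule finite_sampled_trajectory[OF \<Delta> T])+
      have SM: "?S \<subseteq> M" using X_in_M[OF _ \<omega>] asm by (auto simp: sampled_trajectory_def)
      (* One \<epsilon> from y to the centre of its ball, one to the visiting point of the
         path, one to the last sample before it. *)
      have dense: "infdist y ?S \<le> 3 * \<epsilon>" if y: "y \<in> M" for y
      proof -
        obtain i where i: "i < ?N" "y \<in> intrinsic_ball M (x i) \<epsilon>" using cover y by blast
        then have d1: "dist (x i) y < \<epsilon>" using intrinsic_ball_subset[of M "x i" \<epsilon>] by auto
        have "\<omega> \<in> space Om - missing s0 ?n (x i) ?\<rho>" using \<omega>E i(1) \<omega> by (auto simp: E_def bad_def)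
        from not_missing[OF _ time(1) this] heat_kernel(1)
        obtain t where t: "0 \<le> t" "t \<le> T" "X t \<omega> \<in> ball (x i) ?\<rho>" by auto
        have "infdist (X t \<omega>) ?S \<le> \<epsilon>"
          by (rule sampled_trajectory_dense[OF compact_imp_bounded[OF compact_M]]) (use X_in_M[OF _ \<omega>] asm modulus t in auto)
        moreover have "infdist y ?S \<le> infdist (X t \<omega>) ?S + dist y (X t \<omega>)" by (rule infdist_triangle)
        moreover have "dist y (X t \<omega>) \<le> dist (x i) y + dist (x i) (X t \<omega>)" by (rule dist_triangle3)
        moreover have "dist (x i) (X t \<omega>) < ?\<rho>" using t(3) by simp
        ultimately show ?thesis using d1 \<rho>(2) by linarith
      qed
      show "linearly_isomorphic
                (coeff_homology q (top_of_set (offset ?S r)) :: ('k::field, (real ^ 'n, 'k) coeff_chain set) module)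
                (coeff_homology q (top_of_set M))"
        by (rule sampled_offset_homology[OF compact_M ne finite_imp_compact[OF fin(1)] fin(2) SM dense])
           (use r \<epsilon>(1) in auto)
    qed
  qed auto
qed

end
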